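(* Let $\mathfrak g$ be a simply laced Kac–Moody algebra. For each $k\in\mathbb Z$ and $i\in I$, the coefficient $\mathbf X_i^\pm[k]$ of $z^{-k-1}$ in the vertex operator $\mathbf X_i^\pm(z)$ admits an expansion $$\mathbf X_i^\pm[k]=\sum_{a\ge0}\mathbf X_i^\pm[k,a]\,\hbar^a$$ with $\mathbf X_i^\pm[k,a]\in\mathrm{End}_{\mathbb C}\mathcal V$ of degree $(k-a,\pm\alpha_i)$ with respect to the $(\mathbb Z\times Q)$-grading on $\mathcal V$. Consequently, $\mathbf X_i^\pm(z)\in(\mathrm{End}_{\mathbb C[\hbar]}\widetilde{\mathcal V}_\hbar)[[z,z^{-1}]]$, and the assignment $$x_i^\pm(z)\mapsto\mathbf X_i^\pm(z)\qquad\text{for all } i\in I$$ also determines an algebra morphism $\widetilde\rho_\hbar:DY^{\mathsf c}_\hbar(\mathfrak g)\to\mathrm{End}_{\mathbb C[\hbar]}\widetilde{\mathcal V}_\hbar$.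
   Context: Setting. $\mathfrak g$ has indecomposable symmetric Cartan matrix $\mathbf A=(a_{ij})_{i,j\in I}$ with $a_{ii}=2$ and $a_{ij}\in\{0,-1\}$ for $i\ne j$. Simple roots $\alpha_i$, root lattice $Q=\bigoplus_{i\in I}\mathbb Z\alpha_i$, invariant form normalized by $(\alpha_i,\alpha_i)=2$, $d_{ij}=\frac12(\alpha_i,\alpha_j)$. Centrally extended Yangian double. $\delta(w,z)=\sum_{r\in\mathbb Z}w^rz^{-r-1}$; powers $(w+a)^r$ with $r<0$ are expanded in nonnegative powers of $aw^{-1}$. $DY^{\mathsf c}_\hbar(\mathfrak g)$ is the unital associative $\mathbb C[\hbar]$-algebra generated by $\mathsf c$ and $x_{ir}^\pm,h_{ir}$ ($i\in I$, $r\in\mathbb Z$). Put $x_i^\pm(z)=\sum_{r\in\mathbb Z}x_{ir}^\pm z^{-r-1}$, $\tilde h_i^+(z)=\sum_{r\ge0}h_{ir}z^{-r-1}$, $\tilde h_i^-(z)=\sum_{r<0}h_{ir}z^{-r-1}$, $\mathsf c_{ij}^\pm=\hbar d_{ij}\pm\frac{\hbar\mathsf c}{2}$. The defining relations are: $\mathsf c$ is central; $[\tilde h_i^\pm(z),\tilde h_j^\pm(w)]=0$ (same signs); $$((z-w)^2-(\mathsf c_{ij}^+)^2)\tilde h_j^-(w)\tilde h_i^+(z)-((z-w)^2-(\mathsf c_{ij}^-)^2)\tilde h_i^+(z)\tilde h_j^-(w)=-2d_{ij}\mathsf c+2\hbar d_{ij}(\tilde h_j^-(w)-\tilde h_i^+(z))\mathsf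 c;$$ $$(z-w\mp\mathsf c_{ij}^-)\tilde h_i^+(z)x_j^\pm(w)-(z-w\pm\mathsf c_{ij}^+)x_j^\pm(w)\tilde h_i^+(z)=\pm2d_{ij}x_j^\pm(w);$$ $$(z-w\pm\hbar d_{ij})x_j^\pm(w)\tilde h_i^-(z)-(z-w\mp\hbar d_{ij})\tilde h_i^-(z)x_j^\pm(w)=\pm2d_{ij}x_j^\pm(w);$$ $$(z-w\mp\hbar d_{ij})x_i^\pm(z)x_j^\pm(w)=(z-w\pm\hbar d_{ij})x_j^\pm(w)x_i^\pm(z);$$ $$[x_i^+(z),x_j^-(w)]=\delta_{ij}\Big(\tfrac1\hbar(\delta(w+\hbar\mathsf c,z)-\delta(w,z))+\delta(w+\hbar\mathsf c,z)\tilde h_i^+(w+\tfrac{\hbar\mathsf c}2)+\delta(w,z)\tilde h_i^-(z)\Big);$$ $$\sum_{\sigma\in S_m}[x_i^\pm(z_{\sigma(1)}),[x_i^\pm(z_{\sigma(2)}),\cdots,[x_i^\pm(z_{\sigma(m)}),x_j^\pm(w)]\cdots]]=0\quad(i\ne j,\ m=1-a_{ij}).$$ (The algebra $DY^{\mathsf c}_\hbar(\mathfrak g)$ is generated by the elements $x_{ir}^\pm$, $i\in I$, $r\in\mathbb Z$.) Spaces. $\mathcal F=\mathbb C[\mathcal H_{i,-r}]_{i\in I,r>0}$ and $\mathcal V=\mathcal F\otimes\mathbb C_\varepsilon[Q]$. $\mathcal H_{i,-r}$ ($r>0$) acts on $\mathcal F$ by multiplication, $\mathcal H_{ir}$ ($r>0$)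 by $r\,\partial/\partial\mathcal H_{i,-r}$. $\varepsilon:Q\times Q\to\{\pm1\}$ is a fixed bimultiplicative function with $\varepsilon(\alpha,\alpha)=(-1)^{\frac12(\alpha,\alpha)}$; $\mathbb C_\varepsilon[Q]$ has basis $\{e^\alpha\}_{\alpha\in Q}$ with $e^\alpha e^\beta=\varepsilon(\alpha,\beta)e^{\alpha+\beta}$, and $e^\alpha$ acts on $\mathcal V$ by left multiplication on the second factor. $z^{\partial_\alpha}(f\otimes e^\beta)=z^{(\alpha,\beta)}f\otimes e^\beta$. The $(\mathbb Z\times Q)$-grading $\mathcal V=\bigoplus_{n,\beta}\mathcal V_{n,\beta}$ is given by $\deg\mathcal H_{i,-r}=(-r,0)$, $\deg e^\alpha=(-\frac12(\alpha,\alpha),\alpha)$ (degrees of the factors of $f\otimes e^\alpha$ are added). An operator has degree $(m,\gamma)$ if it maps $\mathcal V_{n,\beta}$ into $\mathcal V_{n+m,\beta+\gamma}$ for all $n,\beta$. One has $\mathcal V_{n,\beta}=0$ for $n>n(\beta):=-\frac12(\beta,\beta)$. Set $\mathcal V_\hbar=\mathbb C[\hbar]\otimes\mathcal V$, graded with $\deg\hbar=(0,0)$, so $(\mathcal V_\hbar)_{n,\beta}=\mathbb C[\hbar]\otimes\mathcal V_{n,\beta}$, and $\widetilde{\mathcal V}_\hbar=\bigoplus_{\beta\in Q}\prod_{n\le n(\beta)}(\mathcal V_\hbar)_{n,\beta}$. Vertex operators. $N(i)=\{j\ne i:a_{ij}\ne0\}$. Define $$A_i^\pm(z)=\exp\Big(\pm\sum_{r>0}\tfrac{\mathcal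 H_{i,-r}}r(z^r+(z\mp\hbar)^r)\mp\sum_{r>0}\sum_{j\in N(i)}\tfrac{\mathcal H_{j,-r}}r(z\mp\tfrac\hbar2)^r\Big),\quad B_i^\pm(z)=\exp\Big(\mp\sum_{r>0}\tfrac{\mathcal H_{ir}}rz^{-r}\Big),$$ $$\mathbf X_i^\pm(z)=\pm A_i^\pm(z)B_i^\pm(z)e^{\pm\alpha_i}z^{\partial_{\pm\alpha_i}}=\sum_{k\in\mathbb Z}\mathbf X_i^\pm[k]z^{-k-1},$$ initially a series with coefficients in $\mathrm{End}_{\mathbb C[[\hbar]]}\mathcal V[[\hbar]]$. *)

theory Defs
  imports
    "HOL-Library.Poly_Mapping"
    "HOL-Computational_Algebra.Formal_Power_Series"
    "HOL-Combinatorics.Permutations"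
    "HOL-Analysis.Finite_Cartesian_Product"
    "HOL-Algebra.Algebraic_Closure_Type"
begin

datatype sign = Plus | Minus

definition pm :: "sign \<Rightarrow> 'a :: ring_1" where
  "pm s = (case s of Plus \<Rightarrow> 1 | Minus \<Rightarrow> - 1)"


section \<open>Cartan matrix, root lattice and sign function\<close>

text \<open>
  The index set of the simple roots is a finite type.  The root lattice is \<open>int ^ 'i\<close>,
  where \<open>axis i 1\<close> is the simple root \<open>\<alpha>\<^sub>i\<close>.
\<close>

definition simply_laced_cartan :: "('i :: finite \<Rightarrow> 'i \<Rightarrow> int) \<Rightarrow> bool" where
  "simply_laced_cartan a \<longleftrightarrow>
     (\<forall>i. a i i = 2) \<and> (\<forall>i j. i \<noteq> j \<longrightarrow> a i j \<in> {0, - 1}) \<and> (\<forall>i j. a i j = a j i) \<and>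
     \<not> (\<exists>J. J \<noteq> {} \<and> J \<noteq> UNIV \<and> (\<forall>i\<in>J. \<forall>j\<in>-J. a i j = 0))"

type_synonym 'i lattice = "int ^ 'i"

definition form :: "('i :: finite \<Rightarrow> 'i \<Rightarrow> int) \<Rightarrow> 'i lattice \<Rightarrow> 'i lattice \<Rightarrow> int" where
  "form a \<alpha> \<beta> = (\<Sum>i\<in>UNIV. \<Sum>j\<in>UNIV. a i j * vec_nth \<alpha> i * vec_nth \<beta> j)"

definition sroot :: "sign \<Rightarrow> 'i :: finite \<Rightarrow> 'i lattice" where
  "sroot s i = axis i (pm s)"

text \<open>The number \<open>(\<alpha>, \<alpha>)\<close> is always even, so the integer division below is exact.\<close>

definition half_norm :: "('i :: finite \<Rightarrow> 'i \<Rightarrow> int) \<Rightarrow> 'i lattice \<Rightarrow> int" where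
  "half_norm a \<alpha> = form a \<alpha> \<alpha> div 2"

definition sign_function ::
  "('i :: finite \<Rightarrow> 'i \<Rightarrow> int) \<Rightarrow> ('i lattice \<Rightarrow> 'i lattice \<Rightarrow> complex) \<Rightarrow> bool" where
  "sign_function a \<epsilon> \<longleftrightarrow>
     (\<forall>\<alpha> \<beta>. \<epsilon> \<alpha> \<beta> \<in> {1, - 1}) \<and>
     (\<forall>\<alpha> \<alpha>' \<beta>. \<epsilon> (\<alpha> + \<alpha>') \<beta> = \<epsilon> \<alpha> \<beta> * \<epsilon> \<alpha>' \<beta>) \<and>
     (\<forall>\<alpha> \<beta> \<beta>'. \<epsilon> \<alpha> (\<beta> + \<beta>') = \<epsilon> \<alpha> \<beta> * \<epsilon> \<alpha> \<beta>') \<and>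
     (\<forall>\<alpha>. \<epsilon> \<alpha> \<alpha> = (- 1) powi half_norm a \<alpha>)"


section \<open>Algebras over a commutative ring, linear endomorphisms\<close>

text \<open>
  A unital associative \<open>K\<close>-algebra is represented by a \<open>module\<close> record, all of whose
  fields are used.  Morphisms are extensional functions, so that they can be compared.
\<close>

definition alg_hom ::
  "('k, 'm) ring_scheme \<Rightarrow> ('k, 'a, 'n) module_scheme \<Rightarrow> ('k, 'b, 'l) module_scheme \<Rightarrow> ('a \<Rightarrow> 'b) set" where
  "alg_hom K A B =
     {f \<in> ring_hom A B \<inter> extensional (carrier A).
        \<forall>p\<in>carrier K. \<forall>x\<in>carrier A. f (p \<odot>\<^bsub>A\<^esub> x) = p \<odot>\<^bsub>B\<^esub> f x}"

definition endo_alg ::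
  "('k, 'm) ring_scheme \<Rightarrow> ('k, 'a, 'n) module_scheme \<Rightarrow> ('k, 'a \<Rightarrow> 'a) module" where
  "endo_alg K M =
     \<lparr>carrier =
        {f \<in> (carrier M \<rightarrow> carrier M) \<inter> extensional (carrier M).
           (\<forall>x\<in>carrier M. \<forall>y\<in>carrier M. f (x \<oplus>\<^bsub>M\<^esub> y) = f x \<oplus>\<^bsub>M\<^esub> f y) \<and>
           (\<forall>p\<in>carrier K. \<forall>x\<in>carrier M. f (p \<odot>\<^bsub>M\<^esub> x) = p \<odot>\<^bsub>M\<^esub> f x)},
      monoid.mult = compose (carrier M),
      one = (\<lambda>x\<in>carrier M. x),
      ring.zero = (\<lambda>x\<in>carrier M. \<zero>\<^bsub>M\<^esub>),
      ring.add = (\<lambda>f g. \<lambda>x\<in>carrier M. f x \<oplus>\<^bsub>M\<^esub> g x),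
      module.smult = (\<lambda>p f. \<lambda>x\<in>carrier M. p \<odot>\<^bsub>M\<^esub> f x)\<rparr>"

text \<open>The ring \<open>\<complex>[\<hbar>]\<close>; the polynomial variable is \<open>\<hbar>\<close>.\<close>

abbreviation Ch :: "complex poly ring" where
  "Ch \<equiv> ring_of_type_algebra"


section \<open>The centrally extended Yangian double\<close>

datatype 'g word = Word "'g list"

instantiation word :: (type) monoid_add
begin

definition zero_word :: "'g word" where
  "zero_word = Word []"

fun plus_word :: "'g word \<Rightarrow> 'g word \<Rightarrow> 'g word" where
  "plus_word (Word u) (Word v) = Word (u @ v)"

instance
proof
  fix u v w :: "'g word"
  show "u + v + w = u + (v + w)" by (cases u; cases v; cases w) simp
  show "0 + u = u" "u + 0 = u" by (cases u; simp add: zero_word_def)+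
qed

end

datatype 'i dy_gen = GenC | GenX sign 'i int | GenH 'i int

text \<open>
  The free unital associative \<open>\<complex>[\<hbar>]\<close>-algebra on the generators: the monoid algebra of
  words, with the convolution product of \<open>poly_mapping\<close>.
\<close>

type_synonym 'i dy_free = "'i dy_gen word \<Rightarrow>\<^sub>0 complex poly"

definition scal :: "complex poly \<Rightarrow> 'i dy_free" where
  "scal p = Poly_Mapping.single 0 p"

definition gen :: "'i dy_gen \<Rightarrow> 'i dy_free" where
  "gen g = Poly_Mapping.single (Word [g]) 1"

abbreviation hbar :: "'i dy_free" where
  "hbar \<equiv> scal [:0, 1:]"

abbreviation cc :: "'i dy_free" where
  "cc \<equiv> gen GenC"

definition dd :: "('i \<Rightarrow> 'i \<Rightarrow> int) \<Rightarrow> 'i \<Rightarrow> 'i \<Rightarrow> 'i dy_free" where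
  "dd a i j = scal [:of_int (a i j) / 2:]"

definition cij :: "('i \<Rightarrow> 'i \<Rightarrow> int) \<Rightarrow> sign \<Rightarrow> 'i \<Rightarrow> 'i \<Rightarrow> 'i dy_free" where
  "cij a s i j = hbar * dd a i j + pm s * (scal [:1 / 2:] * hbar * cc)"

definition commutator :: "'a :: ring \<Rightarrow> 'a \<Rightarrow> 'a" where
  "commutator x y = x * y - y * x"

text \<open>
  A formal series is the function sending an exponent \<open>m\<close> to the coefficient of \<open>z\<^sup>m\<close>; hence
  \<open>x\<^sub>i\<^sub>r\<close>, the coefficient of \<open>z\<^sup>-\<^sup>r\<^sup>-\<^sup>1\<close>, is the value at \<open>m = - r - 1\<close>.  A series in two
  variables is a function \<open>F\<close> with \<open>F m n\<close> the coefficient of \<open>z\<^sup>m w\<^sup>n\<close>.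
\<close>

definition ser_x :: "sign \<Rightarrow> 'i \<Rightarrow> int \<Rightarrow> 'i dy_free" where
  "ser_x s i m = gen (GenX s i (- m - 1))"

definition ser_h :: "sign \<Rightarrow> 'i \<Rightarrow> int \<Rightarrow> 'i dy_free" where
  "ser_h s i m =
     (let r = - m - 1 in
      gen (GenH i r) when (case s of Plus \<Rightarrow> r \<ge> 0 | Minus \<Rightarrow> r < 0))"

text \<open>\<open>zw u F\<close> is \<open>(z - w + u) F(z, w)\<close> and \<open>zwsq u F\<close> is \<open>((z - w)\<^sup>2 - u\<^sup>2) F(z, w)\<close>.\<close>

definition zw :: "'a :: ring_1 \<Rightarrow> (int \<Rightarrow> int \<Rightarrow> 'a) \<Rightarrow> int \<Rightarrow> int \<Rightarrow> 'a" where
  "zw u F m n = F (m - 1) n - F m (n - 1) + u * F m n"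

definition zwsq :: "'a :: ring_1 \<Rightarrow> (int \<Rightarrow> int \<Rightarrow> 'a) \<Rightarrow> int \<Rightarrow> int \<Rightarrow> 'a" where
  "zwsq u F m n = zw 0 (zw 0 F) m n - u ^ 2 * F m n"

text \<open>
  \<open>shifted_pow u r n\<close> is the coefficient of \<open>w\<^sup>n\<close> in \<open>(w + u)\<^sup>r\<close>, expanded in nonnegative
  powers of \<open>u w\<^sup>-\<^sup>1\<close>.
\<close>

definition shifted_pow :: "'i dy_free \<Rightarrow> int \<Rightarrow> int \<Rightarrow> 'i dy_free" where
  "shifted_pow u r n =
     (scal [:of_int r gchoose nat (r - n):] * u ^ nat (r - n) when n \<le> r)"

text \<open>Coefficient of \<open>z\<^sup>m w\<^sup>n\<close> in \<open>\<delta>(w + u, z) = \<Sum>\<^sub>r (w + u)\<^sup>r z\<^sup>-\<^sup>r\<^sup>-\<^sup>1\<close>.\<close>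

definition ser_delta :: "'i dy_free \<Rightarrow> int \<Rightarrow> int \<Rightarrow> 'i dy_free" where
  "ser_delta u m n = shifted_pow u (- m - 1) n"

text \<open>
  Coefficient of \<open>z\<^sup>m w\<^sup>n\<close> in \<open>\<hbar>\<^sup>-\<^sup>1 (\<delta>(w + \<hbar>c, z) - \<delta>(w, z))\<close>.  The difference is the sum of
  the terms of \<open>\<delta>(w + \<hbar>c, z)\<close> with at least one factor \<open>\<hbar>c\<close>; one factor \<open>\<hbar>\<close> is cancelled
  before passing to the quotient algebra (lemma \<open>hbar_ser_delta_quot\<close> below).
\<close>

definition ser_delta_quot :: "int \<Rightarrow> int \<Rightarrow> 'i dy_free" where
  "ser_delta_quot m n =
     (let r = - m - 1 in
      scal [:of_int r gchoose nat (r - n):] * hbar ^ (nat (r - n) - 1) * cc ^ nat (r - n)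
        when n < r)"

lemma hbar_ser_delta_quot:
  "hbar * ser_delta_quot m n = ser_delta (hbar * cc) m n - (ser_delta 0 m n :: 'i dy_free)"
proof -
  have ss: "scal p * (scal q * x) = scal q * (scal p * x)" for p q and x :: "'i dy_free"
    by (simp add: mult.assoc [symmetric] scal_def Poly_Mapping.mult_single mult.commute)
  have comm: "hbar * (cc :: 'i dy_free) = cc * hbar"
    by (simp add: scal_def gen_def Poly_Mapping.mult_single)
  have pw: "(hbar * cc) ^ k = hbar ^ k * (cc :: 'i dy_free) ^ k" for k
  proof (induction k)
    case (Suc k)
    have "cc * hbar ^ k = hbar ^ k * (cc :: 'i dy_free)"
      using power_commuting_commutes [OF comm] by simp
    with Suc show ?case
      by (simp add: mult.assoc) (simp add: mult.assoc [symmetric])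
  qed simp
  consider "n < - m - 1" | "n = - m - 1" | "n > - m - 1" by linarith
  then show ?thesis
  proof cases
    case 1
    then obtain k where k: "nat (- m - 1 - n) = Suc k"
      by (metis Suc_pred diff_gt_0_iff_gt zero_less_nat_eq)
    from 1 show ?thesis
      by (simp add: ser_delta_quot_def ser_delta_def shifted_pow_def Let_def k pw ss mult.assoc
               del: power_Suc) (simp add: mult.assoc ss [where p = "[:0, 1:]"])
  qed (simp_all add: ser_delta_quot_def ser_delta_def shifted_pow_def Let_def)
qed

text \<open>Coefficient of \<open>w\<^sup>n\<close> in \<open>h\<^sub>i\<^sup>+(w + u) = \<Sum>\<^sub>r\<^sub>\<ge>\<^sub>0 h\<^sub>i\<^sub>r (w + u)\<^sup>-\<^sup>r\<^sup>-\<^sup>1\<close>.\<close>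

definition ser_h_shifted :: "'i dy_free \<Rightarrow> 'i \<Rightarrow> int \<Rightarrow> 'i dy_free" where
  "ser_h_shifted u i n = Sum_any (\<lambda>m. ser_h Plus i m * shifted_pow u m n)"

text \<open>
  Each of the following is the coefficient of \<open>z\<^sup>m w\<^sup>n\<close> in the difference of the two sides of a
  defining relation.
\<close>

definition rel_hh ::
  "sign \<Rightarrow> 'i \<Rightarrow> 'i \<Rightarrow> int \<Rightarrow> int \<Rightarrow> 'i dy_free" where
  "rel_hh s i j m n = commutator (ser_h s i m) (ser_h s j n)"

definition rel_hh_mixed ::
  "('i \<Rightarrow> 'i \<Rightarrow> int) \<Rightarrow> 'i \<Rightarrow> 'i \<Rightarrow> int \<Rightarrow> int \<Rightarrow> 'i dy_free" where
  "rel_hh_mixed a i j m n =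
     (zwsq (cij a Plus i j) (\<lambda>m n. ser_h Minus j n * ser_h Plus i m) m n
      - zwsq (cij a Minus i j) (\<lambda>m n. ser_h Plus i m * ser_h Minus j n) m n)
     - ((- 2 * dd a i j * cc when m = 0 \<and> n = 0)
        + 2 * hbar * dd a i j *
            ((ser_h Minus j n when m = 0) - (ser_h Plus i m when n = 0)) * cc)"

definition rel_hx_plus ::
  "('i \<Rightarrow> 'i \<Rightarrow> int) \<Rightarrow> sign \<Rightarrow> 'i \<Rightarrow> 'i \<Rightarrow> int \<Rightarrow> int \<Rightarrow> 'i dy_free" where
  "rel_hx_plus a s i j m n =
     (zw (- pm s * cij a Minus i j) (\<lambda>m n. ser_h Plus i m * ser_x s j n) m n
      - zw (pm s * cij a Plus i j) (\<lambda>m n. ser_x s j n * ser_h Plus i m) m n)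
     - (pm s * (2 * dd a i j * ser_x s j n) when m = 0)"

definition rel_hx_minus ::
  "('i \<Rightarrow> 'i \<Rightarrow> int) \<Rightarrow> sign \<Rightarrow> 'i \<Rightarrow> 'i \<Rightarrow> int \<Rightarrow> int \<Rightarrow> 'i dy_free" where
  "rel_hx_minus a s i j m n =
     (zw (pm s * (hbar * dd a i j)) (\<lambda>m n. ser_x s j n * ser_h Minus i m) m n
      - zw (- pm s * (hbar * dd a i j)) (\<lambda>m n. ser_h Minus i m * ser_x s j n) m n)
     - (pm s * (2 * dd a i j * ser_x s j n) when m = 0)"

definition rel_xx ::
  "('i \<Rightarrow> 'i \<Rightarrow> int) \<Rightarrow> sign \<Rightarrow> 'i \<Rightarrow> 'i \<Rightarrow> int \<Rightarrow> int \<Rightarrow> 'i dy_free" where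
  "rel_xx a s i j m n =
     zw (- pm s * (hbar * dd a i j)) (\<lambda>m n. ser_x s i m * ser_x s j n) m n
     - zw (pm s * (hbar * dd a i j)) (\<lambda>m n. ser_x s j n * ser_x s i m) m n"

definition rel_xx_mixed :: "'i \<Rightarrow> 'i \<Rightarrow> int \<Rightarrow> int \<Rightarrow> 'i dy_free" where
  "rel_xx_mixed i j m n =
     commutator (ser_x Plus i m) (ser_x Minus j n)
     - (ser_delta_quot m n
        + Sum_any (\<lambda>q. ser_delta (hbar * cc) m q * ser_h_shifted (scal [:1 / 2:] * hbar * cc) i (n - q))
        + Sum_any (\<lambda>p. ser_delta 0 p n * ser_h Minus i (m - p)) when i = j)"

text \<open>
  The Serre relation between \<open>i\<close> and \<open>j\<close> is a series in \<open>z\<^sub>1, \<dots>, z\<^sub>M, w\<close> with \<open>M = 1 - a\<^sub>i\<^sub>j\<close>;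
  here \<open>e l\<close> is the exponent of \<open>z\<^sub>l\<close> and \<open>n\<close> that of \<open>w\<close>.
\<close>

definition rel_serre ::
  "('i \<Rightarrow> 'i \<Rightarrow> int) \<Rightarrow> sign \<Rightarrow> 'i \<Rightarrow> 'i \<Rightarrow> (nat \<Rightarrow> int) \<Rightarrow> int \<Rightarrow> 'i dy_free" where
  "rel_serre a s i j e n =
     (let M = nat (1 - a i j) in
      \<Sum>\<sigma> | \<sigma> permutes {1..M}.
        foldr (\<lambda>l y. commutator (ser_x s i (e (\<sigma> l))) y) [1..<Suc M] (ser_x s j n))"

definition dy_relators :: "('i \<Rightarrow> 'i \<Rightarrow> int) \<Rightarrow> 'i dy_free set" where
  "dy_relators a =
     {commutator cc (gen g) | g. True}
     \<union> {rel_hh s i j m n | s i j m n. True}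
     \<union> {rel_hh_mixed a i j m n | i j m n. True}
     \<union> {rel_hx_plus a s i j m n | s i j m n. True}
     \<union> {rel_hx_minus a s i j m n | s i j m n. True}
     \<union> {rel_xx a s i j m n | s i j m n. True}
     \<union> {rel_xx_mixed i j m n | i j m n. True}
     \<union> {rel_serre a s i j e n | s i j e n. i \<noteq> j}"

abbreviation dy_free_ring :: "'i dy_free ring" where
  "dy_free_ring \<equiv> ring_of_type_algebra"

definition dy_ideal :: "('i \<Rightarrow> 'i \<Rightarrow> int) \<Rightarrow> 'i dy_free set" where
  "dy_ideal a = genideal dy_free_ring (dy_relators a)"

definition DY :: "('i \<Rightarrow> 'i \<Rightarrow> int) \<Rightarrow> (complex poly, 'i dy_free set) module" where
  "DY a =
     ring.extend (dy_free_ring Quot dy_ideal a)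
       (module.fields (\<lambda>p C. \<Union>x\<in>C. dy_ideal a +>\<^bsub>dy_free_ring\<^esub> (scal p * x)))"

definition dy_x :: "('i \<Rightarrow> 'i \<Rightarrow> int) \<Rightarrow> sign \<Rightarrow> 'i \<Rightarrow> int \<Rightarrow> 'i dy_free set" where
  "dy_x a s i r = dy_ideal a +>\<^bsub>dy_free_ring\<^esub> gen (GenX s i r)"


section \<open>The spaces\<close>

text \<open>
  Polynomials in the variables \<open>\<H>\<^sub>i\<^sub>,\<^sub>-\<^sub>r\<close>, \<open>r > 0\<close>: the pair \<open>(i, q)\<close> indexes the variable with
  \<open>r = q + 1\<close>.  The tensor product with \<open>\<complex>\<^sub>\<epsilon>[Q]\<close> consists of the finitely supported functions
  \<open>v\<close> from \<open>Q\<close> to such polynomials, standing for \<open>\<Sum>\<^sub>\<beta> v \<beta> \<otimes> e\<^sup>\<beta>\<close>.  The convolution product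
  which the library puts on this type is not used.
\<close>

type_synonym 'i fock = "('i \<times> nat \<Rightarrow>\<^sub>0 nat) \<Rightarrow>\<^sub>0 complex"

type_synonym 'i vspace = "'i lattice \<Rightarrow>\<^sub>0 'i fock"

definition vscale :: "complex \<Rightarrow> 'i :: finite vspace \<Rightarrow> 'i vspace" where
  "vscale c = Poly_Mapping.map (\<lambda>f. Poly_Mapping.single 0 c * f)"

definition fock_var :: "'i \<Rightarrow> nat \<Rightarrow> 'i fock" where
  "fock_var i r = Poly_Mapping.single (Poly_Mapping.single (i, r - 1) 1) 1"

definition fock_deriv :: "'i \<Rightarrow> nat \<Rightarrow> 'i fock \<Rightarrow> 'i fock" where
  "fock_deriv i r f =
     Sum_any (\<lambda>\<mu>. Poly_Mapping.single (\<mu> - Poly_Mapping.single (i, r - 1) 1)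
             (of_nat (Poly_Mapping.lookup \<mu> (i, r - 1)) * Poly_Mapping.lookup f \<mu>))"

text \<open>For \<open>r > 0\<close>, the action of \<open>\<H>\<^sub>i\<^sub>,\<^sub>-\<^sub>r\<close> (creation) and of \<open>\<H>\<^sub>i\<^sub>,\<^sub>r\<close> (annihilation).\<close>

definition Hcre :: "'i \<Rightarrow> nat \<Rightarrow> 'i :: finite vspace \<Rightarrow> 'i vspace" where
  "Hcre i r = Poly_Mapping.map (\<lambda>f. fock_var i r * f)"

definition Hann :: "'i \<Rightarrow> nat \<Rightarrow> 'i :: finite vspace \<Rightarrow> 'i vspace" where
  "Hann i r = Poly_Mapping.map (\<lambda>f. of_nat r * fock_deriv i r f)"

definition lat_exp ::
  "('i lattice \<Rightarrow> 'i lattice \<Rightarrow> complex) \<Rightarrow> 'i lattice \<Rightarrow> 'i :: finite vspace \<Rightarrow> 'i vspace" where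
  "lat_exp \<epsilon> \<alpha> v =
     Sum_any (\<lambda>\<beta>. vscale (\<epsilon> \<alpha> \<beta>) (Poly_Mapping.single (\<alpha> + \<beta>) (Poly_Mapping.lookup v \<beta>)))"

definition mon_weight :: "('i \<times> nat \<Rightarrow>\<^sub>0 nat) \<Rightarrow> int" where
  "mon_weight \<mu> = (\<Sum>(i, q)\<in>Poly_Mapping.keys \<mu>. int (q + 1) * int (Poly_Mapping.lookup \<mu> (i, q)))"

definition Vdeg :: "('i :: finite \<Rightarrow> 'i \<Rightarrow> int) \<Rightarrow> int \<Rightarrow> 'i lattice \<Rightarrow> 'i vspace set" where
  "Vdeg a n \<beta> =
     {v. Poly_Mapping.keys v \<subseteq> {\<beta>} \<and> (\<forall>\<mu>\<in>Poly_Mapping.keys (Poly_Mapping.lookup v \<beta>). - mon_weight \<mu> - half_norm a \<beta> = n)}"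

definition has_degree ::
  "('i :: finite \<Rightarrow> 'i \<Rightarrow> int) \<Rightarrow> int \<Rightarrow> 'i lattice \<Rightarrow> ('i vspace \<Rightarrow> 'i vspace) \<Rightarrow> bool" where
  "has_degree a m \<gamma> T \<longleftrightarrow> (\<forall>n \<beta>. T ` Vdeg a n \<beta> \<subseteq> Vdeg a (n + m) (\<beta> + \<gamma>))"

text \<open>
  \<open>\<V>\<^sub>\<hbar> = \<complex>[\<hbar>] \<otimes> \<V>\<close> is the type of polynomials in \<open>\<hbar>\<close> with coefficients in \<open>\<V>\<close>, and
  \<open>\<V>[[\<hbar>]]\<close> the type of formal power series.  On both, \<open>\<complex>[\<hbar>]\<close> acts as follows.
\<close>

definition hact_poly :: "complex poly \<Rightarrow> 'i :: finite vspace poly \<Rightarrow> 'i vspace poly" where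
  "hact_poly p u =
     (\<Sum>b\<le>Polynomial.degree p. \<Sum>c\<le>Polynomial.degree u.
        Polynomial.monom (vscale (Polynomial.coeff p b) (Polynomial.coeff u c)) (b + c))"

definition hact :: "complex poly \<Rightarrow> 'i :: finite vspace fps \<Rightarrow> 'i vspace fps" where
  "hact p v = Abs_fps (\<lambda>n. \<Sum>b\<le>n. vscale (Polynomial.coeff p b) (fps_nth v (n - b)))"

text \<open>
  The completed space.  An element \<open>u\<close> has components \<open>u \<beta> n \<in> \<complex>[\<hbar>] \<otimes> \<V>\<^sub>n\<^sub>,\<^sub>\<beta>\<close>; only finitely
  many \<open>\<beta>\<close> occur, while for fixed \<open>\<beta>\<close> the family over \<open>n \<le> n(\<beta>)\<close> is arbitrary.  The fields
  \<open>mult\<close> and \<open>one\<close> of the record play no role.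
\<close>

definition Vtilde ::
  "('i :: finite \<Rightarrow> 'i \<Rightarrow> int) \<Rightarrow> (complex poly, 'i lattice \<Rightarrow> int \<Rightarrow> 'i vspace poly) module" where
  "Vtilde a =
     \<lparr>carrier =
        {u. finite {\<beta>. \<exists>n. u \<beta> n \<noteq> 0} \<and>
            (\<forall>\<beta> n b. Polynomial.coeff (u \<beta> n) b \<in> Vdeg a n \<beta>) \<and>
            (\<forall>\<beta> n. n > - half_norm a \<beta> \<longrightarrow> u \<beta> n = 0)},
      monoid.mult = undefined, one = undefined,
      ring.zero = (\<lambda>\<beta> n. 0),
      ring.add = (\<lambda>u u' \<beta> n. u \<beta> n + u' \<beta> n),
      module.smult = (\<lambda>p u \<beta> n. hact_poly p (u \<beta> n))\<rparr>"

text \<open>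
  If \<open>T b\<close> has degree \<open>(k - b, \<gamma>)\<close> for every \<open>b\<close>, then the operator \<open>\<Sum>\<^sub>b T b \<hbar>\<^sup>b\<close> acts on the
  completed space: only \<open>u\<^sub>n\<^sub>-\<^sub>k\<^sub>+\<^sub>b\<^sub>,\<^sub>\<beta>\<^sub>-\<^sub>\<gamma>\<close> contributes to the component of degree \<open>(n, \<beta>)\<close> through
  \<open>T b \<hbar>\<^sup>b\<close>, and it vanishes for large \<open>b\<close>.
\<close>

definition complete_op ::
  "('i :: finite \<Rightarrow> 'i \<Rightarrow> int) \<Rightarrow> int \<Rightarrow> 'i lattice \<Rightarrow> (nat \<Rightarrow> 'i vspace \<Rightarrow> 'i vspace) \<Rightarrow>
    ('i lattice \<Rightarrow> int \<Rightarrow> 'i vspace poly) \<Rightarrow> 'i lattice \<Rightarrow> int \<Rightarrow> 'i vspace poly" where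
  "complete_op a k \<gamma> T =
     (\<lambda>u\<in>carrier (Vtilde a). \<lambda>\<beta> n.
        Sum_any (\<lambda>b. hact_poly (Polynomial.monom 1 b) (map_poly (T b) (u (\<beta> - \<gamma>) (n - k + int b)))))"


section \<open>Vertex operators\<close>

text \<open>
  A series \<open>\<Sum>\<^sub>m S m z\<^sup>m\<close> of operators on \<open>\<V>[[\<hbar>]]\<close>.  Infinite sums in \<open>\<V>[[\<hbar>]]\<close> are taken
  coefficientwise in \<open>\<hbar>\<close>; in each sum formed below, only finitely many terms contribute to
  a given coefficient.
\<close>

type_synonym 'i opser = "int \<Rightarrow> 'i vspace fps \<Rightarrow> 'i vspace fps"

definition fps_Sum :: "('b \<Rightarrow> 'a :: comm_monoid_add fps) \<Rightarrow> 'a fps" where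
  "fps_Sum F = Abs_fps (\<lambda>n. Sum_any (\<lambda>x. fps_nth (F x) n))"

definition ext_h :: "('a \<Rightarrow> 'a) \<Rightarrow> 'a fps \<Rightarrow> 'a fps" where
  "ext_h T v = Abs_fps (\<lambda>n. T (fps_nth v n))"

definition op_one :: "'i :: finite opser" where
  "op_one m v = (v when m = 0)"

definition op_mult :: "'i :: finite opser \<Rightarrow> 'i opser \<Rightarrow> 'i opser" where
  "op_mult S T m v = fps_Sum (\<lambda>p. S p (T (m - p) v))"

definition op_exp :: "'i :: finite opser \<Rightarrow> 'i opser" where
  "op_exp S m v =
     fps_Sum (\<lambda>n. ext_h (vscale (1 / fact n)) (((op_mult S ^^ n) op_one) m v))"

text \<open>
  Multiplication by a polynomial in \<open>z\<close> with coefficients in \<open>\<complex>[\<hbar>]\<close>; in the type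
  \<open>complex poly poly\<close> the outer variable is \<open>z\<close> and the inner one is \<open>\<hbar>\<close>.
\<close>

definition op_zpoly :: "complex poly poly \<Rightarrow> 'i :: finite opser" where
  "op_zpoly P m v = (hact (Polynomial.coeff P (nat m)) v when m \<ge> 0)"

abbreviation zvar :: "complex poly poly" where
  "zvar \<equiv> [:0, 1:]"

abbreviation hvar :: "complex poly poly" where
  "hvar \<equiv> [:[:0, 1:]:]"

definition nbrs :: "('i \<Rightarrow> 'i \<Rightarrow> int) \<Rightarrow> 'i \<Rightarrow> 'i set" where
  "nbrs a i = {j. j \<noteq> i \<and> a i j \<noteq> 0}"

definition A_exponent :: "('i :: finite \<Rightarrow> 'i \<Rightarrow> int) \<Rightarrow> sign \<Rightarrow> 'i \<Rightarrow> 'i opser" where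
  "A_exponent a s i m v =
     ext_h (vscale (pm s))
       (fps_Sum (\<lambda>r :: nat.
          ext_h (vscale (1 / of_nat r))
            (ext_h (Hcre i r) (op_zpoly (zvar ^ r + (zvar - pm s * hvar) ^ r) m v))
          when r > 0)
        - fps_Sum (\<lambda>r :: nat.
          \<Sum>j\<in>nbrs a i. ext_h (vscale (1 / of_nat r))
            (ext_h (Hcre j r) (op_zpoly ((zvar - pm s * [:[:1 / 2:]:] * hvar) ^ r) m v))
          when r > 0))"

definition B_exponent :: "sign \<Rightarrow> 'i :: finite \<Rightarrow> 'i opser" where
  "B_exponent s i m v =
     ext_h (vscale (- pm s))
       (fps_Sum (\<lambda>r :: nat.
          ext_h (vscale (1 / of_nat r)) (ext_h (Hann i r) v) when r > 0 \<and> m = - int r))"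

definition op_lat_exp ::
  "('i lattice \<Rightarrow> 'i lattice \<Rightarrow> complex) \<Rightarrow> 'i lattice \<Rightarrow> 'i :: finite opser" where
  "op_lat_exp \<epsilon> \<alpha> m v = (ext_h (lat_exp \<epsilon> \<alpha>) v when m = 0)"

definition op_zpartial :: "('i :: finite \<Rightarrow> 'i \<Rightarrow> int) \<Rightarrow> 'i lattice \<Rightarrow> 'i opser" where
  "op_zpartial a \<alpha> m =
     ext_h (\<lambda>v. Sum_any (\<lambda>\<beta>. (Poly_Mapping.single \<beta> (Poly_Mapping.lookup v \<beta>) when form a \<alpha> \<beta> = m)))"

definition vertex_op ::
  "('i :: finite \<Rightarrow> 'i \<Rightarrow> int) \<Rightarrow> ('i lattice \<Rightarrow> 'i lattice \<Rightarrow> complex) \<Rightarrow> sign \<Rightarrow> 'i \<Rightarrow> 'i opser" where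
  "vertex_op a \<epsilon> s i m v =
     ext_h (vscale (pm s))
       (op_mult (op_mult (op_mult (op_exp (A_exponent a s i)) (op_exp (B_exponent s i)))
          (op_lat_exp \<epsilon> (sroot s i))) (op_zpartial a (sroot s i)) m v)"

definition vertex_mode ::
  "('i :: finite \<Rightarrow> 'i \<Rightarrow> int) \<Rightarrow> ('i lattice \<Rightarrow> 'i lattice \<Rightarrow> complex) \<Rightarrow> sign \<Rightarrow> 'i \<Rightarrow> int \<Rightarrow>
    'i vspace fps \<Rightarrow> 'i vspace fps" where
  "vertex_mode a \<epsilon> s i k = vertex_op a \<epsilon> s i (- k - 1)"

end

theory Submission
  imports Defs "HOL-Library.Product_Plus"
begin

text \<open>
  A vertex operator is a product \<open>A(z) T(z)\<close> of a creation half and an annihilation half, and moving \<open>T(z)\<close> past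
  \<open>A(w)\<close> costs a product of linear factors \<open>z - w + c\<hbar>\<close>.  Hence a product of two vertex operators, multiplied by such
  factors, is normally ordered.  Since multiplication by \<open>z - w + c\<hbar>\<close> is injective on truncated series, the quadratic
  relations and the Serre relations follow.  The central element acts as 1; the currents are given by
  \<open>1 + \<hbar> h\<^sup>+(z) = (z - \<hbar>/2)\<^sup>2 T\<^sup>-(z - \<hbar>/2) T\<^sup>+(z + \<hbar>/2)\<close> and \<open>1 - \<hbar> h\<^sup>-(z) = A\<^sup>+(z) A\<^sup>-(z)\<close>, and their relations are obtained
  after multiplication by \<open>\<hbar>\<close>, which is injective.

  To pass from \<open>\<V>[[\<hbar>]]\<close> to the completed space, where \<open>\<hbar>\<close> has degree \<open>(1, 0)\<close> as an operator, the free algebra is first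
  mapped to the group ring of the group of degrees with coefficients in the operators on \<open>\<V>[[\<hbar>]]\<close>.  A relator goes to an
  element whose coefficients are homogeneous of different degrees and have sum 0, so all of them vanish.

  Uniqueness holds because the commutators of \<open>x\<^sup>+\<close> and \<open>x\<^sup>-\<close> give first the \<open>h\<^sub>r\<close> with \<open>r \<le> 0\<close>, then the central element and
  then, by induction, the \<open>h\<^sub>r\<close> with \<open>r > 0\<close>.
\<close>

text \<open>The sums defining the modes are infinite; they are finite only on a given vector and at
  a given order in \<hbar>. This asymmetry is the source of the delta functions. X^+(z) X^-(w) and
  X^-(w) X^+(z) become equal after multiplication by (z - w)(z - w - \<hbar>); they are two
  expansions of one expression, and their difference lives on z = w and z = w + \<hbar>. The
  residues there are A^+ A^- and T^-(z) T^+(z + \<hbar>), which explains the formulas for the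
  currents. The degrees are carried along by the generators in the group ring, so homogeneity has to
  be verified for the generators only and not for each relator.\<close>

lemma lookup_map: "g 0 = 0 \<Longrightarrow> Poly_Mapping.lookup (Poly_Mapping.map g v) k = g (Poly_Mapping.lookup v k)"
  by transfer (auto simp: when_def)

section \<open>Scalars, linear operators and multiplication operators as rings\<close>

definition cf :: "complex \<Rightarrow> 'i fock" where "cf c = Poly_Mapping.single 0 c"

lemma cf_hom [simp]: "cf 0 = 0" "cf 1 = 1" "cf (c + d) = cf c + cf d" "cf (c * d) = cf c * cf d"
  "cf (- c) = - cf c" "cf (c - d) = cf c - cf d"
  by (simp_all add: cf_def single_add mult_single single_uminus single_diff)

lemma cf_of_nat [simp]: "cf (of_nat n) = of_nat n"
  by (induction n) simp_all

lemma cf_numeral [simp]: "cf (numeral n) = numeral n"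
  using cf_of_nat[of "numeral n"] by simp

lemma lookup_vscale [simp]: "Poly_Mapping.lookup (vscale c v) k = cf c * Poly_Mapping.lookup v k"
  by (simp add: vscale_def lookup_map cf_def)

interpretation vs: vector_space vscale
  by unfold_locales
     (auto intro!: poly_mapping_eqI simp: lookup_add distrib_left distrib_right mult.assoc)

text \<open>Linear endomorphisms of V are made a type so that they can be an instance of
  \<open>ring_1\<close>; power series in \<hbar> and group ring elements with operator coefficients
  then inherit their ring structure.\<close>

typedef (overloaded) 'i vend = "{f :: 'i::finite vspace \<Rightarrow> 'i vspace. Vector_Spaces.linear vscale vscale f}"
  by (rule exI[of _ "\<lambda>v. v"]) (simp add: vs.linear_id[unfolded id_def])

abbreviation ap :: "'i::finite vend \<Rightarrow> 'i vspace \<Rightarrow> 'i vspace" where "ap \<equiv> Rep_vend"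

lemma vlinearI:
  assumes "\<And>u v. f (u + v) = f u + f v" "\<And>c v. f (vscale c v) = vscale c (f v)"
  shows "Vector_Spaces.linear vscale vscale f"
  using assms by unfold_locales auto

lemma vlinear_iff: "Vector_Spaces.linear vscale vscale f \<longleftrightarrow>
    (\<forall>u v. f (u + v) = f u + f v) \<and> (\<forall>c v. f (vscale c v) = vscale c (f v))"
  using vlinearI by (metis (no_types) Vector_Spaces.linear_iff)

lemma ap_linear: "Vector_Spaces.linear vscale vscale (ap f)"
  using Rep_vend by blast

lemma ap_add [simp]: "ap f (u + v) = ap f u + ap f v"
  and ap_vscale [simp]: "ap f (vscale c v) = vscale c (ap f v)"
  using ap_linear[of f] by (simp_all add: vlinear_iff)

lemma ap_zero [simp]: "ap f 0 = 0"
  using ap_vscale[of f 0 0] by simp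

lemma ap_minus [simp]: "ap f (- u) = - ap f u"
  by (metis ap_add ap_zero add.right_inverse add_eq_0_iff)

lemma ap_diff [simp]: "ap f (u - v) = ap f u - ap f v"
  using ap_add[of f u "- v"] by simp

lemma ap_sum: "ap f (sum g A) = (\<Sum>x\<in>A. ap f (g x))"
  by (induction A rule: infinite_finite_induct) simp_all

lemma vend_eqI: "(\<And>v. ap f v = ap g v) \<Longrightarrow> f = g"
  using Rep_vend_inject by blast

instantiation vend :: (finite) ring_1
begin
definition zero_vend :: "'a vend" where "0 = Abs_vend (\<lambda>_. 0)"
definition one_vend :: "'a vend" where "1 = Abs_vend (\<lambda>v. v)"
definition plus_vend :: "'a vend \<Rightarrow> 'a vend \<Rightarrow> 'a vend" where "f + g = Abs_vend (\<lambda>v. ap f v + ap g v)"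
definition minus_vend :: "'a vend \<Rightarrow> 'a vend \<Rightarrow> 'a vend" where "f - g = Abs_vend (\<lambda>v. ap f v - ap g v)"
definition uminus_vend :: "'a vend \<Rightarrow> 'a vend" where "- f = Abs_vend (\<lambda>v. - ap f v)"
definition times_vend :: "'a vend \<Rightarrow> 'a vend \<Rightarrow> 'a vend" where "f * g = Abs_vend (\<lambda>v. ap f (ap g v))"

lemma ap_zero_left: "ap 0 v = (0 :: 'a vspace)"
  and ap_one_left: "ap 1 v = (v :: 'a vspace)"
  and ap_plus_left: "ap (f + g) v = ap f v + (ap g v :: 'a vspace)"
  and ap_minus_left: "ap (f - g) v = ap f v - (ap g v :: 'a vspace)"
  and ap_uminus_left: "ap (- f) v = - (ap f v :: 'a vspace)"
  and ap_times_left: "ap (f * g) v = (ap f (ap g v) :: 'a vspace)"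
  by (simp_all add: zero_vend_def one_vend_def plus_vend_def minus_vend_def uminus_vend_def times_vend_def
      Abs_vend_inverse vlinear_iff vs.scale_right_distrib vs.scale_right_diff_distrib)

lemmas ap_left = ap_zero_left ap_one_left ap_plus_left ap_minus_left ap_uminus_left ap_times_left

instance
proof
  show "(0::'a vend) \<noteq> 1"
  proof
    assume "(0::'a vend) = 1"
    then have "ap (0::'a vend) (Poly_Mapping.single 0 1) = ap 1 (Poly_Mapping.single 0 (1 :: 'a fock))" by simp
    then have "Poly_Mapping.lookup (0::'a vspace) 0 = Poly_Mapping.lookup (Poly_Mapping.single 0 1 :: 'a vspace) 0"
      unfolding ap_left by (rule arg_cong[of _ _ "\<lambda>u. Poly_Mapping.lookup u 0"])
    then show False by simp
  qed
qed (rule vend_eqI; simp add: ap_left algebra_simps)+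
end

lemmas ap_simps [simp] = ap_left

lemma ap_sum_left: "ap (sum f A) v = (\<Sum>x\<in>A. ap (f x) v)"
  by (induction A rule: infinite_finite_induct) simp_all

definition sc :: "complex \<Rightarrow> 'i::finite vend" where "sc c = Abs_vend (vscale c)"

lemma ap_sc [simp]: "ap (sc c) v = vscale c v"
  by (simp add: sc_def Abs_vend_inverse vlinear_iff vs.scale_right_distrib vs.scale_left_commute)

lemma sc_hom [simp]: "sc 0 = 0" "sc 1 = 1" "sc (c + d) = sc c + sc d" "sc (c * d) = sc c * sc d"
  "sc (- c) = - sc c" "sc (c - d) = sc c - sc d"
  by (rule vend_eqI; simp add: vs.scale_left_distrib vs.scale_left_diff_distrib)+

lemma sc_of_nat [simp]: "sc (of_nat n) = of_nat n"
  by (induction n) simp_all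

lemma sc_numeral [simp]: "sc (numeral n) = numeral n"
  using sc_of_nat[of "numeral n"] by simp

lemma sc_commute: "sc c * x = x * sc c"
  by (rule vend_eqI) simp

lemma sc_cancel: "c \<noteq> 0 \<Longrightarrow> sc c * x = sc c * y \<Longrightarrow> x = y"
proof -
  assume "c \<noteq> 0" and eq: "sc c * x = sc c * y"
  then have inv: "sc (inverse c) * (sc c * z) = z" for z :: "'a vend"
    by (simp add: mult.assoc[symmetric] sc_hom(4)[symmetric] del: sc_hom(4))
  show "x = y" using arg_cong[OF eq, of "\<lambda>z. sc (inverse c) * z"] unfolding inv .
qed

text \<open>The Fock algebra acts on the first tensor factor, in the same way over every \<beta>.
  The map is a ring homomorphism (\<open>mo_hom\<close>), so exponentials of creation operators can
  be computed as commutative power series over the Fock space.\<close>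

definition mo :: "'i fock \<Rightarrow> 'i::finite vend" where
  "mo g = Abs_vend (Poly_Mapping.map (\<lambda>f. g * f))"

lemma lookup_mo [simp]: "Poly_Mapping.lookup (ap (mo g) v) b = g * Poly_Mapping.lookup v b"
  unfolding mo_def
  by (subst Abs_vend_inverse)
     (auto simp: vlinear_iff lookup_map lookup_add algebra_simps intro!: poly_mapping_eqI)

lemma mo_hom [simp]: "mo 0 = 0" "mo 1 = 1" "mo (g + h) = mo g + mo h" "mo (g * h) = mo g * mo h"
  "mo (- g) = - mo g" "mo (g - h) = mo g - mo h"
  by (rule vend_eqI; rule poly_mapping_eqI; simp add: lookup_add lookup_minus algebra_simps)+

lemma mo_cf: "mo (cf c) = sc c"
  by (rule vend_eqI; rule poly_mapping_eqI; simp)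

lemma mo_sum: "mo (sum g A) = (\<Sum>x\<in>A. mo (g x))"
  by (induction A rule: infinite_finite_induct) simp_all

lemma mo_commute: "mo g * mo h = mo h * mo g"
  by (simp flip: mo_hom add: mult.commute)

section \<open>Locally finite sums\<close>

text \<open>An element of \<open>'i vend fps\<close> stands for an \<hbar>-linear operator on
  V[[\<hbar>]], and \<open>app\<close> gives the coefficient of \<hbar>^d of its value on a vector
  of V. These values determine the operator (\<open>app_eqI\<close>), and all convergence is tested
  on them.\<close>

definition app :: "'i::finite vend fps \<Rightarrow> nat \<Rightarrow> 'i vspace \<Rightarrow> 'i vspace" where
  "app x d v = ap (fps_nth x d) v"

lemma app_simps [simp]: "app 0 d v = 0" "app (x + y) d v = app x d v + app y d v"
  "app (x - y) d v = app x d v - app y d v" "app (- x) d v = - app x d v" "app x d 0 = 0"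
  "app x d (u + v) = app x d u + app x d v" "app x d (u - v) = app x d u - app x d v"
  by (simp_all add: app_def)

lemma app_mult: "app (x * y) d v = (\<Sum>e\<le>d. app x e (app y (d - e) v))"
  by (simp add: app_def fps_mult_nth ap_sum_left atLeast0AtMost)

lemma app_sum: "app (sum f A) d v = (\<Sum>x\<in>A. app (f x) d v)"
  by (induction A rule: infinite_finite_induct) simp_all

lemma app_sum_right: "app x d (sum f A) = (\<Sum>k\<in>A. app x d (f k))"
  by (simp add: app_def ap_sum)

lemma app_eqI: "(\<And>d v. app x d v = app y d v) \<Longrightarrow> x = y"
  by (rule fps_ext) (auto intro!: vend_eqI simp: app_def)

text \<open>Finiteness is asked for each vector and each order in \<hbar> separately: the family
  behind a mode of a vertex operator is infinite, but a given vector sees only finitely many of its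
  members at a given order.\<close>

definition sumbl :: "('b \<Rightarrow> 'i::finite vend fps) \<Rightarrow> bool" where
  "sumbl F \<longleftrightarrow> (\<forall>d v. finite {p. app (F p) d v \<noteq> 0})"

lemma sumblD: "sumbl F \<Longrightarrow> finite {p. app (F p) d v \<noteq> 0}"
  by (simp add: sumbl_def)


text \<open>If the family is not \<open>sumbl\<close>, the pointwise sum need not be linear and the
  value is not controlled; hence the side conditions on local finiteness throughout.\<close>

definition lsum :: "('b \<Rightarrow> 'i::finite vend fps) \<Rightarrow> 'i vend fps" where
  "lsum F = Abs_fps (\<lambda>d. Abs_vend (\<lambda>v. Sum_any (\<lambda>p. app (F p) d v)))"

lemma app_scale: "app x d (vscale c v) = vscale c (app x d v)"
  by (simp add: app_def)

lemma Sum_any_vscale: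
  assumes "finite {p. g p \<noteq> 0}"
  shows "Sum_any (\<lambda>p. vscale c (g p)) = vscale c (Sum_any g)"
proof -
  have "Sum_any (\<lambda>p. vscale c (g p)) = (\<Sum>p | g p \<noteq> 0. vscale c (g p))"
    by (rule Sum_any.expand_superset) (use assms in auto)
  then show ?thesis by (simp add: vs.scale_sum_right Sum_any.expand_set)
qed

lemma app_lsum:
  assumes "sumbl F"
  shows "app (lsum F) d v = Sum_any (\<lambda>p. app (F p) d v)"
proof -
  have "Vector_Spaces.linear vscale vscale (\<lambda>v. Sum_any (\<lambda>p. app (F p) d v))"
    using sumblD[OF assms] by (intro vlinearI) (simp_all add: Sum_any.distrib app_scale Sum_any_vscale)
  then show ?thesis
    by (simp add: app_def lsum_def Abs_vend_inverse)
qed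

lemma app_lsum_superset:
  assumes "sumbl F" "finite A" "\<And>p. p \<notin> A \<Longrightarrow> app (F p) d v = 0"
  shows "app (lsum F) d v = (\<Sum>p\<in>A. app (F p) d v)"
  unfolding app_lsum[OF assms(1)]
  by (rule Sum_any.expand_superset) (use assms in auto)

lemma sumbl_add: "sumbl F \<Longrightarrow> sumbl G \<Longrightarrow> sumbl (\<lambda>p. F p + G p)"
proof -
  assume F: "sumbl F" and G: "sumbl G"
  have "finite {p. app (F p + G p) d v \<noteq> 0}" for d v
    by (rule finite_subset[OF _ finite_UnI[OF sumblD[OF F, of d v] sumblD[OF G, of d v]]]) auto
  then show ?thesis by (simp add: sumbl_def)
qed

lemma sumbl_uminus: "sumbl F \<Longrightarrow> sumbl (\<lambda>p. - F p)"
  by (simp add: sumbl_def)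

lemma sumbl_diff: "sumbl F \<Longrightarrow> sumbl G \<Longrightarrow> sumbl (\<lambda>p. F p - G p)"
  using sumbl_add[of F "\<lambda>p. - G p"] sumbl_uminus[of G] by simp

text \<open>The left factor may vary with the index, because the right factor acts first and leaves
  only finitely many indices. On the right only a fixed factor is allowed
  (\<open>sumbl_mult_right\<close>). For this reason the annihilating factors are kept on the
  right.\<close>

lemma sumbl_mult_left:
  assumes "sumbl F" shows "sumbl (\<lambda>p. G p * F p)"
  unfolding sumbl_def
proof (intro allI)
  fix d v
  have "{p. app (G p * F p) d v \<noteq> 0} \<subseteq> (\<Union>e\<le>d. {p. app (F p) (d - e) v \<noteq> 0})"
  proof safe
    fix p assume "app (G p * F p) d v \<noteq> 0"
    then obtain e where "e \<le> d" "app (G p) e (app (F p) (d - e) v) \<noteq> 0"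
      unfolding app_mult by (meson atMost_iff sum.not_neutral_contains_not_neutral)
    then have "app (F p) (d - e) v \<noteq> 0" by auto
    with \<open>e \<le> d\<close> show "p \<in> (\<Union>e\<le>d. {p. app (F p) (d - e) v \<noteq> 0})" by blast
  qed
  then show "finite {p. app (G p * F p) d v \<noteq> 0}"
    using sumblD[OF assms] by (meson finite_UN_I finite_atMost finite_subset)
qed

lemma sumbl_mult_right:
  assumes "sumbl F" shows "sumbl (\<lambda>p. F p * y)"
  unfolding sumbl_def
proof (intro allI)
  fix d v
  have "{p. app (F p * y) d v \<noteq> 0} \<subseteq> (\<Union>e\<le>d. {p. app (F p) e (app y (d - e) v) \<noteq> 0})"
    using sum.not_neutral_contains_not_neutral unfolding app_mult by fastforce
  then show "finite {p. app (F p * y) d v \<noteq> 0}"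
    using sumblD[OF assms] by (meson finite_UN_I finite_atMost finite_subset)
qed

lemma sumbl_reindex: "sumbl F \<Longrightarrow> inj f \<Longrightarrow> sumbl (\<lambda>p. F (f p))"
proof -
  assume F: "sumbl F" and f: "inj f"
  have "{p. app (F (f p)) d v \<noteq> 0} = f -` {p. app (F p) d v \<noteq> 0}" for d v by auto
  then show ?thesis unfolding sumbl_def using finite_vimageI[OF sumblD[OF F] f] by simp
qed

lemma sumbl_shift [simp]: "sumbl (\<lambda>p. F (p + k)) \<longleftrightarrow> sumbl F" "sumbl (\<lambda>p. F (p - k)) \<longleftrightarrow> sumbl F"
  "sumbl (\<lambda>p. F (k - p)) \<longleftrightarrow> sumbl F" for F :: "int \<Rightarrow> 'i::finite vend fps"
proof -
  show "sumbl (\<lambda>p. F (p + k)) \<longleftrightarrow> sumbl F"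
    using sumbl_reindex[of F "\<lambda>p. p + k"] sumbl_reindex[of "\<lambda>p. F (p + k)" "\<lambda>p. p - k"]
    by (auto simp: inj_def)
  show "sumbl (\<lambda>p. F (p - k)) \<longleftrightarrow> sumbl F"
    using sumbl_reindex[of F "\<lambda>p. p - k"] sumbl_reindex[of "\<lambda>p. F (p - k)" "\<lambda>p. p + k"]
    by (auto simp: inj_def)
  show "sumbl (\<lambda>p. F (k - p)) \<longleftrightarrow> sumbl F"
    using sumbl_reindex[of F "\<lambda>p. k - p"] sumbl_reindex[of "\<lambda>p. F (k - p)" "\<lambda>p. k - p"]
    by (auto simp: inj_def)
qed

lemma lsum_eqI:
  assumes "sumbl F" "sumbl G" "\<And>d v. Sum_any (\<lambda>p. app (F p) d v) = Sum_any (\<lambda>p. app (G p) d v)"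
  shows "lsum F = lsum G"
  by (rule app_eqI) (simp add: app_lsum assms)

lemma lsum_zero [simp]: "lsum (\<lambda>_. 0) = 0"
  by (rule app_eqI) (simp add: app_lsum sumbl_def)

lemma lsum_add: "sumbl F \<Longrightarrow> sumbl G \<Longrightarrow> lsum (\<lambda>p. F p + G p) = lsum F + lsum G"
  by (rule app_eqI) (simp add: app_lsum sumbl_add Sum_any.distrib sumblD)

lemma lsum_uminus: "lsum (\<lambda>p. - F p) = - lsum F" if "sumbl F"
  using lsum_add[OF that sumbl_uminus[OF that]] by (simp add: eq_neg_iff_add_eq_0 add.commute)

lemma lsum_diff: "sumbl F \<Longrightarrow> sumbl G \<Longrightarrow> lsum (\<lambda>p. F p - G p) = lsum F - lsum G"
  using lsum_add[of F "\<lambda>p. - G p"] sumbl_uminus[of G] lsum_uminus[of G] by simp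

lemma app_Sum_any:
  assumes "finite {p. g p \<noteq> 0}" shows "app x d (Sum_any g) = Sum_any (\<lambda>p. app x d (g p))"
proof -
  have "Sum_any (\<lambda>p. app x d (g p)) = (\<Sum>p | g p \<noteq> 0. app x d (g p))"
    by (rule Sum_any.expand_superset) (use assms in auto)
  then show ?thesis by (simp add: Sum_any.expand_set app_sum_right)
qed

lemma Sum_any_sum:
  assumes "finite A" "\<And>k. k \<in> A \<Longrightarrow> finite {p. g k p \<noteq> (0::'a::comm_monoid_add)}"
  shows "Sum_any (\<lambda>p. \<Sum>k\<in>A. g k p) = (\<Sum>k\<in>A. Sum_any (g k))"
  using assms
proof (induction A rule: finite_induct)
  case (insert k A)
  have "{p. (\<Sum>k\<in>A. g k p) \<noteq> 0} \<subseteq> (\<Union>k\<in>A. {p. g k p \<noteq> 0})"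
    using sum.not_neutral_contains_not_neutral by fastforce
  moreover have "finite (\<Union>k\<in>A. {p. g k p \<noteq> 0})" using insert by auto
  ultimately have "finite {p. (\<Sum>k\<in>A. g k p) \<noteq> 0}" by (rule finite_subset)
  then show ?case using insert by (simp add: Sum_any.distrib)
qed simp

lemma lsum_mult_left: "y * lsum F = lsum (\<lambda>p. y * F p)" if F: "sumbl F"
proof (rule app_eqI)
  fix d v
  have fin: "finite {p. app y e (app (F p) k v) \<noteq> 0}" for e k
    by (rule finite_subset[OF _ sumblD[OF F, of k v]]) auto
  show "app (y * lsum F) d v = app (lsum (\<lambda>p. y * F p)) d v"
    by (simp add: app_lsum F sumbl_mult_left app_mult app_Sum_any sumblD Sum_any_sum fin)
qed

lemma lsum_mult_right: "lsum F * y = lsum (\<lambda>p. F p * y)" if F: "sumbl F"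
  by (rule app_eqI) (simp add: app_lsum F sumbl_mult_right app_mult Sum_any_sum sumblD)

lemma lsum_reindex: "bij f \<Longrightarrow> sumbl F \<Longrightarrow> lsum (\<lambda>p. F (f p)) = lsum F"
proof (rule lsum_eqI)
  fix d v
  assume "bij f"
  then show "Sum_any (\<lambda>p. app (F (f p)) d v) = Sum_any (\<lambda>p. app (F p) d v)"
    by (intro Sum_any.reindex_cong[symmetric, of f]) (simp_all add: comp_def)
qed (simp_all add: sumbl_reindex bij_is_inj)

lemma lsum_shift: "sumbl F \<Longrightarrow> lsum (\<lambda>p. F (p + k)) = lsum F" "sumbl F \<Longrightarrow> lsum (\<lambda>p. F (p - k)) = lsum F"
  "sumbl F \<Longrightarrow> lsum (\<lambda>p. F (k - p)) = lsum F" for F :: "int \<Rightarrow> 'i::finite vend fps"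
proof -
  have "bij (\<lambda>p. p + k)" "bij (\<lambda>p. p - k)" "bij (\<lambda>p. k - p)"
    by (rule o_bij[of "\<lambda>p. p - k"], auto)
       (rule o_bij[of "\<lambda>p. p + k"], auto, rule o_bij[of "\<lambda>p. k - p"], auto)
  then show "sumbl F \<Longrightarrow> lsum (\<lambda>p. F (p + k)) = lsum F" "sumbl F \<Longrightarrow> lsum (\<lambda>p. F (p - k)) = lsum F"
    "sumbl F \<Longrightarrow> lsum (\<lambda>p. F (k - p)) = lsum F"
    using lsum_reindex[of _ F] by blast+
qed

lemma sumbl_single: "(\<And>p. p \<noteq> p0 \<Longrightarrow> F p = 0) \<Longrightarrow> sumbl F"
proof -
  assume F: "\<And>p. p \<noteq> p0 \<Longrightarrow> F p = 0"
  have "finite {p. app (F p) d v \<noteq> 0}" for d v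
    by (rule finite_subset[of _ "{p0}"]) (use F in force, simp)
  then show ?thesis by (simp add: sumbl_def)
qed

lemma lsum_single: "(\<And>p. p \<noteq> p0 \<Longrightarrow> F p = 0) \<Longrightarrow> lsum F = F p0"
proof (rule app_eqI)
  fix d v
  assume F: "\<And>p. p \<noteq> p0 \<Longrightarrow> F p = 0"
  show "app (lsum F) d v = app (F p0) d v"
    using app_lsum_superset[of F "{p0}" d v] sumbl_single[of p0 F] F by simp
qed

lemma sumbl_finite: "finite {p. F p \<noteq> 0} \<Longrightarrow> sumbl F"
proof -
  assume F: "finite {p. F p \<noteq> 0}"
  have "finite {p. app (F p) d v \<noteq> 0}" for d v
    by (rule finite_subset[OF _ F]) auto
  then show ?thesis by (simp add: sumbl_def)
qed

lemma lsum_finite: "finite A \<Longrightarrow> (\<And>p. p \<notin> A \<Longrightarrow> F p = 0) \<Longrightarrow> lsum F = (\<Sum>p\<in>A. F p)"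
proof (rule app_eqI)
  fix d v
  assume A: "finite A" and F: "\<And>p. p \<notin> A \<Longrightarrow> F p = 0"
  have "sumbl F" by (rule sumbl_finite, rule finite_subset[OF _ A]) (use F in auto)
  then show "app (lsum F) d v = app (\<Sum>p\<in>A. F p) d v"
    using app_lsum_superset[of F A d v] A F by (simp add: app_sum)
qed

text \<open>The rightmost factor selects finitely many q, and for each of them the family
  \<open>G p q\<close> is tested on a single vector at each order.\<close>

lemma sumbl_pairI:
  assumes "sumbl F" "\<And>q. sumbl (\<lambda>p. G p q)"
  shows "sumbl (\<lambda>(p, q). G p q * F q)"
  unfolding sumbl_def
proof (intro allI)
  fix d v
  have "{x. app (case x of (p, q) \<Rightarrow> G p q * F q) d v \<noteq> 0}
      \<subseteq> (\<Union>e\<le>d. \<Union>q\<in>{q. app (F q) (d - e) v \<noteq> 0}. {p. app (G p q) e (app (F q) (d - e) v) \<noteq> 0} \<times> {q})"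
  proof clarify
    fix p q assume "app (G p q * F q) d v \<noteq> 0"
    then obtain e where "e \<le> d" "app (G p q) e (app (F q) (d - e) v) \<noteq> 0"
      unfolding app_mult by (meson atMost_iff sum.not_neutral_contains_not_neutral)
    then show "(p, q) \<in> (\<Union>e\<le>d. \<Union>q\<in>{q. app (F q) (d - e) v \<noteq> 0}. {p. app (G p q) e (app (F q) (d - e) v) \<noteq> 0} \<times> {q})"
      by (cases "app (F q) (d - e) v = 0") auto
  qed
  moreover have "finite (\<Union>e\<le>d. \<Union>q\<in>{q. app (F q) (d - e) v \<noteq> 0}. {p. app (G p q) e (app (F q) (d - e) v) \<noteq> 0} \<times> {q})"
    using sumblD[OF assms(1)] sumblD[OF assms(2)] by auto
  ultimately show "finite {x. app (case x of (p, q) \<Rightarrow> G p q * F q) d v \<noteq> 0}" by (rule finite_subset)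
qed

lemma sumbl_pair_sections:
  assumes "sumbl (\<lambda>(p, q). G p q)"
  shows "sumbl (\<lambda>p. G p q)" "sumbl (\<lambda>q. G p q)"
proof -
  show "sumbl (\<lambda>p. G p q)"
    using sumbl_reindex[OF assms, of "\<lambda>p. (p, q)"] by (simp add: inj_def)
  show "sumbl (\<lambda>q. G p q)"
    using sumbl_reindex[OF assms, of "\<lambda>q. (p, q)"] by (simp add: inj_def)
qed

lemma Sum_any_pair:
  assumes "finite {(p, q). g p q \<noteq> (0::'a::comm_monoid_add)}"
  shows "finite {q. Sum_any (\<lambda>p. g p q) \<noteq> 0}"
    "Sum_any (\<lambda>q. Sum_any (\<lambda>p. g p q)) = Sum_any (\<lambda>(p, q). g p q)"
proof -
  let ?C = "{(p, q). g p q \<noteq> 0}"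
  have "{q. Sum_any (\<lambda>p. g p q) \<noteq> 0} \<subseteq> snd ` ?C"
    by (auto simp: image_iff elim!: Sum_any.not_neutral_obtains_not_neutral)
  then show "finite {q. Sum_any (\<lambda>p. g p q) \<noteq> 0}" using assms by (meson finite_surj)
  have sub: "{(p, q). g p q \<noteq> 0} \<subseteq> fst ` ?C \<times> snd ` ?C" by (force simp: image_iff)
  have "Sum_any (\<lambda>(p, q). g p q) = (\<Sum>(p,q)\<in>fst ` ?C \<times> snd ` ?C. g p q)"
    by (rule Sum_any.expand_superset) (use assms sub in auto)
  also have "\<dots> = (\<Sum>q\<in>snd ` ?C. \<Sum>p\<in>fst ` ?C. g p q)"
    by (subst sum.cartesian_product[symmetric]) (rule sum.swap)
  also have "\<dots> = (\<Sum>q\<in>snd ` ?C. Sum_any (\<lambda>p. g p q))"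
    by (intro sum.cong refl Sum_any.expand_superset[symmetric]) (use assms sub in force)+
  also have "\<dots> = Sum_any (\<lambda>q. Sum_any (\<lambda>p. g p q))"
    by (rule Sum_any.expand_superset[symmetric])
       (use assms in \<open>auto simp: image_iff elim!: Sum_any.not_neutral_obtains_not_neutral\<close>)
  finally show "Sum_any (\<lambda>q. Sum_any (\<lambda>p. g p q)) = Sum_any (\<lambda>(p, q). g p q)" by simp
qed

lemma app_case_prod: "app (case x of (p, q) \<Rightarrow> G p q) d v = (case x of (p, q) \<Rightarrow> app (G p q) d v)"
  by (cases x) simp

text \<open>Fubini for locally finite sums. Joint local finiteness is assumed, since finiteness of
  the iterated sums would not justify an exchange.\<close>

lemma lsum_pair:
  assumes "sumbl (\<lambda>(p, q). G p q)"
  shows "sumbl (\<lambda>q. lsum (\<lambda>p. G p q))" "lsum (\<lambda>q. lsum (\<lambda>p. G p q)) = lsum (\<lambda>(p, q). G p q)"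
proof -
  have fin: "finite {(p, q). app (G p q) d v \<noteq> 0}" for d v
    using sumblD[OF assms, of d v] by (simp add: app_case_prod case_prod_unfold)
  note sec = sumbl_pair_sections[OF assms]
  show 1: "sumbl (\<lambda>q. lsum (\<lambda>p. G p q))"
    unfolding sumbl_def by (simp add: app_lsum sec Sum_any_pair[OF fin])
  show "lsum (\<lambda>q. lsum (\<lambda>p. G p q)) = lsum (\<lambda>(p, q). G p q)"
    by (rule app_eqI) (simp add: app_lsum[OF 1] app_lsum[OF assms] app_lsum sec Sum_any_pair[OF fin] app_case_prod)
qed

lemma sumbl_pair_swap: "sumbl (\<lambda>(p, q). G p q) \<Longrightarrow> sumbl (\<lambda>(q, p). G p q)"
  using sumbl_reindex[of "\<lambda>(p, q). G p q" prod.swap]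
  by (simp add: case_prod_unfold)

lemma lsum_swap:
  assumes "sumbl (\<lambda>(p, q). G p q)"
  shows "lsum (\<lambda>q. lsum (\<lambda>p. G p q)) = lsum (\<lambda>p. lsum (\<lambda>q. G p q))"
proof -
  have "lsum (\<lambda>(p, q). G p q) = lsum (\<lambda>(q, p). G p q)"
    using lsum_reindex[of prod.swap "\<lambda>(p, q). G p q"] assms
    by (simp add: case_prod_unfold)
  then show ?thesis
    using lsum_pair(2)[OF assms] lsum_pair(2)[OF sumbl_pair_swap[OF assms]] by simp
qed

section \<open>Creation and annihilation operators\<close>

lemma poly_mapping_single_induct:
  assumes "P 0" "\<And>f g. P f \<Longrightarrow> P g \<Longrightarrow> P (f + g)" "\<And>k c. P (Poly_Mapping.single k c)"
  shows "P f"
proof (induction f rule: update_induct)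
  case const then show ?case by (rule assms(1))
next
  case (update f a b)
  have "Poly_Mapping.update a b f = Poly_Mapping.single a b + f"
    using update(1) by (intro poly_mapping_eqI)
      (auto simp: lookup_update lookup_add lookup_single in_keys_iff when_def)
  then show ?case using update(3) assms(2,3) by metis
qed

lemma exponent_induct:
  assumes "P 0" "\<And>x \<mu>. P \<mu> \<Longrightarrow> P (Poly_Mapping.single x 1 + \<mu>)"
  shows "P (\<mu> :: 'b \<Rightarrow>\<^sub>0 nat)"
proof (induction \<mu> rule: update_induct)
  case const then show ?case by (rule assms(1))
next
  case (update f a b)
  have "P (Poly_Mapping.single a n + f)" for n
  proof (induction n)
    case (Suc n)
    have "Poly_Mapping.single a (Suc n) + f = Poly_Mapping.single a 1 + (Poly_Mapping.single a n + f)"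
      by (simp add: add.assoc[symmetric] single_add[symmetric])
    with Suc assms(2) show ?case by metis
  qed (use update in simp)
  moreover have "Poly_Mapping.update a b f = Poly_Mapping.single a b + f"
    using update(1) by (intro poly_mapping_eqI)
      (auto simp: lookup_update lookup_add lookup_single in_keys_iff when_def)
  ultimately show ?case by metis
qed

lemma fock_induct:
  assumes add: "\<And>f g. P f \<Longrightarrow> P g \<Longrightarrow> P (f + g)" and cf: "\<And>c. P (cf c)"
    and var: "\<And>i r f. r > 0 \<Longrightarrow> P f \<Longrightarrow> P (fock_var i r * f)"
  shows "P f"
proof (induction f rule: poly_mapping_single_induct)
  case 1 show ?case using cf[of 0] by simp
next
  case (3 \<mu> c)
  show ?case
  proof (induction \<mu> rule: exponent_induct)
    case 1 show ?case using cf[of c] by (simp add: cf_def)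
  next
    case (2 x \<mu>)
    obtain i q where x: "x = (i, q)" by (cases x)
    show ?case using var[of "Suc q" _ i, OF _ 2] by (simp add: x fock_var_def mult_single)
  qed
qed (rule add)

definition ebas :: "'i lattice \<Rightarrow> 'i::finite vspace" where "ebas b = Poly_Mapping.single b 1"

lemma lookup_ebas: "Poly_Mapping.lookup (ebas b) c = (1 when b = c)"
  by (simp add: ebas_def lookup_single)

definition hcre :: "'i \<Rightarrow> nat \<Rightarrow> 'i::finite vend" where "hcre i r = mo (fock_var i r)"

lemma ap_hcre: "ap (hcre i r) = Hcre i r"
  by (rule ext, rule poly_mapping_eqI) (simp add: hcre_def Hcre_def lookup_map)

text \<open>V is spanned by what the creation operators make of the e^\<beta>. An operator identity
  therefore needs a check on each \<open>ebas b\<close> and stability under each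
  \<open>hcre i r\<close>.\<close>

lemma vspace_induct:
  assumes add: "\<And>u v. P u \<Longrightarrow> P v \<Longrightarrow> P (u + v)" and sc: "\<And>c v. P v \<Longrightarrow> P (vscale c v)"
    and bas: "\<And>b. P (ebas b)" and var: "\<And>i r v. r > 0 \<Longrightarrow> P v \<Longrightarrow> P (ap (hcre i r) v)"
  shows "P v"
proof (induction v rule: poly_mapping_single_induct)
  case 1 show ?case using sc[OF bas, of 0] by simp
next
  case (3 b f)
  show ?case
  proof (induction f rule: fock_induct)
    case (1 f g) then show ?case using add by (simp add: single_add)
  next
    case (2 c)
    have "Poly_Mapping.single b (cf c) = vscale c (ebas b)"
      by (rule poly_mapping_eqI) (simp add: lookup_ebas lookup_single when_def)
    then show ?case using sc[OF bas] by metis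
  next
    case (3 i r f)
    have "Poly_Mapping.single b (fock_var i r * f) = ap (hcre i r) (Poly_Mapping.single b f)"
      by (rule poly_mapping_eqI) (simp add: hcre_def lookup_single when_def)
    then show ?case using var[OF 3] by metis
  qed
qed (rule add)

lemma lookup_Sum_any:
  "finite {x. g x \<noteq> 0} \<Longrightarrow> Poly_Mapping.lookup (Sum_any g) k = Sum_any (\<lambda>x. Poly_Mapping.lookup (g x) k)"
proof -
  assume fin: "finite {x. g x \<noteq> 0}"
  have "Sum_any (\<lambda>x. Poly_Mapping.lookup (g x) k) = (\<Sum>x | g x \<noteq> 0. Poly_Mapping.lookup (g x) k)"
    by (rule Sum_any.expand_superset[OF fin]) auto
  then show ?thesis by (simp add: Sum_any.expand_set lookup_sum)
qed

lemma lookup_fock_deriv: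
  "Poly_Mapping.lookup (fock_deriv i r f) \<nu> =
     of_nat (Suc (Poly_Mapping.lookup \<nu> (i, r - 1))) * Poly_Mapping.lookup f (\<nu> + Poly_Mapping.single (i, r - 1) 1)"
proof -
  let ?e = "Poly_Mapping.single (i, r - 1) (1::nat)"
  let ?g = "\<lambda>\<mu>. Poly_Mapping.single (\<mu> - ?e) (of_nat (Poly_Mapping.lookup \<mu> (i, r - 1)) * Poly_Mapping.lookup f \<mu>)"
  have "finite {\<mu>. ?g \<mu> \<noteq> 0}"
    by (rule finite_subset[OF _ finite_keys[of f]]) (auto simp: in_keys_iff)
  then have "Poly_Mapping.lookup (fock_deriv i r f) \<nu> = Sum_any (\<lambda>\<mu>. Poly_Mapping.lookup (?g \<mu>) \<nu>)"
    unfolding fock_deriv_def by (rule lookup_Sum_any)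
  also have "\<dots> = (\<Sum>\<mu>\<in>{\<nu> + ?e}. Poly_Mapping.lookup (?g \<mu>) \<nu>)"
  proof (rule Sum_any.expand_superset)
    show "{\<mu>. Poly_Mapping.lookup (?g \<mu>) \<nu> \<noteq> 0} \<subseteq> {\<nu> + ?e}"
    proof
      fix \<mu> assume "\<mu> \<in> {\<mu>. Poly_Mapping.lookup (?g \<mu>) \<nu> \<noteq> 0}"
      \<comment> \<open>Subtraction of exponents is truncated, so \<mu> can be recovered from \<nu>
        only if the variable occurs in \<mu>; monomials without it carry the coefficient 0.\<close>
      then have *: "\<mu> - ?e = \<nu>" "Poly_Mapping.lookup \<mu> (i, r - 1) \<noteq> 0"
        by (auto simp: lookup_single when_def split: if_splits)
      have "\<mu> = \<nu> + ?e"
        unfolding *(1)[symmetric] using *(2)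
        by (intro poly_mapping_eqI) (auto simp: lookup_add lookup_minus lookup_single when_def)
      then show "\<mu> \<in> {\<nu> + ?e}" by simp
    qed
  qed simp
  finally show ?thesis by (simp add: lookup_single lookup_add)
qed

lemma fock_deriv_add: "fock_deriv i r (f + g) = fock_deriv i r f + fock_deriv i r g"
  by (rule poly_mapping_eqI) (simp add: lookup_fock_deriv lookup_add algebra_simps)

lemma lookup_cf_mult: "Poly_Mapping.lookup (cf c * f) \<mu> = c * Poly_Mapping.lookup f \<mu>"
proof -
  have "cf c * f = Poly_Mapping.map ((*) c) f"
    by (simp add: cf_def mult_map_scale_conv_mult)
  then show ?thesis by (simp add: lookup_map)
qed

lemma fock_deriv_cf: "fock_deriv i r (cf c * f) = cf c * fock_deriv i r f"
  by (rule poly_mapping_eqI) (simp add: lookup_fock_deriv lookup_cf_mult)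

lemma fock_deriv_zero [simp]: "fock_deriv i r 0 = 0"
  by (rule poly_mapping_eqI) (simp add: lookup_fock_deriv)

lemma fock_deriv_one [simp]: "fock_deriv i r 1 = 0"
proof -
  have "\<nu> + Poly_Mapping.single (i, r - 1) 1 \<noteq> 0" for \<nu> :: "'a \<times> nat \<Rightarrow>\<^sub>0 nat"
  proof
    assume "\<nu> + Poly_Mapping.single (i, r - 1) 1 = 0"
    from arg_cong[OF this, of "\<lambda>x. Poly_Mapping.lookup x (i, r - 1)"] show False
      by (simp add: lookup_add)
  qed
  then show ?thesis
    by (intro poly_mapping_eqI) (simp add: lookup_fock_deriv lookup_one del: One_nat_def)
qed

lemma fock_deriv_single: "fock_deriv i r (Poly_Mapping.single \<mu> c) =
    Poly_Mapping.single (\<mu> - Poly_Mapping.single (i, r - 1) 1) (of_nat (Poly_Mapping.lookup \<mu> (i, r - 1)) * c)"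
proof -
  have "finite {\<nu>. Poly_Mapping.single (\<nu> - Poly_Mapping.single (i, r - 1) 1)
     (of_nat (Poly_Mapping.lookup \<nu> (i, r - 1)) * Poly_Mapping.lookup (Poly_Mapping.single \<mu> c) \<nu>) \<noteq> 0}"
    by (rule finite_subset[of _ "{\<mu>}"]) (auto simp: lookup_single when_def split: if_splits)
  then have "fock_deriv i r (Poly_Mapping.single \<mu> c) = (\<Sum>\<nu>\<in>{\<mu>}. Poly_Mapping.single (\<nu> - Poly_Mapping.single (i, r - 1) 1)
     (of_nat (Poly_Mapping.lookup \<nu> (i, r - 1)) * Poly_Mapping.lookup (Poly_Mapping.single \<mu> c) \<nu>))"
    unfolding fock_deriv_def
    by (intro Sum_any.expand_superset) (auto simp: lookup_single when_def split: if_splits)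
  then show ?thesis by simp
qed

text \<open>The Leibniz rule for a product with one variable. It is verified on monomials, where the
  coefficient 0 makes the truncated subtraction harmless.\<close>

lemma fock_deriv_var:
  assumes "r > 0" "q > 0"
  shows "fock_deriv i r (fock_var j q * f) = (f when i = j \<and> r = q) + fock_var j q * fock_deriv i r f"
proof (induction f rule: poly_mapping_single_induct)
  case (2 f g)
  then show ?case by (simp add: distrib_left fock_deriv_add when_add_distrib algebra_simps)
next
  case (3 \<mu> c)
  let ?x = "(i, r - 1)" and ?y = "(j, q - 1)"
  have xy: "?x = ?y \<longleftrightarrow> i = j \<and> r = q" using assms by auto
  show ?case
  proof (cases "?x = ?y")
    case True
    have "Poly_Mapping.single ?y 1 + \<mu> - Poly_Mapping.single ?x 1 = \<mu>"
      unfolding True by (rule poly_mapping_eqI) (simp add: lookup_add lookup_minus)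
    moreover have "Poly_Mapping.single ?y 1 + (\<mu> - Poly_Mapping.single ?x 1) = \<mu>" if "Poly_Mapping.lookup \<mu> ?x \<noteq> 0"
      using that unfolding True by (intro poly_mapping_eqI) (auto simp: lookup_add lookup_minus lookup_single when_def)
    ultimately show ?thesis using True xy
      by (cases "Poly_Mapping.lookup \<mu> ?x = 0")
         (simp_all add: fock_var_def mult_single fock_deriv_single lookup_add single_add[symmetric] distrib_right
            del: One_nat_def)
  next
    case False
    have "Poly_Mapping.single ?y 1 + \<mu> - Poly_Mapping.single ?x 1 = Poly_Mapping.single ?y 1 + (\<mu> - Poly_Mapping.single ?x 1)"
      if "Poly_Mapping.lookup \<mu> ?x \<noteq> 0"
      using that False by (intro poly_mapping_eqI) (auto simp: lookup_add lookup_minus lookup_single when_def)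
    moreover have "(1 when j = i \<and> q - 1 = r - 1) = (0::nat)" "\<not> (i = j \<and> r = q)"
      using False xy by auto
    ultimately show ?thesis
      by (cases "Poly_Mapping.lookup \<mu> ?x = 0")
         (simp_all add: fock_var_def mult_single fock_deriv_single lookup_add lookup_single del: One_nat_def)
  qed
qed simp

definition hann :: "'i \<Rightarrow> nat \<Rightarrow> 'i::finite vend" where "hann i r = Abs_vend (Hann i r)"

lemma lookup_Hann: "Poly_Mapping.lookup (Hann i r v) b = of_nat r * fock_deriv i r (Poly_Mapping.lookup v b)"
  by (simp add: Hann_def lookup_map)

lemma ap_hann: "ap (hann i r) = Hann i r"
  unfolding hann_def
  by (rule Abs_vend_inverse)
     (auto intro!: poly_mapping_eqI simp: vlinear_iff lookup_Hann lookup_add fock_deriv_add fock_deriv_cf algebra_simps)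

lemma ap_of_nat: "ap (of_nat n) v = vscale (of_nat n) v"
  unfolding sc_of_nat[symmetric] by (rule ap_sc)

text \<open>The Heisenberg relation. The indices are taken positive because mode q is stored at
  position q - 1, which would identify q = 0 with q = 1.\<close>

lemma hann_hcre: "r > 0 \<Longrightarrow> q > 0 \<Longrightarrow>
    hann i r * hcre j q = hcre j q * hann i r + (of_nat r when i = j \<and> r = q)"
proof (rule vend_eqI, rule poly_mapping_eqI)
  fix v b assume "r > 0" "q > 0"
  then show "Poly_Mapping.lookup (ap (hann i r * hcre j q) v) b =
      Poly_Mapping.lookup (ap (hcre j q * hann i r + (of_nat r when i = j \<and> r = q)) v) b"
    by (cases "i = j \<and> r = q")
       (simp_all add: ap_of_nat ap_hann lookup_Hann hcre_def fock_deriv_var lookup_add algebra_simps)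
qed

lemma hann_ebas [simp]: "ap (hann i r) (ebas b) = 0"
  by (rule poly_mapping_eqI) (simp add: ap_hann lookup_Hann lookup_ebas when_def)

section \<open>The exponential of the annihilation operators\<close>

lemma fps_power_nth_zero: "fps_nth x 0 = 0 \<Longrightarrow> k < n \<Longrightarrow> fps_nth (x ^ n) k = 0"
  for x :: "'a::ring_1 fps"
proof (induction n arbitrary: k)
  case (Suc n)
  have "fps_nth x j * fps_nth (x ^ n) (k - j) = 0" if "j \<le> k" for j
    using Suc that by (cases "j = 0") auto
  then show ?case by (simp add: fps_mult_nth atLeast0AtMost)
qed simp

text \<open>The exponent of B as a power series in z^-1. It has no constant term, so each
  coefficient of its exponential is a finite sum; \<open>bexp\<close> is this sum, cut where the
  powers begin to vanish.\<close>

definition bser :: "sign \<Rightarrow> 'i::finite \<Rightarrow> 'i vend fps" where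
  "bser s i = Abs_fps (\<lambda>r. if r = 0 then 0 else sc (- pm s / of_nat r) * hann i r)"

definition bexp :: "sign \<Rightarrow> 'i::finite \<Rightarrow> nat \<Rightarrow> 'i vend" where
  "bexp s i k = (\<Sum>n\<le>k. sc (1 / fact n) * fps_nth (bser s i ^ n) k)"

lemma bser_0 [simp]: "fps_nth (bser s i) 0 = 0"
  by (simp add: bser_def)

lemma bexp_eq: "k \<le> N \<Longrightarrow> bexp s i k = (\<Sum>n\<le>N. sc (1 / fact n) * fps_nth (bser s i ^ n) k)"
  unfolding bexp_def by (rule sum.mono_neutral_left) (auto simp: fps_power_nth_zero)

lemma sc_pm: "sc (pm s) = pm s"
  by (cases s) (simp_all add: pm_def)

text \<open>The commutator of the exponent with a creation operator is a scalar times z^-r: the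
  factor r of the Heisenberg relation cancels the 1/r of the exponent.\<close>

lemma bser_hcre: "r > 0 \<Longrightarrow> bser s i * fps_const (hcre j r) =
    fps_const (hcre j r) * bser s i - (fps_const (sc (pm s)) * fps_X ^ r when i = j)"
proof (rule fps_ext)
  fix k assume r: "r > 0"
  show "fps_nth (bser s i * fps_const (hcre j r)) k =
      fps_nth (fps_const (hcre j r) * bser s i - (fps_const (sc (pm s)) * fps_X ^ r when i = j)) k"
  proof (cases "k = 0")
    case True
    then show ?thesis using r by (simp add: bser_def when_def)
  next
    case False
    let ?c = "- pm s / of_nat k"
    have c: "sc ?c * of_nat k = - sc (pm s)"
      unfolding sc_of_nat[symmetric] sc_hom(4)[symmetric] sc_hom(5)[symmetric] using False by simp
    have "sc ?c * hann i k * hcre j r = sc ?c * (hcre j r * hann i k + (of_nat k when i = j \<and> k = r))"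
      using hann_hcre[of k r i j] False r by (simp add: mult.assoc)
    also have "\<dots> = hcre j r * (sc ?c * hann i k) - (sc (pm s) when i = j \<and> k = r)"
      unfolding distrib_left mult.assoc[symmetric] sc_commute[of ?c "hcre j r"] using c by (cases "i = j \<and> k = r") simp_all
    finally show ?thesis using False by (cases "i = j"; cases "k = r") (simp_all add: bser_def)
  qed
qed

lemma fps_const_sc_commute: "fps_const (sc c) * x = x * fps_const (sc c)"
  by (rule fps_ext) (simp add: sc_commute)

lemma of_nat_left_commute: "x * (of_nat n * y) = of_nat n * (x * y)" for x y :: "'a::ring_1"
  by (metis mult.assoc mult_of_nat_commute)

lemma fps_nth_of_nat_mult: "fps_nth (of_nat n * y) k = of_nat n * fps_nth y k" for y :: "'a::ring_1 fps"
  by (induction n) (simp_all add: distrib_right)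

lemma fps_nth_const_X_mult:
  "fps_nth (fps_const c * fps_X ^ r * y) k = (if k \<ge> r then c * fps_nth y (k - r) else 0)" for y :: "'a::ring_1 fps"
  by (simp add: mult.assoc fps_X_power_mult_nth)

text \<open>Commuting with H acts on the powers of the exponent as a derivation, and its value on
  the exponent itself is central.\<close>

lemma bser_pow_hcre: "r > 0 \<Longrightarrow> bser s i ^ n * fps_const (hcre j r) =
    fps_const (hcre j r) * bser s i ^ n - (of_nat n * (fps_const (sc (pm s)) * fps_X ^ r) * bser s i ^ (n - 1) when i = j)"
proof (induction n)
  case (Suc n)
  let ?C = "fps_const (hcre j r)" and ?x = "fps_const (sc (pm s)) * fps_X ^ r :: 'a vend fps" and ?b = "bser s i"
  have xb: "?b * ?x = ?x * ?b"
    unfolding mult.assoc[of _ _ ?b] mult.assoc[of ?b, symmetric] fps_const_sc_commute[of _ ?b, symmetric]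
    by (simp only: mult.assoc fps_mult_fps_X_power_commute)
  have bn: "?b * ?b ^ (n - 1) = ?b ^ n" if "n > 0" using that by (cases n) auto
  have "?b * (of_nat n * ?x * ?b ^ (n - 1)) = of_nat n * ((?b * ?x) * ?b ^ (n - 1))"
    by (simp only: mult.assoc of_nat_left_commute)
  also have "\<dots> = of_nat n * (?x * (?b * ?b ^ (n - 1)))"
    by (simp only: xb mult.assoc)
  also have "\<dots> = of_nat n * (?x * ?b ^ n)" using bn by (cases "n = 0") simp_all
  finally have "?b * (of_nat n * ?x * ?b ^ (n - 1)) = of_nat n * (?x * ?b ^ n)" .
  then have *: "?b * (of_nat n * ?x * ?b ^ (n - 1) when i = j) = (of_nat n * (?x * ?b ^ n) when i = j)"
    by (cases "i = j") simp_all
  have "?b ^ Suc n * ?C = ?b * (?b ^ n * ?C)" by (simp add: mult.assoc)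
  also have "\<dots> = ?b * ?C * ?b ^ n - (of_nat n * (?x * ?b ^ n) when i = j)"
    using Suc * by (simp add: right_diff_distrib mult.assoc)
  also have "\<dots> = ?C * ?b ^ Suc n - (of_nat (Suc n) * ?x * ?b ^ n when i = j)"
    unfolding bser_hcre[OF Suc(2), of s i j]
    by (cases "i = j") (simp_all add: left_diff_distrib distrib_right mult.assoc)
  finally show ?case by simp
qed simp

text \<open>Extended by zero to negative indices, so that convolutions with the two-sided zero modes
  run over all integers.\<close>

definition ibexp :: "sign \<Rightarrow> 'i::finite \<Rightarrow> int \<Rightarrow> 'i vend" where
  "ibexp s i k = (if k \<ge> 0 then bexp s i (nat k) else 0)"

text \<open>exp(b) H = (H + [b, H]) exp(b), because [b, H] is central. In the coefficient of z^-k,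
  the scalar multiple of z^-r becomes an index shift by r.\<close>

lemma bexp_hcre:
  assumes "r > 0"
  shows "bexp s i k * hcre j r = hcre j r * bexp s i k - (pm s * (if k \<ge> r then bexp s i (k - r) else 0) when i = j)"
proof -
  let ?b = "bser s i" and ?h = "hcre j r"
  have nth: "fps_nth (?b ^ n) k * ?h = ?h * fps_nth (?b ^ n) k -
      (of_nat n * (pm s * (if k \<ge> r then fps_nth (?b ^ (n - 1)) (k - r) else 0)) when i = j)" for n
    using arg_cong[OF bser_pow_hcre[OF assms, of s i n j], of "\<lambda>x. fps_nth x k"]
    by (cases "i = j") (simp_all add: mult.assoc[of "of_nat n"] fps_nth_of_nat_mult fps_nth_const_X_mult sc_pm)
  have sn: "sc (1 / fact n) * (of_nat n * x) = (if n = 0 then 0 else sc (1 / fact (n - 1)) * x)" for n and x :: "'a vend"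
  proof (cases n)
    case (Suc m)
    have "1 / fact (Suc m) * of_nat (Suc m) = (1 / fact m :: complex)"
      by (simp add: field_simps del: of_nat_Suc)
    then have "sc (1 / fact n) * of_nat n = (sc (1 / fact m) :: 'a vend)"
      unfolding Suc sc_of_nat[symmetric] sc_hom(4)[symmetric] by simp
    then have "sc (1 / fact n) * of_nat n * x = sc (1 / fact m) * x"
      by (rule arg_cong[of _ _ "\<lambda>y. y * x"])
    then show ?thesis by (simp add: Suc mult.assoc del: of_nat_Suc fact_Suc)
  qed simp
  let ?R = "\<lambda>n. if n = 0 then 0 else sc (1 / fact (n - 1)) * (pm s * (if k \<ge> r then fps_nth (?b ^ (n - 1)) (k - r) else 0))"
  have tm: "sc (1 / fact n) * (fps_nth (?b ^ n) k * ?h) = ?h * (sc (1 / fact n) * fps_nth (?b ^ n) k) - (?R n when i = j)" for n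
  proof -
    have "sc (1 / fact n) * (?h * fps_nth (?b ^ n) k) = ?h * (sc (1 / fact n) * fps_nth (?b ^ n) k)"
      unfolding mult.assoc[symmetric] sc_commute[of _ "hcre j r"] ..
    then show ?thesis
      unfolding nth right_diff_distrib mult_when sn by simp
  qed
  have "bexp s i k * ?h = (\<Sum>n\<le>k. sc (1 / fact n) * (fps_nth (?b ^ n) k * ?h))"
    by (simp add: bexp_def sum_distrib_right mult.assoc)
  also have "\<dots> = ?h * bexp s i k - ((\<Sum>n\<le>k. ?R n) when i = j)"
    unfolding tm sum_subtractf bexp_def sum_distrib_left[symmetric] by (cases "i = j") simp_all
  also have "(\<Sum>n\<le>k. (if n = 0 then 0 else sc (1 / fact (n - 1)) * (pm s * (if k \<ge> r then fps_nth (?b ^ (n - 1)) (k - r) else 0))))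
      = pm s * (if k \<ge> r then bexp s i (k - r) else 0)"
  proof (cases "k \<ge> r")
    case True
    then obtain k' where k': "k = Suc k'" using assms by (cases k) auto
    have "(\<Sum>n\<le>k. (if n = 0 then 0 else sc (1 / fact (n - 1)) * (pm s * fps_nth (?b ^ (n - 1)) (k - r))))
        = (\<Sum>n\<le>k'. sc (1 / fact n) * (pm s * fps_nth (?b ^ n) (k - r)))"
      unfolding k' by (subst sum.atMost_Suc_shift) simp
    also have "\<dots> = pm s * (\<Sum>n\<le>k'. sc (1 / fact n) * fps_nth (?b ^ n) (k - r))"
      by (cases s) (simp_all add: pm_def sum_negf)
    \<comment> \<open>The sum runs to k - 1, which is at least k - r as r > 0; the surplus powers
      have no coefficient in that degree.\<close>
    also have "\<dots> = pm s * bexp s i (k - r)"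
      using assms k' by (subst bexp_eq[of "k - r" k']) auto
    finally show ?thesis using True by (simp cong: if_cong)
  qed (auto intro!: sum.neutral)
  finally show ?thesis .
qed

lemma ibexp_hcre: "r > 0 \<Longrightarrow>
    ibexp s i k * hcre j r = hcre j r * ibexp s i k - (pm s * ibexp s i (k - int r) when i = j)"
  using bexp_hcre[of r s i "nat k" j]
  by (auto simp: ibexp_def when_def nat_diff_distrib' le_nat_iff)

lemma bser_ebas [simp]: "ap (fps_nth (bser s i) k) (ebas b) = 0"
  by (simp add: bser_def)

lemma bser_pow_ebas: "ap (fps_nth (bser s i ^ n) k) (ebas b) = (if n = 0 \<and> k = 0 then ebas b else 0)"
proof (cases n)
  case (Suc m)
  have *: "bser s i ^ Suc m = bser s i ^ m * bser s i" by (rule power_Suc2)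
  show ?thesis unfolding Suc * by (simp add: fps_mult_nth ap_sum_left)
qed simp

lemma ibexp_ebas: "ap (ibexp s i k) (ebas b) = (if k = 0 then ebas b else 0)"
  by (auto simp: ibexp_def bexp_def ap_sum_left bser_pow_ebas if_distrib cong: if_cong)

section \<open>The root lattice\<close>

lemma form_add_left: "form a (x + y) z = form a x z + form a y z"
  by (simp add: form_def algebra_simps sum.distrib)

lemma form_add_right: "form a x (y + z) = form a x y + form a x z"
  by (simp add: form_def algebra_simps sum.distrib)

lemma form_uminus_left: "form a (- x) z = - form a x z"
  using form_add_left[of a x "- x" z] by (simp add: form_def)

lemma form_axis: "form a (axis i p) (axis j q) = a i j * p * q"
proof -
  have "(\<Sum>l\<in>UNIV. a k l * axis i p $ k * axis j q $ l) = (if k = i then a i j * p * q else 0)" for k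
  proof -
    have "(\<Sum>l\<in>UNIV. a k l * axis i p $ k * axis j q $ l) = (\<Sum>l\<in>{j}. a k l * axis i p $ k * axis j q $ l)"
      by (rule sum.mono_neutral_right) (auto simp: axis_def)
    then show ?thesis by (simp add: axis_def)
  qed
  then show ?thesis by (simp add: form_def)
qed

lemma pm_simps [simp]: "pm s * pm s = (1 :: 'a::ring_1)" "pm s * (pm s * x) = (x :: 'a::ring_1)"
  "of_int (pm s) = (pm s :: 'a::ring_1)" "pm Plus = (1 :: 'a::ring_1)" "pm Minus = (- 1 :: 'a::ring_1)"
  by (cases s; simp add: pm_def)+

lemma pm_commute: "pm s * x = x * (pm s :: 'a::ring_1)"
  by (cases s) (simp_all add: pm_def)

lemma sroot_Minus: "sroot Minus i = - sroot Plus i"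
  by (simp add: sroot_def vec_eq_iff axis_def)

lemma form_sroot: "form a (sroot s i) (sroot t j) = pm s * pm t * a i j"
  by (simp add: sroot_def form_axis)

lemma sumbl_when: "sumbl F \<Longrightarrow> sumbl (\<lambda>p. F p when P)"
  by (cases P) (simp_all add: sumbl_def)

locale vertex =
  fixes a :: "'i::finite \<Rightarrow> 'i \<Rightarrow> int" and \<epsilon> :: "'i lattice \<Rightarrow> 'i lattice \<Rightarrow> complex"
  assumes cartan: "simply_laced_cartan a" and sgnf: "sign_function a \<epsilon>"
begin

lemma a_diag [simp]: "a i i = 2" and a_off: "i \<noteq> j \<Longrightarrow> a i j = 0 \<or> a i j = - 1" and a_sym: "a i j = a j i"
  using cartan by (auto simp: simply_laced_cartan_def)

lemma form_sym: "form a x y = form a y x"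
  unfolding form_def by (subst sum.swap) (simp add: a_sym mult.commute mult.left_commute)

lemma eps_cases: "\<epsilon> x y = 1 \<or> \<epsilon> x y = - 1"
  using sgnf unfolding sign_function_def by blast

lemma eps_add_left: "\<epsilon> (x + y) z = \<epsilon> x z * \<epsilon> y z"
  using sgnf unfolding sign_function_def by blast

lemma eps_add_right: "\<epsilon> x (y + z) = \<epsilon> x y * \<epsilon> x z"
  using sgnf unfolding sign_function_def by blast

lemma eps_diag: "\<epsilon> x x = (- 1) powi half_norm a x"
  using sgnf unfolding sign_function_def by blast

lemma eps_nz [simp]: "\<epsilon> x y \<noteq> 0"
  using eps_cases[of x y] by auto

lemma eps_sq [simp]: "\<epsilon> x y * \<epsilon> x y = 1" "\<epsilon> x y * (\<epsilon> x y * c) = c"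
  using eps_cases[of x y] by auto

lemma eps_zero [simp]: "\<epsilon> 0 y = 1" "\<epsilon> x 0 = 1"
  using eps_add_left[of 0 0 y] eps_add_right[of x 0 0] by simp_all

lemma eps_uminus [simp]: "\<epsilon> (- x) y = \<epsilon> x y" "\<epsilon> x (- y) = \<epsilon> x y"
proof -
  have "\<epsilon> x y * \<epsilon> (- x) y = 1" "\<epsilon> x y * \<epsilon> x (- y) = 1"
    by (simp_all flip: eps_add_left eps_add_right)
  moreover have "d = c" if "c * d = 1" "c = 1 \<or> c = - 1" for c d :: complex
    using that by (metis minus_minus mult_1 mult_minus_left)
  ultimately show "\<epsilon> (- x) y = \<epsilon> x y" "\<epsilon> x (- y) = \<epsilon> x y"
    using eps_cases[of x y] by blast+
qed

lemma half_norm_sroot: "half_norm a (sroot s i) = 1"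
  by (simp add: half_norm_def form_sroot)

text \<open>(\<alpha>_i, \<alpha>_i) = 2 makes the change of the norm under translation by a simple
  root affine in (\<alpha>_i, \<beta>). Both the symmetry of \<epsilon> and the degree of e^\<alpha>
  rest on this.\<close>

lemma half_norm_add_sroot: "half_norm a (sroot s i + b) = half_norm a b + form a (sroot s i) b + 1"
proof -
  have "form a (sroot s i + b) (sroot s i + b) = form a b b + 2 * (form a (sroot s i) b + 1)"
    by (simp add: form_add_left form_add_right form_sroot form_sym[of b "sroot s i"])
  then show ?thesis by (simp add: half_norm_def)
qed

definition asgn :: "'i \<Rightarrow> 'i \<Rightarrow> complex" where "asgn i j = (if even (a i j) then 1 else - 1)"

text \<open>Polarisation: expand \<epsilon> (x + y) (x + y) by bimultiplicativity and compare with
  the diagonal values, which are given by \<open>half_norm\<close>.\<close>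

lemma eps_swap: "\<epsilon> (sroot s i) (sroot t j) = asgn i j * \<epsilon> (sroot t j) (sroot s i)"
proof -
  let ?x = "sroot s i" and ?y = "sroot t j"
  have m1: "(- 1 :: complex) powi n = (if even n then 1 else - 1)" for n
    by (simp add: power_int_minus_left)
  have "\<epsilon> (?x + ?y) (?x + ?y) = (if even (a i j) then 1 else - 1)"
    unfolding eps_diag half_norm_add_sroot half_norm_sroot form_sroot m1 by (cases s; cases t) simp_all
  moreover have "\<epsilon> (?x + ?y) (?x + ?y) = \<epsilon> ?x ?y * \<epsilon> ?y ?x"
    by (simp add: eps_add_left eps_add_right) (simp add: eps_diag half_norm_sroot)
  ultimately have "\<epsilon> ?x ?y * \<epsilon> ?y ?x = asgn i j" by (simp add: asgn_def)
  then show ?thesis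
    by (metis eps_sq(2) mult.commute)
qed

lemma eps_sroot_self [simp]: "\<epsilon> (sroot s i) (sroot s i) = - 1"
  by (simp add: eps_diag half_norm_sroot)

section \<open>Zero modes\<close>

text \<open>The coefficient of z^m in e^\<alpha> z^\<partial>, where \<alpha> is
  \<open>sroot s i\<close>.\<close>

definition zmode :: "sign \<Rightarrow> 'i \<Rightarrow> int \<Rightarrow> 'i vend" where
  "zmode s i m = Abs_vend (\<lambda>v. lat_exp \<epsilon> (sroot s i)
     (Sum_any (\<lambda>\<beta>. (Poly_Mapping.single \<beta> (Poly_Mapping.lookup v \<beta>) when form a (sroot s i) \<beta> = m))))"

lemma lookup_lat_exp: "Poly_Mapping.lookup (lat_exp \<epsilon> x v) c = cf (\<epsilon> x (c - x)) * Poly_Mapping.lookup v (c - x)"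
proof -
  let ?g = "\<lambda>\<beta>. vscale (\<epsilon> x \<beta>) (Poly_Mapping.single (x + \<beta>) (Poly_Mapping.lookup v \<beta>))"
  have "finite {b. ?g b \<noteq> 0}"
    by (rule finite_subset[OF _ finite_keys[of v]]) (auto simp: in_keys_iff)
  then have "Poly_Mapping.lookup (lat_exp \<epsilon> x v) c = Sum_any (\<lambda>b. Poly_Mapping.lookup (?g b) c)"
    unfolding lat_exp_def by (rule lookup_Sum_any)
  also have "\<dots> = (\<Sum>b\<in>{c - x}. Poly_Mapping.lookup (?g b) c)"
    by (rule Sum_any.expand_superset) (auto simp: lookup_single when_def algebra_simps split: if_splits)
  finally show ?thesis by simp
qed

lemma lookup_zpart: "Poly_Mapping.lookup (Sum_any (\<lambda>\<beta>. (Poly_Mapping.single \<beta> (Poly_Mapping.lookup v \<beta>) when form a x \<beta> = m))) c =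
   (Poly_Mapping.lookup v c when form a x c = m)"
proof -
  let ?g = "\<lambda>\<beta>. (Poly_Mapping.single \<beta> (Poly_Mapping.lookup v \<beta>) when form a x \<beta> = m)"
  have "finite {b. ?g b \<noteq> 0}"
    by (rule finite_subset[OF _ finite_keys[of v]]) (auto simp: in_keys_iff)
  then have "Poly_Mapping.lookup (Sum_any ?g) c = Sum_any (\<lambda>b. Poly_Mapping.lookup (?g b) c)"
    by (rule lookup_Sum_any)
  also have "\<dots> = (\<Sum>b\<in>{c}. Poly_Mapping.lookup (?g b) c)"
    by (rule Sum_any.expand_superset) (auto simp: lookup_single when_def split: if_splits)
  finally show ?thesis by (simp add: when_def)
qed

lemma ap_zmode: "ap (zmode s i m) v = lat_exp \<epsilon> (sroot s i)
     (Sum_any (\<lambda>\<beta>. (Poly_Mapping.single \<beta> (Poly_Mapping.lookup v \<beta>) when form a (sroot s i) \<beta> = m)))"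
proof -
  define Z where "Z v = Sum_any (\<lambda>\<beta>. (Poly_Mapping.single \<beta> (Poly_Mapping.lookup v \<beta>) when form a (sroot s i) \<beta> = m))" for v :: "'i vspace"
  have Z: "Poly_Mapping.lookup (Z v) c = (Poly_Mapping.lookup v c when form a (sroot s i) c = m)" for v c
    unfolding Z_def by (rule lookup_zpart)
  have "Vector_Spaces.linear vscale vscale (\<lambda>v. lat_exp \<epsilon> (sroot s i) (Z v))"
    by (intro vlinearI poly_mapping_eqI[of "_ :: 'i vspace"])
       (simp_all add: lookup_lat_exp Z lookup_add when_def distrib_left mult.left_commute)
  then show ?thesis
    unfolding zmode_def Z_def[symmetric] by (simp add: Abs_vend_inverse)
qed

lemma lookup_zmode: "Poly_Mapping.lookup (ap (zmode s i m) v) c =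
   (cf (\<epsilon> (sroot s i) (c - sroot s i)) * Poly_Mapping.lookup v (c - sroot s i)
      when form a (sroot s i) (c - sroot s i) = m)"
  by (simp add: ap_zmode lookup_lat_exp lookup_zpart mult_when)

lemma zmode_mo: "zmode s i m * mo g = mo g * zmode s i m"
  by (rule vend_eqI, rule poly_mapping_eqI) (simp add: lookup_zmode mult_when mult.left_commute)

lemma zmode_ebas: "ap (zmode s i m) (ebas b) =
   (vscale (\<epsilon> (sroot s i) b) (ebas (sroot s i + b)) when form a (sroot s i) b = m)"
  by (rule poly_mapping_eqI) (auto simp: lookup_zmode lookup_ebas when_def algebra_simps)

lemma sumbl_zmode: "sumbl (\<lambda>m. fps_const (zmode s i m))"
proof -
  have "finite {m. app (fps_const (zmode s i m)) d v \<noteq> 0}" for d v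
  proof (rule finite_subset)
    show "finite (form a (sroot s i) ` Poly_Mapping.keys v)" by simp
    show "{m. app (fps_const (zmode s i m)) d v \<noteq> 0} \<subseteq> form a (sroot s i) ` Poly_Mapping.keys v"
    proof
      fix m assume "m \<in> {m. app (fps_const (zmode s i m)) d v \<noteq> 0}"
      then have "ap (zmode s i m) v \<noteq> 0" by (auto simp: app_def split: if_splits)
      then obtain c where "Poly_Mapping.lookup (ap (zmode s i m) v) c \<noteq> 0"
        by (metis lookup_zero poly_mapping_eqI)
      then show "m \<in> form a (sroot s i) ` Poly_Mapping.keys v"
        by (auto simp: lookup_zmode when_def split: if_splits intro!: imageI)
          (auto simp: in_keys_iff intro!: imageI)
    qed
  qed
  then show ?thesis by (simp add: sumbl_def)
qed

section \<open>The annihilation part of a vertex operator\<close>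

text \<open>The annihilation half of the vertex operator, including \<open>e\<^sup>\<alpha>\<close> and \<open>z\<^sup>\<partial>\<close>: \<open>vT s i m\<close> is the coefficient of \<open>z\<^sup>m\<close>.\<close>

definition vT :: "sign \<Rightarrow> 'i \<Rightarrow> int \<Rightarrow> 'i vend fps" where
  "vT s i m = lsum (\<lambda>k. fps_const (pm s * (ibexp s i k * zmode s i (m + k))))"

lemma sumbl_vT_terms: "sumbl (\<lambda>k. fps_const (pm s * (ibexp t j (k - l) * zmode s i (m + k))))"
proof -
  have "sumbl (\<lambda>k. fps_const (pm s * ibexp t j (k - l)) * fps_const (zmode s i (k + m)))"
    by (rule sumbl_mult_left, subst sumbl_shift(1)[of "\<lambda>k. fps_const (zmode s i k)"]) (rule sumbl_zmode)
  then show ?thesis by (simp add: mult.assoc add.commute)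
qed

abbreviation HH :: "'i \<Rightarrow> nat \<Rightarrow> 'i vend fps" where "HH j r \<equiv> fps_const (hcre j r)"

text \<open>The zero modes commute with creation operators, so only the scalar of
  \<open>ibexp_hcre\<close> enters: T(z) H = (H - c z^-r) T(z). Multiplication by z^-r moves the
  coefficient index from m to m + r.\<close>

lemma vT_HH:
  assumes r: "r > 0"
  shows "vT s i m * HH j r = HH j r * vT s i m - (pm s * vT s i (m + int r) when i = j)"
proof -
  let ?F = "\<lambda>m k. fps_const (pm s * (ibexp s i k * zmode s i (m + k)))"
  have F: "sumbl (?F m)" for m using sumbl_vT_terms[of s s i 0 i m] by simp
  have F': "sumbl (\<lambda>k. fps_const (pm s * (ibexp s i (k - int r) * zmode s i (m + k))))"
    by (rule sumbl_vT_terms)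
  have tm: "?F m k * HH j r = HH j r * ?F m k
      - (pm s * fps_const (pm s * (ibexp s i (k - int r) * zmode s i (m + k))) when i = j)" for k
  proof -
    have "ibexp s i k * zmode s i (m + k) * hcre j r = ibexp s i k * hcre j r * zmode s i (m + k)"
      by (simp add: hcre_def mult.assoc zmode_mo)
    also have "\<dots> = hcre j r * (ibexp s i k * zmode s i (m + k)) - (pm s * (ibexp s i (k - int r) * zmode s i (m + k)) when i = j)"
      unfolding ibexp_hcre[OF r] by (simp add: left_diff_distrib when_def mult.assoc)
    finally have "pm s * (ibexp s i k * zmode s i (m + k)) * hcre j r =
       hcre j r * (pm s * (ibexp s i k * zmode s i (m + k))) - (pm s * (pm s * (ibexp s i (k - int r) * zmode s i (m + k))) when i = j)"
      unfolding mult.assoc by (cases "i = j"; cases s; simp add: algebra_simps)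
    then show ?thesis by (cases "i = j"; cases s; simp)
  qed
  have "vT s i m * HH j r = lsum (\<lambda>k. HH j r * ?F m k
      - (pm s * fps_const (pm s * (ibexp s i (k - int r) * zmode s i (m + k))) when i = j))"
    unfolding vT_def lsum_mult_right[OF F] tm ..
  also have "\<dots> = lsum (\<lambda>k. HH j r * ?F m k)
      - lsum (\<lambda>k. (pm s * fps_const (pm s * (ibexp s i (k - int r) * zmode s i (m + k))) when i = j))"
  proof (rule lsum_diff)
    show "sumbl (\<lambda>k. HH j r * ?F m k)" by (rule sumbl_mult_left[OF F])
    show "sumbl (\<lambda>k. (pm s * fps_const (pm s * (ibexp s i (k - int r) * zmode s i (m + k))) when i = j))"
      by (intro sumbl_when sumbl_mult_left[OF F'])
  qed
  also have "lsum (\<lambda>k. HH j r * ?F m k) = HH j r * vT s i m"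
    unfolding vT_def by (rule lsum_mult_left[OF F, symmetric])
  also have "lsum (\<lambda>k. (pm s * fps_const (pm s * (ibexp s i (k - int r) * zmode s i (m + k))) when i = j))
      = (pm s * vT s i (m + int r) when i = j)"
  proof (cases "i = j")
    case True
    have "lsum (\<lambda>k. fps_const (pm s * (ibexp s i (k - int r) * zmode s i (m + k)))) = vT s i (m + int r)"
      unfolding vT_def using lsum_shift(2)[OF F[of "m + int r"], of "int r"] by (simp add: algebra_simps)
    then show ?thesis using True lsum_mult_left[OF F', of "pm s"] by simp
  qed simp
  finally show ?thesis .
qed

lemma app_vT_pos: "d > 0 \<Longrightarrow> app (vT s i m) d v = 0"
  unfolding vT_def using sumbl_vT_terms[of s s i 0 i m]
  by (subst app_lsum) (simp_all add: app_def)

lemma vT_ebas: "app (vT s i m) d (ebas b) =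
   (vscale (pm s * \<epsilon> (sroot s i) b) (ebas (sroot s i + b)) when d = 0 \<and> m = form a (sroot s i) b)"
proof (cases "d = 0")
  case True
  have "app (vT s i m) 0 (ebas b) = app (fps_const (pm s * (ibexp s i 0 * zmode s i (m + 0)))) 0 (ebas b)"
    unfolding vT_def
    by (subst app_lsum_superset[of _ "{0}"])
       (use sumbl_vT_terms[of s s i 0 i m] in \<open>auto simp: app_def zmode_ebas ibexp_ebas when_def sc_pm[symmetric]\<close>)
  also have "\<dots> = (vscale (pm s * \<epsilon> (sroot s i) b) (ebas (sroot s i + b)) when m = form a (sroot s i) b)"
    by (auto simp: app_def zmode_ebas ibexp_ebas when_def sc_pm[symmetric])
  finally show ?thesis using True by simp
qed (simp add: app_vT_pos)

lemma app_HH: "app (x * HH j r) d v = app x d (ap (hcre j r) v)" "app (HH j r * x) d v = ap (hcre j r) (app x d v)"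
  by (simp_all add: app_def)

lemma app_one: "app 1 d v = (v when d = 0)"
  by (simp add: app_def when_def)

lemma app_pm: "app (pm s * x) d v = pm s * app x d v" for x :: "'b::finite vend fps"
  by (cases s) simp_all

text \<open>On e^\<beta> only one mode survives, and a creation operator enlarges the finite set of
  surviving modes at most by its translate by -r.\<close>

lemma sumbl_vT: "sumbl (vT s i)"
proof -
  have "\<forall>d. finite {m. app (vT s i m) d v \<noteq> 0}" for v
  proof (induction v rule: vspace_induct)
    case (1 u v)
    show ?case
    proof
      fix d
      have "finite ({m. app (vT s i m) d u \<noteq> 0} \<union> {m. app (vT s i m) d v \<noteq> 0})" using 1 by blast
      then show "finite {m. app (vT s i m) d (u + v) \<noteq> 0}" by (rule rev_finite_subset) auto
    qed
  next
    case (2 c v)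
    show ?case
    proof
      fix d show "finite {m. app (vT s i m) d (vscale c v) \<noteq> 0}"
        by (rule finite_subset[OF _ 2[rule_format, of d]]) (auto simp: app_scale)
    qed
  next
    case (3 b)
    show ?case
    proof
      fix d show "finite {m. app (vT s i m) d (ebas b) \<noteq> 0}"
        by (rule finite_subset[of _ "{form a (sroot s i) b}"]) (auto simp: vT_ebas)
    qed
  next
    case (4 j r v)
    show ?case
    proof
      fix d
      let ?A = "{m. app (vT s i m) d v \<noteq> 0}"
      have "finite ?A" using 4 by blast
      then have "finite (?A \<union> (\<lambda>m. m - int r) ` ?A)" by blast
      moreover have "{m. app (vT s i m) d (ap (hcre j r) v) \<noteq> 0} \<subseteq> ?A \<union> (\<lambda>m. m - int r) ` ?A"
      proof
        fix m assume "m \<in> {m. app (vT s i m) d (ap (hcre j r) v) \<noteq> 0}"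
        then have "app (HH j r * vT s i m - (pm s * vT s i (m + int r) when i = j)) d v \<noteq> 0"
          by (simp add: vT_HH[OF 4(1), symmetric] app_HH)
        then have "app (vT s i m) d v \<noteq> 0 \<or> app (vT s i (m + int r)) d v \<noteq> 0"
          by (auto simp: app_HH app_pm when_def split: if_splits)
        then show "m \<in> ?A \<union> (\<lambda>m. m - int r) ` ?A" by (auto simp: image_iff intro!: exI[of _ "m + int r"])
      qed
      ultimately show "finite {m. app (vT s i m) d (ap (hcre j r) v) \<noteq> 0}" by (rule rev_finite_subset)
    qed
  qed
  then show ?thesis by (simp add: sumbl_def)
qed

lemma app_vT_vT_ebas: "app (vT s i m * vT t j n) d (ebas b) =
   (vscale (pm s * pm t * \<epsilon> (sroot s i) (sroot t j) * \<epsilon> (sroot s i) b * \<epsilon> (sroot t j) b) (ebas (sroot s i + sroot t j + b))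
     when d = 0 \<and> n = form a (sroot t j) b \<and> m = form a (sroot s i) b + pm s * pm t * a i j)"
proof -
  have "app (vT s i m * vT t j n) d (ebas b) = app (vT s i m) d (app (vT t j n) 0 (ebas b))"
    unfolding app_mult by (subst sum.mono_neutral_right[of _ "{d}"]) (auto simp: app_vT_pos)
  then show ?thesis
    by (auto simp: vT_ebas when_def app_scale form_add_right form_sroot eps_add_right ac_simps)
qed

text \<open>Two solutions of the same recursion under right multiplication by creation operators
  agree if they agree on the e^\<beta>. Whole families are compared, because the recursion mixes the
  indices.\<close>

lemma ebas_HH_eqI:
  fixes x y :: "'k \<Rightarrow> 'i vend fps"
  assumes bas: "\<And>k d b. app (x k) d (ebas b) = app (y k) d (ebas b)"
    and var: "\<And>k j r. r > 0 \<Longrightarrow> \<exists>A C. x k * HH j r = HH j r * x k + (\<Sum>l\<in>A. C l * x l)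
                   \<and> y k * HH j r = HH j r * y k + (\<Sum>l\<in>A. C l * y l)"
  shows "x k = y k"
proof -
  have "\<forall>k d. app (x k) d v = app (y k) d v" for v
  proof (induction v rule: vspace_induct)
    case (4 j r v)
    show ?case
    proof (intro allI)
      fix k d
      obtain A C where AC: "x k * HH j r = HH j r * x k + (\<Sum>l\<in>A. C l * x l)"
        "y k * HH j r = HH j r * y k + (\<Sum>l\<in>A. C l * y l)"
        using var[OF 4(1)] by blast
      show "app (x k) d (ap (hcre j r) v) = app (y k) d (ap (hcre j r) v)"
        using 4(2) unfolding app_HH(1)[symmetric] AC by (simp add: app_HH app_sum app_mult)
    qed
  qed (auto simp: bas app_scale)
  then show ?thesis by (intro app_eqI) blast
qed

lemma pm_left_commute: "x * (pm s * y) = pm s * (x * y)" for x y :: "'b::ring_1"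
  by (metis mult.assoc pm_commute)

lemma vT_vT_HH:
  assumes r: "r > 0"
  shows "vT s i m * vT t j n * HH k r = HH k r * (vT s i m * vT t j n)
    - (pm s * (vT s i (m + int r) * vT t j n) when i = k) - (pm t * (vT s i m * vT t j (n + int r)) when j = k)"
proof -
  have "vT s i m * vT t j n * HH k r = vT s i m * (HH k r * vT t j n - (pm t * vT t j (n + int r) when j = k))"
    by (simp add: mult.assoc vT_HH[OF r])
  also have "\<dots> = vT s i m * HH k r * vT t j n - (pm t * (vT s i m * vT t j (n + int r)) when j = k)"
    by (simp add: right_diff_distrib mult_when pm_left_commute mult.assoc)
  also have "\<dots> = HH k r * (vT s i m * vT t j n)
    - (pm s * (vT s i (m + int r) * vT t j n) when i = k) - (pm t * (vT s i m * vT t j (n + int r)) when j = k)"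
    unfolding vT_HH[OF r] by (simp add: left_diff_distrib when_mult mult.assoc)
  finally show ?thesis .
qed

abbreviation cs :: "complex \<Rightarrow> 'i vend fps" where "cs c \<equiv> fps_const (sc c)"

lemma app_cs: "app (cs c * x) d v = vscale c (app x d v)"
  by (simp add: app_def)

lemma cs_commute: "cs c * x = x * cs c"
  by (rule fps_const_sc_commute)

lemma cs_left_commute: "x * (cs c * y) = cs c * (x * y)"
  by (metis mult.assoc cs_commute)

text \<open>Only the zero modes matter here: exchanging them moves the power given by the pairing of
  the two roots from one variable to the other and costs the sign of \<open>eps_swap\<close>.
  Comparing both sides by \<open>ebas_HH_eqI\<close> avoids computing commutators of annihilation
  operators.\<close>

lemma vT_commute:
  "vT s i (m + pm s * pm t * a i j) * vT t j n = cs (asgn i j) * (vT t j (n + pm s * pm t * a i j) * vT s i m)"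
proof -
  let ?c = "pm s * pm t * a i j"
  define U where "U = (\<lambda>(m, n). vT s i (m + ?c) * vT t j n)"
  define W where "W = (\<lambda>(m, n). cs (asgn i j) * (vT t j (n + ?c) * vT s i m))"
  have "U (m, n) = W (m, n)"
  proof (rule ebas_HH_eqI[where x = U and y = W and k = "(m, n)"])
    fix k :: "int \<times> int" and d b
    show "app (U k) d (ebas b) = app (W k) d (ebas b)"
      using eps_swap[of s i t j]
      by (cases k) (auto simp: U_def W_def app_cs app_vT_vT_ebas when_def a_sym[of j i] ac_simps)
  next
    fix k :: "int \<times> int" and l and r :: nat
    assume r: "r > 0"
    obtain m n where k: "k = (m, n)" by (cases k)
    \<comment> \<open>The recursion common to both sides: the creation operator meets the first or
      the second series and raises its index by r.\<close>
    let ?C = "\<lambda>u. (- pm s when i = l \<and> u = (m + int r, n)) + (- pm t when j = l \<and> u = (m, n + int r))"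
    let ?A = "{(m + int r, n), (m, n + int r)}"
    have S: "(\<Sum>u\<in>?A. ?C u * Z u) = - (pm s * Z (m + int r, n) when i = l) - (pm t * Z (m, n + int r) when j = l)"
      for Z :: "int \<times> int \<Rightarrow> 'i vend fps"
      using r by (simp add: when_def)
    have shift: "m + ?c + int r = m + int r + ?c" by simp
    have diff_diff_add_eq: "p - x - y = p + (- x - y)" for p x y :: "'i vend fps" by simp
    have "U k * HH l r = HH l r * U k + (\<Sum>u\<in>?A. ?C u * U u)"
      unfolding S k U_def prod.case vT_vT_HH[OF r] shift by (rule diff_diff_add_eq)
    moreover have "W k * HH l r = HH l r * W k + (\<Sum>u\<in>?A. ?C u * W u)"
    proof -
      have shift: "n + ?c + int r = n + int r + ?c" by simp
      have "cs (asgn i j) * (vT t j (n + ?c) * vT s i m) * HH l r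
        = cs (asgn i j) * (HH l r * (vT t j (n + ?c) * vT s i m) - (pm t * (vT t j (n + int r + ?c) * vT s i m) when j = l)
          - (pm s * (vT t j (n + ?c) * vT s i (m + int r)) when i = l))"
        unfolding mult.assoc[of "cs (asgn i j)"] vT_vT_HH[OF r] shift ..
      also have "\<dots> = HH l r * (cs (asgn i j) * (vT t j (n + ?c) * vT s i m))
          + (- (pm s * (cs (asgn i j) * (vT t j (n + ?c) * vT s i (m + int r))) when i = l)
             - (pm t * (cs (asgn i j) * (vT t j (n + int r + ?c) * vT s i m)) when j = l))"
        unfolding right_diff_distrib mult_when cs_left_commute[of "HH l r"] pm_left_commute[of "cs (asgn i j)"] by simp
      finally show ?thesis unfolding S k W_def prod.case .
    qed
    ultimately show "\<exists>A C. U k * HH l r = HH l r * U k + (\<Sum>u\<in>A. C u * U u)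
        \<and> W k * HH l r = HH l r * W k + (\<Sum>u\<in>A. C u * W u)"
      by (intro exI[of _ ?A] exI[of _ ?C] conjI)
  qed
  then show ?thesis by (simp add: U_def W_def)
qed

lemma sumbl_vT_vT: "sumbl (\<lambda>p. vT s i p * vT t j (m - p))"
  by (rule sumbl_mult_left) (simp add: sumbl_vT)

text \<open>On e^\<beta> the product lives at p + q = -2 only. Creation operators replace p or q by
  larger indices, so vanishing above -2 is inherited.\<close>

lemma vT_pair_zero: "p + q > - 2 \<Longrightarrow> vT Minus i p * vT Plus i q = 0"
proof -
  have "\<forall>p q d. p + q > - 2 \<longrightarrow> app (vT Minus i p * vT Plus i q) d v = 0" for v
  proof (induction v rule: vspace_induct)
    case (4 j r v)
    show ?case
    proof (intro allI impI)
      fix p q d assume "p + q > (- 2::int)"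
      then have "app (vT Minus i p * vT Plus i q) d v = 0" "app (vT Minus i (p + int r) * vT Plus i q) d v = 0"
          "app (vT Minus i p * vT Plus i (q + int r)) d v = 0"
        using 4 by auto
      then show "app (vT Minus i p * vT Plus i q) d (ap (hcre j r) v) = 0"
        unfolding app_HH(1)[symmetric] vT_vT_HH[OF 4(1)] by (auto simp: when_def app_HH)
    qed
  qed (auto simp: app_scale app_vT_vT_ebas when_def sroot_Minus form_uminus_left)
  then show "p + q > - 2 \<Longrightarrow> vT Minus i p * vT Plus i q = 0"
    by (intro app_eqI) simp
qed

text \<open>T^-(z) T^+(z) = z^-2: the exponentials cancel, the zero modes leave z^-2, and the sign
  of X^- compensates \<epsilon>(\<alpha>, \<alpha>) = -1. In the proof the convolution commutes with
  every creation operator, since the two index shifts cancel after reindexing.\<close>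

lemma vT_conv: "lsum (\<lambda>p. vT Minus i p * vT Plus i (m - p)) = (1 when m = - 2)"
proof -
  let ?x = "\<lambda>m. lsum (\<lambda>p. vT Minus i p * vT Plus i (m - p))"
  have "?x m = (1 when m = - 2)"
  proof (rule ebas_HH_eqI[where x = "?x" and y = "\<lambda>m. (1 when m = - 2)" and k = m])
    fix m :: int and d b
    let ?f = "form a (sroot Plus i) b"
    have "app (?x m) d (ebas b) = app (vT Minus i (m - ?f) * vT Plus i ?f) d (ebas b)"
      by (subst app_lsum_superset[OF sumbl_vT_vT, of "{m - ?f}"]) (auto simp: app_vT_vT_ebas)
    then show "app (?x m) d (ebas b) = app (1 when m = - 2) d (ebas b)"
      by (auto simp: app_one app_vT_vT_ebas when_def sroot_Minus form_uminus_left)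
  next
    fix m :: int and j and r :: nat
    assume r: "r > 0"
    have "?x m * HH j r = lsum (\<lambda>p. HH j r * (vT Minus i p * vT Plus i (m - p))
        + ((vT Minus i (p + int r) * vT Plus i (m - p) when i = j) - (vT Minus i p * vT Plus i (m - p + int r) when i = j)))"
    proof -
      have "vT Minus i p * vT Plus i (m - p) * HH j r = HH j r * (vT Minus i p * vT Plus i (m - p))
        + ((vT Minus i (p + int r) * vT Plus i (m - p) when i = j) - (vT Minus i p * vT Plus i (m - p + int r) when i = j))" for p
        unfolding vT_vT_HH[OF r] by (cases "i = j") simp_all
      then show ?thesis by (simp only: lsum_mult_right[OF sumbl_vT_vT])
    qed
    also have "\<dots> = HH j r * ?x m + lsum (\<lambda>p. (vT Minus i (p + int r) * vT Plus i (m - p) when i = j)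
         - (vT Minus i p * vT Plus i (m - p + int r) when i = j))"
    proof -
      have s1: "sumbl (\<lambda>p. vT Minus i (p + int r) * vT Plus i (m - p))"
        by (rule sumbl_mult_left) (simp add: sumbl_vT)
      have s2: "sumbl (\<lambda>p. vT Minus i p * vT Plus i (m - p + int r))"
        using sumbl_vT_vT[of Minus i Plus i "m + int r"] by (simp add: algebra_simps)
      show ?thesis
        unfolding lsum_mult_left[OF sumbl_vT_vT]
        by (intro lsum_add sumbl_mult_left sumbl_vT_vT sumbl_diff sumbl_when s1 s2)
    qed
    also have "lsum (\<lambda>p. (vT Minus i (p + int r) * vT Plus i (m - p) when i = j)
         - (vT Minus i p * vT Plus i (m - p + int r) when i = j)) = 0"
    proof (cases "i = j")
      case True
      have s1: "sumbl (\<lambda>p. vT Minus i (p + int r) * vT Plus i (m - p))"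
        by (rule sumbl_mult_left) (simp add: sumbl_vT)
      have s2: "sumbl (\<lambda>p. vT Minus i p * vT Plus i (m - p + int r))"
        using sumbl_vT_vT[of Minus i Plus i "m + int r"] by (simp add: algebra_simps)
      have "lsum (\<lambda>p. vT Minus i (p + int r) * vT Plus i (m - p)) = lsum (\<lambda>p. vT Minus i p * vT Plus i (m - p + int r))"
        using lsum_shift(1)[OF s2, of "int r"] by (simp add: algebra_simps)
      moreover have e: "(i = j) = True" using True by simp
      ultimately show ?thesis unfolding e when_simps lsum_diff[OF s1 s2] by simp
    qed simp
    finally show "\<exists>A C. ?x m * HH j r = HH j r * ?x m + (\<Sum>l\<in>A. C l * ?x l)
        \<and> (1 when m = - 2) * HH j r = HH j r * (1 when m = - 2) + (\<Sum>l\<in>A. C l * (1 when l = - 2))"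
      by (intro exI[of _ "{}"]) (simp add: when_def)
  qed
  then show ?thesis .
qed

end

section \<open>Power series with values in the Fock space\<close>

text \<open>In \<open>fock fps fps\<close> the outer variable is \<open>z\<close> and the inner one is \<open>\<hbar>\<close>; \<open>Ec c f\<close> is \<open>f(z + c\<hbar>)\<close>.\<close>

definition Ec :: "complex \<Rightarrow> 'i fock fps \<Rightarrow> 'i fock fps fps" where
  "Ec c f = Abs_fps (\<lambda>m. Abs_fps (\<lambda>d. cf (of_nat (m + d choose d) * c ^ d) * fps_nth f (m + d)))"

lemma Ec_nth: "fps_nth (fps_nth (Ec c f) m) d = cf (of_nat (m + d choose d) * c ^ d) * fps_nth f (m + d)"
  by (simp add: Ec_def)

lemma fps2_eqI: "(\<And>m d. fps_nth (fps_nth x m) d = fps_nth (fps_nth y m) d) \<Longrightarrow> x = y"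
  by (intro fps_ext)

lemma fps2_mult_nth: "fps_nth (fps_nth (x * y) m) d =
    (\<Sum>k\<le>m. \<Sum>e\<le>d. fps_nth (fps_nth x k) e * fps_nth (fps_nth y (m - k)) (d - e))"
  by (simp add: fps_mult_nth fps_sum_nth atLeast0AtMost)

text \<open>The coefficient identity behind the multiplicativity of the substitution z + c\<hbar>.
  On each diagonal j = k + e it is Vandermonde's identity.\<close>

lemma binomial_convolution:
  fixes h :: "nat \<Rightarrow> 'a::comm_semiring_1"
  shows "(\<Sum>k\<le>m. \<Sum>e\<le>d. of_nat ((k + e choose e) * ((m - k) + (d - e) choose (d - e))) * h (k + e))
       = of_nat (m + d choose d) * (\<Sum>j\<le>m + d. h j)"
proof -
  let ?F = "\<lambda>j e. of_nat ((j choose e) * ((m + d) - j choose (d - e))) * h j"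
  have "(\<Sum>k\<le>m. \<Sum>e\<le>d. of_nat ((k + e choose e) * ((m - k) + (d - e) choose (d - e))) * h (k + e))
      = (\<Sum>e\<le>d. \<Sum>k\<le>m. ?F (k + e) e)"
    by (subst sum.swap, intro sum.cong refl) simp
  also have "\<dots> = (\<Sum>e\<le>d. \<Sum>j\<le>m + d. ?F j e)"
  proof (rule sum.cong[OF refl])
    fix e assume "e \<in> {..d}"
    then have e: "e \<le> d" by simp
    have "(\<Sum>k\<le>m. ?F (k + e) e) = (\<Sum>j\<in>{e..m + e}. ?F j e)"
      by (rule sum.reindex_bij_witness[of _ "\<lambda>j. j - e" "\<lambda>k. k + e"]) auto
    \<comment> \<open>Outside e \<le> j \<le> m + e one of the two binomials is 0, so the range can
      be made independent of e.\<close>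
    also have "\<dots> = (\<Sum>j\<le>m + d. ?F j e)"
    proof (rule sum.mono_neutral_left)
      show "\<forall>j\<in>{..m + d} - {e..m + e}. ?F j e = 0"
      proof
        fix j assume "j \<in> {..m + d} - {e..m + e}"
        then have "j < e \<or> m + d - j < d - e" using e by auto
        then show "?F j e = 0" by (auto simp: binomial_eq_0)
      qed
    qed (use e in auto)
    finally show "(\<Sum>k\<le>m. ?F (k + e) e) = (\<Sum>j\<le>m + d. ?F j e)" .
  qed
  also have "\<dots> = (\<Sum>j\<le>m + d. \<Sum>e\<le>d. ?F j e)" by (rule sum.swap)
  also have "\<dots> = (\<Sum>j\<le>m + d. of_nat (m + d choose d) * h j)"
  proof (rule sum.cong[OF refl])
    fix j assume "j \<in> {..m + d}"
    then have "(\<Sum>e\<le>d. (j choose e) * ((m + d) - j choose (d - e))) = (m + d choose d)"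
      using vandermonde[of j "m + d - j" d] by simp
    then show "(\<Sum>e\<le>d. ?F j e) = of_nat (m + d choose d) * h j"
      unfolding sum_distrib_right[symmetric] of_nat_sum[symmetric] by simp
  qed
  finally show ?thesis by (simp add: sum_distrib_left)
qed

lemma Ec_mult: "Ec c (f * g) = Ec c f * Ec c g"
proof (rule fps2_eqI)
  fix m d
  have "fps_nth (fps_nth (Ec c f * Ec c g) m) d =
     (\<Sum>k\<le>m. \<Sum>e\<le>d. of_nat ((k + e choose e) * ((m - k) + (d - e) choose (d - e)))
        * (cf (c ^ d) * (fps_nth f (k + e) * fps_nth g (m + d - (k + e)))))"
    unfolding fps2_mult_nth Ec_nth
  proof (intro sum.cong refl)
    fix k e assume "k \<in> {..m}" "e \<in> {..d}"
    then have ke: "k \<le> m" "e \<le> d" by auto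
    then have "c ^ d = c ^ e * c ^ (d - e)" by (simp flip: power_add)
    moreover have "m - k + (d - e) = m + d - (k + e)" using ke by simp
    ultimately show "cf (of_nat (k + e choose e) * c ^ e) * fps_nth f (k + e)
        * (cf (of_nat (m - k + (d - e) choose (d - e)) * c ^ (d - e)) * fps_nth g (m - k + (d - e)))
        = of_nat ((k + e choose e) * ((m - k) + (d - e) choose (d - e)))
          * (cf (c ^ d) * (fps_nth f (k + e) * fps_nth g (m + d - (k + e))))"
      by (simp add: mult_ac)
  qed
  also have "\<dots> = fps_nth (fps_nth (Ec c (f * g)) m) d"
    unfolding binomial_convolution[of m d "\<lambda>j. cf (c ^ d) * (fps_nth f j * fps_nth g (m + d - j))"]
    by (simp add: Ec_nth fps_mult_nth atLeast0AtMost sum_distrib_left mult_ac)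
  finally show "fps_nth (fps_nth (Ec c (f * g)) m) d = fps_nth (fps_nth (Ec c f * Ec c g) m) d" ..
qed

lemma Ec_one [simp]: "Ec c 1 = 1"
  by (rule fps2_eqI) (simp add: Ec_nth)

definition uu :: "complex \<Rightarrow> 'i fock fps fps" where
  "uu c = fps_X + fps_const (fps_const (cf c) * fps_X)"

lemma Ec_X: "Ec c fps_X = uu c"
proof (rule fps2_eqI)
  fix m d
  show "fps_nth (fps_nth (Ec c fps_X) m) d = fps_nth (fps_nth (uu c :: 'i fock fps fps) m) d"
    by (cases m; cases d) (auto simp: Ec_nth uu_def fps_X_def)
qed

section \<open>Logarithmic derivatives\<close>

definition theta :: "'i fock fps \<Rightarrow> 'i fock fps" where "theta f = fps_X * fps_deriv f"

lemma theta_nth: "fps_nth (theta f) n = of_nat n * fps_nth f n"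
  by (cases n) (simp_all add: theta_def)

lemma theta_mult: "theta (f * g) = theta f * g + f * theta g"
  by (simp add: theta_def algebra_simps)

text \<open>The Euler operator z d/dz + \<hbar> d/d\<hbar>. Unlike z d/dz alone it is compatible
  with the substitution z + c\<hbar>, which is homogeneous of degree 1
  (\<open>Dt_Ec\<close>).\<close>

definition Dt :: "'i fock fps fps \<Rightarrow> 'i fock fps fps" where
  "Dt x = Abs_fps (\<lambda>m. Abs_fps (\<lambda>d. of_nat (m + d) * fps_nth (fps_nth x m) d))"

lemma Dt_nth: "fps_nth (fps_nth (Dt x) m) d = of_nat (m + d) * fps_nth (fps_nth x m) d"
  by (simp add: Dt_def)

lemma Dt_Ec: "Dt (Ec c f) = Ec c (theta f)"
  by (rule fps2_eqI) (simp add: Dt_nth Ec_nth theta_nth mult_ac)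

lemma Dt_add: "Dt (x + y) = Dt x + Dt y" and Dt_minus: "Dt (- x) = - Dt x" and Dt_zero [simp]: "Dt 0 = 0" "Dt 1 = 0"
  by (rule fps2_eqI; auto simp: Dt_nth algebra_simps; fail)+

lemma Dt_mult: "Dt (x * y) = Dt x * y + x * Dt y"
proof (rule fps2_eqI)
  fix m d
  have "of_nat (m + d) * (fps_nth (fps_nth x k) e * fps_nth (fps_nth y (m - k)) (d - e)) =
      of_nat (k + e) * fps_nth (fps_nth x k) e * fps_nth (fps_nth y (m - k)) (d - e)
      + fps_nth (fps_nth x k) e * (of_nat ((m - k) + (d - e)) * fps_nth (fps_nth y (m - k)) (d - e))"
    if "k \<le> m" "e \<le> d" for k e
  proof -
    have "m + d = (k + e) + ((m - k) + (d - e))" using that by simp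
    then have "(of_nat (m + d) :: 'a fock) = of_nat (k + e) + of_nat ((m - k) + (d - e))"
      by (metis of_nat_add)
    then show ?thesis by (simp only: algebra_simps)
  qed
  then show "fps_nth (fps_nth (Dt (x * y)) m) d = fps_nth (fps_nth (Dt x * y + x * Dt y) m) d"
    unfolding Dt_nth fps_add_nth fps2_mult_nth sum_distrib_left sum.distrib[symmetric]
    by (intro sum.cong refl) auto
qed

text \<open>A logarithmic derivative together with a normalised constant term. This characterises
  exponentials without infinite sums and turns products into sums; so the product \<open>vA\<close>
  can be recognised as an exponential.\<close>

definition logD :: "'i fock fps fps \<Rightarrow> 'i fock fps fps \<Rightarrow> bool" where
  "logD x y \<longleftrightarrow> Dt x = y * x \<and> fps_nth (fps_nth x 0) 0 = 1"

lemma logD_mult: "logD x y \<Longrightarrow> logD x' y' \<Longrightarrow> logD (x * x') (y + y')"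
  by (simp add: logD_def Dt_mult algebra_simps)

lemma logD_prod: "(\<And>j. j \<in> J \<Longrightarrow> logD (x j) (y j)) \<Longrightarrow> logD (\<Prod>j\<in>J. x j) (\<Sum>j\<in>J. y j)"
  by (induction J rule: infinite_finite_induct) (auto simp: logD_mult, simp_all add: logD_def)

lemma of_nat_fock_cancel: "n > 0 \<Longrightarrow> of_nat n * x = of_nat n * y \<Longrightarrow> x = (y :: 'i fock)"
proof -
  assume "n > 0" and eq: "of_nat n * x = of_nat n * y"
  then have inv: "cf (1 / of_nat n) * (of_nat n * z) = z" for z :: "'i fock"
    unfolding cf_of_nat[symmetric] mult.assoc[symmetric] cf_hom(4)[symmetric] by simp
  show "x = y" using arg_cong[OF eq, of "\<lambda>z. cf (1 / of_nat n) * z"] unfolding inv .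
qed

text \<open>Comparison of coefficients expresses m + d times the coefficient of x at (m, d) by
  coefficients of smaller total degree, as y has no constant term.\<close>

lemma logD_unique:
  assumes "logD x y" "logD x' y" "fps_nth (fps_nth y 0) 0 = 0"
  shows "x = x'"
proof (rule fps2_eqI)
  fix m d
  show "fps_nth (fps_nth x m) d = fps_nth (fps_nth x' m) d"
  proof (induction "m + d" arbitrary: m d rule: less_induct)
    case less
    show ?case
    proof (cases "m + d = 0")
      case True then show ?thesis using assms by (simp add: logD_def)
    next
      case False
      have "(\<Sum>k\<le>m. \<Sum>e\<le>d. fps_nth (fps_nth y k) e * fps_nth (fps_nth x (m - k)) (d - e))
          = (\<Sum>k\<le>m. \<Sum>e\<le>d. fps_nth (fps_nth y k) e * fps_nth (fps_nth x' (m - k)) (d - e))"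
      proof (intro sum.cong refl)
        fix k e assume "k \<in> {..m}" "e \<in> {..d}"
        then show "fps_nth (fps_nth y k) e * fps_nth (fps_nth x (m - k)) (d - e)
          = fps_nth (fps_nth y k) e * fps_nth (fps_nth x' (m - k)) (d - e)"
          using less[of "m - k" "d - e"] assms(3) by (cases "k = 0 \<and> e = 0") auto
      qed
      then have "fps_nth (fps_nth (Dt x) m) d = fps_nth (fps_nth (Dt x') m) d"
        using assms unfolding logD_def by (simp add: fps2_mult_nth)
      then show ?thesis using of_nat_fock_cancel[of "m + d"] False unfolding Dt_nth by blast
    qed
  qed
qed

definition eS :: "'i fock fps fps \<Rightarrow> 'i fock fps fps" where
  "eS x = Abs_fps (\<lambda>m. Abs_fps (\<lambda>d. \<Sum>n\<le>m + d. cf (1 / fact n) * fps_nth (fps_nth (x ^ n) m) d))"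

lemma fps2_power_zero:
  "fps_nth (fps_nth x 0) 0 = (0 :: 'i fock) \<Longrightarrow> m + d < n \<Longrightarrow> fps_nth (fps_nth (x ^ n) m) d = 0"
proof (induction n arbitrary: m d)
  case (Suc n)
  have "fps_nth (fps_nth x k) e * fps_nth (fps_nth (x ^ n) (m - k)) (d - e) = 0" if "k \<le> m" "e \<le> d" for k e
    using Suc that by (cases "k = 0 \<and> e = 0") auto
  then show ?case by (simp add: fps2_mult_nth)
qed simp

lemma eS_nth:
  assumes "fps_nth (fps_nth x 0) 0 = 0" "m + d \<le> N"
  shows "fps_nth (fps_nth (eS x) m) d = (\<Sum>n\<le>N. cf (1 / fact n) * fps_nth (fps_nth (x ^ n) m) d)"
  unfolding eS_def using assms by (simp, intro sum.mono_neutral_left) (auto simp: fps2_power_zero)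

lemma Dt_power: "Dt (x ^ n) = of_nat n * x ^ (n - 1) * Dt x"
proof (induction n)
  case (Suc n) then show ?case by (cases n) (simp_all add: Dt_mult algebra_simps)
qed simp

lemma logD_eS:
  assumes x0: "fps_nth (fps_nth x 0) 0 = 0"
  shows "logD (eS x) (Dt x)"
proof -
  let ?c = "\<lambda>n. fps_const (fps_const (cf (1 / fact n))) :: 'a fock fps fps"
  have "fps_nth (fps_nth (Dt (eS x)) m) d = fps_nth (fps_nth (Dt x * eS x) m) d" for m d
  proof -
    let ?P = "\<Sum>n\<le>m + d. ?c n * x ^ n"
    have cn: "?c (Suc n) * of_nat (Suc n) = ?c n" for n
    proof -
      have "1 / fact (Suc n) * of_nat (Suc n) = (1 / fact n :: complex)"
        by (simp add: field_simps del: of_nat_Suc)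
      then have "cf (1 / fact (Suc n)) * of_nat (Suc n) = (cf (1 / fact n) :: 'a fock)"
        unfolding cf_of_nat[symmetric] cf_hom(4)[symmetric] by simp
      then show ?thesis
        unfolding fps_of_nat[symmetric] fps_const_mult by simp
    qed
    \<comment> \<open>One term more than the degree requires, because differentiation lowers the
      exponent by 1.\<close>
    have "fps_nth (fps_nth (Dt (eS x)) m) d = fps_nth (fps_nth (Dt (\<Sum>n\<le>Suc (m + d). ?c n * x ^ n)) m) d"
      by (simp add: Dt_nth eS_nth[OF x0, of m d "Suc (m + d)"] fps_sum_nth del: sum.atMost_Suc)
    also have "Dt (\<Sum>n\<le>Suc (m + d). ?c n * x ^ n) = (\<Sum>n\<le>Suc (m + d). Dt (?c n * x ^ n))"
    proof -
      have "Dt (sum f A) = (\<Sum>n\<in>A. Dt (f n))" for f :: "nat \<Rightarrow> 'a fock fps fps" and A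
        by (induction A rule: infinite_finite_induct) (simp_all add: Dt_add)
      then show ?thesis .
    qed
    also have "\<dots> = (\<Sum>n\<le>Suc (m + d). ?c n * (of_nat n * x ^ (n - 1) * Dt x))"
    proof (rule sum.cong[OF refl])
      fix n
      have "Dt (?c n) = 0"
        by (rule fps2_eqI) (auto simp: Dt_nth)
      then show "Dt (?c n * x ^ n) = ?c n * (of_nat n * x ^ (n - 1) * Dt x)"
        by (simp add: Dt_mult Dt_power)
    qed
    also have "\<dots> = (\<Sum>n\<le>m + d. ?c (Suc n) * (of_nat (Suc n) * x ^ n * Dt x))"
      by (subst sum.atMost_Suc_shift) simp
    also have "\<dots> = (\<Sum>n\<le>m + d. ?c n * x ^ n * Dt x)"
      unfolding mult.assoc[symmetric] cn ..
    also have "\<dots> = Dt x * ?P" by (simp add: sum_distrib_left mult_ac)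
    also have "fps_nth (fps_nth (Dt x * ?P) m) d = fps_nth (fps_nth (Dt x * eS x) m) d"
      unfolding fps2_mult_nth
      by (intro sum.cong refl arg_cong2[of _ _ _ _ "(*)"])
         (auto simp: eS_nth[OF x0, of _ _ "m + d"] fps_sum_nth)
    finally show ?thesis .
  qed
  moreover have "fps_nth (fps_nth (eS x) 0) 0 = 1" by (simp add: eS_def)
  ultimately show ?thesis by (auto simp: logD_def intro: fps2_eqI)
qed

section \<open>Exponentials of creation operators\<close>

fun sflip :: "sign \<Rightarrow> sign" where "sflip Plus = Minus" | "sflip Minus = Plus"

lemma pm_sflip [simp]: "pm (sflip s) = - pm s" "sflip (sflip s) = s"
  by (cases s; simp)+

text \<open>Newton's recursion for the coefficients of exp(\<plusminus> \<Sum> H_{j,-r} z^r / r). It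
  is the differential equation \<open>theta_gh\<close> read in coefficients.\<close>

fun gco :: "sign \<Rightarrow> 'i \<Rightarrow> nat \<Rightarrow> 'i fock" where
  "gco s j 0 = 1"
| "gco s j (Suc n) = cf (pm s / of_nat (Suc n)) * (\<Sum>k\<le>n. fock_var j (Suc n - k) * gco s j k)"

definition gh :: "sign \<Rightarrow> 'i \<Rightarrow> 'i fock fps" where "gh s j = Abs_fps (gco s j)"

definition hv :: "'i \<Rightarrow> 'i fock fps" where "hv j = Abs_fps (\<lambda>r. if r = 0 then 0 else fock_var j r)"

lemma gh_nth [simp]: "fps_nth (gh s j) n = gco s j n"
  by (simp add: gh_def)

lemma cf_pm: "cf (pm s) = pm s"
  by (cases s) simp_all

lemma gco_rec: "of_nat n * gco s j n = pm s * (\<Sum>k<n. fock_var j (n - k) * gco s j k)"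
proof (cases n)
  case (Suc m)
  have "of_nat (Suc m) * (cf (pm s / of_nat (Suc m)) * z) = pm s * z" for z :: "'a fock"
    unfolding cf_of_nat[symmetric] mult.assoc[symmetric] cf_hom(4)[symmetric] by (simp add: cf_pm del: of_nat_Suc)
  then show ?thesis unfolding Suc by (simp add: lessThan_Suc_atMost del: of_nat_Suc)
qed simp

lemma theta_gh: "theta (gh s j) = pm s * hv j * gh s j"
proof (rule fps_ext)
  fix n
  have "fps_nth (hv j * gh s j) n = (\<Sum>k\<le>n. fps_nth (hv j) (n - k) * gco s j k)"
    unfolding fps_mult_nth atLeast0AtMost
    by (rule sum.reindex_bij_witness[of _ "\<lambda>k. n - k" "\<lambda>k. n - k"]) auto
  also have "\<dots> = (\<Sum>k<n. fock_var j (n - k) * gco s j k)"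
    by (rule sum.mono_neutral_cong_right) (auto simp: hv_def)
  finally have "fps_nth (hv j * gh s j) n = (\<Sum>k<n. fock_var j (n - k) * gco s j k)" .
  then show "fps_nth (theta (gh s j)) n = fps_nth (pm s * hv j * gh s j) n"
    unfolding theta_nth gh_nth gco_rec by (cases s) simp_all
qed

text \<open>The logarithmic derivatives are opposite, so the product has derivative 0 and constant
  term 1.\<close>

lemma gh_inverse: "gh s j * gh (sflip s) j = 1"
proof (rule fps_ext)
  fix n
  have "theta (gh s j * gh (sflip s) j) = 0"
    by (simp add: theta_mult theta_gh algebra_simps)
  then have "of_nat n * fps_nth (gh s j * gh (sflip s) j) n = 0"
    by (metis theta_nth fps_zero_nth)
  then show "fps_nth (gh s j * gh (sflip s) j) n = fps_nth 1 n"
    using of_nat_fock_cancel[of n _ 0] by (cases "n = 0") auto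
qed

lemma Ec_gh_inverse: "Ec c (gh s j) * Ec c (gh (sflip s) j) = 1"
  by (simp flip: Ec_mult add: gh_inverse)

lemma Ec_pm: "Ec c (pm s * f) = pm s * Ec c f"
  by (rule fps2_eqI) (cases s; simp add: Ec_nth)

lemma logD_Ec_gh: "logD (Ec c (gh s j)) (pm s * Ec c (hv j))"
proof -
  have "Dt (Ec c (gh s j)) = pm s * Ec c (hv j) * Ec c (gh s j)"
    unfolding Dt_Ec theta_gh mult.assoc Ec_pm unfolding Ec_mult ..
  then show ?thesis by (simp add: logD_def Ec_nth)
qed

definition eta :: "'i \<Rightarrow> 'i fock fps" where
  "eta j = Abs_fps (\<lambda>r. if r = 0 then 0 else cf (1 / of_nat r) * fock_var j r)"

lemma theta_eta: "theta (eta j) = hv j"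
proof (rule fps_ext)
  fix n
  have "of_nat n * (cf (1 / of_nat n) * z) = z" if "n > 0" for z :: "'a fock"
    unfolding cf_of_nat[symmetric] mult.assoc[symmetric] cf_hom(4)[symmetric] using that by simp
  then show "fps_nth (theta (eta j)) n = fps_nth (hv j) n"
    by (cases "n = 0") (simp_all add: theta_nth eta_def hv_def)
qed

text \<open>The series A as a product of elementary exponentials with shifted arguments. In this
  form T(z) can be moved past A one linear factor at a time; \<open>vA_eq_exp\<close> identifies it
  with the exponential that defines A.\<close>

definition vA :: "('i::finite \<Rightarrow> 'i \<Rightarrow> int) \<Rightarrow> sign \<Rightarrow> 'i \<Rightarrow> 'i fock fps fps" where
  "vA a s i = Ec 0 (gh s i) * Ec (- pm s) (gh s i) * (\<Prod>j\<in>nbrs a i. Ec (- pm s / 2) (gh (sflip s) j))"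

definition vAexp :: "('i::finite \<Rightarrow> 'i \<Rightarrow> int) \<Rightarrow> sign \<Rightarrow> 'i \<Rightarrow> 'i fock fps fps" where
  "vAexp a s i = pm s * (Ec 0 (eta i) + Ec (- pm s) (eta i) - (\<Sum>j\<in>nbrs a i. Ec (- pm s / 2) (eta j)))"

lemma vAexp_0: "fps_nth (fps_nth (vAexp a s i) 0) 0 = 0"
  by (cases s) (simp_all add: vAexp_def Ec_nth eta_def fps_sum_nth)

lemma Dt_vAexp: "Dt (vAexp a s i) = pm s * (Ec 0 (hv i) + Ec (- pm s) (hv i) - (\<Sum>j\<in>nbrs a i. Ec (- pm s / 2) (hv j)))"
proof -
  have Dsum: "Dt (sum f A) = (\<Sum>n\<in>A. Dt (f n))" for f :: "'a \<Rightarrow> 'a fock fps fps" and A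
    by (induction A rule: infinite_finite_induct) (simp_all add: Dt_add)
  have Ddiff: "Dt (x - y) = Dt x - Dt y" for x y :: "'a fock fps fps"
    using Dt_add[of x "- y"] by (simp add: Dt_minus)
  have "Dt (pm s * x) = pm s * Dt x" for x :: "'a fock fps fps"
    by (cases s) (simp_all add: Dt_minus)
  then show ?thesis by (simp add: vAexp_def Ddiff Dt_add Dsum Dt_Ec theta_eta)
qed

text \<open>Both sides have the same logarithmic derivative; the operator \<open>Dt\<close> removes
  the denominators 1/r from the exponent.\<close>

lemma vA_eq_exp: "vA a s i = eS (vAexp a s i)"
proof (rule logD_unique)
  show "logD (eS (vAexp a s i)) (Dt (vAexp a s i))" by (rule logD_eS[OF vAexp_0])
  have "logD (vA a s i) (pm s * Ec 0 (hv i) + pm s * Ec (- pm s) (hv i) + (\<Sum>j\<in>nbrs a i. pm (sflip s) * Ec (- pm s / 2) (hv j)))"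
    unfolding vA_def by (intro logD_mult logD_prod logD_Ec_gh)
  then show "logD (vA a s i) (Dt (vAexp a s i))"
    unfolding Dt_vAexp by (simp add: algebra_simps sum_distrib_left sum_negf)
  show "fps_nth (fps_nth (Dt (vAexp a s i)) 0) 0 = 0"
    by (simp add: Dt_nth)
qed

section \<open>Multiplication operators\<close>

text \<open>Extended by 0 to negative exponents, so that the creation and annihilation halves are
  both indexed by all integers.\<close>

definition mu :: "'i fock fps fps \<Rightarrow> int \<Rightarrow> 'i::finite vend fps" where
  "mu x m = (if m \<ge> 0 then Abs_fps (\<lambda>d. mo (fps_nth (fps_nth x (nat m)) d)) else 0)"

lemma mu_neg [simp]: "m < 0 \<Longrightarrow> mu x m = 0"
  by (simp add: mu_def)

lemma mu_nth: "fps_nth (mu x (int m)) d = mo (fps_nth (fps_nth x m) d)"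
  by (simp add: mu_def)

lemma mu_add: "mu (x + y) m = mu x m + mu y m" and mu_minus: "mu (- x) m = - mu x m"
  and mu_diff: "mu (x - y) m = mu x m - mu y m" and mu_zero [simp]: "mu 0 m = 0"
  by (auto simp: mu_def intro: fps_ext)

lemma mu_one: "mu 1 m = (1 when m = 0)"
  by (rule fps_ext) (auto simp: mu_def when_def)

lemma mu_mult: "mu (x * y) n = (\<Sum>k\<in>{0..n}. mu x k * mu y (n - k))"
proof (cases "n \<ge> 0")
  case True
  then obtain N where n: "n = int N" using nonneg_int_cases by blast
  have "{0..n} = int ` {..N}"
    by (auto simp: n image_iff) (metis atMost_iff nat_le_iff int_nat_eq)
  then have "(\<Sum>k\<in>{0..n}. mu x k * mu y (n - k)) = (\<Sum>k\<le>N. mu x (int k) * mu y (int N - int k))"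
    by (simp add: sum.reindex n)
  also have "\<dots> = (\<Sum>k\<le>N. mu x (int k) * mu y (int (N - k)))"
    by (intro sum.cong refl) (simp add: of_nat_diff)
  finally have eq: "(\<Sum>k\<in>{0..n}. mu x k * mu y (n - k)) = (\<Sum>k\<le>N. mu x (int k) * mu y (int (N - k)))" .
  show ?thesis
    by (rule fps_ext, unfold eq fps_sum_nth fps_mult_nth atLeast0AtMost mu_nth)
       (simp add: n mu_nth fps2_mult_nth mo_sum)
qed simp

lemma mu_commute: "mu x m * mu y n = mu y n * mu x m"
proof (rule fps_ext)
  fix d
  have "(\<Sum>e\<le>d. mo (f e) * mo (g (d - e))) = (\<Sum>e\<le>d. mo (g e) * mo (f (d - e)))"
    for f g :: "nat \<Rightarrow> 'a fock"
    by (rule sum.reindex_bij_witness[of _ "\<lambda>e. d - e" "\<lambda>e. d - e"]) (auto simp: mo_commute)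
  then show "fps_nth (mu x m * mu y n) d = fps_nth (mu y n * mu x m) d"
    by (simp add: mu_def fps_mult_nth atLeast0AtMost)
qed

abbreviation (in vertex) hh :: "'i vend fps" where "hh \<equiv> fps_X"

lemma mu_uu: "mu (uu c * x) n = mu x (n - 1) + fps_const (sc c) * (fps_X * mu x n)"
proof (cases "n \<ge> 0")
  case True
  then obtain N where n: "n = int N" using nonneg_int_cases by blast
  have 1: "mu (fps_X * x) n = mu x (n - 1)"
    by (rule fps_ext) (cases N; simp add: n mu_def nat_add_distrib)
  have 2: "mu (fps_const (fps_const (cf c) * fps_X) * x) n = fps_const (sc c) * (fps_X * mu x n)"
    by (rule fps_ext) (auto simp: n mu_nth mult.assoc mo_cf)
  show ?thesis by (simp add: uu_def distrib_right mu_add 1 2)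
qed simp

lemma mu_Ec_nth: "fps_nth (mu (Ec c f) (int n)) d = sc (of_nat (n + d choose d) * c ^ d) * mo (fps_nth f (n + d))"
  by (simp add: mu_nth Ec_nth flip: mo_cf)

section \<open>Series in two variables\<close>

definition hb :: "complex \<Rightarrow> 'i::finite vend fps" where "hb c = fps_const (sc c) * fps_X"

lemma hb_zero [simp]: "hb 0 = 0"
  by (simp add: hb_def)

lemma hb_commute: "hb c * x = x * hb c"
proof -
  have "hb c * x = fps_const (sc c) * (x * fps_X)"
    unfolding hb_def mult.assoc fps_mult_fps_X_commute[of x] ..
  also have "\<dots> = x * hb c"
    unfolding hb_def mult.assoc[symmetric] fps_const_sc_commute[of c x] ..
  finally show ?thesis .
qed

lemma hb_left_commute: "x * (hb c * y) = hb c * (x * y)"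
  unfolding mult.assoc[symmetric] hb_commute[of c x] ..

lemma hb_add: "hb (c + d) = hb c + hb d" and hb_minus: "hb (- c) = - hb c"
  by (simp_all add: hb_def distrib_right flip: fps_const_add fps_const_neg)

lemma hb_pm: "hb (pm s * c) = pm s * hb c"
  by (cases s) (simp_all add: hb_minus)

lemma hb_nth: "fps_nth (hb c * x) n = (if n = 0 then 0 else sc c * fps_nth x (n - 1))"
  by (simp add: hb_def mult.assoc)

lemma app_hb: "app (hb c * x) d v = (if d = 0 then 0 else vscale c (app x (d - 1) v))"
  by (simp add: app_def hb_nth)

lemma zw_hb_commute: "zw (hb u) (zw (hb v) F) = zw (hb v) (zw (hb u) F)"
  by (intro ext) (simp add: zw_def algebra_simps hb_left_commute[of "hb v"])

lemma zw_hb_mult_left: "zw (hb u) (\<lambda>m n. x * F m n) m n = x * zw (hb u) F m n"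
  by (simp add: zw_def algebra_simps hb_left_commute)

lemma zw_hb_mult_right: "zw (hb u) (\<lambda>m n. F m n * x) m n = zw (hb u) F m n * x"
  by (simp add: zw_def algebra_simps)

lemma zw_shift: "zw u (\<lambda>m n. F (m + p) (n + q)) m n = zw u F (m + p) (n + q)"
  by (simp add: zw_def algebra_simps)

lemma zw_uminus: "zw u (\<lambda>m n. - F m n) m n = - zw u F m n"
  by (simp add: zw_def)

lemma zw_diff: "zw u (\<lambda>m n. F m n - G m n) m n = zw u F m n - zw u G m n"
  by (simp add: zw_def algebra_simps)

lemma zw_add: "zw u (\<lambda>m n. F m n + G m n) m n = zw u F m n + zw u G m n"
  by (simp add: zw_def algebra_simps)

lemma zw_lsum:
  assumes "\<And>m n. sumbl (\<lambda>q. F q m n)"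
  shows "sumbl (\<lambda>q. zw (hb u) (F q) m n)"
    "zw (hb u) (\<lambda>m n. lsum (\<lambda>q. F q m n)) m n = lsum (\<lambda>q. zw (hb u) (F q) m n)"
  unfolding zw_def
  by (intro sumbl_add sumbl_diff sumbl_mult_left assms)
     (simp add: lsum_add lsum_diff sumbl_add sumbl_diff sumbl_mult_left assms lsum_mult_left)

text \<open>
  The factor \<open>(z - w)(z - w \<plusminus> \<hbar>)\<close> for \<open>a = 2\<close>, \<open>z - w \<plusminus> \<hbar>/2\<close> for \<open>a = -1\<close>, and 1 for \<open>a = 0\<close>.
\<close>

definition Qop :: "sign \<Rightarrow> int \<Rightarrow> (int \<Rightarrow> int \<Rightarrow> 'i::finite vend fps) \<Rightarrow> int \<Rightarrow> int \<Rightarrow> 'i vend fps" where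
  "Qop t a F = (if a = 2 then zw (hb 0) (zw (hb (pm t)) F) else if a = - 1 then zw (hb (pm t / 2)) F else F)"

lemma zw_hb_mult_left': "zw (hb u) (\<lambda>m n. x * F m n) = (\<lambda>m n. x * zw (hb u) F m n)"
  by (intro ext zw_hb_mult_left)

lemma zw_hb_mult_right': "zw (hb u) (\<lambda>m n. F m n * x) = (\<lambda>m n. zw (hb u) F m n * x)"
  by (intro ext zw_hb_mult_right)

lemma zw_shift': "zw u (\<lambda>m n. F (m + p) (n + q)) = (\<lambda>m n. zw u F (m + p) (n + q))"
  by (intro ext zw_shift)

lemma Qop_mult_left: "Qop t a (\<lambda>m n. x * F m n) m n = x * Qop t a F m n"
  by (simp add: Qop_def zw_hb_mult_left' del: hb_zero)

lemma Qop_mult_right: "Qop t a (\<lambda>m n. F m n * x) m n = Qop t a F m n * x"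
  by (simp add: Qop_def zw_hb_mult_right' del: hb_zero)

lemma Qop_shift: "Qop t a (\<lambda>m n. F (m + p) (n + q)) m n = Qop t a F (m + p) (n + q)"
  by (simp add: Qop_def zw_shift')

lemma Qop_lsum:
  assumes "\<And>m n. sumbl (\<lambda>q. F q m n)"
  shows "Qop t a (\<lambda>m n. lsum (\<lambda>q. F q m n)) m n = lsum (\<lambda>q. Qop t a (F q) m n)"
    "sumbl (\<lambda>q. Qop t a (F q) m n)"
proof -
  have eq: "zw (hb u) (\<lambda>m n. lsum (\<lambda>q. G q m n)) = (\<lambda>m n. lsum (\<lambda>q. zw (hb u) (G q) m n))"
    if "\<And>m n. sumbl (\<lambda>q. G q m n)" for u and G :: "'a \<Rightarrow> int \<Rightarrow> int \<Rightarrow> 'b vend fps"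
    by (intro ext zw_lsum(2) that)
  show "Qop t a (\<lambda>m n. lsum (\<lambda>q. F q m n)) m n = lsum (\<lambda>q. Qop t a (F q) m n)"
  proof -
    consider "a = 2" | "a = - 1" | "a \<noteq> 2" "a \<noteq> - 1" by blast
    then show ?thesis
    proof cases
      case 1
      then have "Qop t a G = zw (hb 0) (zw (hb (pm t)) G)" for G :: "int \<Rightarrow> int \<Rightarrow> 'b vend fps"
        by (simp add: Qop_def del: hb_zero)
      then show ?thesis by (simp only: eq[OF assms] eq[OF zw_lsum(1)[OF assms]])
    next
      case 2
      then have "Qop t a G = zw (hb (pm t / 2)) G" for G :: "int \<Rightarrow> int \<Rightarrow> 'b vend fps"
        by (simp add: Qop_def)
      then show ?thesis by (simp only: eq[OF assms])
    qed (simp add: Qop_def)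
  qed
  show "sumbl (\<lambda>q. Qop t a (F q) m n)"
  proof -
    consider "a = 2" | "a = - 1" | "a \<noteq> 2" "a \<noteq> - 1" by blast
    then show ?thesis
    proof cases
      case 1
      have "sumbl (\<lambda>q. zw (hb 0) (zw (hb (pm t)) (F q)) m n)" by (intro zw_lsum(1) assms)
      then show ?thesis using 1 by (simp add: Qop_def del: hb_zero)
    next
      case 2
      have "sumbl (\<lambda>q. zw (hb (pm t / 2)) (F q) m n)" by (intro zw_lsum(1) assms)
      then show ?thesis using 2 by (simp add: Qop_def)
    qed (simp add: Qop_def assms)
  qed
qed

text \<open>z - w + u = -(w - z - u). This exchanges the roles of the variables, so that results
  about one of them can be used for the other.\<close>

lemma zw_swap: "zw (hb u) (\<lambda>m n. F n m) m n = - zw (hb (- u)) F n m"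
  by (simp add: zw_def hb_minus)

section \<open>Commutation of the two halves of the vertex operators\<close>

context vertex
begin

abbreviation vt :: "sign \<Rightarrow> 'i \<Rightarrow> int \<Rightarrow> 'i vend" where "vt s i m \<equiv> fps_nth (vT s i m) 0"

lemma vT_const: "vT s i m = fps_const (vt s i m)"
proof (rule fps_ext)
  fix d
  have "fps_nth (vT s i m) d = 0" if "d > 0"
    by (rule vend_eqI) (use app_vT_pos[OF that] in \<open>simp add: app_def\<close>)
  then show "fps_nth (vT s i m) d = fps_nth (fps_const (vt s i m)) d" by simp
qed

lemma vT_mult_nth: "fps_nth (vT s i m * x) d = vt s i m * fps_nth x d"
  using arg_cong[OF vT_const[of s i m], of "\<lambda>y. fps_nth (y * x) d"] by (simp only: fps_mult_left_const_nth)

lemma mult_vT_nth: "fps_nth (x * vT s i m) d = fps_nth x d * vt s i m"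
  using arg_cong[OF vT_const[of s i m], of "\<lambda>y. fps_nth (x * y) d"] by (simp only: fps_mult_right_const_nth)

lemma vt_hcre: "r > 0 \<Longrightarrow> vt s i m * hcre j r = hcre j r * vt s i m - (pm s * vt s i (m + int r) when i = j)"
  using arg_cong[OF vT_HH[of r s i m j], of "\<lambda>x. fps_nth x 0"]
  by (cases "i = j"; cases s) simp_all

lemma mo_of_nat: "mo (of_nat n * x) = of_nat n * mo x"
  by (induction n) (simp_all add: distrib_right)

lemma mo_pm: "mo (pm s * x) = pm s * mo x"
  by (cases s) simp_all

lemma mo_gco_rec: "of_nat n * mo (gco s j n) = pm s * (\<Sum>k<n. hcre j (n - k) * mo (gco s j k))"
  using arg_cong[OF gco_rec[of n s j], of mo]
  unfolding mo_of_nat mo_pm mo_sum by (simp add: hcre_def)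

lemma of_nat_vend_cancel: "n > 0 \<Longrightarrow> of_nat n * x = of_nat n * y \<Longrightarrow> x = (y :: 'i vend)"
  using sc_cancel[of "of_nat n" x y] by simp

text \<open>Newton's recursion combined with \<open>vt_hcre\<close>: each creation operator that T
  passes contributes a scalar and an index shift. The exchange lemmas \<open>vt_gco_other\<close>,
  \<open>vt_gco_same\<close> and \<open>vt_gco_flip\<close> are inductions based on it.\<close>

lemma vt_gco_rec:
  assumes "n > 0"
  shows "of_nat n * (vt s i m * mo (gco t j n)) = pm t * (\<Sum>k<n. hcre j (n - k) * (vt s i m * mo (gco t j k)))
     - (pm t * pm s * (\<Sum>k<n. vt s i (m + int (n - k)) * mo (gco t j k)) when i = j)"
proof -
  have "of_nat n * (vt s i m * mo (gco t j n)) = vt s i m * (pm t * (\<Sum>k<n. hcre j (n - k) * mo (gco t j k)))"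
    by (simp add: of_nat_left_commute[symmetric] mo_gco_rec)
  also have "\<dots> = pm t * (\<Sum>k<n. vt s i m * hcre j (n - k) * mo (gco t j k))"
    by (simp add: pm_left_commute sum_distrib_left mult.assoc)
  also have "(\<Sum>k<n. vt s i m * hcre j (n - k) * mo (gco t j k))
     = (\<Sum>k<n. hcre j (n - k) * (vt s i m * mo (gco t j k)) - (pm s * (vt s i (m + int (n - k)) * mo (gco t j k)) when i = j))"
    by (intro sum.cong refl) (simp add: vt_hcre left_diff_distrib when_mult mult.assoc)
  also have "\<dots> = (\<Sum>k<n. hcre j (n - k) * (vt s i m * mo (gco t j k)))
     - (pm s * (\<Sum>k<n. vt s i (m + int (n - k)) * mo (gco t j k)) when i = j)"
    by (cases "i = j") (simp_all add: sum_subtractf sum_distrib_left)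
  finally show ?thesis by (cases "i = j") (simp_all add: right_diff_distrib mult.assoc)
qed

lemma mo_gco_rec': "pm s * (\<Sum>k<n. hcre j (n - k) * (mo (gco s j k) * x)) = of_nat n * (mo (gco s j n) * x)"
  by (simp add: mult.assoc[symmetric] mo_gco_rec sum_distrib_right sum_distrib_left)

lemma vt_gco_other: "i \<noteq> j \<Longrightarrow> vt s i m * mo (gco t j n) = mo (gco t j n) * vt s i m"
proof (induction n rule: less_induct)
  case (less n)
  show ?case
  proof (cases "n = 0")
    case False
    then have "of_nat n * (vt s i m * mo (gco t j n)) = pm t * (\<Sum>k<n. hcre j (n - k) * (vt s i m * mo (gco t j k)))"
      using vt_gco_rec[of n s i m t j] less(2) by simp
    also have "\<dots> = pm t * (\<Sum>k<n. hcre j (n - k) * (mo (gco t j k) * vt s i m))"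
      using less by simp
    also have "\<dots> = of_nat n * (mo (gco t j n) * vt s i m)" by (rule mo_gco_rec')
    finally show ?thesis using False of_nat_vend_cancel by blast
  qed simp
qed

text \<open>T(z) passes the exponential series in w of its own sign with the scalar exp(- \<Sum>
  (w/z)^r / r) = 1 - w/z; the two terms on the right are this factor in coefficients.\<close>

lemma vt_gco_same: "vt s i m * mo (gco s i n) = mo (gco s i n) * vt s i m
     - (if n = 0 then 0 else mo (gco s i (n - 1)) * vt s i (m + 1))"
proof (induction n arbitrary: m rule: less_induct)
  case (less n)
  show ?case
  proof (cases n)
    case (Suc N)
    let ?g = "\<lambda>k. mo (gco s i k)" and ?t = "vt s i"
    let ?g' = "\<lambda>k. if k = 0 then 0 else ?g (k - 1)"
    have IH: "?t m * ?g k = ?g k * ?t m - ?g' k * ?t (m + 1)" if "k < n" for k m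
      using less[OF that] by (cases "k = 0") auto
    \<comment> \<open>With the induction hypothesis inserted the sum telescopes, and only the term
      of k = n - 1 remains.\<close>
    have tel: "(\<Sum>k<n. ?t (m + int (n - k)) * ?g k) = ?g N * ?t (m + 1)"
    proof -
      have "(\<Sum>k<n. ?t (m + int (n - k)) * ?g k) = (\<Sum>k<n. ?g k * ?t (m + int (n - k)) - ?g' k * ?t (m + int (n - k) + 1))"
        by (intro sum.cong refl IH) auto
      also have "\<dots> = (\<Sum>k<n. ?g k * ?t (m + int (n - k))) - (\<Sum>k<n. ?g' k * ?t (m + int (n - k) + 1))"
        by (rule sum_subtractf)
      also have "(\<Sum>k<n. ?g' k * ?t (m + int (n - k) + 1)) = (\<Sum>k<N. ?g k * ?t (m + int (n - k)))"
        unfolding Suc by (subst sum.lessThan_Suc_shift) (auto intro!: sum.cong simp: of_nat_diff algebra_simps)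
      finally show ?thesis unfolding Suc by simp
    qed
    have h': "pm s * (\<Sum>k<n. hcre i (n - k) * (?g' k * ?t (m + 1))) = of_nat N * (?g N * ?t (m + 1))"
      unfolding Suc mo_gco_rec'[symmetric] by (subst sum.lessThan_Suc_shift) simp
    have "of_nat n * (?t m * ?g n) = pm s * (\<Sum>k<n. hcre i (n - k) * (?t m * ?g k)) - ?g N * ?t (m + 1)"
      using vt_gco_rec[of n s i m s i] Suc tel by simp
    also have "(\<Sum>k<n. hcre i (n - k) * (?t m * ?g k)) = (\<Sum>k<n. hcre i (n - k) * (?g k * ?t m)) - (\<Sum>k<n. hcre i (n - k) * (?g' k * ?t (m + 1)))"
      unfolding sum_subtractf[symmetric] right_diff_distrib[symmetric]
      by (intro sum.cong refl arg_cong2[of _ _ _ _ "(*)"] IH) auto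
    also have "pm s * \<dots> - ?g N * ?t (m + 1) = of_nat n * (?g n * ?t m) - of_nat N * (?g N * ?t (m + 1)) - ?g N * ?t (m + 1)"
      unfolding right_diff_distrib h' mo_gco_rec' ..
    also have "\<dots> = of_nat n * (?g n * ?t m - ?g N * ?t (m + 1))"
      by (simp add: Suc algebra_simps)
    finally show ?thesis using of_nat_vend_cancel[of n] Suc by auto
  qed simp
qed

text \<open>For opposite signs the scalar is 1 / (1 - w/z). The denominator is kept as a factor on
  the left, which avoids its infinite expansion.\<close>

lemma vt_gco_flip: "vt s i m * mo (gco (sflip s) i n)
     - (if n = 0 then 0 else vt s i (m + 1) * mo (gco (sflip s) i (n - 1))) = mo (gco (sflip s) i n) * vt s i m"
proof (induction n arbitrary: m rule: less_induct)
  case (less n)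
  show ?case
  proof (cases n)
    case (Suc N)
    let ?f = "sflip s"
    let ?g = "\<lambda>k. mo (gco ?f i k)" and ?t = "vt s i"
    let ?g' = "\<lambda>k. if k = 0 then 0 else ?g (k - 1)"
    have IH: "?t m * ?g k - ?t (m + 1) * ?g' k = ?g k * ?t m" if "k < n" for k
      using less[OF that] by (cases "k = 0") auto
    have 1: "of_nat n * (?t m * ?g n) = pm ?f * (\<Sum>k<n. hcre i (n - k) * (?t m * ?g k))
        + (\<Sum>k<n. ?t (m + int (n - k)) * ?g k)"
      using vt_gco_rec[of n s i m ?f i] Suc by (cases s) simp_all
    have 2: "of_nat N * (?t (m + 1) * ?g N) = pm ?f * (\<Sum>k<n. hcre i (n - k) * (?t (m + 1) * ?g' k))
        + (\<Sum>k<N. ?t (m + int (n - k)) * ?g k)"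
    proof (cases "N = 0")
      case True
      then show ?thesis by (simp add: Suc)
    next
      case False
      have "(\<Sum>k<N. ?t (m + 1 + int (N - k)) * ?g k) = (\<Sum>k<N. ?t (m + int (n - k)) * ?g k)"
        by (intro sum.cong refl) (auto simp: Suc of_nat_diff algebra_simps)
      moreover have "(\<Sum>k<n. hcre i (n - k) * (?t (m + 1) * ?g' k)) = (\<Sum>k<N. hcre i (N - k) * (?t (m + 1) * ?g k))"
        unfolding Suc by (subst sum.lessThan_Suc_shift) simp
      ultimately show ?thesis
        using vt_gco_rec[of N s i "m + 1" ?f i] False by (cases s) simp_all
    qed
    have "of_nat n * (?t m * ?g n - ?t (m + 1) * ?g N)
       = of_nat n * (?t m * ?g n) - of_nat N * (?t (m + 1) * ?g N) - ?t (m + 1) * ?g N"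
      by (simp add: Suc algebra_simps)
    also have "\<dots> = pm ?f * ((\<Sum>k<n. hcre i (n - k) * (?t m * ?g k)) - (\<Sum>k<n. hcre i (n - k) * (?t (m + 1) * ?g' k)))"
      unfolding 1 2 right_diff_distrib by (simp add: Suc)
    also have "(\<Sum>k<n. hcre i (n - k) * (?t m * ?g k)) - (\<Sum>k<n. hcre i (n - k) * (?t (m + 1) * ?g' k))
       = (\<Sum>k<n. hcre i (n - k) * (?g k * ?t m))"
      unfolding sum_subtractf[symmetric] right_diff_distrib[symmetric]
      by (intro sum.cong refl arg_cong2[of _ _ _ _ "(*)"] IH) auto
    also have "pm ?f * \<dots> = of_nat n * (?g n * ?t m)" by (rule mo_gco_rec')
    finally show ?thesis using of_nat_vend_cancel[of n] Suc by auto
  qed simp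
qed

text \<open>The two ways in which \<open>T(z)\<close> passes a series \<open>x(w)\<close>: up to a factor \<open>1 - (w + c\<hbar>)/z\<close> on the right
  or on the left.\<close>

definition tI :: "sign \<Rightarrow> 'i \<Rightarrow> complex \<Rightarrow> 'i fock fps fps \<Rightarrow> bool" where
  "tI s i c x \<longleftrightarrow> (\<forall>m n. vT s i m * mu x n = mu x n * vT s i m - mu (uu c * x) n * vT s i (m + 1))"

definition tII :: "sign \<Rightarrow> 'i \<Rightarrow> complex \<Rightarrow> 'i fock fps fps \<Rightarrow> bool" where
  "tII s i c x \<longleftrightarrow> (\<forall>m n. vT s i m * mu x n - vT s i (m + 1) * mu (uu c * x) n = mu x n * vT s i m)"

definition t0 :: "sign \<Rightarrow> 'i \<Rightarrow> 'i fock fps fps \<Rightarrow> bool" where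
  "t0 s i x \<longleftrightarrow> (\<forall>m n. vT s i m * mu x n = mu x n * vT s i m)"

lemma vT_mu_Ec_nth: "fps_nth (vT s i m * mu (Ec c f) (int n)) d =
    sc (of_nat (n + d choose d) * c ^ d) * (vt s i m * mo (fps_nth f (n + d)))"
  "fps_nth (mu (Ec c f) (int n) * vT s i m) d =
    sc (of_nat (n + d choose d) * c ^ d) * (mo (fps_nth f (n + d)) * vt s i m)"
proof -
  show "fps_nth (vT s i m * mu (Ec c f) (int n)) d =
    sc (of_nat (n + d choose d) * c ^ d) * (vt s i m * mo (fps_nth f (n + d)))"
    unfolding vT_mult_nth mu_Ec_nth mult.assoc[symmetric] sc_commute[of _ "vt s i m"] ..
  show "fps_nth (mu (Ec c f) (int n) * vT s i m) d =
    sc (of_nat (n + d choose d) * c ^ d) * (mo (fps_nth f (n + d)) * vt s i m)"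
    unfolding mult_vT_nth mu_Ec_nth mult.assoc ..
qed

lemma tI_gh: "tI s i c (Ec c (gh s i))"
  unfolding tI_def Ec_X[symmetric] Ec_mult[symmetric]
proof (intro allI)
  fix m n
  show "vT s i m * mu (Ec c (gh s i)) n = mu (Ec c (gh s i)) n * vT s i m - mu (Ec c (fps_X * gh s i)) n * vT s i (m + 1)"
  proof (cases "n \<ge> 0")
    case True
    then obtain N where n: "n = int N" using nonneg_int_cases by blast
    show ?thesis
      unfolding n by (rule fps_ext, unfold fps_sub_nth vT_mu_Ec_nth right_diff_distrib[symmetric])
        (simp only: gh_nth fps_X_mult_nth vt_gco_same, simp)
  qed simp
qed

lemma tII_gh: "tII s i c (Ec c (gh (sflip s) i))"
  unfolding tII_def Ec_X[symmetric] Ec_mult[symmetric]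
proof (intro allI)
  fix m n
  show "vT s i m * mu (Ec c (gh (sflip s) i)) n - vT s i (m + 1) * mu (Ec c (fps_X * gh (sflip s) i)) n
     = mu (Ec c (gh (sflip s) i)) n * vT s i m"
  proof (cases "n \<ge> 0")
    case True
    then obtain N where n: "n = int N" using nonneg_int_cases by blast
    show ?thesis
      unfolding n by (rule fps_ext, unfold fps_sub_nth vT_mu_Ec_nth right_diff_distrib[symmetric])
        (simp only: gh_nth fps_X_mult_nth vt_gco_flip[symmetric], simp)
  qed simp
qed

lemma t0_gh: "i \<noteq> j \<Longrightarrow> t0 s i (Ec c (gh t j))"
  unfolding t0_def
proof (intro allI)
  fix m n
  assume "i \<noteq> j"
  then show "vT s i m * mu (Ec c (gh t j)) n = mu (Ec c (gh t j)) n * vT s i m"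
  proof (cases "n \<ge> 0")
    case True
    then obtain N where n: "n = int N" using nonneg_int_cases by blast
    show ?thesis
      unfolding n by (rule fps_ext, unfold vT_mu_Ec_nth) (simp only: gh_nth vt_gco_other[OF \<open>i \<noteq> j\<close>])
  qed simp
qed

lemma t0_one: "t0 s i 1"
  by (simp add: t0_def mu_one when_mult mult_when)

lemma t0_mult: "t0 s i x \<Longrightarrow> t0 s i y \<Longrightarrow> t0 s i (x * y)"
proof -
  assume x: "t0 s i x" and y: "t0 s i y"
  have "vT s i m * (mu x k * mu y l) = mu x k * mu y l * vT s i m" for m k l
  proof -
    have "vT s i m * (mu x k * mu y l) = vT s i m * mu x k * mu y l" by (simp only: mult.assoc)
    also have "\<dots> = mu x k * (vT s i m * mu y l)" using x unfolding t0_def by (simp add: mult.assoc)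
    finally show ?thesis using y unfolding t0_def by (simp add: mult.assoc)
  qed
  then show ?thesis unfolding t0_def mu_mult by (simp add: sum_distrib_left sum_distrib_right)
qed

lemma t0_prod: "(\<And>j. j \<in> J \<Longrightarrow> t0 s i (x j)) \<Longrightarrow> t0 s i (\<Prod>j\<in>J. x j)"
  by (induction J rule: infinite_finite_induct) (auto simp: t0_mult t0_one)

lemma tI_t0: "tI s i c x \<Longrightarrow> t0 s i y \<Longrightarrow> tI s i c (x * y)"
  unfolding tI_def
proof (intro allI)
  fix m n
  assume x: "\<forall>m n. vT s i m * mu x n = mu x n * vT s i m - mu (uu c * x) n * vT s i (m + 1)"
    and y: "t0 s i y"
  have "vT s i m * (mu x k * mu y (n - k)) = mu x k * mu y (n - k) * vT s i m - mu (uu c * x) k * mu y (n - k) * vT s i (m + 1)" for k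
  proof -
    have "vT s i m * (mu x k * mu y (n - k)) = (mu x k * vT s i m - mu (uu c * x) k * vT s i (m + 1)) * mu y (n - k)"
      using x by (simp add: mult.assoc[symmetric])
    then show ?thesis using y unfolding t0_def by (simp add: left_diff_distrib mult.assoc)
  qed
  then show "vT s i m * mu (x * y) n = mu (x * y) n * vT s i m - mu (uu c * (x * y)) n * vT s i (m + 1)"
    unfolding mult.assoc[symmetric, of "uu c"] by (simp add: mu_mult sum_distrib_left sum_distrib_right sum_subtractf)
qed

lemma tII_t0: "tII s i c x \<Longrightarrow> t0 s i y \<Longrightarrow> tII s i c (x * y)"
  unfolding tII_def
proof (intro allI)
  fix m n
  assume x: "\<forall>m n. vT s i m * mu x n - vT s i (m + 1) * mu (uu c * x) n = mu x n * vT s i m"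
    and y: "t0 s i y"
  have "vT s i m * (mu x k * mu y (n - k)) - vT s i (m + 1) * (mu (uu c * x) k * mu y (n - k)) = mu x k * mu y (n - k) * vT s i m" for k
  proof -
    have "vT s i m * (mu x k * mu y (n - k)) - vT s i (m + 1) * (mu (uu c * x) k * mu y (n - k)) = mu x k * vT s i m * mu y (n - k)"
      using x by (simp add: mult.assoc[symmetric] flip: left_diff_distrib)
    then show ?thesis using y unfolding t0_def by (simp add: mult.assoc)
  qed
  then show "vT s i m * mu (x * y) n - vT s i (m + 1) * mu (uu c * (x * y)) n = mu (x * y) n * vT s i m"
    unfolding mult.assoc[symmetric, of "uu c"] by (simp add: mu_mult sum_distrib_left sum_distrib_right flip: sum_subtractf)
qed

lemma tI_tI:
  assumes x: "tI s i c x" and y: "tI s i d y"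
  shows "vT s i m * mu (x * y) n = mu (x * y) n * vT s i m - mu (uu c * (x * y)) n * vT s i (m + 1)
    - mu (uu d * (x * y)) n * vT s i (m + 1) + mu (uu c * (uu d * (x * y))) n * vT s i (m + 2)"
proof -
  have "vT s i m * (mu x k * mu y l) = mu x k * mu y l * vT s i m - mu (uu c * x) k * mu y l * vT s i (m + 1)
    - mu x k * mu (uu d * y) l * vT s i (m + 1) + mu (uu c * x) k * mu (uu d * y) l * vT s i (m + 2)" for k l
  proof -
    have "vT s i m * (mu x k * mu y l) = (vT s i m * mu x k) * mu y l" by (simp only: mult.assoc)
    also have "\<dots> = mu x k * (vT s i m * mu y l) - mu (uu c * x) k * (vT s i (m + 1) * mu y l)"
      using x unfolding tI_def by (simp add: left_diff_distrib mult.assoc)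
    finally show ?thesis using y unfolding tI_def by (simp add: algebra_simps)
  qed
  note k = this
  have e: "uu c * (x * (uu d * y)) = (uu c * x) * (uu d * y)" "uu c * (x * y) = (uu c * x) * y" "uu d * (x * y) = x * (uu d * y)"
    by (simp_all add: mult_ac)
  show ?thesis
    unfolding e mu_mult[of x y] mu_mult[of "uu c * x"] mu_mult[of x "uu d * y"]
      sum_distrib_left sum_distrib_right k sum_subtractf sum.distrib ..
qed

lemma tII_tII:
  assumes x: "tII s i c x" and y: "tII s i d y"
  shows "vT s i m * mu (x * y) n - vT s i (m + 1) * mu (uu c * (x * y)) n
    - vT s i (m + 1) * mu (uu d * (x * y)) n + vT s i (m + 2) * mu (uu c * (uu d * (x * y))) n = mu (x * y) n * vT s i m"
proof -
  have "vT s i m * (mu x k * mu y l) - vT s i (m + 1) * (mu (uu c * x) k * mu y l)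
    - vT s i (m + 1) * (mu x k * mu (uu d * y) l) + vT s i (m + 2) * (mu (uu c * x) k * mu (uu d * y) l)
    = mu x k * mu y l * vT s i m" for k l
  proof -
    have "vT s i m * (mu x k * mu y l) - vT s i (m + 1) * (mu (uu c * x) k * mu y l)
      - vT s i (m + 1) * (mu x k * mu (uu d * y) l) + vT s i (m + 2) * (mu (uu c * x) k * mu (uu d * y) l)
      = (vT s i m * mu x k - vT s i (m + 1) * mu (uu c * x) k) * mu y l
      - (vT s i (m + 1) * mu x k - vT s i (m + 1 + 1) * mu (uu c * x) k) * mu (uu d * y) l"
      by (simp add: algebra_simps)
    also have "\<dots> = mu x k * (vT s i m * mu y l - vT s i (m + 1) * mu (uu d * y) l)"
      using x unfolding tII_def by (simp only: right_diff_distrib mult.assoc)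
    finally show ?thesis using y unfolding tII_def by (simp add: mult.assoc)
  qed
  note k = this
  have e: "uu c * (x * (uu d * y)) = (uu c * x) * (uu d * y)" "uu c * (x * y) = (uu c * x) * y" "uu d * (x * y) = x * (uu d * y)"
    by (simp_all add: mult_ac)
  show ?thesis
    unfolding e mu_mult[of x y] mu_mult[of "uu c * x"] mu_mult[of x "uu d * y"]
      sum_distrib_left sum_distrib_right sum_subtractf[symmetric] sum.distrib[symmetric] k ..
qed

lemma tI_tII:
  assumes x: "tI s i c x" and y: "tII s i d y"
  shows "vT s i m * mu (x * y) n - vT s i (m + 1) * mu (uu d * (x * y)) n
     = mu (x * y) n * vT s i m - mu (uu c * (x * y)) n * vT s i (m + 1)"
proof -
  have "vT s i m * (mu x k * mu y l) - vT s i (m + 1) * (mu x k * mu (uu d * y) l)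
    = mu x k * mu y l * vT s i m - mu (uu c * x) k * mu y l * vT s i (m + 1)" for k l
  proof -
    have "vT s i m * (mu x k * mu y l) - vT s i (m + 1) * (mu x k * mu (uu d * y) l)
      = (vT s i m * mu x k) * mu y l - (vT s i (m + 1) * mu x k) * mu (uu d * y) l"
      by (simp only: mult.assoc)
    also have "\<dots> = (mu x k * vT s i m - mu (uu c * x) k * vT s i (m + 1)) * mu y l
      - (mu x k * vT s i (m + 1) - mu (uu c * x) k * vT s i (m + 1 + 1)) * mu (uu d * y) l"
      using x unfolding tI_def by metis
    also have "\<dots> = mu x k * (vT s i m * mu y l - vT s i (m + 1) * mu (uu d * y) l)
       - mu (uu c * x) k * (vT s i (m + 1) * mu y l - vT s i (m + 1 + 1) * mu (uu d * y) l)"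
      by (simp add: algebra_simps)
    also have "\<dots> = mu x k * (mu y l * vT s i m) - mu (uu c * x) k * (mu y l * vT s i (m + 1))"
      using y unfolding tII_def by (simp only:)
    finally show ?thesis by (simp only: mult.assoc)
  qed
  note k = this
  have e: "uu c * (x * y) = (uu c * x) * y" "uu d * (x * y) = x * (uu d * y)"
    by (simp_all add: mult_ac)
  show ?thesis
    unfolding e mu_mult[of x y] mu_mult[of "uu c * x"] mu_mult[of x "uu d * y"]
      sum_distrib_left sum_distrib_right sum_subtractf[symmetric] k ..
qed

lemma mu_uu_hb: "mu (uu c * x) n = mu x (n - 1) + hb c * mu x n"
  unfolding mu_uu hb_def mult.assoc ..

lemma Tx_uu: "vT s i (m + 1) * mu (uu c * x) n = vT s i (m + 1) * mu x (n - 1) + hb c * (vT s i (m + 1) * mu x n)"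
  unfolding mu_uu_hb distrib_left hb_left_commute ..

text \<open>1 - (w + c\<hbar>)/z = z^-1 (z - w - c\<hbar>): the factor z^-1 is the index shift to m
  + 1, and c changes its sign.\<close>

lemma tI_zw: "tI s i c x \<Longrightarrow> vT s i m * mu x n = zw (hb (- c)) (\<lambda>m n. mu x n * vT s i m) (m + 1) n"
  unfolding tI_def mu_uu_hb by (simp add: zw_def hb_minus distrib_right mult.assoc)

lemma tII_zw: "tII s i c x \<Longrightarrow> zw (hb (- c)) (\<lambda>m n. vT s i m * mu x n) (m + 1) n = mu x n * vT s i m"
  unfolding tII_def Tx_uu by (simp add: zw_def hb_minus diff_diff_eq)

lemma tI_tI_zw: "tI s i c x \<Longrightarrow> tI s i d y \<Longrightarrow>
    vT s i m * mu (x * y) n = zw (hb (- c)) (zw (hb (- d)) (\<lambda>m n. mu (x * y) n * vT s i m)) (m + 2) n"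
  unfolding tI_tI[of s i c x d y m n] mu_uu_hb by (simp add: zw_def hb_minus algebra_simps)

lemma tII_tII_zw: "tII s i c x \<Longrightarrow> tII s i d y \<Longrightarrow>
    zw (hb (- c)) (zw (hb (- d)) (\<lambda>m n. vT s i m * mu (x * y) n)) (m + 2) n = mu (x * y) n * vT s i m"
  unfolding tII_tII[of s i c x d y m n, symmetric] mu_uu_hb
  by (simp add: zw_def hb_minus algebra_simps hb_left_commute[of "vT s i k" for k])

lemma tI_tII_zw: "tI s i c x \<Longrightarrow> tII s i d y \<Longrightarrow>
    zw (hb (- d)) (\<lambda>m n. vT s i m * mu (x * y) n) m n = zw (hb (- c)) (\<lambda>m n. mu (x * y) n * vT s i m) m n"
  using tI_tII[of s i c x d y "m - 1" n] unfolding mu_uu_hb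
  by (simp add: zw_def hb_minus algebra_simps hb_left_commute[of "vT s i k" for k])


section \<open>Vertex operators and their quadratic relations\<close>

abbreviation al :: "sign \<Rightarrow> 'i \<Rightarrow> int \<Rightarrow> 'i vend fps" where "al s i \<equiv> mu (vA a s i)"

lemma nbrs_iff: "j \<in> nbrs a i \<longleftrightarrow> a i j = - 1"
  using a_off[of i j] by (auto simp: nbrs_def)

lemma a_cases: "a i j = 2 \<and> i = j \<or> a i j = - 1 \<and> i \<noteq> j \<or> a i j = 0 \<and> i \<noteq> j"
  using a_off[of i j] by (cases "i = j") auto

lemma vA_self: "vA a t i = Ec 0 (gh t i) * (Ec (- pm t) (gh t i) * (\<Prod>j\<in>nbrs a i. Ec (- pm t / 2) (gh (sflip t) j)))"
  by (simp add: vA_def mult.assoc)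

lemma t0_prod_nbrs: "i \<notin> J \<Longrightarrow> t0 s i (\<Prod>j\<in>J. Ec c (gh t j))"
  by (rule t0_prod) (auto intro!: t0_gh)

text \<open>T_i(z) only meets the factors of A_j(w) with index i: two if i = j, one for neighbours,
  with the shifts of \<open>Qop\<close>. If the pairing of the roots is positive they give zeros,
  one per unit of the pairing, and each of them brings a factor z^-1.\<close>

lemma vT_al_pos:
  assumes "pm s * pm t * a i j > 0"
  shows "vT s i m * al t j n = Qop t (a i j) (\<lambda>m n. al t j n * vT s i m) (m + pm s * pm t * a i j) n"
  using a_cases[of i j]
proof (elim disjE conjE)
  assume 2: "a i j = 2" "i = j"
  then have st: "s = t" using assms by (cases s; cases t) auto
  have nb: "i \<notin> nbrs a i" by (simp add: nbrs_def)
  show ?thesis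
    using tI_tI_zw[OF tI_gh[of t i 0] tI_t0[OF tI_gh[of t i "- pm t"] t0_prod_nbrs[OF nb, of t "- pm t / 2" "sflip t"]], of m n]
    unfolding 2(2)[symmetric] vA_self st by (simp add: Qop_def)
next
  assume 1: "a i j = - 1" "i \<noteq> j"
  then have st: "t = sflip s" using assms by (cases s; cases t) auto
  have "i \<in> nbrs a j" using 1 by (simp add: nbrs_iff a_sym)
  then have "vA a t j = Ec (- pm t / 2) (gh s i) * (Ec 0 (gh t j) * Ec (- pm t) (gh t j)
      * (\<Prod>k\<in>nbrs a j - {i}. Ec (- pm t / 2) (gh (sflip t) k)))"
    unfolding vA_def by (subst prod.remove[of _ i]) (simp_all add: st mult_ac)
  moreover have "t0 s i (Ec 0 (gh t j) * Ec (- pm t) (gh t j) * (\<Prod>k\<in>nbrs a j - {i}. Ec (- pm t / 2) (gh (sflip t) k)))"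
    using 1 by (intro t0_mult t0_gh t0_prod_nbrs) auto
  ultimately have "tI s i (- pm t / 2) (vA a t j)" using tI_t0[OF tI_gh] by metis
  from tI_zw[OF this, of m n] show ?thesis using 1 st by (simp add: Qop_def)
next
  assume "a i j = 0"
  then show ?thesis using assms by simp
qed

text \<open>If the pairing is not positive, the same factors are poles and stand on the left, by
  \<open>tII\<close>.\<close>

lemma vT_al_neg:
  assumes "pm s * pm t * a i j \<le> 0"
  shows "Qop t (a i j) (\<lambda>m n. vT s i m * al t j n) m n = al t j n * vT s i (m + pm s * pm t * a i j)"
  using a_cases[of i j]
proof (elim disjE conjE)
  assume 2: "a i j = 2" "i = j"
  then have st: "t = sflip s" using assms by (cases s; cases t) auto
  have nb: "i \<notin> nbrs a i" by (simp add: nbrs_def)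
  show ?thesis
    using tII_tII_zw[OF tII_gh[of s i 0] tII_t0[OF tII_gh[of s i "- pm t"] t0_prod_nbrs[OF nb, of s "- pm t / 2" "sflip t"]], of "m - 2" n]
    unfolding 2(2)[symmetric] vA_self st by (simp add: Qop_def)
next
  assume 1: "a i j = - 1" "i \<noteq> j"
  then have st: "t = s" using assms by (cases s; cases t) auto
  have "i \<in> nbrs a j" using 1 by (simp add: nbrs_iff a_sym)
  then have "vA a t j = Ec (- pm t / 2) (gh (sflip s) i) * (Ec 0 (gh t j) * Ec (- pm t) (gh t j)
      * (\<Prod>k\<in>nbrs a j - {i}. Ec (- pm t / 2) (gh (sflip t) k)))"
    unfolding vA_def by (subst prod.remove[of _ i]) (simp_all add: st mult_ac)
  moreover have "t0 s i (Ec 0 (gh t j) * Ec (- pm t) (gh t j) * (\<Prod>k\<in>nbrs a j - {i}. Ec (- pm t / 2) (gh (sflip t) k)))"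
    using 1 by (intro t0_mult t0_gh t0_prod_nbrs) auto
  ultimately have "tII s i (- pm t / 2) (vA a t j)" using tII_t0[OF tII_gh] by metis
  from tII_zw[OF this, of "m - 1" n] show ?thesis using 1 st by (simp add: Qop_def)
next
  assume 0: "a i j = 0" "i \<noteq> j"
  then have "i \<notin> nbrs a j" by (simp add: nbrs_iff a_sym)
  then have "t0 s i (vA a t j)"
    unfolding vA_def using 0 by (intro t0_mult t0_gh t0_prod_nbrs) auto
  then show ?thesis using 0 by (simp add: Qop_def t0_def)
qed

definition kap :: "'i \<Rightarrow> 'i fock fps fps" where "kap j = vA a Plus j * vA a Minus j"

text \<open>The factors without shift are inverse to each other; the remaining ones have opposite
  shifts for opposite signs.\<close>

lemma kap_eq: "kap j = Ec (- 1) (gh Plus j) * Ec 1 (gh Minus j)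
    * (\<Prod>k\<in>nbrs a j. Ec (1 / 2) (gh Plus k) * Ec (- 1 / 2) (gh Minus k))"
proof -
  have "kap j = (Ec 0 (gh Plus j) * Ec 0 (gh (sflip Plus) j)) * (Ec (- 1) (gh Plus j) * Ec 1 (gh Minus j))
     * ((\<Prod>k\<in>nbrs a j. Ec (1 / 2) (gh Plus k)) * (\<Prod>k\<in>nbrs a j. Ec (- 1 / 2) (gh Minus k)))"
    by (simp add: kap_def vA_def mult_ac)
  then show ?thesis by (simp only: Ec_gh_inverse prod.distrib mult_1)
qed

text \<open>If i = j or i and j are neighbours, one factor of \<open>kap j\<close> with index i has
  the sign of T and one the opposite sign, with opposite shifts. They give one zero and one pole,
  kept on different sides.\<close>

lemma vT_kap: "zw (hb (- pm s * of_int (a i j) / 2)) (\<lambda>m n. vT s i m * mu (kap j) n) m n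
    = zw (hb (pm s * of_int (a i j) / 2)) (\<lambda>m n. mu (kap j) n * vT s i m) m n"
  using a_cases[of i j]
proof (elim disjE conjE)
  assume 2: "a i j = 2" "i = j"
  let ?R = "\<Prod>k\<in>nbrs a i. Ec (1 / 2) (gh Plus k) * Ec (- 1 / 2) (gh Minus k)"
  have R: "t0 s i ?R" by (rule t0_prod, intro t0_mult t0_gh) (auto simp: nbrs_def)
  show ?thesis
  proof (cases s)
    case Plus
    have "kap i = Ec (- 1) (gh Plus i) * (Ec 1 (gh (sflip Plus) i) * ?R)" by (simp add: kap_eq mult.assoc)
    then show ?thesis
      using tI_tII_zw[OF tI_gh[of Plus i "- 1"] tII_t0[OF tII_gh[of Plus i 1] R[unfolded Plus]], of m n] 2 Plus by simp
  next
    case Minus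
    have "kap i = Ec 1 (gh Minus i) * (Ec (- 1) (gh (sflip Minus) i) * ?R)" by (simp add: kap_eq mult_ac)
    then show ?thesis
      using tI_tII_zw[OF tI_gh[of Minus i 1] tII_t0[OF tII_gh[of Minus i "- 1"] R[unfolded Minus]], of m n] 2 Minus by simp
  qed
next
  assume 1: "a i j = - 1" "i \<noteq> j"
  let ?R = "Ec (- 1) (gh Plus j) * Ec 1 (gh Minus j) * (\<Prod>k\<in>nbrs a j - {i}. Ec (1 / 2) (gh Plus k) * Ec (- 1 / 2) (gh Minus k))"
  have R: "t0 s i ?R" using 1 by (intro t0_mult t0_gh t0_prod) auto
  have "i \<in> nbrs a j" using 1 by (simp add: nbrs_iff a_sym)
  then have k: "kap j = Ec (1 / 2) (gh Plus i) * (Ec (- 1 / 2) (gh Minus i) * ?R)"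
    unfolding kap_eq by (subst prod.remove[of _ i]) (simp_all add: mult_ac)
  show ?thesis
  proof (cases s)
    case Plus
    have "kap j = Ec (1 / 2) (gh Plus i) * (Ec (- 1 / 2) (gh (sflip Plus) i) * ?R)" using k by simp
    then show ?thesis
      using tI_tII_zw[OF tI_gh[of Plus i "1 / 2"] tII_t0[OF tII_gh[of Plus i "- 1 / 2"] R[unfolded Plus]], of m n] 1 Plus by simp
  next
    case Minus
    have "kap j = Ec (- 1 / 2) (gh Minus i) * (Ec (1 / 2) (gh (sflip Minus) i) * ?R)" using k by (simp add: mult_ac)
    then show ?thesis
      using tI_tII_zw[OF tI_gh[of Minus i "- 1 / 2"] tII_t0[OF tII_gh[of Minus i "1 / 2"] R[unfolded Minus]], of m n] 1 Minus by simp
  qed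
next
  assume 0: "a i j = 0" "i \<noteq> j"
  then have "i \<notin> nbrs a j" by (simp add: nbrs_iff a_sym)
  then have "t0 s i (kap j)"
    unfolding kap_eq using 0 by (intro t0_mult t0_gh t0_prod) auto
  then show ?thesis using 0 by (simp add: t0_def)
qed

definition Xf :: "sign \<Rightarrow> 'i \<Rightarrow> int \<Rightarrow> 'i vend fps" where
  "Xf s i m = lsum (\<lambda>p. al s i (m - p) * vT s i p)"

text \<open>Conjugating \<open>B\<close> into a vertex operator: creation part on the left, annihilation part on the right.\<close>

definition NO :: "sign \<Rightarrow> 'i \<Rightarrow> 'i vend fps \<Rightarrow> int \<Rightarrow> 'i vend fps" where
  "NO s i B m = lsum (\<lambda>p. al s i (m - p) * (B * vT s i p))"

lemma sumbl_al_vT: "sumbl (\<lambda>p. G p * vT s i p)" "sumbl (\<lambda>p. G p * vT s i (k - p))" "sumbl (\<lambda>p. G p * vT s i (p + k))"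
  by (rule sumbl_mult_left; simp add: sumbl_vT)+

lemma sumbl_al_B_vT: "sumbl (\<lambda>p. G p * (B p * vT s i p))" "sumbl (\<lambda>p. G p * (B p * vT s i (k - p)))"
  by (rule sumbl_mult_left, rule sumbl_al_vT)+

lemma sumbl_vT_mult: "sumbl (\<lambda>p. G p * (vT s i p * y))" "sumbl (\<lambda>p. G p * (vT s i (k - p) * y))"
  by (rule sumbl_mult_left, rule sumbl_mult_right, simp add: sumbl_vT)+

lemma Xf_alt: "Xf s i m = lsum (\<lambda>p. al s i p * vT s i (m - p))"
  using lsum_shift(3)[OF sumbl_al_vT(1)[of "\<lambda>p. al s i (m - p)" s i], of m] by (simp add: Xf_def)

lemma NO_alt: "NO s i B m = lsum (\<lambda>p. al s i p * (B * vT s i (m - p)))"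
  using lsum_shift(3)[OF sumbl_al_B_vT(1)[of "\<lambda>p. al s i (m - p)" "\<lambda>_. B" s i], of m] by (simp add: NO_def)

lemma Xf_mult: "Xf s i m * B = lsum (\<lambda>p. al s i p * (vT s i (m - p) * B))"
  unfolding Xf_alt by (simp add: lsum_mult_right sumbl_al_vT mult.assoc)

lemma mult_Xf: "B * Xf s i m = lsum (\<lambda>p. B * al s i (m - p) * vT s i p)"
  unfolding Xf_def by (simp add: lsum_mult_left sumbl_al_vT mult.assoc)

lemma Qop_shift1: "Qop t c (\<lambda>m n. F m (n - q)) m n = Qop t c F m (n - q)"
  "Qop t c (\<lambda>m n. F (m - p) n) m n = Qop t c F (m - p) n"
  using Qop_shift[of t c F 0 "- q" m n] Qop_shift[of t c F "- p" 0 m n] by simp_all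

lemma Qop_cs: "Qop t c (\<lambda>m n. cs k * F m n) m n = cs k * Qop t c F m n"
  by (rule Qop_mult_left)

lemma vT_vT_swap: "vT s i m * vT t j n = cs (asgn i j) * (vT t j (n + pm s * pm t * a i j) * vT s i (m - pm s * pm t * a i j))"
  using vT_commute[of s i "m - pm s * pm t * a i j" t j n] by simp

text \<open>T(z) passes the creation half with the poles of \<open>vT_al_neg\<close> and the
  annihilation half with the sign of \<open>vT_commute\<close>. The power of z that the poles
  produce is moved by this second exchange to the other variable, where it is a shift of n.\<close>

lemma vT_Xf_neg:
  assumes "pm s * pm t * a i j \<le> 0"
  shows "Qop t (a i j) (\<lambda>m n. vT s i m * Xf t j n) m n = cs (asgn i j) * (Xf t j (n + pm s * pm t * a i j) * vT s i m)"
proof -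
  let ?c = "pm s * pm t * a i j"
  have "Qop t (a i j) (\<lambda>m n. vT s i m * Xf t j n) m n = Qop t (a i j) (\<lambda>m n. lsum (\<lambda>q. vT s i m * al t j (n - q) * vT t j q)) m n"
    by (simp add: mult_Xf)
  also have "\<dots> = lsum (\<lambda>q. Qop t (a i j) (\<lambda>m n. vT s i m * al t j (n - q) * vT t j q) m n)"
    by (rule Qop_lsum, rule sumbl_al_vT)
  also have "\<dots> = lsum (\<lambda>q. cs (asgn i j) * (al t j (n - q) * (vT t j (q + ?c) * vT s i m)))"
  proof (rule arg_cong[of _ _ lsum], rule ext)
    fix q
    have "Qop t (a i j) (\<lambda>m n. vT s i m * al t j (n - q) * vT t j q) m n = al t j (n - q) * (vT s i (m + ?c) * vT t j q)"
      unfolding Qop_mult_right Qop_shift1(1)[of t "a i j" "\<lambda>m n. vT s i m * al t j n"] vT_al_neg[OF assms]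
      by (simp only: mult.assoc)
    then show "Qop t (a i j) (\<lambda>m n. vT s i m * al t j (n - q) * vT t j q) m n = cs (asgn i j) * (al t j (n - q) * (vT t j (q + ?c) * vT s i m))"
      by (simp add: vT_vT_swap[of s i "m + ?c"] cs_left_commute[of "al t j (n - q)"])
  qed
  also have "\<dots> = lsum (\<lambda>q. cs (asgn i j) * (al t j (n + ?c - q) * (vT t j q * vT s i m)))"
    using lsum_shift(1)[of "\<lambda>q. cs (asgn i j) * (al t j (n + ?c - q) * (vT t j q * vT s i m))" ?c]
    by (simp add: sumbl_mult_left[OF sumbl_vT_mult(1)])
  also have "\<dots> = cs (asgn i j) * (Xf t j (n + ?c) * vT s i m)"
    unfolding Xf_def by (simp add: lsum_mult_right lsum_mult_left sumbl_al_vT sumbl_vT_mult mult.assoc)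
  finally show ?thesis .
qed

lemma vT_Xf_pos:
  assumes "pm s * pm t * a i j > 0"
  shows "vT s i m * Xf t j n = cs (asgn i j) * Qop t (a i j) (\<lambda>m n. Xf t j n * vT s i m) m (n + pm s * pm t * a i j)"
proof -
  let ?c = "pm s * pm t * a i j"
  have inner: "lsum (\<lambda>q. al t j (n - q) * (vT s i m * vT t j q)) = cs (asgn i j) * (Xf t j (n + ?c) * vT s i (m - ?c))" for m n
  proof -
    have "lsum (\<lambda>q. al t j (n - q) * (vT s i m * vT t j q))
        = lsum (\<lambda>q. cs (asgn i j) * (al t j (n - q) * (vT t j (q + ?c) * vT s i (m - ?c))))"
      by (simp add: vT_vT_swap[of s i m] cs_left_commute[of "al t j k" for k])
    also have "\<dots> = lsum (\<lambda>q. cs (asgn i j) * (al t j (n + ?c - q) * (vT t j q * vT s i (m - ?c))))"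
      using lsum_shift(1)[of "\<lambda>q. cs (asgn i j) * (al t j (n + ?c - q) * (vT t j q * vT s i (m - ?c)))" ?c]
      by (simp add: sumbl_mult_left[OF sumbl_vT_mult(1)])
    also have "\<dots> = cs (asgn i j) * (Xf t j (n + ?c) * vT s i (m - ?c))"
      unfolding Xf_def by (simp add: lsum_mult_right lsum_mult_left sumbl_al_vT sumbl_vT_mult mult.assoc)
    finally show ?thesis .
  qed
  have "vT s i m * Xf t j n = lsum (\<lambda>q. Qop t (a i j) (\<lambda>m n. al t j n * vT s i m) (m + ?c) (n - q) * vT t j q)"
    by (simp add: mult_Xf vT_al_pos[OF assms])
  also have "\<dots> = lsum (\<lambda>q. Qop t (a i j) (\<lambda>m n. al t j (n - q) * (vT s i m * vT t j q)) (m + ?c) n)"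
    by (simp add: Qop_mult_right Qop_shift1(1)[of t "a i j" "\<lambda>m n. al t j n * vT s i m", symmetric] flip: mult.assoc)
  also have "\<dots> = Qop t (a i j) (\<lambda>m n. lsum (\<lambda>q. al t j (n - q) * (vT s i m * vT t j q))) (m + ?c) n"
    by (rule Qop_lsum(1)[symmetric], rule sumbl_al_B_vT)
  also have "\<dots> = cs (asgn i j) * Qop t (a i j) (\<lambda>m n. Xf t j (n + ?c) * vT s i (m - ?c)) (m + ?c) n"
    unfolding inner by (rule Qop_cs)
  also have "\<dots> = cs (asgn i j) * Qop t (a i j) (\<lambda>m n. Xf t j n * vT s i m) m (n + ?c)"
    using Qop_shift[of t "a i j" "\<lambda>m n. Xf t j n * vT s i m" "- ?c" ?c "m + ?c" n] by simp
  finally show ?thesis .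
qed

lemma Xf_al_neg:
  assumes "pm s * pm t * a i j \<le> 0"
  shows "Qop s (a i j) (\<lambda>n m. Xf t j n * al s i m) n m = al s i m * Xf t j (n + pm s * pm t * a i j)"
proof -
  let ?c = "pm s * pm t * a i j"
  have e: "pm t * pm s * a j i = ?c" by (simp add: a_sym[of j i] mult.commute)
  have c: "pm t * pm s * a j i \<le> 0" using assms unfolding e .
  have neg: "Qop s (a i j) (\<lambda>m n. vT t j m * al s i n) m n = al s i n * vT t j (m + ?c)" for m n
    using vT_al_neg[OF c] unfolding e unfolding a_sym[of j i] .
  have "Qop s (a i j) (\<lambda>n m. Xf t j n * al s i m) n m = Qop s (a i j) (\<lambda>n m. lsum (\<lambda>q. al t j q * (vT t j (n - q) * al s i m))) n m"
    by (simp add: Xf_mult)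
  also have "\<dots> = lsum (\<lambda>q. Qop s (a i j) (\<lambda>n m. al t j q * (vT t j (n - q) * al s i m)) n m)"
    by (rule Qop_lsum, rule sumbl_vT_mult)
  also have "\<dots> = lsum (\<lambda>q. al t j q * (al s i m * vT t j (n - q + ?c)))"
    by (simp add: Qop_mult_left Qop_shift1(2)[of s "a i j" "\<lambda>n m. vT t j n * al s i m"] neg)
  also have "\<dots> = lsum (\<lambda>q. al s i m * (al t j q * vT t j (n + ?c - q)))"
  proof (rule arg_cong[of _ _ lsum], rule ext)
    fix q
    have shift: "n - q + ?c = n + ?c - q" by simp
    show "al t j q * (al s i m * vT t j (n - q + ?c)) = al s i m * (al t j q * vT t j (n + ?c - q))"
      unfolding mult.assoc[symmetric] mu_commute[of "vA a t j"] shift ..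
  qed
  also have "\<dots> = al s i m * Xf t j (n + ?c)"
    unfolding Xf_alt by (rule lsum_mult_left[symmetric], rule sumbl_al_vT)
  finally show ?thesis .
qed

lemma Xf_al_pos:
  assumes "pm s * pm t * a i j > 0"
  shows "Xf t j n * al s i m = Qop s (a i j) (\<lambda>n m. al s i m * Xf t j n) (n + pm s * pm t * a i j) m"
proof -
  let ?c = "pm s * pm t * a i j"
  have e: "pm t * pm s * a j i = ?c" by (simp add: a_sym[of j i] mult.commute)
  have c: "pm t * pm s * a j i > 0" using assms unfolding e .
  have shift: "n - q + ?c = n + ?c - q" for q by simp
  have "Xf t j n * al s i m = lsum (\<lambda>q. al t j q * Qop s (a i j) (\<lambda>n m. al s i m * vT t j n) (n + ?c - q) m)"
    unfolding Xf_mult vT_al_pos[OF c] unfolding e unfolding a_sym[of j i] shift ..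
  also have "\<dots> = lsum (\<lambda>q. Qop s (a i j) (\<lambda>n m. al t j q * (al s i m * vT t j (n - q))) (n + ?c) m)"
    by (simp add: Qop_mult_left Qop_shift1(2)[of s "a i j" "\<lambda>n m. al s i m * vT t j n"])
  also have "\<dots> = Qop s (a i j) (\<lambda>n m. lsum (\<lambda>q. al t j q * (al s i m * vT t j (n - q)))) (n + ?c) m"
    by (rule Qop_lsum(1)[symmetric], rule sumbl_al_B_vT)
  also have "(\<lambda>n m. lsum (\<lambda>q. al t j q * (al s i m * vT t j (n - q)))) = (\<lambda>n m. al s i m * Xf t j n)"
  proof (intro ext)
    fix n m
    have "al t j q * (al s i m * vT t j (n - q)) = al s i m * (al t j q * vT t j (n - q))" for q
      unfolding mult.assoc[symmetric] mu_commute[of "vA a t j"] ..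
    then show "lsum (\<lambda>q. al t j q * (al s i m * vT t j (n - q))) = al s i m * Xf t j n"
      unfolding Xf_alt by (simp add: lsum_mult_left sumbl_al_vT)
  qed
  finally show ?thesis .
qed

text \<open>The aim is a form in which X_j(w) sits between the two halves of X_i(z). The primed
  versions reach the same \<open>NO\<close> from the product in the other order, and so the two
  orders become comparable.\<close>

lemma Xf_Xf_neg:
  assumes "pm s * pm t * a i j \<le> 0"
  shows "Qop t (a i j) (\<lambda>m n. Xf s i m * Xf t j n) m n = cs (asgn i j) * NO s i (Xf t j (n + pm s * pm t * a i j)) m"
proof -
  let ?c = "pm s * pm t * a i j"
  have "Qop t (a i j) (\<lambda>m n. Xf s i m * Xf t j n) m n = lsum (\<lambda>p. Qop t (a i j) (\<lambda>m n. al s i p * (vT s i (m - p) * Xf t j n)) m n)"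
    unfolding Xf_mult[of s i] by (rule Qop_lsum, rule sumbl_vT_mult)
  also have "\<dots> = lsum (\<lambda>p. al s i p * (cs (asgn i j) * (Xf t j (n + ?c) * vT s i (m - p))))"
    by (simp add: Qop_mult_left Qop_shift1(2)[of t "a i j" "\<lambda>m n. vT s i m * Xf t j n"] vT_Xf_neg[OF assms])
  also have "\<dots> = cs (asgn i j) * NO s i (Xf t j (n + ?c)) m"
    unfolding NO_alt by (simp add: cs_left_commute[of "al s i p" for p] lsum_mult_left sumbl_al_B_vT)
  finally show ?thesis .
qed

lemma Xf_Xf_pos:
  assumes "pm s * pm t * a i j > 0"
  shows "Xf s i m * Xf t j n = cs (asgn i j) * Qop t (a i j) (\<lambda>m n. NO s i (Xf t j n) m) m (n + pm s * pm t * a i j)"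
proof -
  let ?c = "pm s * pm t * a i j"
  have "Xf s i m * Xf t j n = lsum (\<lambda>p. cs (asgn i j) * (al s i p * Qop t (a i j) (\<lambda>m n. Xf t j n * vT s i m) (m - p) (n + ?c)))"
    unfolding Xf_mult[of s i] vT_Xf_pos[OF assms] cs_left_commute[of "al s i p" for p] ..
  also have "\<dots> = lsum (\<lambda>p. cs (asgn i j) * Qop t (a i j) (\<lambda>m n. al s i p * (Xf t j n * vT s i (m - p))) m (n + ?c))"
    by (simp add: Qop_mult_left Qop_shift1(2)[of t "a i j" "\<lambda>m n. Xf t j n * vT s i m"])
  also have "\<dots> = cs (asgn i j) * lsum (\<lambda>p. Qop t (a i j) (\<lambda>m n. al s i p * (Xf t j n * vT s i (m - p))) m (n + ?c))"
    by (rule lsum_mult_left[symmetric], rule Qop_lsum(2), rule sumbl_al_B_vT)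
  also have "lsum (\<lambda>p. Qop t (a i j) (\<lambda>m n. al s i p * (Xf t j n * vT s i (m - p))) m (n + ?c))
      = Qop t (a i j) (\<lambda>m n. NO s i (Xf t j n) m) m (n + ?c)"
    unfolding NO_alt by (rule Qop_lsum(1)[symmetric], rule sumbl_al_B_vT)
  finally show ?thesis .
qed

lemma Xf_Xf_neg':
  assumes "pm s * pm t * a i j \<le> 0"
  shows "Qop s (a i j) (\<lambda>n m. Xf t j n * Xf s i m) n m = NO s i (Xf t j (n + pm s * pm t * a i j)) m"
proof -
  let ?c = "pm s * pm t * a i j"
  have "Qop s (a i j) (\<lambda>n m. Xf t j n * Xf s i m) n m = lsum (\<lambda>p. Qop s (a i j) (\<lambda>n m. Xf t j n * al s i (m - p) * vT s i p) n m)"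
    unfolding mult_Xf by (rule Qop_lsum, rule sumbl_al_vT)
  also have "\<dots> = NO s i (Xf t j (n + ?c)) m"
    unfolding NO_def Qop_mult_right Qop_shift1(1)[of s "a i j" "\<lambda>n m. Xf t j n * al s i m"] Xf_al_neg[OF assms]
    by (simp only: mult.assoc)
  finally show ?thesis .
qed

lemma Xf_Xf_pos':
  assumes "pm s * pm t * a i j > 0"
  shows "Xf t j n * Xf s i m = Qop s (a i j) (\<lambda>n m. NO s i (Xf t j n) m) (n + pm s * pm t * a i j) m"
proof -
  let ?c = "pm s * pm t * a i j"
  have "Xf t j n * Xf s i m = lsum (\<lambda>p. Qop s (a i j) (\<lambda>n m. al s i m * Xf t j n) (n + ?c) (m - p) * vT s i p)"
    unfolding mult_Xf Xf_al_pos[OF assms] ..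
  also have "\<dots> = lsum (\<lambda>p. Qop s (a i j) (\<lambda>n m. al s i (m - p) * (Xf t j n * vT s i p)) (n + ?c) m)"
    by (simp add: Qop_mult_right Qop_shift1(1)[of s "a i j" "\<lambda>n m. al s i m * Xf t j n", symmetric] flip: mult.assoc)
  also have "\<dots> = Qop s (a i j) (\<lambda>n m. NO s i (Xf t j n) m) (n + ?c) m"
    unfolding NO_def by (rule Qop_lsum(1)[symmetric], rule sumbl_al_B_vT)
  finally show ?thesis .
qed

end

section \<open>Truncated series and cancellation\<close>

text \<open>Boundedness below in the second exponent, for each vector and order in \<hbar>, but
  uniformly in the first exponent. A product X(z) Y(w) has this property because Y(w) acts
  first.\<close>

definition ntr :: "(int \<Rightarrow> int \<Rightarrow> 'i::finite vend fps) \<Rightarrow> bool" where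
  "ntr F \<longleftrightarrow> (\<forall>d v. \<exists>Q. \<forall>m n. n < Q \<longrightarrow> app (F m n) d v = 0)"

lemma ntrI: "(\<And>d v. \<exists>Q. \<forall>m n. n < Q \<longrightarrow> app (F m n) d v = 0) \<Longrightarrow> ntr F"
  by (simp add: ntr_def)

lemma ntr_finite:
  assumes "finite A" "\<And>x. x \<in> A \<Longrightarrow> \<exists>Q::int. \<forall>m n. n < Q \<longrightarrow> (f x m n :: 'b::zero) = 0"
  shows "\<exists>Q. \<forall>x\<in>A. \<forall>m n. n < Q \<longrightarrow> f x m n = 0"
  using assms
proof (induction A rule: finite_induct)
  case (insert x A)
  have "\<exists>Q. \<forall>x\<in>A. \<forall>m n. n < Q \<longrightarrow> f x m n = 0"
    by (rule insert.IH, rule insert.prems) simp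
  then obtain Q where Q: "\<forall>x\<in>A. \<forall>m n. n < Q \<longrightarrow> f x m n = 0" ..
  obtain Q' where Q': "\<forall>m n. n < Q' \<longrightarrow> f x m n = 0" using insert.prems[of x] by auto
  show ?case
  proof (intro exI[of _ "min Q Q'"] ballI allI impI)
    fix y m and n :: int assume "y \<in> insert x A" "n < min Q Q'"
    then show "f y m n = 0" using Q Q' by (cases "y = x") simp_all
  qed
qed simp

lemma ntr_mult_left:
  assumes "ntr F" shows "ntr (\<lambda>m n. G m n * F m n)"
proof (rule ntrI)
  fix d v
  have "\<exists>Q. \<forall>e\<in>{..d}. \<forall>m n. n < Q \<longrightarrow> app (F m n) e v = 0"
    by (rule ntr_finite) (use assms in \<open>auto simp: ntr_def\<close>)
  then obtain Q where "\<forall>e\<in>{..d}. \<forall>m n. n < Q \<longrightarrow> app (F m n) e v = 0" by blast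
  then show "\<exists>Q. \<forall>m n. n < Q \<longrightarrow> app (G m n * F m n) d v = 0"
    by (intro exI[of _ Q]) (auto simp: app_mult)
qed

lemma ntr_mult_right:
  assumes "ntr F" shows "ntr (\<lambda>m n. F m n * y)"
proof (rule ntrI)
  fix d v
  have "\<exists>Q. \<forall>e\<in>{..d}. \<forall>m n. n < Q \<longrightarrow> app (F m n) e (app y (d - e) v) = 0"
    by (rule ntr_finite) (use assms in \<open>auto simp: ntr_def\<close>)
  then obtain Q where "\<forall>e\<in>{..d}. \<forall>m n. n < Q \<longrightarrow> app (F m n) e (app y (d - e) v) = 0" by blast
  then show "\<exists>Q. \<forall>m n. n < Q \<longrightarrow> app (F m n * y) d v = 0"
    by (intro exI[of _ Q]) (auto simp: app_mult)
qed

lemma ntr_add: "ntr F \<Longrightarrow> ntr G \<Longrightarrow> ntr (\<lambda>m n. F m n + G m n)"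
  and ntr_uminus: "ntr F \<Longrightarrow> ntr (\<lambda>m n. - F m n)"
proof -
  show "ntr (\<lambda>m n. F m n + G m n)" if F: "ntr F" and G: "ntr G"
  proof (rule ntrI)
    fix d v
    obtain Q Q' where "\<forall>m n. n < Q \<longrightarrow> app (F m n) d v = 0" "\<forall>m n. n < Q' \<longrightarrow> app (G m n) d v = 0"
      using F G unfolding ntr_def by meson
    then show "\<exists>Q. \<forall>m n. n < Q \<longrightarrow> app (F m n + G m n) d v = 0"
      by (intro exI[of _ "min Q Q'"]) simp
  qed
qed (simp add: ntr_def)

lemma ntr_diff: "ntr F \<Longrightarrow> ntr G \<Longrightarrow> ntr (\<lambda>m n. F m n - G m n)"
  using ntr_add[of F "\<lambda>m n. - G m n"] ntr_uminus[of G] by simp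

lemma ntr_shift: "ntr F \<Longrightarrow> ntr (\<lambda>m n. F (f m) (n + q))"
  unfolding ntr_def
proof (intro allI)
  fix d v assume "\<forall>d v. \<exists>Q. \<forall>m n. n < Q \<longrightarrow> app (F m n) d v = 0"
  then obtain Q where "\<forall>m n. n < Q \<longrightarrow> app (F m n) d v = 0" by blast
  then show "\<exists>Q. \<forall>m n. n < Q \<longrightarrow> app (F (f m) (n + q)) d v = 0"
    by (intro exI[of _ "Q - q"]) simp
qed

lemma ntr_shift': "ntr F \<Longrightarrow> ntr (\<lambda>m n. F (f m) (n - q))" "ntr F \<Longrightarrow> ntr (\<lambda>m n. F (f m) n)"
  using ntr_shift[of F f "- q"] ntr_shift[of F f 0] by simp_all

lemma ntr_zw: "ntr F \<Longrightarrow> ntr (zw u F)"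
  unfolding zw_def[abs_def]
  by (intro ntr_add ntr_diff ntr_mult_left ntr_shift'(1)[of F "\<lambda>m. m"] ntr_shift'(2)[of F "\<lambda>m. m - 1"])

text \<open>At order d in \<hbar> the term c\<hbar> F involves lower orders only, which vanish by
  induction. Hence F is constant along antidiagonals at this order, and every antidiagonal enters
  the region where F is 0.\<close>

lemma zw_inj:
  assumes "ntr F" "\<And>m n. zw (hb c) F m n = 0"
  shows "F m n = 0"
proof -
  have "\<forall>m n. app (F m n) d v = 0" for d v
  proof (induction d rule: less_induct)
    case (less d)
    have step: "app (F m n) d v = app (F (m + 1) (n - 1)) d v" for m n
    proof -
      have "app (F m n) d v - app (F (m + 1) (n - 1)) d v + app (hb c * F (m + 1) n) d v = 0"
        using arg_cong[OF assms(2)[of "m + 1" n], of "\<lambda>x. app x d v"] by (simp add: zw_def)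
      moreover have "app (hb c * F (m + 1) n) d v = 0"
        using less by (simp add: app_hb)
      ultimately show ?thesis by simp
    qed
    have steps: "app (F m n) d v = app (F (m + int j) (n - int j)) d v" for m n j
    proof (induction j)
      case (Suc j)
      show ?case unfolding Suc step[of "m + int j"] by (simp add: algebra_simps)
    qed simp
    obtain Q where Q: "\<forall>m n. n < Q \<longrightarrow> app (F m n) d v = 0" using assms(1) unfolding ntr_def by blast
    show ?case
    proof (intro allI)
      fix m n
      have "n - int (nat (n - Q + 1)) < Q" by linarith
      then show "app (F m n) d v = 0" using Q steps[of m n "nat (n - Q + 1)"] by simp
    qed
  qed
  then show ?thesis by (intro app_eqI) simp
qed

lemma zw_cancel:
  assumes "ntr F" "ntr G" "\<And>m n. zw (hb c) F m n = zw (hb c) G m n"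
  shows "F m n = G m n"
  using zw_inj[of "\<lambda>m n. F m n - G m n" c m n] assms by (simp add: ntr_diff zw_diff)

lemma zw_cancel':
  assumes "ntr (\<lambda>n m. F m n)" "ntr (\<lambda>n m. G m n)" "\<And>m n. zw (hb c) F m n = zw (hb c) G m n"
  shows "F m n = G m n"
proof (rule zw_cancel[OF assms(1,2), of "- c"])
  fix m n show "zw (hb (- c)) (\<lambda>n m. F m n) m n = zw (hb (- c)) (\<lambda>n m. G m n) m n"
    unfolding zw_swap[of "- c" F m n] zw_swap[of "- c" G m n] using assms(3)[of n m] by simp
qed

context vertex
begin

lemma vT_finite: "finite {p. app (vT s i p) 0 v \<noteq> 0}"
  by (rule sumblD[OF sumbl_vT])

lemma app_mult_vT: "app (x * vT s i p) d v = app x d (app (vT s i p) 0 v)"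
  unfolding app_mult by (subst sum.mono_neutral_right[of _ "{d}"]) (auto simp: app_vT_pos)

lemma app_lsum_vT: "app (lsum (\<lambda>p. G p * vT s i p)) d v = (\<Sum>p | app (vT s i p) 0 v \<noteq> 0. app (G p) d (app (vT s i p) 0 v))"
  using app_lsum_superset[OF sumbl_al_vT(1)[of G s i] vT_finite[of s i v], of d v] by (simp add: app_mult_vT)

lemma ntr_lsum_vT:
  assumes "\<And>p. ntr (G p)"
  shows "ntr (\<lambda>m n. lsum (\<lambda>p. G p m n * vT s i p))"
proof (rule ntrI)
  fix d v
  have "\<exists>Q. \<forall>p\<in>{p. app (vT s i p) 0 v \<noteq> 0}. \<forall>m n. n < Q \<longrightarrow> app (G p m n) d (app (vT s i p) 0 v) = 0"
    by (rule ntr_finite[OF vT_finite]) (use assms in \<open>auto simp: ntr_def\<close>)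
  then obtain Q where "\<forall>p\<in>{p. app (vT s i p) 0 v \<noteq> 0}. \<forall>m n. n < Q \<longrightarrow> app (G p m n) d (app (vT s i p) 0 v) = 0"
    by blast
  then show "\<exists>Q. \<forall>m n. n < Q \<longrightarrow> app (lsum (\<lambda>p. G p m n * vT s i p)) d v = 0"
    by (intro exI[of _ Q]) (simp add: app_lsum_vT)
qed

lemma ntr_mu: "ntr (\<lambda>m n. mu x (n - p))"
  by (rule ntrI, rule exI[of _ p]) simp

lemma ntr_mu_mult: "ntr (\<lambda>m n. mu x (n - p) * B m)"
  by (rule ntrI, rule exI[of _ p]) simp

lemma ntr_Xf: "ntr (\<lambda>m n. Xf s i n)"
  unfolding Xf_def by (intro ntr_lsum_vT ntr_mu)

lemma ntr_NO: "ntr (\<lambda>m n. B m n) \<Longrightarrow> ntr (\<lambda>m n. NO s i (B m n) (f m))"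
  unfolding NO_def mult.assoc[symmetric] by (intro ntr_lsum_vT ntr_mult_left)

lemma ntr_NO': "ntr (\<lambda>n m. NO s i (B n) m)"
  unfolding NO_def mult.assoc[symmetric] by (intro ntr_lsum_vT ntr_mu_mult)

section \<open>Relations between vertex operators of the same sign\<close>

lemma fps_const_m1 [simp]: "fps_const (- 1) * x = - x" for x :: "'b::ring_1 fps"
  by (simp flip: fps_const_neg)

lemma asgn_self [simp]: "asgn i i = 1"
  by (simp add: asgn_def)

lemma asgn_adj: "a i j = - 1 \<Longrightarrow> asgn i j = - 1" "a i j = 0 \<Longrightarrow> asgn i j = 1"
  by (simp_all add: asgn_def)

lemma zw_swap2: "zw (hb u) (zw (hb v) (\<lambda>n m. F m n)) n m = zw (hb (- u)) (zw (hb (- v)) F) m n"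
proof -
  have "zw (hb v) (\<lambda>n m. F m n) = (\<lambda>n m. - zw (hb (- v)) F m n)" by (intro ext zw_swap)
  then show ?thesis by (simp only: zw_uminus zw_swap[of u "zw (hb (- v)) F" n m] minus_minus)
qed

lemma zw_shift2: "zw u (\<lambda>m n. F m (n + q)) m n = zw u F m (n + q)" "zw u (\<lambda>m n. F m (n - q)) m n = zw u F m (n - q)"
  using zw_shift[of u F 0 q m n] zw_shift[of u F 0 "- q" m n] by simp_all

text \<open>Both orders are expressed through the same \<open>NO\<close>, so nothing is cancelled.
  For i = j the linear factor in the relation supplies the zero that only the other order has; for
  neighbours it is exactly the pole.\<close>

lemma Xf_Xf: "zw (hb (- pm s * of_int (a i j) / 2)) (\<lambda>m n. Xf s i m * Xf s j n) m n
    = zw (hb (pm s * of_int (a i j) / 2)) (\<lambda>m n. Xf s j n * Xf s i m) m n"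
  using a_cases[of i j]
proof (elim disjE conjE)
  assume 2: "a i j = 2" "i = j"
  have c: "pm s * pm s * a i i > 0" by simp
  let ?N = "\<lambda>m n. NO s i (Xf s i n) m"
  have L: "(\<lambda>m n. Xf s i m * Xf s i n) = (\<lambda>m n. zw (hb 0) (zw (hb (pm s)) ?N) m (n + 2))"
    using Xf_Xf_pos[OF c] by (intro ext) (simp add: Qop_def)
  have R: "(\<lambda>m n. Xf s i n * Xf s i m) = (\<lambda>m n. zw (hb 0) (zw (hb (- pm s)) ?N) m (n + 2))"
    unfolding Xf_Xf_pos'[OF c] Qop_def using zw_swap2[of 0 "pm s" ?N] by (intro ext) simp
  show ?thesis
    unfolding 2(2)[symmetric] L R zw_shift2
    by (simp add: zw_hb_commute[of _ 0] zw_hb_commute[of "- pm s" "pm s"] del: hb_zero)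
next
  assume 1: "a i j = - 1" "i \<noteq> j"
  then have c: "pm s * pm s * a i j \<le> 0" by simp
  have "zw (hb (pm s / 2)) (\<lambda>m n. Xf s i m * Xf s j n) m n = - NO s i (Xf s j (n - 1)) m"
    using Xf_Xf_neg[OF c, of m n] 1 by (simp add: Qop_def asgn_adj)
  moreover have "zw (hb (- pm s / 2)) (\<lambda>m n. Xf s j n * Xf s i m) m n = - NO s i (Xf s j (n - 1)) m"
    using Xf_Xf_neg'[OF c, of n m] 1 zw_swap[of "pm s / 2" "\<lambda>m n. Xf s j n * Xf s i m" n m]
    by (simp add: Qop_def minus_equation_iff)
  ultimately show ?thesis using 1 by simp
next
  assume 0: "a i j = 0"
  then have c: "pm s * pm s * a i j \<le> 0" by simp
  show ?thesis using Xf_Xf_neg[OF c] Xf_Xf_neg'[OF c] 0 by (simp add: Qop_def asgn_adj)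
qed

text \<open>For neighbours the two orders carry the factors z - w - \<hbar>/2 and w - z + \<hbar>/2,
  and the cocycle sign -1 makes them equal.\<close>

lemma Xf_Xf_mixed: "i \<noteq> j \<Longrightarrow> Xf Plus i m * Xf Minus j n = Xf Minus j n * Xf Plus i m"
  using a_cases[of i j]
proof (elim disjE conjE)
  assume 1: "a i j = - 1"
  then have c: "pm Plus * pm Minus * a i j > 0" by simp
  show ?thesis
    unfolding Xf_Xf_pos[OF c] Xf_Xf_pos'[OF c]
    using 1 zw_swap[of "1 / 2" "\<lambda>m n. NO Plus i (Xf Minus j n) m" "n + 1" m]
    by (simp add: Qop_def asgn_adj)
next
  assume 0: "a i j = 0"
  then have c: "pm Plus * pm Minus * a i j \<le> 0" by simp
  show ?thesis using Xf_Xf_neg[OF c] Xf_Xf_neg'[OF c] 0 by (simp add: Qop_def asgn_adj)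
qed simp

section \<open>The Serre relations\<close>

lemma NO_lin: "NO s i (B + C) m = NO s i B m + NO s i C m" "NO s i (B - C) m = NO s i B m - NO s i C m"
  "NO s i (- B) m = - NO s i B m" "NO s i (hb c * B) m = hb c * NO s i B m"
proof -
  note S = sumbl_al_B_vT(1)[of "\<lambda>p. al s i (m - p)" "\<lambda>_. D" s i for D]
  show "NO s i (B + C) m = NO s i B m + NO s i C m" "NO s i (B - C) m = NO s i B m - NO s i C m"
    unfolding NO_def by (simp_all add: distrib_left distrib_right left_diff_distrib right_diff_distrib
        lsum_add[OF S S] lsum_diff[OF S S])
  show "NO s i (- B) m = - NO s i B m"
    unfolding NO_def by (simp add: lsum_uminus[OF S])
  show "NO s i (hb c * B) m = hb c * NO s i B m"
    unfolding NO_def lsum_mult_left[OF S] by (simp add: mult.assoc hb_left_commute[of "mu x k" for x k])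
qed

lemma zw_NO: "zw (hb c) (\<lambda>m n. NO s i (B m n) k) m n = NO s i (zw (hb c) B m n) k"
  by (simp add: zw_def NO_lin)

context
  fixes s :: sign and i j :: 'i
  assumes adj: "a i j = - 1"
begin

abbreviation "Xi \<equiv> Xf s i"
abbreviation "Yj \<equiv> Xf s j"
abbreviation "Ti \<equiv> vT s i"

lemma vT_X: "Ti m * Xi n = zw (hb 0) (zw (hb (pm s)) (\<lambda>m n. Xi n * Ti m)) m (n + 2)"
  using vT_Xf_pos[of s s i i m n] by (simp add: Qop_def)

lemma vT_Y: "zw (hb (pm s / 2)) (\<lambda>m n. Ti m * Yj n) m n = - (Yj (n - 1) * Ti m)"
  using vT_Xf_neg[of s s i j m n] adj by (simp add: Qop_def asgn_adj)

lemma X_al: "Xi n * al s i m = zw (hb 0) (zw (hb (- pm s)) (\<lambda>m n. al s i m * Xi n)) m (n + 2)"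
  using Xf_al_pos[of s s i i n m] zw_swap2[of 0 "pm s" "\<lambda>m n. al s i m * Xi n" "n + 2" m]
  by (simp add: Qop_def)

lemma Y_al: "zw (hb (- pm s / 2)) (\<lambda>m n. Yj n * al s i m) m n = - (al s i m * Yj (n - 1))"
  using Xf_al_neg[of s s i j n m] adj zw_swap[of "pm s / 2" "\<lambda>m n. Yj n * al s i m" n m]
  by (simp add: Qop_def minus_equation_iff)

text \<open>X_i contributes only zeros, so the single factor that removes the pole at X_j
  suffices.\<close>

lemma vT_XY: "zw (hb (pm s / 2)) (\<lambda>m n. Ti m * (Xi k * Yj n)) m n
    = - zw (hb 0) (zw (hb (pm s)) (\<lambda>m k. Xi k * Yj (n - 1) * Ti m)) m (k + 2)"
proof -
  have "zw (hb (pm s / 2)) (\<lambda>m n. Ti m * (Xi k * Yj n)) m n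
      = zw (hb 0) (zw (hb (pm s)) (\<lambda>m k. Xi k * zw (hb (pm s / 2)) (\<lambda>m n. Ti m * Yj n) m n)) m (k + 2)"
    unfolding mult.assoc[symmetric] vT_X
    by (simp add: zw_def algebra_simps hb_left_commute[of "Xi l" for l] hb_left_commute[of "hb (pm s / 2)" "pm s"])
  then show ?thesis unfolding vT_Y by (simp add: zw_uminus zw_uminus[abs_def] mult.assoc zw_def algebra_simps)
qed

lemma vT_YX: "zw (hb (pm s / 2)) (\<lambda>m n. Ti m * (Yj n * Xi k)) m n
    = - zw (hb 0) (zw (hb (pm s)) (\<lambda>m k. Yj (n - 1) * Xi k * Ti m)) m (k + 2)"
proof -
  have "zw (hb (pm s / 2)) (\<lambda>m n. Ti m * (Yj n * Xi k)) m n = - (Yj (n - 1) * Ti m) * Xi k"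
    using zw_hb_mult_right[of "pm s / 2" "\<lambda>m n. Ti m * Yj n" "Xi k" m n] by (simp add: vT_Y mult.assoc)
  also have "\<dots> = - (Yj (n - 1) * (Ti m * Xi k))" by (simp add: mult.assoc)
  finally show ?thesis
    unfolding vT_X by (simp add: zw_hb_mult_left' mult.assoc del: hb_zero)
qed

lemma YX_al: "zw (hb (- pm s / 2)) (\<lambda>m n. Yj n * Xi k * al s i m) m n
    = - zw (hb 0) (zw (hb (- pm s)) (\<lambda>m k. al s i m * (Yj (n - 1) * Xi k))) m (k + 2)"
proof -
  have "zw (hb (- pm s / 2)) (\<lambda>m n. Yj n * Xi k * al s i m) m n
      = zw (hb 0) (zw (hb (- pm s)) (\<lambda>m k. zw (hb (- pm s / 2)) (\<lambda>m n. Yj n * al s i m) m n * Xi k)) m (k + 2)"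
    unfolding mult.assoc X_al
    by (simp add: zw_def algebra_simps hb_left_commute[of "Yj l" for l] hb_left_commute[of "hb (- (pm s / 2))" "- pm s"])
  then show ?thesis unfolding Y_al by (simp add: zw_uminus zw_uminus[abs_def] mult.assoc zw_def algebra_simps)
qed

end

end

lemma Qop_uminus:
  fixes F :: "int \<Rightarrow> int \<Rightarrow> 'i::finite vend fps"
  shows "Qop t c (\<lambda>m n. - F m n) m n = - Qop t c F m n"
proof -
  have "zw u (\<lambda>m n. - F m n) = (\<lambda>m n. - zw u F m n)" for u and F :: "int \<Rightarrow> int \<Rightarrow> 'i vend fps"
    by (intro ext zw_uminus)
  then show ?thesis by (simp add: Qop_def del: hb_zero)
qed

context vertex
begin

text \<open>Passage from T_i to X_i: the creation half stands on the left and takes no part in the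
  exchange. The minus sign is the cocycle sign of neighbours, and the index shifts 2 and -1 are the
  pairings of \<alpha>_i with \<alpha>_i and \<alpha>_j.\<close>

lemma Xf_left_mult:
  assumes "\<And>m n k. zw (hb c) (\<lambda>m n. vT s i m * B k n) m n = - Qop t 2 (\<lambda>m k. B k (n - 1) * vT s i m) m (k + 2)"
  shows "zw (hb c) (\<lambda>m n. Xf s i m * B k n) m n = Qop t 2 (\<lambda>m k. - NO s i (B (k + 2) (n - 1)) m) m k"
proof -
  let ?F = "\<lambda>p m k. al s i p * (B k (n - 1) * vT s i (m - p))"
  have "zw (hb c) (\<lambda>m n. Xf s i m * B k n) m n = lsum (\<lambda>p. zw (hb c) (\<lambda>m n. al s i p * (vT s i (m - p) * B k n)) m n)"
    unfolding Xf_mult by (rule zw_lsum(2), rule sumbl_vT_mult)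
  also have "\<dots> = lsum (\<lambda>p. - Qop t 2 (?F p) m (k + 2))"
  proof (rule arg_cong[of _ _ lsum], rule ext)
    fix p
    have "zw (hb c) (\<lambda>m n. al s i p * (vT s i (m - p) * B k n)) m n = al s i p * zw (hb c) (\<lambda>m n. vT s i m * B k n) (m - p) n"
      using zw_shift[of "hb c" "\<lambda>m n. vT s i m * B k n" "- p" 0 m n] by (simp add: zw_hb_mult_left)
    also have "\<dots> = - (al s i p * Qop t 2 (\<lambda>m k. B k (n - 1) * vT s i (m - p)) m (k + 2))"
      unfolding assms Qop_shift1(2)[of t 2 "\<lambda>m k. B k (n - 1) * vT s i m"] by simp
    finally show "zw (hb c) (\<lambda>m n. al s i p * (vT s i (m - p) * B k n)) m n = - Qop t 2 (?F p) m (k + 2)"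
      unfolding Qop_mult_left .
  qed
  also have "\<dots> = - Qop t 2 (\<lambda>m k. NO s i (B k (n - 1)) m) m (k + 2)"
    unfolding NO_alt Qop_lsum(1)[of ?F, OF sumbl_al_B_vT(2)]
    by (rule lsum_uminus, rule Qop_lsum(2), rule sumbl_al_B_vT)
  also have "\<dots> = Qop t 2 (\<lambda>m k. - NO s i (B (k + 2) (n - 1)) m) m k"
    using Qop_shift[of t 2 "\<lambda>m k. NO s i (B k (n - 1)) m" 0 2 m k] by (simp add: Qop_uminus)
  finally show ?thesis .
qed

lemma Xf_right_mult:
  assumes "\<And>m n k. zw (hb c) (\<lambda>m n. B k n * al s i m) m n = - Qop t 2 (\<lambda>m k. al s i m * B k (n - 1)) m (k + 2)"
  shows "zw (hb c) (\<lambda>m n. B k n * Xf s i m) m n = Qop t 2 (\<lambda>m k. - NO s i (B (k + 2) (n - 1)) m) m k"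
proof -
  let ?F = "\<lambda>p m k. al s i (m - p) * (B k (n - 1) * vT s i p)"
  have "zw (hb c) (\<lambda>m n. B k n * Xf s i m) m n = lsum (\<lambda>p. zw (hb c) (\<lambda>m n. B k n * al s i (m - p) * vT s i p) m n)"
    unfolding mult_Xf by (rule zw_lsum(2), rule sumbl_al_vT)
  also have "\<dots> = lsum (\<lambda>p. - Qop t 2 (?F p) m (k + 2))"
  proof (rule arg_cong[of _ _ lsum], rule ext)
    fix p
    have "zw (hb c) (\<lambda>m n. B k n * al s i (m - p) * vT s i p) m n = zw (hb c) (\<lambda>m n. B k n * al s i m) (m - p) n * vT s i p"
      using zw_shift[of "hb c" "\<lambda>m n. B k n * al s i m" "- p" 0 m n] by (simp add: zw_hb_mult_right)
    also have "\<dots> = - (Qop t 2 (\<lambda>m k. al s i (m - p) * B k (n - 1)) m (k + 2) * vT s i p)"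
      unfolding assms Qop_shift1(2)[of t 2 "\<lambda>m k. al s i m * B k (n - 1)"] by simp
    finally show "zw (hb c) (\<lambda>m n. B k n * al s i (m - p) * vT s i p) m n = - Qop t 2 (?F p) m (k + 2)"
      unfolding Qop_mult_right[symmetric] mult.assoc .
  qed
  also have "\<dots> = - Qop t 2 (\<lambda>m k. NO s i (B k (n - 1)) m) m (k + 2)"
    unfolding NO_def Qop_lsum(1)[of ?F, OF sumbl_al_B_vT(1)]
    by (rule lsum_uminus, rule Qop_lsum(2), rule sumbl_al_B_vT)
  also have "\<dots> = Qop t 2 (\<lambda>m k. - NO s i (B (k + 2) (n - 1)) m) m k"
    using Qop_shift[of t 2 "\<lambda>m k. NO s i (B k (n - 1)) m" 0 2 m k] by (simp add: Qop_uminus)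
  finally show ?thesis .
qed

lemma sumbl_NO_pair: "sumbl (\<lambda>(q, p). G p q * (B * vT s i q) * vT s i p)"
  by (rule sumbl_pairI[of "vT s i" "\<lambda>q p. G p q * (B * vT s i q)"], rule sumbl_vT)
     (rule sumbl_mult_left, rule sumbl_al_vT)

lemma NO_NO: "NO s i (NO s i B m) n = lsum (\<lambda>p. lsum (\<lambda>q. al s i (n - p) * (al s i (m - q) * (B * vT s i q) * vT s i p)))"
proof -
  have "al s i (n - p) * (NO s i B m * vT s i p) = lsum (\<lambda>q. al s i (n - p) * (al s i (m - q) * (B * vT s i q) * vT s i p))" for p
    unfolding NO_def[of s i B]
    by (simp add: lsum_mult_left lsum_mult_right sumbl_al_B_vT sumbl_mult_right)
  then show ?thesis by (simp add: NO_def[of s i "NO s i B m"])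
qed

text \<open>Creation halves commute, and annihilation halves commute up to an index exchange by
  (\<alpha>_i, \<alpha>_i) = 2, which the shifts by 2 in the statement compensate.\<close>

lemma NO_NO_sym: "NO s i (NO s i B (m + 2)) n = NO s i (NO s i B (n + 2)) m"
proof -
  let ?G = "\<lambda>m n p q. al s i (n - p) * (al s i (m - q) * (B * vT s i q) * vT s i p)"
  have S: "sumbl (\<lambda>(q, p). ?G m n p q)" for m n
    using sumbl_NO_pair[of "\<lambda>p q. al s i (n - p) * al s i (m - q)" B s i] by (simp add: mult.assoc)
  note sec = sumbl_pair_sections[OF S]
  have "NO s i (NO s i B (m + 2)) n = lsum (\<lambda>p. lsum (\<lambda>q. ?G (m + 2) n p q))"
    by (rule NO_NO)
  also have "\<dots> = lsum (\<lambda>p. lsum (\<lambda>q. ?G (m + 2) n p (q + 2)))"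
    by (rule arg_cong[of _ _ lsum], rule ext, rule lsum_shift(1)[symmetric], rule sec)
  also have "\<dots> = lsum (\<lambda>q. lsum (\<lambda>p. ?G (m + 2) n p (q + 2)))"
  proof -
    have "sumbl (\<lambda>(q, p). ?G (m + 2) n p (q + 2))"
      using sumbl_reindex[OF S[where m = "m + 2" and n = n], of "\<lambda>(q, p). (q + 2, p)"] by (simp add: inj_def case_prod_unfold)
    then show ?thesis by (rule lsum_swap)
  qed
  also have "\<dots> = lsum (\<lambda>q. lsum (\<lambda>p. ?G (m + 2) n (p - 2) (q + 2)))"
  proof (rule arg_cong[of _ _ lsum], rule ext)
    fix q
    have "sumbl (\<lambda>p. ?G (m + 2) n p (q + 2))" by (rule sec)
    then show "lsum (\<lambda>p. ?G (m + 2) n p (q + 2)) = lsum (\<lambda>p. ?G (m + 2) n (p - 2) (q + 2))"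
      by (rule lsum_shift(2)[symmetric])
  qed
  also have "\<dots> = lsum (\<lambda>q. lsum (\<lambda>p. ?G (n + 2) m q p))"
  proof (rule arg_cong[of _ _ lsum], rule ext, rule arg_cong[of _ _ lsum], rule ext)
    fix q p
    have e: "vT s i (q + 2) * vT s i (p - 2) = vT s i p * vT s i q"
      using vT_vT_swap[of s i p s i q] by simp
    have e': "al s i (n + 2 - p) * (al s i (m - q) * y) = al s i (m - q) * (al s i (n + 2 - p) * y)" for y
      unfolding mult.assoc[symmetric] mu_commute[of _ "n + 2 - p"] ..
    have "?G (m + 2) n (p - 2) (q + 2) = al s i (n + 2 - p) * (al s i (m - q) * (B * (vT s i (q + 2) * vT s i (p - 2))))"
    proof -
      have "n - (p - 2) = n + 2 - p" "m + 2 - (q + 2) = m - q" by simp_all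
      then show ?thesis by (simp only: mult.assoc)
    qed
    also have "\<dots> = ?G (n + 2) m q p" unfolding e e' by (simp add: mult.assoc)
    finally show "?G (m + 2) n (p - 2) (q + 2) = ?G (n + 2) m q p" .
  qed
  also have "\<dots> = NO s i (NO s i B (n + 2)) m" by (rule NO_NO[symmetric])
  finally show ?thesis .
qed

section \<open>Partial fractions for products of three vertex operators\<close>

context
  fixes s :: sign and i j :: 'i
  assumes adj: "a i j = - 1"
begin

text \<open>With m, k, n the exponents of z_1, z_2, w: removing the pole in z_1 - w from a cubic
  product leaves (z_1 - z_2)(z_1 - z_2 \<plusminus> \<hbar>) times \<open>P1\<close> or
  \<open>P2\<close>, where X_i(z_1) already encloses the other two factors. Removing the pole in z_2
  - w as well gives \<open>PN\<close>, which is symmetric in z_1 and z_2.\<close>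

definition P1 :: "int \<Rightarrow> int \<Rightarrow> int \<Rightarrow> 'i vend fps" where
  "P1 m k n = - NO s i (Xf s i (k + 2) * Xf s j (n - 1)) m"

definition P2 :: "int \<Rightarrow> int \<Rightarrow> int \<Rightarrow> 'i vend fps" where
  "P2 m k n = - NO s i (Xf s j (n - 1) * Xf s i (k + 2)) m"

definition PN :: "int \<Rightarrow> int \<Rightarrow> int \<Rightarrow> 'i vend fps" where
  "PN m k n = NO s i (NO s i (Xf s j (n - 2)) (k + 2)) m"

lemma Q2: "Qop s 2 F = zw (hb 0) (zw (hb (pm s)) F)" "Qop (sflip s) 2 F = zw (hb 0) (zw (hb (- pm s)) F)"
  by (simp_all add: Qop_def)

lemma S1: "zw (hb (pm s / 2)) (\<lambda>m n. Xf s i m * (Xf s i k * Xf s j n)) m n = zw (hb 0) (zw (hb (pm s)) (\<lambda>m k. P1 m k n)) m k"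
  unfolding P1_def Q2[symmetric] using vT_XY[OF adj] by (intro Xf_left_mult) (simp add: Q2 del: hb_zero)

lemma S2: "zw (hb (pm s / 2)) (\<lambda>m n. Xf s i m * (Xf s j n * Xf s i k)) m n = zw (hb 0) (zw (hb (pm s)) (\<lambda>m k. P2 m k n)) m k"
  unfolding P2_def Q2[symmetric] using vT_YX[OF adj]
  by (intro Xf_left_mult[of _ _ _ "\<lambda>k n. Xf s j n * Xf s i k"]) (simp add: Q2 del: hb_zero)

lemma S4: "zw (hb (- pm s / 2)) (\<lambda>m n. Xf s j n * Xf s i k * Xf s i m) m n = zw (hb 0) (zw (hb (- pm s)) (\<lambda>m k. P2 m k n)) m k"
  unfolding P2_def Q2[symmetric] using YX_al[OF adj]
  by (intro Xf_right_mult[of _ "\<lambda>k n. Xf s j n * Xf s i k"]) (simp add: Q2 del: hb_zero)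

lemma P1_N: "zw (hb (pm s / 2)) (P1 m) k n = PN m k n"
proof -
  have c: "pm s * pm s * a i j \<le> 0" using adj by simp
  have e: "zw (hb (pm s / 2)) (\<lambda>m n. Xf s i m * Xf s j n) m n = - NO s i (Xf s j (n - 1)) m" for m n
    using Xf_Xf_neg[OF c, of m n] adj by (simp add: Qop_def asgn_adj)
  have "zw (hb (pm s / 2)) (P1 m) k n = - zw (hb (pm s / 2)) (\<lambda>k n. NO s i (Xf s i (k + 2) * Xf s j (n - 1)) m) k n"
    unfolding P1_def[abs_def] by (rule zw_uminus)
  also have "zw (hb (pm s / 2)) (\<lambda>k n. NO s i (Xf s i (k + 2) * Xf s j (n - 1)) m) k n
      = NO s i (zw (hb (pm s / 2)) (\<lambda>m n. Xf s i m * Xf s j n) (k + 2) (n - 1)) m"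
    using zw_shift[of "hb (pm s / 2)" "\<lambda>m n. Xf s i m * Xf s j n" 2 "- 1" k n] by (simp add: zw_NO)
  finally show ?thesis unfolding e NO_lin PN_def by simp
qed

lemma P2_N: "zw (hb (- pm s / 2)) (P2 m) k n = PN m k n"
proof -
  have c: "pm s * pm s * a i j \<le> 0" using adj by simp
  have e: "zw (hb (- pm s / 2)) (\<lambda>m n. Xf s j n * Xf s i m) m n = - NO s i (Xf s j (n - 1)) m" for m n
    using Xf_Xf_neg'[OF c, of n m] adj zw_swap[of "pm s / 2" "\<lambda>m n. Xf s j n * Xf s i m" n m]
    by (simp add: Qop_def minus_equation_iff)
  have "zw (hb (- pm s / 2)) (P2 m) k n = - zw (hb (- pm s / 2)) (\<lambda>k n. NO s i (Xf s j (n - 1) * Xf s i (k + 2)) m) k n"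
    unfolding P2_def[abs_def] by (rule zw_uminus)
  also have "zw (hb (- pm s / 2)) (\<lambda>k n. NO s i (Xf s j (n - 1) * Xf s i (k + 2)) m) k n
      = NO s i (zw (hb (- pm s / 2)) (\<lambda>m n. Xf s j n * Xf s i m) (k + 2) (n - 1)) m"
    using zw_shift[of "hb (- pm s / 2)" "\<lambda>m n. Xf s j n * Xf s i m" 2 "- 1" k n] by (simp add: zw_NO)
  finally show ?thesis unfolding e NO_lin PN_def by simp
qed

lemma PN_sym: "PN m k n = PN k m n"
  unfolding PN_def by (rule NO_NO_sym)

lemma ntr_P: "ntr (\<lambda>m n. P1 (f m) k n)" "ntr (\<lambda>m n. P1 k (f m) n)" "ntr (\<lambda>m n. P2 (f m) k n)"
proof -
  have Y: "ntr (\<lambda>m n. Xf s j (n - 1))" using ntr_shift'(1)[OF ntr_Xf[of s j], of 1] .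
  show "ntr (\<lambda>m n. P1 (f m) k n)" "ntr (\<lambda>m n. P1 k (f m) n)" "ntr (\<lambda>m n. P2 (f m) k n)"
    unfolding P1_def P2_def by (intro ntr_uminus ntr_NO ntr_mult_left ntr_mult_right Y)+
qed

lemma mtr_P: "ntr (\<lambda>n m. P2 (m - q) k n)" "ntr (\<lambda>n m. P2 k (m - q) n)"
proof -
  have X: "ntr (\<lambda>n m. Xf s i (m - q + 2))" using ntr_shift(1)[OF ntr_Xf[of s i], of "2 - q"]
    by (simp add: algebra_simps)
  show "ntr (\<lambda>n m. P2 k (m - q) n)"
    unfolding P2_def by (intro ntr_uminus ntr_NO ntr_mult_left X)
  show "ntr (\<lambda>n m. P2 (m - q) k n)"
    unfolding P2_def by (intro ntr_uminus ntr_shift'(1)[of "\<lambda>n m. NO s i (Xf s j (n - 1) * Xf s i (k + 2)) m" "\<lambda>n. n"] ntr_NO')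
qed

text \<open>Write c for \<plusminus>\<hbar>/2. As (z_2 - w + c) P1(z_1, z_2) is symmetric, (z_1 - w
  + c)(P1(z_1, z_2) - P1(z_2, z_1)) = (z_1 - z_2) P1(z_1, z_2), and the common factor z_1 - w + c of
  the two sides is cancelled.\<close>

lemma C1: "Xf s i m * (Xf s i k * Xf s j n) = zw (hb (pm s)) (\<lambda>m k. P1 m k n - P1 k m n) m k"
proof (rule zw_cancel[where F = "\<lambda>m n. Xf s i m * (Xf s i k * Xf s j n)"
      and G = "\<lambda>m n. zw (hb (pm s)) (\<lambda>m k. P1 m k n - P1 k m n) m k" and c = "pm s / 2"])
  show "ntr (\<lambda>m n. Xf s i m * (Xf s i k * Xf s j n))"
    by (intro ntr_mult_left ntr_Xf)
  show "ntr (\<lambda>m n. zw (hb (pm s)) (\<lambda>m k. P1 m k n - P1 k m n) m k)"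
    unfolding zw_def by (intro ntr_add ntr_diff ntr_mult_left ntr_P(1)[of "\<lambda>m. m"] ntr_P(1)[of "\<lambda>m. m - 1"] ntr_P(2)[of _ "\<lambda>m. m"] ntr_P(2)[of _ "\<lambda>m. m - 1"])
  fix m n
  have "zw (hb (pm s / 2)) (\<lambda>m n. zw (hb (pm s)) (\<lambda>m k. P1 m k n - P1 k m n) m k) m n
      = zw (hb (pm s)) (\<lambda>m k. zw (hb (pm s / 2)) (\<lambda>m n. P1 m k n) m n - zw (hb (pm s / 2)) (\<lambda>m n. P1 k m n) m n) m k"
    by (simp add: zw_def algebra_simps hb_left_commute[of "hb (pm s / 2)" "pm s"])
  also have "\<dots> = zw (hb (pm s)) (\<lambda>m k. zw (hb (pm s / 2)) (\<lambda>m n. P1 m k n) m n - zw (hb (pm s / 2)) (\<lambda>k n. P1 m k n) k n) m k"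
    using P1_N PN_sym by simp
  also have "\<dots> = zw (hb (pm s)) (zw (hb 0) (\<lambda>m k. P1 m k n)) m k"
    by (simp add: zw_def algebra_simps)
  finally show "zw (hb (pm s / 2)) (\<lambda>m n. Xf s i m * (Xf s i k * Xf s j n)) m n
      = zw (hb (pm s / 2)) (\<lambda>m n. zw (hb (pm s)) (\<lambda>m k. P1 m k n - P1 k m n) m k) m n"
    unfolding S1 by (simp add: zw_hb_commute[of _ 0] del: hb_zero)
qed

text \<open>As for \<open>C1\<close>, but the poles of \<open>P1\<close> and \<open>P2\<close> have
  opposite shifts, so the difference of the factors is z_1 - z_2 \<plusminus> \<hbar>.\<close>

lemma C2: "Xf s i m * (Xf s j n * Xf s i k) = zw (hb 0) (\<lambda>m k. P2 m k n - P1 k m n) m k"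
proof (rule zw_cancel[where F = "\<lambda>m n. Xf s i m * (Xf s j n * Xf s i k)"
      and G = "\<lambda>m n. zw (hb 0) (\<lambda>m k. P2 m k n - P1 k m n) m k" and c = "pm s / 2"])
  show "ntr (\<lambda>m n. Xf s i m * (Xf s j n * Xf s i k))"
    by (intro ntr_mult_left ntr_mult_right ntr_Xf)
  show "ntr (\<lambda>m n. zw (hb 0) (\<lambda>m k. P2 m k n - P1 k m n) m k)"
    unfolding zw_def by (intro ntr_add ntr_diff ntr_mult_left ntr_P(3)[of "\<lambda>m. m"] ntr_P(3)[of "\<lambda>m. m - 1"] ntr_P(2)[of _ "\<lambda>m. m"] ntr_P(2)[of _ "\<lambda>m. m - 1"])
  fix m n
  have "zw (hb (pm s / 2)) (\<lambda>m n. zw (hb 0) (\<lambda>m k. P2 m k n - P1 k m n) m k) m n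
      = zw (hb 0) (\<lambda>m k. zw (hb (pm s / 2)) (\<lambda>m n. P2 m k n) m n - zw (hb (pm s / 2)) (\<lambda>m n. P1 k m n) m n) m k"
    by (simp add: zw_def algebra_simps)
  also have "\<dots> = zw (hb 0) (\<lambda>m k. zw (hb (pm s / 2)) (\<lambda>m n. P2 m k n) m n - zw (hb (- pm s / 2)) (\<lambda>k n. P2 m k n) k n) m k"
    using P1_N P2_N PN_sym by simp
  also have "\<dots> = zw (hb 0) (zw (hb (pm s)) (\<lambda>m k. P2 m k n)) m k"
  proof -
    have "hb (pm s) * x = hb (pm s / 2) * x + hb (pm s / 2) * x" for x :: "'i vend fps"
      unfolding distrib_right[symmetric] hb_add[symmetric] by simp
    then show ?thesis by (simp add: zw_def algebra_simps hb_minus)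
  qed
  finally show "zw (hb (pm s / 2)) (\<lambda>m n. Xf s i m * (Xf s j n * Xf s i k)) m n
      = zw (hb (pm s / 2)) (\<lambda>m n. zw (hb 0) (\<lambda>m k. P2 m k n - P1 k m n) m k) m n"
    unfolding S2 by simp
qed

text \<open>X_i(z_1) stands on the right here, so the series is bounded below in z_1, and the
  cancellation takes place in that variable.\<close>

lemma C4: "Xf s j n * Xf s i k * Xf s i m = zw (hb (- pm s)) (\<lambda>m k. P2 m k n - P2 k m n) m k"
proof (rule zw_cancel'[where F = "\<lambda>m n. Xf s j n * Xf s i k * Xf s i m"
      and G = "\<lambda>m n. zw (hb (- pm s)) (\<lambda>m k. P2 m k n - P2 k m n) m k" and c = "- pm s / 2"])
  show "ntr (\<lambda>n m. Xf s j n * Xf s i k * Xf s i m)"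
    by (intro ntr_mult_left ntr_Xf)
  show "ntr (\<lambda>n m. zw (hb (- pm s)) (\<lambda>m k. P2 m k n - P2 k m n) m k)"
    unfolding zw_def
    using mtr_P(1)[of 0] mtr_P(2)[of _ 0]
    by (intro ntr_add ntr_diff ntr_mult_left mtr_P) simp_all
  fix m n
  have "zw (hb (- pm s / 2)) (\<lambda>m n. zw (hb (- pm s)) (\<lambda>m k. P2 m k n - P2 k m n) m k) m n
      = zw (hb (- pm s)) (\<lambda>m k. zw (hb (- pm s / 2)) (\<lambda>m n. P2 m k n) m n - zw (hb (- pm s / 2)) (\<lambda>m n. P2 k m n) m n) m k"
    by (simp add: zw_def algebra_simps hb_left_commute[of "hb (- (pm s / 2))" "- pm s"])
  also have "\<dots> = zw (hb (- pm s)) (\<lambda>m k. zw (hb (- pm s / 2)) (\<lambda>m n. P2 m k n) m n - zw (hb (- pm s / 2)) (\<lambda>k n. P2 m k n) k n) m k"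
    using P2_N PN_sym by simp
  also have "\<dots> = zw (hb (- pm s)) (zw (hb 0) (\<lambda>m k. P2 m k n)) m k"
    by (simp add: zw_def algebra_simps)
  finally show "zw (hb (- pm s / 2)) (\<lambda>m n. Xf s j n * Xf s i k * Xf s i m) m n
      = zw (hb (- pm s / 2)) (\<lambda>m n. zw (hb (- pm s)) (\<lambda>m k. P2 m k n - P2 k m n) m k) m n"
    unfolding S4 by (simp add: zw_hb_commute[of _ 0] del: hb_zero)
qed

text \<open>After symmetrisation in z_1 and z_2 each kind of product is z_1 - z_2 times a
  combination of the four series P1, P2 in both orders of the variables: the terms with \<hbar> drop
  out, and the combinations add up to zero.\<close>

lemma Serre_adjacent:
  "commutator (Xf s i m) (commutator (Xf s i k) (Xf s j n)) + commutator (Xf s i k) (commutator (Xf s i m) (Xf s j n)) = 0"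
proof -
  have e: "commutator (Xf s i m) (commutator (Xf s i k) (Xf s j n)) = Xf s i m * (Xf s i k * Xf s j n)
      - Xf s i m * (Xf s j n * Xf s i k) - Xf s i k * (Xf s j n * Xf s i m) + Xf s j n * Xf s i k * Xf s i m" for m k
    by (simp add: commutator_def algebra_simps)
  show ?thesis unfolding e C1 C2 C4 by (simp add: zw_def algebra_simps hb_minus)
qed

end

lemma Serre_commute: "i \<noteq> j \<Longrightarrow> a i j = 0 \<Longrightarrow> commutator (Xf s i m) (Xf s j n) = 0"
proof -
  assume "i \<noteq> j" and 0: "a i j = 0"
  then have c: "pm s * pm s * a i j \<le> 0" by simp
  show ?thesis using Xf_Xf_neg[OF c] Xf_Xf_neg'[OF c] 0 by (simp add: Qop_def asgn_adj commutator_def)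
qed

end

section \<open>Translation of the formal variable\<close>

definition xp :: "complex \<Rightarrow> nat \<Rightarrow> 'i::finite vend fps" where "xp k f = fps_const (sc k) * fps_X ^ f"

lemma xp_commute: "xp k f * x = x * xp k f"
proof -
  have "xp k f * x = fps_const (sc k) * (x * fps_X ^ f)"
    unfolding xp_def mult.assoc fps_mult_fps_X_power_commute[of f x] ..
  also have "\<dots> = x * xp k f"
    unfolding xp_def mult.assoc[symmetric] fps_const_sc_commute[of k x] ..
  finally show ?thesis .
qed

lemma xp_left_commute: "x * (xp k f * y) = xp k f * (x * y)"
  unfolding mult.assoc[symmetric] xp_commute[of k f x] ..

lemma app_xp: "app (xp k f * x) d v = (if f \<le> d then vscale k (app x (d - f) v) else 0)"
  by (simp add: app_def xp_def mult.assoc fps_X_power_mult_nth)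

lemma xp_0 [simp]: "xp 0 f = 0" "xp 1 0 = 1"
  by (simp_all add: xp_def)

lemma xp_1: "xp k 1 = hb k"
  by (simp add: xp_def hb_def)

lemma sumbl_xp: "sumbl (\<lambda>f. xp (k f) f * G f)"
proof -
  have "finite {f. app (xp (k f) f * G f) d v \<noteq> 0}" for d v
    by (rule finite_subset[of _ "{..d}"]) (auto simp: app_xp split: if_splits)
  then show ?thesis by (simp add: sumbl_def)
qed

lemma app_lsum_xp: "app (lsum (\<lambda>f. xp (k f) f * G f)) d v = (\<Sum>f\<le>d. vscale (k f) (app (G f) (d - f) v))"
  by (subst app_lsum_superset[OF sumbl_xp, of "{..d}"]) (auto simp: app_xp intro!: sum.cong)

lemma sumbl_xp_pair:
  assumes "\<And>f. sumbl (\<lambda>p. G p f)"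
  shows "sumbl (\<lambda>(p, f). xp (k p f) f * G p f)"
proof -
  have "finite {x. app (case x of (p, f) \<Rightarrow> xp (k p f) f * G p f) d v \<noteq> 0}" for d v
  proof (rule finite_subset)
    show "{x. app (case x of (p, f) \<Rightarrow> xp (k p f) f * G p f) d v \<noteq> 0}
        \<subseteq> (\<Union>f\<le>d. {p. app (G p f) (d - f) v \<noteq> 0} \<times> {f})"
      by (auto simp: app_xp split: if_splits)
    show "finite (\<Union>f\<le>d. {p. app (G p f) (d - f) v \<noteq> 0} \<times> {f})"
      using sumblD[OF assms] by auto
  qed
  then show ?thesis by (simp add: sumbl_def)
qed

text \<open>The coefficient of z^m in (z + c)^(m + e).\<close>

definition gb :: "complex \<Rightarrow> int \<Rightarrow> nat \<Rightarrow> complex" where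
  "gb c m e = (of_int (m + int e) gchoose e) * c ^ e"

text \<open>The substitution of \<open>z + c\<hbar>\<close> for \<open>z\<close>, expanded in nonnegative powers of \<open>c\<hbar>/z\<close>.\<close>

definition sh :: "complex \<Rightarrow> (int \<Rightarrow> 'i::finite vend fps) \<Rightarrow> int \<Rightarrow> 'i vend fps" where
  "sh c F m = lsum (\<lambda>e. xp (gb c m e) e * F (m + int e))"

lemma app_sh: "app (sh c F m) d v = (\<Sum>e\<le>d. vscale (gb c m e) (app (F (m + int e)) (d - e) v))"
  unfolding sh_def by (rule app_lsum_xp)

lemma gb_0 [simp]: "gb c m 0 = 1"
  by (simp add: gb_def)

lemma sh_mult_left: "sh c (\<lambda>m. x * F m) m = x * sh c F m"
  unfolding sh_def lsum_mult_left[OF sumbl_xp] xp_left_commute ..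

lemma sh_mult_right: "sh c (\<lambda>m. F m * x) m = sh c F m * x"
  unfolding sh_def by (simp add: lsum_mult_right[OF sumbl_xp] mult.assoc)

lemma sh_add: "sh c (\<lambda>m. F m + G m) m = sh c F m + sh c G m"
  unfolding sh_def distrib_left by (rule lsum_add[OF sumbl_xp sumbl_xp])

lemma sh_diff: "sh c (\<lambda>m. F m - G m) m = sh c F m - sh c G m"
  unfolding sh_def right_diff_distrib by (rule lsum_diff[OF sumbl_xp sumbl_xp])

lemma sh_lsum:
  assumes "\<And>m. sumbl (\<lambda>p. F p m)"
  shows "sh c (\<lambda>m. lsum (\<lambda>p. F p m)) m = lsum (\<lambda>p. sh c (F p) m)"
proof -
  have S: "sumbl (\<lambda>(p, e). xp (gb c m e) e * F p (m + int e))"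
    by (rule sumbl_xp_pair) (rule assms)
  have "sh c (\<lambda>m. lsum (\<lambda>p. F p m)) m = lsum (\<lambda>e. lsum (\<lambda>p. xp (gb c m e) e * F p (m + int e)))"
    unfolding sh_def by (simp add: lsum_mult_left assms)
  also have "\<dots> = lsum (\<lambda>p. sh c (F p) m)"
    unfolding sh_def by (rule lsum_swap[OF S])
  finally show ?thesis .
qed

lemma triangle_sum: "(\<Sum>f\<le>d. \<Sum>e\<le>d - f. g f e) = (\<Sum>h\<le>d. \<Sum>f\<le>h. (g f (h - f) :: 'a::comm_monoid_add))" for d :: nat
proof -
  have "(\<Sum>f\<le>d. \<Sum>e\<le>d - f. g f e) = (\<Sum>(f, e)\<in>(SIGMA f:{..d}. {..d - f}). g f e)"
    by (rule sum.Sigma) auto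
  also have "(SIGMA f:{..d}. {..d - f}) = {(f, e). f + e \<le> d}" by auto
  also have "(\<Sum>(f, e)\<in>{(f, e). f + e \<le> d}. g f e) = (\<Sum>h\<le>d. \<Sum>f\<le>h. g f (h - f))"
    by (rule sum.triangle_reindex_eq)
  finally show ?thesis .
qed

text \<open>Substitution in z^p F(z) gives (z + c\<hbar>)^p times the substituted series, also for
  negative p. In coefficients this is Vandermonde's identity for generalised binomials.\<close>

lemma sh_shift_gen: "sh c (\<lambda>m. F (m - p)) m = lsum (\<lambda>f. xp ((of_int p gchoose f) * c ^ f) f * sh c F (m - p + int f))"
proof (rule app_eqI)
  fix d v
  have "app (lsum (\<lambda>f. xp ((of_int p gchoose f) * c ^ f) f * sh c F (m - p + int f))) d v
     = (\<Sum>f\<le>d. \<Sum>e\<le>d - f. vscale ((of_int p gchoose f) * c ^ f * gb c (m - p + int f) e) (app (F (m - p + int f + int e)) (d - f - e) v))"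
    unfolding app_lsum_xp app_sh vs.scale_sum_right vs.scale_scale ..
  also have "\<dots> = (\<Sum>h\<le>d. \<Sum>f\<le>h. vscale ((of_int p gchoose f) * c ^ f * gb c (m - p + int f) (h - f)) (app (F (m - p + int f + int (h - f))) (d - f - (h - f)) v))"
    by (rule triangle_sum)
  also have "\<dots> = (\<Sum>h\<le>d. vscale (gb c m h) (app (F (m + int h - p)) (d - h) v))"
  proof (rule sum.cong[OF refl])
    fix h assume "h \<in> {..d}"
    then have h: "h \<le> d" by simp
    have "(\<Sum>f\<le>h. vscale ((of_int p gchoose f) * c ^ f * gb c (m - p + int f) (h - f)) (app (F (m - p + int f + int (h - f))) (d - f - (h - f)) v))
        = (\<Sum>f\<le>h. vscale (((of_int p gchoose f) * (of_int (m - p + int h) gchoose (h - f))) * c ^ h) (app (F (m + int h - p)) (d - h) v))"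
    proof (rule sum.cong[OF refl])
      fix f assume "f \<in> {..h}"
      then have f: "f \<le> h" by simp
      have e: "m - p + int f + int (h - f) = m + int h - p" "d - f - (h - f) = d - h" "m - p + int h = m + int h - p"
        using f by simp_all
      have ch: "c ^ h = c ^ f * c ^ (h - f)" using f by (simp flip: power_add)
      show "vscale ((of_int p gchoose f) * c ^ f * gb c (m - p + int f) (h - f)) (app (F (m - p + int f + int (h - f))) (d - f - (h - f)) v)
        = vscale (((of_int p gchoose f) * (of_int (m - p + int h) gchoose (h - f))) * c ^ h) (app (F (m + int h - p)) (d - h) v)"
        unfolding gb_def e ch by (simp only: mult_ac)
    qed
    also have "\<dots> = vscale ((\<Sum>f\<le>h. (of_int p gchoose f) * (of_int (m - p + int h) gchoose (h - f))) * c ^ h) (app (F (m + int h - p)) (d - h) v)"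
      by (simp add: vs.scale_sum_left sum_distrib_right)
    also have "(\<Sum>f\<le>h. (of_int p gchoose f) * (of_int (m - p + int h) gchoose (h - f))) = (of_int (m + int h) gchoose h :: complex)"
      using gbinomial_Vandermonde[of "of_int p :: complex" "of_int (m - p + int h)" h] by (simp add: atLeast0AtMost)
    finally show "(\<Sum>f\<le>h. vscale ((of_int p gchoose f) * c ^ f * gb c (m - p + int f) (h - f)) (app (F (m - p + int f + int (h - f))) (d - f - (h - f)) v))
        = vscale (gb c m h) (app (F (m + int h - p)) (d - h) v)"
      by (simp add: gb_def)
  qed
  also have "\<dots> = app (sh c (\<lambda>m. F (m - p)) m) d v" by (simp add: app_sh)
  finally show "app (sh c (\<lambda>m. F (m - p)) m) d v = app (lsum (\<lambda>f. xp ((of_int p gchoose f) * c ^ f) f * sh c F (m - p + int f))) d v" ..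
qed

lemma sh_shift1: "sh c (\<lambda>m. F (m - 1)) m = sh c F (m - 1) + hb c * sh c F m"
proof -
  have "(1 gchoose f :: complex) = 0" if "f > 1" for f
    using that binomial_gbinomial[of 1 f, where 'a = complex] by (simp add: binomial_eq_0)
  then have "lsum (\<lambda>f. xp ((1 gchoose f) * c ^ f) f * sh c F (m - 1 + int f)) = (\<Sum>f\<in>{0, 1}. xp ((1 gchoose f) * c ^ f) f * sh c F (m - 1 + int f))"
    by (intro lsum_finite) auto
  then show ?thesis using sh_shift_gen[of c F 1 m] by (simp add: xp_1[unfolded One_nat_def])
qed

lemma sh_zw: "sh c (\<lambda>m. zw (hb u) F m n) m = zw (hb (u + c)) (\<lambda>m n. sh c (\<lambda>m. F m n) m) m n"
  unfolding zw_def by (simp add: sh_add sh_diff sh_mult_left sh_shift1[of c "\<lambda>m. F m n" m] hb_add distrib_right)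

text \<open>Trinomial revision followed by the binomial theorem. Together with
  \<open>sh_zero\<close> it makes every translation invertible, so a residue can be computed after a
  translation and carried back.\<close>

lemma sh_sh: "sh c (\<lambda>m. sh b F m) m = sh (b + c) F m"
proof (rule app_eqI)
  fix d v
  have "app (sh c (\<lambda>m. sh b F m) m) d v = (\<Sum>f\<le>d. \<Sum>e\<le>d - f. vscale (gb c m f * gb b (m + int f) e) (app (F (m + int f + int e)) (d - f - e) v))"
    unfolding app_sh vs.scale_sum_right vs.scale_scale ..
  also have "\<dots> = (\<Sum>h\<le>d. \<Sum>f\<le>h. vscale (gb c m f * gb b (m + int f) (h - f)) (app (F (m + int f + int (h - f))) (d - f - (h - f)) v))"
    by (rule triangle_sum)
  also have "\<dots> = (\<Sum>h\<le>d. vscale (gb (b + c) m h) (app (F (m + int h)) (d - h) v))"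
  proof (rule sum.cong[OF refl])
    fix h assume "h \<in> {..d}"
    have "(\<Sum>f\<le>h. vscale (gb c m f * gb b (m + int f) (h - f)) (app (F (m + int f + int (h - f))) (d - f - (h - f)) v))
       = (\<Sum>f\<le>h. vscale ((of_int (m + int h) gchoose h) * (of_nat (h choose f) * c ^ f * b ^ (h - f))) (app (F (m + int h)) (d - h) v))"
    proof (rule sum.cong[OF refl])
      fix f assume "f \<in> {..h}"
      then have f: "f \<le> h" by simp
      have "(of_int (m + int h) gchoose h) * (of_nat h gchoose (h - f)) = (of_int (m + int h) gchoose (h - f)) * (of_int (m + int h) - of_nat (h - f) gchoose (h - (h - f)) :: complex)"
        by (rule gbinomial_trinomial_revision) simp
      moreover have "of_int (m + int h) - of_nat (h - f) = (of_int (m + int f) :: complex)" using f by (simp add: of_nat_diff)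
      moreover have "(of_nat h gchoose (h - f) :: complex) = of_nat (h choose f)"
        using f by (simp add: binomial_gbinomial[symmetric] binomial_symmetric[symmetric])
      ultimately have g: "(of_int (m + int f) gchoose f) * (of_int (m + int h) gchoose (h - f)) = (of_int (m + int h) gchoose h) * (of_nat (h choose f) :: complex)"
        using f by (simp add: mult.commute)
      have e: "m + int f + int (h - f) = m + int h" "d - f - (h - f) = d - h" using f by simp_all
      have "gb c m f * gb b (m + int f) (h - f) = ((of_int (m + int f) gchoose f) * (of_int (m + int h) gchoose (h - f))) * (c ^ f * b ^ (h - f))"
        unfolding gb_def e by (simp only: mult_ac)
      then have "gb c m f * gb b (m + int f) (h - f) = (of_int (m + int h) gchoose h) * (of_nat (h choose f) * c ^ f * b ^ (h - f))"
        unfolding g by (simp only: mult_ac)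
      then show "vscale (gb c m f * gb b (m + int f) (h - f)) (app (F (m + int f + int (h - f))) (d - f - (h - f)) v)
         = vscale ((of_int (m + int h) gchoose h) * (of_nat (h choose f) * c ^ f * b ^ (h - f))) (app (F (m + int h)) (d - h) v)"
        unfolding e by simp
    qed
    also have "\<dots> = vscale ((of_int (m + int h) gchoose h) * (\<Sum>f\<le>h. of_nat (h choose f) * c ^ f * b ^ (h - f))) (app (F (m + int h)) (d - h) v)"
      by (simp add: vs.scale_sum_left sum_distrib_left)
    finally show "(\<Sum>f\<le>h. vscale (gb c m f * gb b (m + int f) (h - f)) (app (F (m + int f + int (h - f))) (d - f - (h - f)) v))
        = vscale (gb (b + c) m h) (app (F (m + int h)) (d - h) v)"
      unfolding gb_def add.commute[of b c] binomial_ring .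
  qed
  finally show "app (sh c (\<lambda>m. sh b F m) m) d v = app (sh (b + c) F m) d v" by (simp add: app_sh)
qed

lemma sh_zero [simp]: "sh 0 F m = F m"
proof (rule app_eqI)
  fix d v
  have "app (sh 0 F m) d v = (\<Sum>e\<in>{0}. vscale (gb 0 m e) (app (F (m + int e)) (d - e) v))"
    unfolding app_sh by (rule sum.mono_neutral_right) (auto simp: gb_def)
  then show "app (sh 0 F m) d v = app (F m) d v" by simp
qed

lemma sumbl_sh: "sumbl F \<Longrightarrow> sumbl (sh c F)"
proof -
  assume F: "sumbl F"
  have "sumbl (\<lambda>(m, e). xp (gb c m e) e * F (m + int e))"
    by (rule sumbl_xp_pair) (simp add: F)
  from lsum_pair(1)[OF sumbl_pair_swap[OF this]] show ?thesis unfolding sh_def[abs_def] .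
qed

lemma ntr_sh: "ntr F \<Longrightarrow> ntr (\<lambda>m n. sh c (\<lambda>m. F m n) m)"
proof (rule ntrI)
  fix d v assume F: "ntr F"
  have "\<exists>Q. \<forall>e\<in>{..d}. \<forall>m n. n < Q \<longrightarrow> app (F m n) e v = 0"
    by (rule ntr_finite) (use F in \<open>auto simp: ntr_def\<close>)
  then obtain Q where "\<forall>e\<in>{..d}. \<forall>m n. n < Q \<longrightarrow> app (F m n) e v = 0" by blast
  then show "\<exists>Q. \<forall>m n. n < Q \<longrightarrow> app (sh c (\<lambda>m. F m n) m) d v = 0"
    by (intro exI[of _ Q]) (auto simp: app_sh intro!: sum.neutral)
qed

lemma mtr_sh: "ntr (\<lambda>n m. F m n) \<Longrightarrow> ntr (\<lambda>n m. sh c (\<lambda>m. F m n) m)"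
proof (rule ntrI)
  fix d v assume F: "ntr (\<lambda>n m. F m n)"
  have "\<exists>Q. \<forall>e\<in>{..d}. \<forall>n m. m < Q \<longrightarrow> app (F m n) e v = 0"
    by (rule ntr_finite) (use F in \<open>auto simp: ntr_def\<close>)
  then obtain Q where "\<forall>e\<in>{..d}. \<forall>n m. m < Q \<longrightarrow> app (F m n) e v = 0" by blast
  then show "\<exists>Q. \<forall>n m. m < Q \<longrightarrow> app (sh c (\<lambda>m. F m n) m) d v = 0"
    by (intro exI[of _ "Q - int d"]) (auto simp: app_sh intro!: sum.neutral)
qed

text \<open>Multiplicativity of the substitution. Neither series need be bounded; besides the given
  convolution, the one with only the left factor substituted has to be locally finite, because it
  occurs when the sums are exchanged.\<close>

lemma sh_conv:
  assumes H1: "\<And>m. sumbl (\<lambda>p. A (m - p) * (B * T p))"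
    and H2: "\<And>m. sumbl (\<lambda>p. sh c A (m - p) * (B * T p))"
  shows "sh c (\<lambda>m. lsum (\<lambda>p. A (m - p) * (B * T p))) m = lsum (\<lambda>p. sh c A (m - p) * (B * sh c T p))"
proof -
  let ?k = "\<lambda>p f. (of_int p gchoose f) * c ^ f"
  have S1: "sumbl (\<lambda>(p, f). xp (gb c p f) f * (sh c A (m - p) * (B * T (p + int f))))"
  proof (rule sumbl_xp_pair)
    fix f
    show "sumbl (\<lambda>p. sh c A (m - p) * (B * T (p + int f)))"
      using sumbl_shift(1)[of "\<lambda>p. sh c A (m + int f - p) * (B * T p)" "int f"] H2[of "m + int f"] by simp
  qed
  have S2: "sumbl (\<lambda>(p, f). xp (?k p f) f * (sh c A (m - p + int f) * (B * T p)))"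
  proof (rule sumbl_xp_pair)
    fix f
    show "sumbl (\<lambda>p. sh c A (m - p + int f) * (B * T p))"
      using H2[of "m + int f"] by (simp add: algebra_simps)
  qed
  have "lsum (\<lambda>p. sh c A (m - p) * (B * sh c T p))
      = lsum (\<lambda>p. lsum (\<lambda>f. xp (gb c p f) f * (sh c A (m - p) * (B * T (p + int f)))))"
    unfolding sh_def[of c T]
    by (simp add: lsum_mult_left[OF sumbl_xp] xp_left_commute[of B] xp_left_commute[of "sh c A l" for l])
  also have "\<dots> = lsum (\<lambda>f. lsum (\<lambda>p. xp (gb c p f) f * (sh c A (m - p) * (B * T (p + int f)))))"
    by (rule lsum_swap[OF sumbl_pair_swap[OF S1]])
  also have "\<dots> = lsum (\<lambda>f. lsum (\<lambda>p. xp (?k p f) f * (sh c A (m - p + int f) * (B * T p))))"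
  proof (rule arg_cong[of _ _ lsum], rule ext)
    fix f
    have "lsum (\<lambda>p. xp (gb c p f) f * (sh c A (m - p) * (B * T (p + int f))))
        = lsum (\<lambda>p. xp (gb c (p - int f) f) f * (sh c A (m - (p - int f)) * (B * T (p - int f + int f))))"
      by (rule lsum_shift(2)[symmetric], rule sumbl_pair_sections(1)[OF S1])
    then show "lsum (\<lambda>p. xp (gb c p f) f * (sh c A (m - p) * (B * T (p + int f))))
        = lsum (\<lambda>p. xp (?k p f) f * (sh c A (m - p + int f) * (B * T p)))"
      by (simp add: gb_def algebra_simps)
  qed
  also have "\<dots> = lsum (\<lambda>p. lsum (\<lambda>f. xp (?k p f) f * (sh c A (m - p + int f) * (B * T p))))"
    by (rule lsum_swap[OF S2])
  also have "\<dots> = lsum (\<lambda>p. sh c (\<lambda>m. A (m - p)) m * (B * T p))"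
    unfolding sh_shift_gen by (simp add: lsum_mult_right[OF sumbl_xp] mult.assoc)
  also have "\<dots> = lsum (\<lambda>p. sh c (\<lambda>m. A (m - p) * (B * T p)) m)"
    by (simp add: sh_mult_right)
  also have "\<dots> = sh c (\<lambda>m. lsum (\<lambda>p. A (m - p) * (B * T p))) m"
    by (rule sh_lsum[symmetric]) (rule H1)
  finally show ?thesis ..
qed

section \<open>The difference of two expansions\<close>

text \<open>U and U' are the two expansions of N / (z - w), bounded below in opposite variables.
  Their difference is the delta function times the restriction of N to z = w, whose coefficients are
  sums over antidiagonals.\<close>

lemma delta_lemma:
  assumes U: "ntr U" and U': "ntr (\<lambda>n m. U' m n)"
    and N: "\<And>m n. zw (hb 0) U m n = N m n" "\<And>m n. zw (hb 0) U' m n = N m n"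
  shows "sumbl (\<lambda>k. N k (s - k))" "U m n - U' m n = lsum (\<lambda>k. N k (m + n + 1 - k))"
proof -
  have Nd: "N m n = U (m - 1) n - U m (n - 1)" "N m n = U' (m - 1) n - U' m (n - 1)" for m n
    using N(1)[of m n, symmetric] N(2)[of m n, symmetric] by (simp_all add: zw_def)
  have bnd: "\<exists>P Q. (\<forall>m n. n < Q \<longrightarrow> app (U m n) d v = 0) \<and> (\<forall>m n. m < P \<longrightarrow> app (U' m n) d v = 0)" for d v
    using U U' unfolding ntr_def by meson
  show S: "sumbl (\<lambda>k. N k (s - k))" for s
  proof -
    have "finite {k. app (N k (s - k)) d v \<noteq> 0}" for d v
    proof -
      obtain P Q where Q: "\<forall>m n. n < Q \<longrightarrow> app (U m n) d v = 0" and P: "\<forall>m n. m < P \<longrightarrow> app (U' m n) d v = 0"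
        using bnd by blast
      have "{k. app (N k (s - k)) d v \<noteq> 0} \<subseteq> {P..s - Q}"
      proof
        fix k assume k: "k \<in> {k. app (N k (s - k)) d v \<noteq> 0}"
        have "\<not> s - k < Q" using k Q by (auto simp: Nd(1))
        moreover have "\<not> k < P" using k P by (auto simp: Nd(2))
        ultimately show "k \<in> {P..s - Q}" by auto
      qed
      then show ?thesis by (rule finite_subset) simp
    qed
    then show ?thesis by (simp add: sumbl_def)
  qed
  show "U m n - U' m n = lsum (\<lambda>k. N k (m + n + 1 - k))"
  proof (rule app_eqI)
    fix d v
    obtain P Q where Q: "\<forall>m n. n < Q \<longrightarrow> app (U m n) d v = 0" and P: "\<forall>m n. m < P \<longrightarrow> app (U' m n) d v = 0"
      using bnd by blast
    let ?D = "\<lambda>j. app (U (m + j) (n - j) - U' (m + j) (n - j)) d v"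
    have Dstep: "?D (j - 1) = ?D j" for j
    proof -
      have "x - x' = y - y'" if "N' = x - y" "N' = x' - y'" for N' x x' y y' :: "'a vend fps"
        using that by (simp add: algebra_simps)
      from this[OF Nd[of "m + j" "n - j + 1"]]
      have "U (m + j - 1) (n - j + 1) - U' (m + j - 1) (n - j + 1) = U (m + j) (n - j) - U' (m + j) (n - j)" by simp
      moreover have "m + (j - 1) = m + j - 1" "n - (j - 1) = n - j + 1" by simp_all
      ultimately show ?thesis by metis
    qed
    have Dconst: "?D (- int l) = ?D 0" for l
    proof (induction l)
      case (Suc l)
      have "- int (Suc l) = - int l - 1" by simp
      then show ?case using Dstep[of "- int l"] Suc by metis
    qed simp
    \<comment> \<open>So far out on the antidiagonal that U' vanishes at the left end and U at the
      right end. The telescoping sum then equals U - U' at the left end, and this difference is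
      constant along the antidiagonal.\<close>
    define J where "J = nat (max (m - P + 1) (n - Q + 1))"
    have J: "m - int J < P" "n - int J < Q" unfolding J_def by linarith+
    have tele: "(\<Sum>k\<in>{m - int J + 1..m - int J + int L}. app (N k (m + n + 1 - k)) d v)
        = app (U (m - int J) (n + int J)) d v - app (U (m - int J + int L) (n + int J - int L)) d v" for L
    proof (induction L)
      case (Suc L)
      have "{m - int J + 1..m - int J + int (Suc L)} = insert (m - int J + int L + 1) {m - int J + 1..m - int J + int L}" by auto
      then show ?case using Suc by (simp add: Nd(1) algebra_simps)
    qed simp
    have "app (lsum (\<lambda>k. N k (m + n + 1 - k))) d v = (\<Sum>k\<in>{m - int J + 1..m - int J + int (2 * J)}. app (N k (m + n + 1 - k)) d v)"
    proof (rule app_lsum_superset[OF S])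
      fix k assume k: "k \<notin> {m - int J + 1..m - int J + int (2 * J)}"
      then consider "k \<le> m - int J" | "k > m + int J" by fastforce
      then show "app (N k (m + n + 1 - k)) d v = 0"
      proof cases
        case 1 then show ?thesis using J P by (simp add: Nd(2))
      next
        case 2 then show ?thesis using J Q by (simp add: Nd(1))
      qed
    qed simp
    also have "\<dots> = app (U (m - int J) (n + int J)) d v"
      unfolding tele using J Q by simp
    also have "\<dots> = ?D (- int J)" using J P by simp
    also have "\<dots> = app (U m n - U' m n) d v" unfolding Dconst by simp
    finally show "app (U m n - U' m n) d v = app (lsum (\<lambda>k. N k (m + n + 1 - k))) d v" ..
  qed
qed

section \<open>The currents \<open>h\<close>\<close>

text \<open>The translation \<open>sh\<close> of operator coefficients agrees with the translation
  inside the Fock series. It is stated as a relation so that it can be established factor by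
  factor.\<close>

definition shmu :: "complex \<Rightarrow> 'i::finite fock fps fps \<Rightarrow> 'i fock fps fps \<Rightarrow> bool" where
  "shmu c x y \<longleftrightarrow> (\<forall>m. sh c (mu x) m = mu y m)"

text \<open>A nonnegative power of z + c\<hbar> contains no negative powers of z: the upper entry of
  the binomial is a natural number below e.\<close>

lemma gb_neg: "m < 0 \<Longrightarrow> m + int e \<ge> 0 \<Longrightarrow> gb c m e = 0"
proof -
  assume m: "m < 0" "m + int e \<ge> 0"
  then obtain k where k: "m + int e = int k" using nonneg_int_cases by blast
  then have "k < e" using m by simp
  then have "(of_nat k gchoose e :: complex) = 0"
    by (simp add: binomial_gbinomial[symmetric] binomial_eq_0)
  then show ?thesis using k by (simp add: gb_def)
qed

lemma sh_mu_neg: "m < 0 \<Longrightarrow> sh c (mu x) m = 0"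
  unfolding sh_def
proof -
  assume m: "m < 0"
  have "xp (gb c m e) e * mu x (m + int e) = 0" for e
    using gb_neg[OF m, of e c] by (cases "m + int e < 0") auto
  then show "lsum (\<lambda>e. xp (gb c m e) e * mu x (m + int e)) = 0" by simp
qed

lemma shmu_Ec: "shmu c (Ec b f) (Ec (b + c) f)"
  unfolding shmu_def
proof
  fix m
  show "sh c (mu (Ec b f)) m = mu (Ec (b + c) f) m"
  proof (cases "m < 0")
    case False
    then obtain M where m: "m = int M" using nonneg_int_cases[of m] by auto
    show ?thesis
    proof (rule app_eqI)
      fix d v
      have "app (sh c (mu (Ec b f)) m) d v
          = (\<Sum>e\<le>d. vscale (of_nat (M + d choose d) * (of_nat (d choose e) * c ^ e * b ^ (d - e))) (ap (mo (fps_nth f (M + d))) v))"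
        unfolding app_sh
      proof (rule sum.cong[OF refl])
        fix e assume "e \<in> {..d}"
        then have e: "e \<le> d" by simp
        have "(M + e choose e) * (M + d choose (d - e)) = (M + d choose d) * (d choose e)"
          using choose_mult[of "d - e" d "M + d"] e by (simp add: binomial_symmetric[of "e" d, symmetric] mult.commute algebra_simps)
        then have g: "of_nat (M + e choose e) * of_nat (M + d choose (d - e)) = of_nat (M + d choose d) * (of_nat (d choose e) :: complex)"
          by (metis of_nat_mult)
        have gbe: "gb c m e = of_nat (M + e choose e) * c ^ e"
          by (simp add: gb_def m binomial_gbinomial)
        have ap: "app (mu (Ec b f) (m + int e)) (d - e) v = vscale (of_nat (M + d choose (d - e)) * b ^ (d - e)) (ap (mo (fps_nth f (M + d))) v)"
        proof -
          have M: "M + e + (d - e) = M + d" using e by simp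
          have "app (mu (Ec b f) (m + int e)) (d - e) v = ap (fps_nth (mu (Ec b f) (int (M + e))) (d - e)) v"
            by (simp add: app_def m)
          then show ?thesis unfolding mu_Ec_nth M ap_simps ap_sc .
        qed
        have "gb c m e * (of_nat (M + d choose (d - e)) * b ^ (d - e))
            = (of_nat (M + e choose e) * of_nat (M + d choose (d - e))) * (c ^ e * b ^ (d - e))"
          unfolding gbe by (simp only: mult_ac)
        also have "\<dots> = of_nat (M + d choose d) * (of_nat (d choose e) * c ^ e * b ^ (d - e))"
          unfolding g by (simp only: mult_ac)
        finally show "vscale (gb c m e) (app (mu (Ec b f) (m + int e)) (d - e) v)
            = vscale (of_nat (M + d choose d) * (of_nat (d choose e) * c ^ e * b ^ (d - e))) (ap (mo (fps_nth f (M + d))) v)"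
          unfolding ap by simp
      qed
      also have "\<dots> = vscale (of_nat (M + d choose d) * (b + c) ^ d) (ap (mo (fps_nth f (M + d))) v)"
        unfolding add.commute[of b c] binomial_ring by (simp add: vs.scale_sum_left sum_distrib_left)
      also have "\<dots> = app (mu (Ec (b + c) f) m) d v"
        unfolding app_def m mu_Ec_nth ap_simps ap_sc ..
      finally show "app (sh c (mu (Ec b f)) m) d v = app (mu (Ec (b + c) f) m) d v" .
    qed
  qed (simp add: sh_mu_neg)
qed

lemma sumbl_mu_conv: "(\<And>p. p > m \<Longrightarrow> A (m - p) = 0) \<Longrightarrow> sumbl (\<lambda>p. A (m - p) * (1 * mu y p))"
  by (rule sumbl_finite, rule finite_subset[of _ "{0..m}"]) (auto, metis mu_neg mult_zero_right not_le, metis mult_zero_left not_le)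

lemma mu_mult_lsum: "mu (x * y) m = lsum (\<lambda>p. mu x (m - p) * (1 * mu y p))"
proof -
  have "lsum (\<lambda>p. mu x (m - p) * (1 * mu y p)) = (\<Sum>p\<in>{0..m}. mu x (m - p) * mu y p)"
    by (subst lsum_finite[of "{0..m}"]) (auto simp: not_le)
  also have "\<dots> = (\<Sum>k\<in>{0..m}. mu x k * mu y (m - k))"
    by (rule sum.reindex_bij_witness[of _ "\<lambda>k. m - k" "\<lambda>p. m - p"]) auto
  finally show ?thesis by (simp add: mu_mult)
qed

lemma shmu_mult: "shmu c x x' \<Longrightarrow> shmu c y y' \<Longrightarrow> shmu c (x * y) (x' * y')"
  unfolding shmu_def
proof
  fix m
  assume x: "\<forall>m. sh c (mu x) m = mu x' m" and y: "\<forall>m. sh c (mu y) m = mu y' m"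
  have "sh c (mu (x * y)) m = sh c (\<lambda>m. lsum (\<lambda>p. mu x (m - p) * (1 * mu y p))) m"
    unfolding mu_mult_lsum[abs_def] ..
  also have "\<dots> = lsum (\<lambda>p. sh c (mu x) (m - p) * (1 * sh c (mu y) p))"
    by (rule sh_conv) (rule sumbl_mu_conv, simp add: x)+
  finally show "sh c (mu (x * y)) m = mu (x' * y') m" unfolding mu_mult_lsum using x y by simp
qed

lemma shmu_one: "shmu c 1 1"
  using shmu_Ec[of c 0 1] by simp

lemma shmu_prod: "(\<And>j. j \<in> J \<Longrightarrow> shmu c (x j) (y j)) \<Longrightarrow> shmu c (\<Prod>j\<in>J. x j) (\<Prod>j\<in>J. y j)"
  by (induction J rule: infinite_finite_induct) (auto simp: shmu_mult shmu_one)

lemma lsum_conv_swap: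
  assumes "sumbl T" "\<And>p. sumbl (\<lambda>q. G q p)"
  shows "lsum (\<lambda>q. lsum (\<lambda>p. G q p * T p)) = lsum (\<lambda>p. lsum (\<lambda>q. G q p) * T p)"
proof -
  have "sumbl (\<lambda>(q, p). G q p * T p)" by (rule sumbl_pairI) (rule assms)+
  then have "lsum (\<lambda>q. lsum (\<lambda>p. G q p * T p)) = lsum (\<lambda>p. lsum (\<lambda>q. G q p * T p))"
    using lsum_swap[of "\<lambda>q p. G q p * T p"] by simp
  then show ?thesis by (simp add: lsum_mult_right assms)
qed

context vertex
begin

text \<open>T^-(z) T^+(z + \<hbar>), which arises as the residue on z = w + \<hbar>;
  \<open>Kp\<close> is the same series multiplied by z^2 and recentred by \<hbar>/2.\<close>

definition Cc :: "'i \<Rightarrow> int \<Rightarrow> 'i vend fps" where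
  "Cc i m = lsum (\<lambda>p. vT Minus i p * sh 1 (vT Plus i) (m - p))"

lemma sumbl_sT: "sumbl (sh c (vT s i))"
  by (rule sumbl_sh[OF sumbl_vT])

lemma sumbl_Cc_terms: "sumbl (\<lambda>p. G p * sh c (vT s i) (m - p))"
  by (rule sumbl_mult_left) (simp add: sumbl_sT)

lemma sumbl_Cc: "sumbl (Cc i)"
proof -
  have "sumbl (\<lambda>(p, q). vT Minus i p * sh 1 (vT Plus i) q)"
    by (rule sumbl_pairI[OF sumbl_sT sumbl_vT])
  from sumbl_reindex[OF this, of "\<lambda>(p, m). (p, m - p)"]
  have "sumbl (\<lambda>(p, m). vT Minus i p * sh 1 (vT Plus i) (m - p))"
    by (simp add: inj_def case_prod_unfold)
  from lsum_pair(1)[OF this] show ?thesis unfolding Cc_def[abs_def] .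
qed

text \<open>Ordering the double sum by powers of \<hbar> makes \<open>vT_pair_zero\<close> and
  \<open>vT_conv\<close> applicable at each order.\<close>

lemma Cc_expand: "Cc i m = lsum (\<lambda>e. xp 1 e * lsum (\<lambda>p. cs (gb 1 (m - p) e) * (vT Minus i p * vT Plus i (m - p + int e))))"
proof -
  have xpcs: "xp k e = xp 1 e * cs k" for k e
    by (simp add: xp_def cs_commute)
  have F: "sumbl (\<lambda>p. cs (k p) * (vT Minus i p * vT Plus i (m - p + int e)))" for k e
    by (rule sumbl_mult_left, rule sumbl_mult_left)
       (use sumbl_vT[of Plus i] in \<open>simp only: sumbl_shift(3)[of "\<lambda>p. vT Plus i (p + int e)" m] sumbl_shift(1)\<close>)
  have "Cc i m = lsum (\<lambda>p. lsum (\<lambda>e. xp (gb 1 (m - p) e) e * (vT Minus i p * vT Plus i (m - p + int e))))"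
    unfolding Cc_def sh_def by (simp add: lsum_mult_left[OF sumbl_xp] xp_left_commute[of "vT Minus i p" for p])
  also have "\<dots> = lsum (\<lambda>e. lsum (\<lambda>p. xp (gb 1 (m - p) e) e * (vT Minus i p * vT Plus i (m - p + int e))))"
  proof (rule lsum_swap, rule sumbl_pair_swap, rule sumbl_xp_pair, rule sumbl_mult_left)
    show "sumbl (\<lambda>p. vT Plus i (m - p + int e))" for e
      using sumbl_vT[of Plus i] by (simp only: sumbl_shift(3)[of "\<lambda>p. vT Plus i (p + int e)" m] sumbl_shift(1))
  qed
  also have "\<dots> = lsum (\<lambda>e. xp 1 e * lsum (\<lambda>p. cs (gb 1 (m - p) e) * (vT Minus i p * vT Plus i (m - p + int e))))"
    unfolding xpcs[of "gb 1 k e" for k e] mult.assoc using lsum_mult_left[OF F, of "xp 1 e" for e] by simp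
  finally show ?thesis .
qed

lemma Cc_pos: "m > - 2 \<Longrightarrow> Cc i m = 0"
  unfolding Cc_expand by (simp add: vT_pair_zero)

text \<open>By \<open>vT_pair_zero\<close> only the term without \<hbar> reaches the index -2, and
  there \<open>vT_conv\<close> applies.\<close>

lemma Cc_top: "Cc i (- 2) = 1"
proof -
  have "xp 1 e * lsum (\<lambda>p. cs (gb 1 (- 2 - p) e) * (vT Minus i p * vT Plus i (- 2 - p + int e))) = 0" if "e \<noteq> 0" for e
    using that by (simp add: vT_pair_zero)
  then have "Cc i (- 2) = xp 1 0 * lsum (\<lambda>p. cs (gb 1 (- 2 - p) 0) * (vT Minus i p * vT Plus i (- 2 - p + int 0)))"
    unfolding Cc_expand by (rule lsum_single)
  then show ?thesis using vT_conv[of i "- 2"] by simp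
qed

lemma Cc_mod: "app (Cc i m) 0 v = (v when m = - 2)"
proof -
  have "app (Cc i m) 0 v = app (lsum (\<lambda>p. vT Minus i p * vT Plus i (m - p))) 0 v"
    unfolding Cc_expand app_lsum_xp by simp
  then show ?thesis unfolding vT_conv by (simp add: app_one when_def)
qed

text \<open>\<open>Kp\<close> is \<open>1 + \<hbar> h\<^sup>+(z) = (z - \<hbar>/2)\<^sup>2 T\<^sup>-(z - \<hbar>/2) T\<^sup>+(z + \<hbar>/2)\<close>, and \<open>1 - \<hbar> h\<^sup>-(z)\<close> is
  \<open>A\<^sup>+(z) A\<^sup>-(z)\<close>, the series \<open>kap\<close>.  Both are 1 modulo \<open>\<hbar>\<close>, so that the division below is exact.\<close>

definition Kp :: "'i \<Rightarrow> int \<Rightarrow> 'i vend fps" where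
  "Kp i m = sh (- 1 / 2) (\<lambda>m. Cc i (m - 2)) m"

lemma Kp_nonneg: "m \<ge> 0 \<Longrightarrow> Kp i m = (1 when m = 0)"
proof -
  assume m: "m \<ge> 0"
  have "Kp i m = xp (gb (- 1 / 2) m 0) 0 * Cc i (m + int 0 - 2)"
    unfolding Kp_def sh_def by (rule lsum_single) (use m in \<open>simp add: Cc_pos\<close>)
  then show ?thesis using m by (cases "m = 0") (simp_all add: Cc_pos Cc_top)
qed

lemma Kp_mod: "fps_nth (Kp i m) 0 = (1 when m = 0)"
proof (rule vend_eqI)
  fix v
  have "app (Kp i m) 0 v = app (Cc i (m - 2)) 0 v" by (simp add: Kp_def app_sh)
  then show "ap (fps_nth (Kp i m) 0) v = ap (1 when m = 0) v"
    using Cc_mod[of i "m - 2" v] by (simp add: app_def when_def)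
qed

lemma sh_half_Kp: "sh (1 / 2) (Kp i) m = Cc i (m - 2)"
  using sh_sh[of "1 / 2" "- 1 / 2" "\<lambda>m. Cc i (m - 2)" m] by (simp add: Kp_def[abs_def])

definition hpl :: "'i \<Rightarrow> int \<Rightarrow> 'i vend fps" where "hpl i m = fps_shift 1 (Kp i m)"

definition hmi :: "'i \<Rightarrow> int \<Rightarrow> 'i vend fps" where "hmi i m = - fps_shift 1 (mu (kap i) m)"

lemma hb_1: "hb 1 = fps_X"
  by (simp add: hb_def)

lemma X_fps_shift: "fps_X * fps_shift 1 x = x - fps_const (fps_nth x 0)" for x :: "'b::ring_1 fps"
  by (rule fps_ext) simp

lemma hb_hpl: "hb 1 * hpl i m = Kp i m - (1 when m = 0)"
  unfolding hb_1 hpl_def X_fps_shift Kp_mod by (simp add: when_def)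

lemma Ec_at_0: "fps_nth (fps_nth (Ec c f) m) 0 = fps_nth f m"
  by (simp add: Ec_nth)

text \<open>Modulo \<hbar> all shifts disappear and the factors of opposite sign cancel;
  \<open>r\<close> is this reduction, which is multiplicative.\<close>

lemma kap_mod: "fps_nth (fps_nth (kap i) m) 0 = (1 when m = 0)"
proof -
  define r where "r x = Abs_fps (\<lambda>m. fps_nth (fps_nth x m) 0)" for x :: "'i fock fps fps"
  have r1: "r 1 = 1" by (rule fps_ext) (simp add: r_def)
  have rm: "r (x * y) = r x * r y" for x y
    by (rule fps_ext) (simp add: r_def fps_mult_nth fps_sum_nth atLeast0AtMost)
  have rE: "r (Ec c f) = f" for c f by (rule fps_ext) (simp add: r_def Ec_at_0)
  have rp: "r (\<Prod>j\<in>J. x j) = (\<Prod>j\<in>J. r (x j))" for x :: "'i \<Rightarrow> 'i fock fps fps" and J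
    by (induction J rule: infinite_finite_induct) (simp_all add: r1 rm)
  have g: "gh Plus j * gh Minus j = 1" for j using gh_inverse[of Plus j] by simp
  have "r (kap i) = 1" unfolding kap_eq rm rE rp g by simp
  then have "fps_nth (r (kap i)) m = fps_nth 1 m" by simp
  then show ?thesis by (simp add: r_def when_def)
qed

lemma hb_hmi: "hb 1 * hmi i m = (1 when m = 0) - mu (kap i) m"
proof -
  have "fps_nth (mu (kap i) m) 0 = (1 when m = 0)"
    by (cases "m \<ge> 0") (auto simp: mu_def kap_mod when_def nat_eq_iff)
  then show ?thesis unfolding hb_1 hmi_def mult_minus_right X_fps_shift by (simp add: when_def)
qed

lemma hpl_zero: "m \<ge> 0 \<Longrightarrow> hpl i m = 0"
  by (rule fps_ext) (simp add: hpl_def Kp_nonneg when_def)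

lemma hmi_zero: "m < 0 \<Longrightarrow> hmi i m = 0"
  by (simp add: hmi_def)

lemma hb_cancel: "hb 1 * x = hb 1 * y \<Longrightarrow> x = y"
proof (rule fps_ext)
  fix n assume "hb 1 * x = hb 1 * y"
  then have "fps_nth (fps_X * x) (Suc n) = fps_nth (fps_X * y) (Suc n)" unfolding hb_1 by (rule arg_cong)
  then show "fps_nth x n = fps_nth y n" by simp
qed

section \<open>Commutators of vertex operators of opposite sign\<close>

text \<open>Evaluation of a normally ordered product on the diagonal: summation over b sets the two
  variables equal, the creation series multiply to E, and the annihilation series are
  convolved.\<close>

lemma Xf_conv:
  assumes A: "\<And>k. k < 0 \<Longrightarrow> A k = 0" and T: "sumbl T"
    and E: "\<And>l. (\<Sum>k\<in>{0..l}. A k * al t i (l - k)) = mu E l"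
  shows "lsum (\<lambda>b. lsum (\<lambda>p. A (b - p) * (Xf t i (s - b) * T p))) = lsum (\<lambda>l. mu E l * lsum (\<lambda>p. vT t i (s - l - p) * T p))"
proof -
  have fin: "sumbl (\<lambda>b. A (b - p) * al t i (s - b - q))" for p q
    by (rule sumbl_finite, rule finite_subset[of _ "{p..s - q}"])
       (auto, metis A diff_less_0_iff_less mult_zero_left not_le, metis mu_neg mult_zero_right diff_diff_eq diff_diff_eq2 diff_less_0_iff_less add.commute not_le)
  have AX: "A (b - p) * Xf t i (s - b) = lsum (\<lambda>q. A (b - p) * al t i (s - b - q) * vT t i q)" for b p
    unfolding Xf_def by (simp add: lsum_mult_left sumbl_al_vT mult.assoc)
  have pr: "sumbl (\<lambda>(b, q). A (b - p) * al t i (s - b - q) * vT t i q)" for p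
    by (rule sumbl_pairI[OF sumbl_vT fin])
  have sAX: "sumbl (\<lambda>b. A (b - p) * Xf t i (s - b))" for p
    unfolding AX using lsum_pair(1)[OF sumbl_pair_swap[OF pr]] .
  have inner: "lsum (\<lambda>b. A (b - p) * al t i (s - b - q)) = mu E (s - p - q)" for p q
  proof -
    have "lsum (\<lambda>b. A (b - p) * al t i (s - b - q)) = (\<Sum>b\<in>{p..s - q}. A (b - p) * al t i (s - b - q))"
      by (rule lsum_finite) (auto simp: A)
    also have "\<dots> = (\<Sum>k\<in>{0..s - p - q}. A k * al t i (s - p - q - k))"
      by (rule sum.reindex_bij_witness[of _ "\<lambda>k. k + p" "\<lambda>b. b - p"]) (auto simp: algebra_simps)
    finally show ?thesis unfolding E .
  qed
  have "lsum (\<lambda>b. lsum (\<lambda>p. A (b - p) * (Xf t i (s - b) * T p))) = lsum (\<lambda>p. lsum (\<lambda>b. A (b - p) * Xf t i (s - b)) * T p)"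
    unfolding mult.assoc[symmetric] by (rule lsum_conv_swap[OF T sAX])
  also have "\<dots> = lsum (\<lambda>p. lsum (\<lambda>q. mu E (s - p - q) * vT t i q) * T p)"
    unfolding AX lsum_conv_swap[OF sumbl_vT fin] inner ..
  also have "\<dots> = lsum (\<lambda>p. lsum (\<lambda>l. mu E l * vT t i (s - p - l)) * T p)"
  proof -
    have "lsum (\<lambda>q. mu E (s - p - q) * vT t i q) = lsum (\<lambda>l. mu E l * vT t i (s - p - l))" for p
      using lsum_shift(3)[OF sumbl_al_vT(1)[of "\<lambda>q. mu E (s - p - q)" t i], of "s - p"] by simp
    then show ?thesis by simp
  qed
  also have "\<dots> = lsum (\<lambda>l. lsum (\<lambda>p. mu E l * vT t i (s - p - l) * T p))"
    by (rule lsum_conv_swap[OF T, symmetric]) (rule sumbl_al_vT)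
  also have "\<dots> = lsum (\<lambda>l. mu E l * lsum (\<lambda>p. vT t i (s - l - p) * T p))"
    using lsum_mult_left[OF sumbl_mult_left[OF T], of "mu E l" "\<lambda>p. vT t i (s - l - p)" for l]
    by (simp add: mult.assoc diff_diff_eq add.commute)
  finally show ?thesis .
qed

text \<open>\<hbar> is the difference of z - w and z - w - \<hbar>. Multiplying the commutator by
  one of these factors removes one of its two poles, and \<open>delta_lemma\<close> evaluates the
  residue at the other.\<close>

lemma Xf_commutator:
  "hb 1 * commutator (Xf Plus i m) (Xf Minus i n) = sh (- 1) (\<lambda>m. Cc i (m + n - 1)) m - mu (kap i) (m + n + 1)"
proof -
  let ?G = "\<lambda>m n. Xf Plus i m * Xf Minus i n" and ?G' = "\<lambda>m n. Xf Minus i n * Xf Plus i m"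
  let ?N = "\<lambda>m n. NO Plus i (Xf Minus i (n - 2)) m"
  have c: "pm Plus * pm Minus * a i i \<le> 0" by simp
  have G: "zw (hb 0) (zw (hb (- 1)) ?G) m n = ?N m n" for m n
    using Xf_Xf_neg[OF c, of m n] by (simp add: Qop_def)
  have G': "zw (hb 0) (zw (hb (- 1)) ?G') m n = ?N m n" for m n
    using Xf_Xf_neg'[OF c, of n m] zw_swap2[of 0 1 ?G' n m] by (simp add: Qop_def)
  have nG: "ntr ?G" by (intro ntr_mult_left ntr_Xf)
  have nG': "ntr (\<lambda>n m. ?G' m n)" by (intro ntr_mult_left ntr_Xf)
  have swp: "(\<lambda>n m. zw (hb u) ?G' m n) = (\<lambda>n m. - zw (hb (- u)) (\<lambda>n m. ?G' m n) n m)" for u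
    using zw_swap[of "- u" ?G'] by (intro ext) simp
  have nzw: "ntr (zw (hb u) ?G)" "ntr (\<lambda>n m. zw (hb u) ?G' m n)" for u
    unfolding swp by (intro ntr_zw nG ntr_uminus nG')+
  \<comment> \<open>Residue on z = w: the creation halves give A^+ A^-, the annihilation halves z^-2
    by \<open>vT_conv\<close>.\<close>
  have D0: "zw (hb (- 1)) ?G m n - zw (hb (- 1)) ?G' m n = mu (kap i) (m + n + 1)"
  proof -
    have "zw (hb (- 1)) ?G m n - zw (hb (- 1)) ?G' m n = lsum (\<lambda>k. ?N k (m + n + 1 - k))"
      by (rule delta_lemma(2)[OF nzw]) (rule G, rule G')
    also have "\<dots> = lsum (\<lambda>k. lsum (\<lambda>p. al Plus i (k - p) * (Xf Minus i (m + n - 1 - k) * vT Plus i p)))"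
      unfolding NO_def by (simp add: algebra_simps)
    also have "\<dots> = lsum (\<lambda>l. mu (kap i) l * lsum (\<lambda>p. vT Minus i (m + n - 1 - l - p) * vT Plus i p))"
      by (rule Xf_conv[OF _ sumbl_vT]) (simp_all add: kap_def mu_mult)
    also have "\<dots> = lsum (\<lambda>l. mu (kap i) l * (1 when m + n - 1 - l = - 2))"
    proof -
      have "lsum (\<lambda>p. vT Minus i (r - p) * vT Plus i p) = (1 when r = - 2)" for r
        using lsum_shift(3)[OF sumbl_vT_vT[where s = Minus and i = i and t = Plus and j = i and m = r], of r] vT_conv[of i r]
        by simp
      then show ?thesis by simp
    qed
    also have "\<dots> = mu (kap i) (m + n + 1) * (1 when m + n - 1 - (m + n + 1) = - 2)"
      by (rule lsum_single) (auto simp: when_def)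
    finally show ?thesis by simp
  qed
  \<comment> \<open>Residue on z = w + \<hbar>: translating z by \<hbar> brings this pole to the
    diagonal. There A^+(w + \<hbar>) A^-(w) = 1, and the annihilation halves give
    \<open>Cc\<close>.\<close>
  have D1: "sh 1 (\<lambda>m. zw (hb 0) ?G m n) m - sh 1 (\<lambda>m. zw (hb 0) ?G' m n) m = Cc i (m + n - 1)" for m n
  proof -
    let ?sN = "\<lambda>m n. sh 1 (\<lambda>m. ?N m n) m"
    have sN: "zw (hb 0) (\<lambda>m n. sh 1 (\<lambda>m. zw (hb 0) H m n) m) m n = ?sN m n"
      if "\<And>m n. zw (hb 0) (zw (hb (- 1)) H) m n = ?N m n" for H m n
    proof -
      have "zw (hb (- 1 + 1)) (\<lambda>m n. sh 1 (\<lambda>m. zw (hb 0) H m n) m) m n = sh 1 (\<lambda>m. zw (hb (- 1)) (zw (hb 0) H) m n) m"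
        by (rule sh_zw[symmetric])
      also have "(\<lambda>m. zw (hb (- 1)) (zw (hb 0) H) m n) = (\<lambda>m. ?N m n)"
        using that zw_hb_commute[of "- 1" 0 H] by simp
      finally show ?thesis by simp
    qed
    have sNk: "?sN k l = lsum (\<lambda>p. sh 1 (al Plus i) (k - p) * (Xf Minus i (l - 2) * sh 1 (vT Plus i) p))" for k l
      unfolding NO_def by (rule sh_conv; rule sumbl_al_B_vT)
    have "sh 1 (\<lambda>m. zw (hb 0) ?G m n) m - sh 1 (\<lambda>m. zw (hb 0) ?G' m n) m = lsum (\<lambda>k. ?sN k (m + n + 1 - k))"
      by (rule delta_lemma(2)[OF ntr_sh[OF nzw(1)] mtr_sh[OF nzw(2)]]) (rule sN, rule G, rule sN, rule G')
    also have "\<dots> = lsum (\<lambda>k. lsum (\<lambda>p. sh 1 (al Plus i) (k - p) * (Xf Minus i (m + n - 1 - k) * sh 1 (vT Plus i) p)))"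
      unfolding sNk by (simp add: algebra_simps)
    also have "\<dots> = lsum (\<lambda>l. mu 1 l * lsum (\<lambda>p. vT Minus i (m + n - 1 - l - p) * sh 1 (vT Plus i) p))"
    proof (rule Xf_conv[OF _ sumbl_sT])
      let ?x = "Ec 1 (gh Plus i) * Ec 0 (gh Plus i) * (\<Prod>j\<in>nbrs a i. Ec (1 / 2) (gh Minus j))"
      have "shmu 1 (vA a Plus i) (Ec (0 + 1) (gh Plus i) * Ec (- 1 + 1) (gh Plus i) * (\<Prod>j\<in>nbrs a i. Ec (- 1 / 2 + 1) (gh Minus j)))"
        unfolding vA_def pm_simps sflip.simps by (intro shmu_mult shmu_prod shmu_Ec)
      then have x: "sh 1 (al Plus i) k = mu ?x k" for k by (simp add: shmu_def)
      have "?x * vA a Minus i = (Ec 0 (gh Plus i) * Ec 0 (gh (sflip Plus) i)) * (Ec 1 (gh Plus i) * Ec 1 (gh (sflip Plus) i))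
          * ((\<Prod>j\<in>nbrs a i. Ec (1 / 2) (gh Minus j)) * (\<Prod>j\<in>nbrs a i. Ec (1 / 2) (gh (sflip Minus) j)))"
        by (simp add: vA_def mult_ac)
      also have "\<dots> = 1" by (simp only: prod.distrib[symmetric] Ec_gh_inverse) simp
      finally have xA: "?x * vA a Minus i = 1" .
      show "(\<Sum>k\<in>{0..l}. sh 1 (al Plus i) k * al Minus i (l - k)) = mu 1 l" for l
        unfolding x mu_mult[symmetric] xA ..
      show "sh 1 (al Plus i) k = 0" if "k < 0" for k by (rule sh_mu_neg[OF that])
    qed
    also have "\<dots> = mu 1 0 * lsum (\<lambda>p. vT Minus i (m + n - 1 - 0 - p) * sh 1 (vT Plus i) p)"
      by (rule lsum_single) (simp add: mu_one)
    also have "\<dots> = Cc i (m + n - 1)"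
      using lsum_shift(3)[OF sumbl_Cc_terms[of "vT Minus i" 1 Plus i "m + n - 1"], of "m + n - 1"]
      by (simp add: mu_one Cc_def)
    finally show ?thesis .
  qed
  have "zw (hb 0) ?G m n - zw (hb 0) ?G' m n = sh (- 1) (\<lambda>m. sh 1 (\<lambda>m. zw (hb 0) ?G m n - zw (hb 0) ?G' m n) m) m"
    unfolding sh_sh by simp
  also have "\<dots> = sh (- 1) (\<lambda>m. Cc i (m + n - 1)) m"
    unfolding sh_diff D1 ..
  finally have "zw (hb 0) ?G m n - zw (hb 0) ?G' m n - (zw (hb (- 1)) ?G m n - zw (hb (- 1)) ?G' m n)
      = sh (- 1) (\<lambda>m. Cc i (m + n - 1)) m - mu (kap i) (m + n + 1)"
    unfolding D0 by simp
  then show ?thesis by (simp add: zw_def commutator_def algebra_simps hb_minus)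
qed

section \<open>Relations between the currents\<close>

text \<open>The product \<open>T\<^sup>-(z) B(w) T\<^sup>+(z + \<hbar>)\<close>, half way between \<open>B(w) C(z)\<close> and \<open>C(z) B(w)\<close>.\<close>

definition Mid :: "'i \<Rightarrow> (int \<Rightarrow> 'i vend fps) \<Rightarrow> int \<Rightarrow> int \<Rightarrow> 'i vend fps" where
  "Mid i B m n = lsum (\<lambda>p. vT Minus i p * (B n * sh 1 (vT Plus i) (m - p)))"

lemma Mid_alt: "Mid i B m n = lsum (\<lambda>p. vT Minus i (m - p) * B n * sh 1 (vT Plus i) p)"
proof -
  have "sumbl (\<lambda>p. vT Minus i p * (B n * sh 1 (vT Plus i) (m - p)))"
    by (rule sumbl_mult_left, rule sumbl_Cc_terms)
  from lsum_shift(3)[OF this, of m] show ?thesis by (simp add: Mid_def mult.assoc)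
qed

lemma Cc_alt: "Cc i m = lsum (\<lambda>p. vT Minus i (m - p) * sh 1 (vT Plus i) p)"
  using lsum_shift(3)[OF sumbl_Cc_terms[of "vT Minus i" 1 Plus i m], of m] by (simp add: Cc_def)

lemma sumbl_sT_mult: "sumbl (\<lambda>p. G p * (sh 1 (vT Plus i) (m - p) * y))"
  by (rule sumbl_mult_left, rule sumbl_mult_right) (simp add: sumbl_sT)

end

text \<open>Compatibility with convolution in the first variable. The operations that occur when a
  half of \<open>Cc\<close> moves past another series are composed of factors z - w + u, shifts of n
  and signs; through this property the exchange rule of a half is lifted to \<open>Cc\<close>
  uniformly for all of them.\<close>

definition passes :: "((int \<Rightarrow> int \<Rightarrow> 'i::finite vend fps) \<Rightarrow> int \<Rightarrow> int \<Rightarrow> 'i vend fps) \<Rightarrow> bool" where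
  "passes P \<longleftrightarrow>
    (\<forall>(G :: int \<Rightarrow> 'i vend fps) F. (\<forall>m n. sumbl (\<lambda>p. G p * F (m - p) n)) \<longrightarrow>
      (\<forall>m n. sumbl (\<lambda>p. G p * P F (m - p) n) \<and> P (\<lambda>m n. lsum (\<lambda>p. G p * F (m - p) n)) m n = lsum (\<lambda>p. G p * P F (m - p) n))) \<and>
    (\<forall>(G :: int \<Rightarrow> 'i vend fps) F. (\<forall>m n. sumbl (\<lambda>p. F (m - p) n * G p)) \<longrightarrow>
      (\<forall>m n. sumbl (\<lambda>p. P F (m - p) n * G p) \<and> P (\<lambda>m n. lsum (\<lambda>p. F (m - p) n * G p)) m n = lsum (\<lambda>p. P F (m - p) n * G p)))"

lemma passes_left:
  assumes "passes P" "\<And>m n. sumbl (\<lambda>p. G p * F (m - p) n)"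
  shows "P (\<lambda>m n. lsum (\<lambda>p. G p * F (m - p) n)) m n = lsum (\<lambda>p. G p * P F (m - p) n)"
    "sumbl (\<lambda>p. G p * P F (m - p) n)"
  using assms unfolding passes_def by blast+

lemma passes_right:
  assumes "passes P" "\<And>m n. sumbl (\<lambda>p. F (m - p) n * G p)"
  shows "P (\<lambda>m n. lsum (\<lambda>p. F (m - p) n * G p)) m n = lsum (\<lambda>p. P F (m - p) n * G p)"
    "sumbl (\<lambda>p. P F (m - p) n * G p)"
  using assms unfolding passes_def by blast+

lemma passesI:
  assumes "\<And>(G :: int \<Rightarrow> 'i::finite vend fps) F m n. (\<And>m n. sumbl (\<lambda>p. G p * F (m - p) n)) \<Longrightarrow>
      sumbl (\<lambda>p. G p * P F (m - p) n) \<and> P (\<lambda>m n. lsum (\<lambda>p. G p * F (m - p) n)) m n = lsum (\<lambda>p. G p * P F (m - p) n)"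
    "\<And>(G :: int \<Rightarrow> 'i vend fps) F m n. (\<And>m n. sumbl (\<lambda>p. F (m - p) n * G p)) \<Longrightarrow>
      sumbl (\<lambda>p. P F (m - p) n * G p) \<and> P (\<lambda>m n. lsum (\<lambda>p. F (m - p) n * G p)) m n = lsum (\<lambda>p. P F (m - p) n * G p)"
  shows "passes P"
  using assms unfolding passes_def by blast

lemma passes_zw: "passes (zw (hb u) :: (int \<Rightarrow> int \<Rightarrow> 'i::finite vend fps) \<Rightarrow> _)"
proof (rule passesI)
  fix G :: "int \<Rightarrow> 'i vend fps" and F :: "int \<Rightarrow> int \<Rightarrow> 'i vend fps" and m n :: int
  assume S: "\<And>m n. sumbl (\<lambda>p. G p * F (m - p) n)"
  have e: "zw (hb u) (\<lambda>m n. G p * F (m - p) n) m n = G p * zw (hb u) F (m - p) n" for p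
    using zw_shift[of "hb u" F "- p" 0 m n] by (simp add: zw_hb_mult_left)
  from zw_lsum[of "\<lambda>p m n. G p * F (m - p) n" u m n] S
  show "sumbl (\<lambda>p. G p * zw (hb u) F (m - p) n) \<and> zw (hb u) (\<lambda>m n. lsum (\<lambda>p. G p * F (m - p) n)) m n = lsum (\<lambda>p. G p * zw (hb u) F (m - p) n)"
    unfolding e by simp
next
  fix G :: "int \<Rightarrow> 'i vend fps" and F :: "int \<Rightarrow> int \<Rightarrow> 'i vend fps" and m n :: int
  assume S: "\<And>m n. sumbl (\<lambda>p. F (m - p) n * G p)"
  have e: "zw (hb u) (\<lambda>m n. F (m - p) n * G p) m n = zw (hb u) F (m - p) n * G p" for p
    using zw_shift[of "hb u" F "- p" 0 m n] by (simp add: zw_hb_mult_right)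
  from zw_lsum[of "\<lambda>p m n. F (m - p) n * G p" u m n] S
  show "sumbl (\<lambda>p. zw (hb u) F (m - p) n * G p) \<and> zw (hb u) (\<lambda>m n. lsum (\<lambda>p. F (m - p) n * G p)) m n = lsum (\<lambda>p. zw (hb u) F (m - p) n * G p)"
    unfolding e by simp
qed

lemma passes_comp:
  fixes P Q :: "(int \<Rightarrow> int \<Rightarrow> 'i::finite vend fps) \<Rightarrow> int \<Rightarrow> int \<Rightarrow> 'i vend fps"
  assumes P: "passes P" and Q: "passes Q"
  shows "passes (\<lambda>F. P (Q F))"
proof (rule passesI)
  fix G :: "int \<Rightarrow> 'i vend fps" and F :: "int \<Rightarrow> int \<Rightarrow> 'i vend fps" and m n :: int
  assume S: "\<And>m n. sumbl (\<lambda>p. G p * F (m - p) n)"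
  have e: "Q (\<lambda>m n. lsum (\<lambda>p. G p * F (m - p) n)) = (\<lambda>m n. lsum (\<lambda>p. G p * Q F (m - p) n))"
    by (intro ext passes_left(1)[OF Q] S)
  show "sumbl (\<lambda>p. G p * P (Q F) (m - p) n) \<and> P (Q (\<lambda>m n. lsum (\<lambda>p. G p * F (m - p) n))) m n = lsum (\<lambda>p. G p * P (Q F) (m - p) n)"
    unfolding e by (intro conjI passes_left[OF P] passes_left(2)[OF Q] S)
next
  fix G :: "int \<Rightarrow> 'i vend fps" and F :: "int \<Rightarrow> int \<Rightarrow> 'i vend fps" and m n :: int
  assume S: "\<And>m n. sumbl (\<lambda>p. F (m - p) n * G p)"
  have e: "Q (\<lambda>m n. lsum (\<lambda>p. F (m - p) n * G p)) = (\<lambda>m n. lsum (\<lambda>p. Q F (m - p) n * G p))"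
    by (intro ext passes_right(1)[OF Q] S)
  show "sumbl (\<lambda>p. P (Q F) (m - p) n * G p) \<and> P (Q (\<lambda>m n. lsum (\<lambda>p. F (m - p) n * G p))) m n = lsum (\<lambda>p. P (Q F) (m - p) n * G p)"
    unfolding e by (intro conjI passes_right[OF P] passes_right(2)[OF Q] S)
qed

lemma passes_shift: "passes (\<lambda>F m n. F m (n + c))"
  by (rule passesI) auto

lemma passes_uminus: "passes (\<lambda>F m n. - F m n)"
  by (rule passesI) (auto simp: sumbl_uminus lsum_uminus)

lemma passes_id: "passes (\<lambda>F. F)"
  by (rule passesI) auto

context vertex
begin

lemma Cc_B:
  assumes P: "passes P" and Q: "passes Q"
    and rel: "\<And>m n. P (\<lambda>m n. sh 1 (vT Plus i) m * B n) m n = Q (\<lambda>m n. B n * sh 1 (vT Plus i) m) m n"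
  shows "P (\<lambda>m n. Cc i m * B n) m n = Q (Mid i B) m n"
proof -
  have "(\<lambda>m n. Cc i m * B n) = (\<lambda>m n. lsum (\<lambda>p. vT Minus i p * (sh 1 (vT Plus i) (m - p) * B n)))"
    unfolding Cc_def by (simp add: lsum_mult_right sumbl_Cc_terms mult.assoc)
  then have "P (\<lambda>m n. Cc i m * B n) m n = lsum (\<lambda>p. vT Minus i p * P (\<lambda>m n. sh 1 (vT Plus i) m * B n) (m - p) n)"
    using passes_left(1)[OF P, of "vT Minus i" "\<lambda>m n. sh 1 (vT Plus i) m * B n", OF sumbl_sT_mult] by simp
  also have "\<dots> = Q (Mid i B) m n"
    unfolding rel Mid_def[abs_def]
    using passes_left(1)[OF Q, of "vT Minus i" "\<lambda>m n. B n * sh 1 (vT Plus i) m", OF sumbl_mult_left[OF sumbl_Cc_terms]] by simp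
  finally show ?thesis .
qed

lemma B_Cc:
  assumes P: "passes P" and Q: "passes Q"
    and rel: "\<And>m n. P (\<lambda>m n. vT Minus i m * B n) m n = Q (\<lambda>m n. B n * vT Minus i m) m n"
  shows "P (Mid i B) m n = Q (\<lambda>m n. B n * Cc i m) m n"
proof -
  have "P (Mid i B) m n = lsum (\<lambda>p. P (\<lambda>m n. vT Minus i m * B n) (m - p) n * sh 1 (vT Plus i) p)"
    unfolding Mid_alt[abs_def]
    using passes_right(1)[OF P, of "\<lambda>m n. vT Minus i m * B n" "sh 1 (vT Plus i)", OF sumbl_mult_left[OF sumbl_sT]] by simp
  also have "\<dots> = Q (\<lambda>m n. lsum (\<lambda>p. B n * vT Minus i (m - p) * sh 1 (vT Plus i) p)) m n"
    unfolding rel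
    using passes_right(1)[OF Q, of "\<lambda>m n. B n * vT Minus i m" "sh 1 (vT Plus i)", OF sumbl_mult_left[OF sumbl_sT]] by simp
  also have "(\<lambda>m n. lsum (\<lambda>p. B n * vT Minus i (m - p) * sh 1 (vT Plus i) p)) = (\<lambda>m n. B n * Cc i m)"
    unfolding Cc_alt by (simp add: lsum_mult_left sumbl_mult_left[OF sumbl_sT] mult.assoc)
  finally show ?thesis .
qed

lemma sh_zw2: "sh c (\<lambda>m. zw (hb u) (zw (hb v) F) m n) m = zw (hb (u + c)) (zw (hb (v + c)) (\<lambda>m n. sh c (\<lambda>m. F m n) m)) m n"
proof -
  have "(\<lambda>m n. sh c (\<lambda>m. zw (hb v) F m n) m) = zw (hb (v + c)) (\<lambda>m n. sh c (\<lambda>m. F m n) m)"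
    by (intro ext sh_zw)
  then show ?thesis by (simp add: sh_zw)
qed

lemma sh_eqI: "(\<And>m. F m = G m) \<Longrightarrow> sh c F m = sh c G m"
  by (simp add: sh_def)

lemma Kp_B:
  assumes "\<And>m n. zw (hb u) (\<lambda>m n. Cc i m * B n) m n = zw (hb v) (\<lambda>m n. B n * Cc i m) m n"
  shows "zw (hb (u - 1 / 2)) (\<lambda>m n. Kp i m * B n) m n = zw (hb (v - 1 / 2)) (\<lambda>m n. B n * Kp i m) m n"
proof -
  have "sh (- 1 / 2) (\<lambda>m. zw (hb u) (\<lambda>m n. Cc i m * B n) (m - 2) n) m = sh (- 1 / 2) (\<lambda>m. zw (hb v) (\<lambda>m n. B n * Cc i m) (m - 2) n) m"
    by (rule sh_eqI) (rule assms)
  moreover have "zw (hb u) F (m - 2) n = zw (hb u) (\<lambda>m n. F (m - 2) n) m n" for u m n and F :: "int \<Rightarrow> int \<Rightarrow> 'i vend fps"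
    using zw_shift[of "hb u" F "- 2" 0 m n] by simp
  ultimately have "zw (hb (u + - 1 / 2)) (\<lambda>m n. sh (- 1 / 2) (\<lambda>m. Cc i (m - 2) * B n) m) m n
      = zw (hb (v + - 1 / 2)) (\<lambda>m n. sh (- 1 / 2) (\<lambda>m. B n * Cc i (m - 2)) m) m n"
    by (simp only: sh_zw)
  moreover have "x + - 1 / 2 = x - 1 / 2" for x :: complex by simp
  ultimately show ?thesis by (simp only: sh_mult_left sh_mult_right Kp_def)
qed

text \<open>X(w) is not the factor that acts first here. On a given vector and at a given order only
  finitely many modes of \<open>Cc\<close> are nonzero, so one bound for X(w) serves them
  all.\<close>

lemma ntr_Cc: "ntr (\<lambda>m n. Xf s j n * Cc i m)"
proof (rule ntrI)
  fix d v
  let ?A = "{(e, m). e \<le> d \<and> app (Cc i m) (d - e) v \<noteq> 0}"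
  have "?A \<subseteq> (\<Union>e\<le>d. {e} \<times> {m. app (Cc i m) (d - e) v \<noteq> 0})" by auto
  moreover have "finite (\<Union>e\<le>d. {e} \<times> {m. app (Cc i m) (d - e) v \<noteq> 0})" using sumblD[OF sumbl_Cc] by auto
  ultimately have fin: "finite ?A" by (rule finite_subset)
  have "\<exists>Q. \<forall>x\<in>?A. \<forall>(m::int) n. n < Q \<longrightarrow> (case x of (e, k) \<Rightarrow> app (Xf s j n) e (app (Cc i k) (d - e) v)) = 0"
  proof (rule ntr_finite[OF fin])
    fix x assume "x \<in> ?A"
    show "\<exists>Q::int. \<forall>(m::int) n. n < Q \<longrightarrow> (case x of (e, k) \<Rightarrow> app (Xf s j n) e (app (Cc i k) (d - e) v)) = 0"
      using ntr_Xf[of s j] unfolding ntr_def by (cases x) simp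
  qed
  then obtain Q where Q: "\<forall>x\<in>?A. \<forall>(m::int) n. n < Q \<longrightarrow> (case x of (e, k) \<Rightarrow> app (Xf s j n) e (app (Cc i k) (d - e) v)) = 0"
    by blast
  show "\<exists>Q. \<forall>m n. n < Q \<longrightarrow> app (Xf s j n * Cc i m) d v = 0"
  proof (intro exI[of _ Q] allI impI)
    fix m n :: int assume n: "n < Q"
    have "app (Xf s j n) e (app (Cc i m) (d - e) v) = 0" if "e \<le> d" for e
      using Q n that by (cases "app (Cc i m) (d - e) v = 0") auto
    then show "app (Xf s j n * Cc i m) d v = 0" by (simp add: app_mult)
  qed
qed

text \<open>B is carried first past T^+(z + \<hbar>), which gives \<open>Mid\<close>, and then past
  T^-(z).\<close>

lemma Cc_B_gen:
  assumes P: "passes P" "passes Q" "passes P'" "passes Q'"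
    and rel: "\<And>m n. P (\<lambda>m n. sh 1 (vT Plus i) m * B n) m n = Q (\<lambda>m n. B n * sh 1 (vT Plus i) m) m n"
    and rel': "\<And>m n. P' (\<lambda>m n. vT Minus i m * B n) m n = Q' (\<lambda>m n. B n * vT Minus i m) m n"
    and comm: "\<And>F. P' (Q F) = Q (P' F)"
  shows "P' (P (\<lambda>m n. Cc i m * B n)) = Q (Q' (\<lambda>m n. B n * Cc i m))"
proof -
  have "P (\<lambda>m n. Cc i m * B n) = Q (Mid i B)" by (intro ext Cc_B[OF P(1,2)] rel)
  moreover have "P' (Mid i B) = Q' (\<lambda>m n. B n * Cc i m)" by (intro ext B_Cc[OF P(3,4)] rel')
  ultimately show ?thesis using comm[of "Mid i B"] by simp
qed

lemma zw_neg: "zw u (\<lambda>m n. - F m n) = (\<lambda>m n. - zw u F m n)"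
  by (intro ext) (simp add: zw_def)

lemma zw_shiftn: "zw u (\<lambda>m n. F m (n + q)) = (\<lambda>m n. zw u F m (n + q))"
  by (intro ext) (simp add: zw_def algebra_simps)

lemma zw_comm: "zw (hb u) (zw (hb v) F) = zw (hb v) (zw (hb u) F)"
  by (rule zw_hb_commute)

text \<open>T^+ and T^- pair oppositely with X_j: unless the pairing is 0, one contributes zeros and
  the other poles, and the factors of T^+ have z translated by \<hbar>. For i = j each side has two
  linear factors, of which one is common and is cancelled; the constants of the statement are what
  remains.\<close>

lemma Cc_Xf: "zw (hb (1 / 2 - pm s * (of_int (a i j) / 2 - 1 / 2))) (\<lambda>m n. Cc i m * Xf s j n) m n
    = zw (hb (1 / 2 + pm s * (of_int (a i j) / 2 + 1 / 2))) (\<lambda>m n. Xf s j n * Cc i m) m n"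
proof -
  let ?X = "Xf s j" and ?S = "sh 1 (vT Plus i)"
  let ?SX = "\<lambda>m n. ?S m * ?X n" and ?XS = "\<lambda>m n. ?X n * ?S m"
  have xs: "(\<lambda>m n. sh 1 (\<lambda>m. ?X n * vT Plus i m) m) = ?XS" by (intro ext sh_mult_left)
  have sx: "(\<lambda>m n. sh 1 (\<lambda>m. vT Plus i m * ?X n) m) = ?SX" by (intro ext sh_mult_right)
  have xsn: "(\<lambda>m. sh 1 (\<lambda>m. ?X n * vT Plus i m) m) = (\<lambda>m. ?XS m n)" for n by (intro ext sh_mult_left)
  have sm: "zw u (zw v (\<lambda>m n. F m (n + - 2))) m (n + 2) = zw u (zw v F) m n"
    for u v m n and F :: "int \<Rightarrow> int \<Rightarrow> 'i vend fps"
    unfolding zw_shiftn by simp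
  note nA = ntr_zw[OF ntr_mult_left[OF ntr_Xf]] and nB = ntr_zw[OF ntr_Cc]
  note zz = passes_comp[OF passes_zw passes_zw]
  consider (p2) "a i j = 2" "s = Plus" | (m2) "a i j = 2" "s = Minus"
    | (p1) "a i j = - 1" "s = Plus" | (m1) "a i j = - 1" "s = Minus" | (z) "a i j = 0"
    using a_cases[of i j] by (cases s) auto
  then show ?thesis
  proof cases
    case p2
    have ij: "i = j" using p2 a_cases[of i j] by auto
    have c: "pm Plus * pm Plus * a i j > 0" and c': "pm Minus * pm Plus * a i j \<le> 0" using p2 by simp_all
    have "zw (hb 0) (zw (hb 1) (\<lambda>m n. Cc i m * ?X n))
        = (\<lambda>m n. zw (hb 1) (zw (hb 2) (\<lambda>m n. ?X (n + - 2) * Cc i m)) m (n + 2))"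
    proof (rule Cc_B_gen[where P = "\<lambda>F. F" and P' = "\<lambda>F. zw (hb 0) (zw (hb 1) F)" and Q = "\<lambda>F m n. zw (hb 1) (zw (hb 2) F) m (n + 2)"
          and Q' = "\<lambda>F m n. F m (n + - 2)" and B = ?X])
      fix m n
      have "sh 1 (\<lambda>m. vT Plus i m * ?X n) m = sh 1 (\<lambda>m. zw (hb 0) (zw (hb 1) (\<lambda>m n. ?X n * vT Plus i m)) m (n + 2)) m"
        by (rule sh_eqI) (use vT_Xf_pos[OF c] p2 ij in \<open>simp add: Qop_def\<close>)
      then show "?S m * ?X n = zw (hb 1) (zw (hb 2) ?XS) m (n + 2)"
        unfolding sh_mult_right sh_zw2 xs by simp
      show "zw (hb 0) (zw (hb 1) (\<lambda>m n. vT Minus i m * ?X n)) m n = ?X (n + - 2) * vT Minus i m"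
        using vT_Xf_neg[OF c', of m n] p2 ij by (simp add: Qop_def)
    next
      show "zw (hb 0) (zw (hb 1) (\<lambda>m n. zw (hb 1) (zw (hb 2) F) m (n + 2)))
          = (\<lambda>m n. zw (hb 1) (zw (hb 2) (zw (hb 0) (zw (hb 1) F))) m (n + 2))" for F :: "int \<Rightarrow> int \<Rightarrow> 'i vend fps"
        unfolding zw_shiftn zw_comm[of 1 2 "zw (hb 0) (zw (hb 1) F)"] zw_comm[of 1 0] zw_comm[of 2 0] zw_comm[of 2 1] ..
    qed (intro passes_id zz passes_shift passes_comp[OF passes_shift zz])+
    then have "zw (hb 1) (zw (hb 0) (\<lambda>m n. Cc i m * ?X n)) m n = zw (hb 1) (zw (hb 2) (\<lambda>m n. ?X n * Cc i m)) m n" for m n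
      unfolding zw_comm[of 1 0] by (simp add: sm[of _ _ "\<lambda>m n. ?X n * Cc i m", simplified])
    \<comment> \<open>The factors are (z - w)(z - w + \<hbar>) on the left and (z - w + \<hbar>)(z -
      w + 2\<hbar>) on the right, with z - w + \<hbar> in common.\<close>
    from zw_cancel[OF nA nB this] show ?thesis using p2 by simp
  next
    case m2
    have ij: "i = j" using m2 a_cases[of i j] by auto
    have c: "pm Minus * pm Minus * a i j > 0" and c': "pm Plus * pm Minus * a i j \<le> 0" using m2 by simp_all
    have "zw (hb 1) (zw (hb 0) (\<lambda>m n. Cc i m * ?X n))
        = (\<lambda>m n. zw (hb 0) (zw (hb (- 1)) (\<lambda>m n. ?X n * Cc i m)) m (n + - 2 + 2))"
    proof (rule Cc_B_gen[where P' = "\<lambda>F. F" and P = "\<lambda>F. zw (hb 1) (zw (hb 0) F)" and Q' = "\<lambda>F m n. zw (hb 0) (zw (hb (- 1)) F) m (n + 2)"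
          and Q = "\<lambda>F m n. F m (n + - 2)" and B = ?X])
      fix m n
      have "sh 1 (\<lambda>m. zw (hb 0) (zw (hb (- 1)) (\<lambda>m n. vT Plus i m * ?X n)) m n) m = sh 1 (\<lambda>m. ?X (n + - 2) * vT Plus i m) m"
        by (rule sh_eqI) (use vT_Xf_neg[OF c'] m2 ij in \<open>simp add: Qop_def\<close>)
      then show "zw (hb 1) (zw (hb 0) ?SX) m n = ?X (n + - 2) * ?S m"
        unfolding sh_mult_left sh_zw2 sx by simp
      show "vT Minus i m * ?X n = zw (hb 0) (zw (hb (- 1)) (\<lambda>m n. ?X n * vT Minus i m)) m (n + 2)"
        using vT_Xf_pos[OF c, of m n] m2 ij by (simp add: Qop_def)
    next
    qed (intro refl passes_id zz passes_shift passes_comp[OF passes_shift zz])+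
    then have "zw (hb 0) (zw (hb 1) (\<lambda>m n. Cc i m * ?X n)) m n = zw (hb 0) (zw (hb (- 1)) (\<lambda>m n. ?X n * Cc i m)) m n" for m n
      unfolding zw_comm[of 0 1] by simp
    from zw_cancel[OF nA nB this] show ?thesis using m2 by simp
  next
    case p1
    have c: "pm Minus * pm Plus * a i j > 0" and c': "pm Plus * pm Plus * a i j \<le> 0" using p1 by simp_all
    have "zw (hb (3 / 2)) (\<lambda>m n. Cc i m * ?X n)
        = (\<lambda>m n. - (- zw (hb (1 / 2)) (\<lambda>m n. ?X n * Cc i m) m (n + - 1 + 1)))"
    proof (rule Cc_B_gen[where P' = "\<lambda>F. F" and P = "zw (hb (3 / 2))" and Q' = "\<lambda>F m n. - zw (hb (1 / 2)) F m (n + 1)"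
          and Q = "\<lambda>F m n. - F m (n + - 1)" and B = ?X])
      fix m n
      have "sh 1 (\<lambda>m. zw (hb (1 / 2)) (\<lambda>m n. vT Plus i m * ?X n) m n) m = sh 1 (\<lambda>m. - ?X (n + - 1) * vT Plus i m) m"
        by (rule sh_eqI) (use vT_Xf_neg[OF c'] p1 asgn_adj in \<open>simp add: Qop_def\<close>)
      then show "zw (hb (3 / 2)) ?SX m n = - (?X (n + - 1) * ?S m)"
        unfolding sh_mult_left sh_zw sx by simp
      show "vT Minus i m * ?X n = - zw (hb (1 / 2)) (\<lambda>m n. ?X n * vT Minus i m) m (n + 1)"
        using vT_Xf_pos[OF c, of m n] p1 asgn_adj by (simp add: Qop_def)
    next
    qed (intro refl passes_id passes_zw passes_shift passes_comp[OF passes_uminus passes_comp[OF passes_shift passes_zw]] passes_comp[OF passes_uminus passes_shift])+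
    from fun_cong[OF fun_cong[OF this]] show ?thesis using p1 by simp
  next
    case m1
    have c: "pm Plus * pm Minus * a i j > 0" and c': "pm Minus * pm Minus * a i j \<le> 0" using m1 by simp_all
    have "zw (hb (- 1 / 2)) (\<lambda>m n. Cc i m * ?X n)
        = (\<lambda>m n. - zw (hb (1 / 2)) (\<lambda>m n. - (?X (n + - 1) * Cc i m)) m (n + 1))"
    proof (rule Cc_B_gen[where P = "\<lambda>F. F" and P' = "zw (hb (- 1 / 2))" and Q = "\<lambda>F m n. - zw (hb (1 / 2)) F m (n + 1)"
          and Q' = "\<lambda>F m n. - F m (n + - 1)" and B = ?X])
      fix m n
      have "sh 1 (\<lambda>m. vT Plus i m * ?X n) m = sh 1 (\<lambda>m. - 1 * zw (hb (- 1 / 2)) (\<lambda>m n. ?X n * vT Plus i m) m (n + 1)) m"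
        by (rule sh_eqI) (use vT_Xf_pos[OF c] m1 asgn_adj in \<open>simp add: Qop_def\<close>)
      then show "?S m * ?X n = - zw (hb (1 / 2)) ?XS m (n + 1)"
        unfolding sh_mult_right sh_mult_left[of 1 "- 1"] sh_zw xs by simp
      show "zw (hb (- 1 / 2)) (\<lambda>m n. vT Minus i m * ?X n) m n = - (?X (n + - 1) * vT Minus i m)"
        using vT_Xf_neg[OF c', of m n] m1 asgn_adj by (simp add: Qop_def)
    next
      show "zw (hb (- 1 / 2)) (\<lambda>m n. - zw (hb (1 / 2)) F m (n + 1)) = (\<lambda>m n. - zw (hb (1 / 2)) (zw (hb (- 1 / 2)) F) m (n + 1))"
        for F :: "int \<Rightarrow> int \<Rightarrow> 'i vend fps"
        unfolding zw_neg zw_shiftn zw_comm[of "- 1 / 2" "1 / 2"] ..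
    qed (intro passes_id passes_zw passes_shift passes_comp[OF passes_uminus passes_comp[OF passes_shift passes_zw]] passes_comp[OF passes_uminus passes_shift])+
    from fun_cong[OF fun_cong[OF this]] show ?thesis using zw_shiftn[of "hb (1 / 2)" "\<lambda>m n. ?X n * Cc i m" "- 1"] m1 by (simp add: zw_neg)
  next
    case z
    have c: "pm t * pm s * a i j \<le> 0" for t using z by simp
    have vx: "vT t i m * ?X n = ?X n * vT t i m" for t m n
      using vT_Xf_neg[OF c[of t], of m n] z by (simp add: Qop_def asgn_adj(2))
    have "(\<lambda>m n. Cc i m * ?X n) = (\<lambda>m n. ?X n * Cc i m)"
    proof (rule Cc_B_gen[where P = "\<lambda>F. F" and P' = "\<lambda>F. F" and Q = "\<lambda>F. F" and Q' = "\<lambda>F. F" and B = ?X])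
      fix m n
      have "sh 1 (\<lambda>m. vT Plus i m * ?X n) m = sh 1 (\<lambda>m. ?X n * vT Plus i m) m" by (rule sh_eqI) (rule vx)
      then show "?S m * ?X n = ?X n * ?S m" unfolding sh_mult_left sh_mult_right .
    qed (intro passes_id vx refl)+
    then show ?thesis using z by (cases s) simp_all
  qed
qed

theorem Kp_Xf: "zw (hb (- pm s * (of_int (a i j) / 2 - 1 / 2))) (\<lambda>m n. Kp i m * Xf s j n) m n
    = zw (hb (pm s * (of_int (a i j) / 2 + 1 / 2))) (\<lambda>m n. Xf s j n * Kp i m) m n"
  using Kp_B[OF Cc_Xf, of s i j m n] by simp

lemma Kp_B2:
  assumes "\<And>m n. zw (hb u) (zw (hb u') (\<lambda>m n. Cc i m * B n)) m n = zw (hb v) (zw (hb v') (\<lambda>m n. B n * Cc i m)) m n"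
  shows "zw (hb (u - 1 / 2)) (zw (hb (u' - 1 / 2)) (\<lambda>m n. Kp i m * B n)) m n
    = zw (hb (v - 1 / 2)) (zw (hb (v' - 1 / 2)) (\<lambda>m n. B n * Kp i m)) m n"
proof -
  have sm: "zw (hb u) (zw (hb u') F) (m - 2) n = zw (hb u) (zw (hb u') (\<lambda>m n. F (m - 2) n)) m n"
    for u u' m n and F :: "int \<Rightarrow> int \<Rightarrow> 'i vend fps"
    by (simp add: zw_def algebra_simps)
  have "sh (- 1 / 2) (\<lambda>m. zw (hb u) (zw (hb u') (\<lambda>m n. Cc i m * B n)) (m - 2) n) m
      = sh (- 1 / 2) (\<lambda>m. zw (hb v) (zw (hb v') (\<lambda>m n. B n * Cc i m)) (m - 2) n) m"
    by (rule sh_eqI) (rule assms)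
  then have "zw (hb (u + - 1 / 2)) (zw (hb (u' + - 1 / 2)) (\<lambda>m n. sh (- 1 / 2) (\<lambda>m. Cc i (m - 2) * B n) m)) m n
      = zw (hb (v + - 1 / 2)) (zw (hb (v' + - 1 / 2)) (\<lambda>m n. sh (- 1 / 2) (\<lambda>m. B n * Cc i (m - 2)) m)) m n"
    by (simp only: sm sh_zw2)
  moreover have "x + - 1 / 2 = x - 1 / 2" for x :: complex by simp
  ultimately show ?thesis by (simp only: sh_mult_left sh_mult_right Kp_def)
qed

text \<open>Each half of \<open>Cc\<close> contributes the ratio of \<open>vT_kap\<close>, that of
  T^+ with z translated by \<hbar>. After recentring by \<hbar>/2 the two factors on each side have
  opposite constants, so that they form a difference of squares.\<close>

theorem Kp_kap:
  assumes d_def: "d = of_int (a i j) / 2"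
  shows "zw (hb (d - 1 / 2)) (zw (hb (- (d - 1 / 2))) (\<lambda>m n. Kp i m * mu (kap j) n)) m n
    = zw (hb (d + 1 / 2)) (zw (hb (- (d + 1 / 2))) (\<lambda>m n. mu (kap j) n * Kp i m)) m n"
proof -
  let ?B = "mu (kap j)" and ?S = "sh 1 (vT Plus i)"
  have "zw (hb d) (zw (hb (1 - d)) (\<lambda>m n. Cc i m * ?B n)) = zw (hb (1 + d)) (zw (hb (- d)) (\<lambda>m n. ?B n * Cc i m))"
  proof (rule Cc_B_gen[where P = "zw (hb (1 - d))" and P' = "zw (hb d)" and Q = "zw (hb (1 + d))" and Q' = "zw (hb (- d))" and B = ?B])
    fix m n
    have "sh 1 (\<lambda>m. zw (hb (- d)) (\<lambda>m n. vT Plus i m * ?B n) m n) m = sh 1 (\<lambda>m. zw (hb d) (\<lambda>m n. ?B n * vT Plus i m) m n) m"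
      by (rule sh_eqI) (use vT_kap[of Plus i j] in \<open>simp add: d_def\<close>)
    then show "zw (hb (1 - d)) (\<lambda>m n. ?S m * ?B n) m n = zw (hb (1 + d)) (\<lambda>m n. ?B n * ?S m) m n"
      unfolding sh_zw by (simp add: sh_mult_left sh_mult_right add.commute)
    show "zw (hb d) (\<lambda>m n. vT Minus i m * ?B n) m n = zw (hb (- d)) (\<lambda>m n. ?B n * vT Minus i m) m n"
      using vT_kap[of Minus i j m n] by (simp add: d_def)
  qed (intro passes_zw zw_comm)+
  from fun_cong[OF fun_cong[OF this]] have "zw (hb d) (zw (hb (1 - d)) (\<lambda>m n. Cc i m * ?B n)) m n
      = zw (hb (1 + d)) (zw (hb (- d)) (\<lambda>m n. ?B n * Cc i m)) m n" for m n .
  from Kp_B2[OF this, of m n] show ?thesis by (simp add: algebra_simps)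
qed

text \<open>\<open>kap\<close> is a creation series and commutes with the creation half of X, so
  only the annihilation half contributes.\<close>

theorem kap_Xf: "zw (hb (pm s * of_int (a i j) / 2)) (\<lambda>m n. Xf s j n * mu (kap i) m) m n
    = zw (hb (- pm s * of_int (a i j) / 2)) (\<lambda>m n. mu (kap i) m * Xf s j n) m n"
proof -
  let ?c = "pm s * of_int (a i j) / 2 :: complex" and ?k = "mu (kap i)"
  have mn: "- ?c = - pm s * of_int (a i j) / 2" by simp
  have k: "zw (hb ?c) (\<lambda>m n. vT s j n * ?k m) m n = zw (hb (- ?c)) (\<lambda>m n. ?k m * vT s j n) m n" for m n
  proof -
    have "zw (hb (- ?c)) (\<lambda>m n. vT s j m * ?k n) n m = zw (hb ?c) (\<lambda>m n. ?k n * vT s j m) n m"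
      using vT_kap[of s j i n m] by (simp add: a_sym[of j i])
    then show ?thesis
      unfolding zw_swap[of ?c "\<lambda>n m. vT s j n * ?k m"] zw_swap[of "- ?c" "\<lambda>n m. ?k m * vT s j n"] by simp
  qed
  have e1: "zw (hb u) (\<lambda>m n. al s j p * (vT s j (n - p) * ?k m)) m n = al s j p * zw (hb u) (\<lambda>m n. vT s j n * ?k m) m (n - p)" for u p m n
    unfolding zw_hb_mult_left using zw_shift[of "hb u" "\<lambda>m n. vT s j n * ?k m" 0 "- p" m n] by simp
  have e2: "zw (hb u) (\<lambda>m n. al s j p * (?k m * vT s j (n - p))) m n = al s j p * zw (hb u) (\<lambda>m n. ?k m * vT s j n) m (n - p)" for u p m n
    unfolding zw_hb_mult_left using zw_shift[of "hb u" "\<lambda>m n. ?k m * vT s j n" 0 "- p" m n] by simp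
  have kx: "?k m * Xf s j n = lsum (\<lambda>p. al s j p * (?k m * vT s j (n - p)))" for m n
    unfolding Xf_alt lsum_mult_left[OF sumbl_al_vT(2)] mult.assoc[symmetric] mu_commute[of "kap i" m "vA a s j"] ..
  show ?thesis
    unfolding Xf_mult kx mn[symmetric]
    by (subst (1 2) zw_lsum(2)) (simp_all only: sumbl_vT_mult sumbl_al_B_vT e1 e2 k)
qed

lemma commute_lsum:
  assumes "sumbl F" "\<And>p. F p * y = y * F p"
  shows "lsum F * y = y * lsum F"
  unfolding lsum_mult_right[OF assms(1)] lsum_mult_left[OF assms(1)] assms(2) ..

text \<open>Four exchanges of annihilation series: the sign occurs four times and the index shifts
  cancel, so the products T^-_p T^+_q commute exactly.\<close>

lemma Cc_commute: "Cc i m * Cc j n = Cc j n * Cc i m"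
proof -
  have U: "vT Minus i p * vT Plus i q * (vT Minus j p' * vT Plus j q') = vT Minus j p' * vT Plus j q' * (vT Minus i p * vT Plus i q)" for p q p' q'
  proof -
    let ?a = "a i j" and ?e = "cs (asgn i j) :: 'i vend fps"
    have c: "?e * (?e * x) = x" for x
      using asgn_adj[of i j] a_cases[of i j] by auto
    have l: "vT s k m * (?e * x) = ?e * (vT s k m * x)" for s k m x by (rule cs_left_commute)
    have "vT Minus i p * vT Plus i q * (vT Minus j p' * vT Plus j q') = vT Minus i p * ((vT Plus i q * vT Minus j p') * vT Plus j q')"
      by (simp only: mult.assoc)
    also have "vT Plus i q * vT Minus j p' = ?e * (vT Minus j (p' - ?a) * vT Plus i (q + ?a))"
      using vT_vT_swap[of Plus i q Minus j p'] by simp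
    also have "vT Minus i p * (?e * (vT Minus j (p' - ?a) * vT Plus i (q + ?a)) * vT Plus j q')
        = ?e * (vT Minus i p * (vT Minus j (p' - ?a) * (vT Plus i (q + ?a) * vT Plus j q')))"
      by (simp only: mult.assoc l)
    also have "vT Plus i (q + ?a) * vT Plus j q' = ?e * (vT Plus j (q' + ?a) * vT Plus i q)"
      using vT_vT_swap[of Plus i "q + ?a" Plus j q'] by simp
    also have "?e * (vT Minus i p * (vT Minus j (p' - ?a) * (?e * (vT Plus j (q' + ?a) * vT Plus i q))))
        = (vT Minus i p * vT Minus j (p' - ?a)) * (vT Plus j (q' + ?a) * vT Plus i q)"
      by (simp only: l c mult.assoc)
    also have "vT Minus i p * vT Minus j (p' - ?a) = ?e * (vT Minus j p' * vT Minus i (p - ?a))"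
      using vT_vT_swap[of Minus i p Minus j "p' - ?a"] by simp
    also have "?e * (vT Minus j p' * vT Minus i (p - ?a)) * (vT Plus j (q' + ?a) * vT Plus i q)
        = ?e * (vT Minus j p' * ((vT Minus i (p - ?a) * vT Plus j (q' + ?a)) * vT Plus i q))"
      by (simp only: mult.assoc)
    also have "vT Minus i (p - ?a) * vT Plus j (q' + ?a) = ?e * (vT Plus j q' * vT Minus i p)"
      using vT_vT_swap[of Minus i "p - ?a" Plus j "q' + ?a"] by simp
    also have "?e * (vT Minus j p' * (?e * (vT Plus j q' * vT Minus i p) * vT Plus i q))
        = vT Minus j p' * vT Plus j q' * (vT Minus i p * vT Plus i q)"
      by (simp only: l c mult.assoc)
    finally show ?thesis .
  qed
  have cc: "Cc k m * y = y * Cc k m" if t: "\<And>p q. vT Minus k p * vT Plus k q * y = y * (vT Minus k p * vT Plus k q)" for k m y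
    unfolding Cc_expand
  proof (intro commute_lsum sumbl_xp)
    fix e
    let ?g = "\<lambda>p. cs (gb 1 (m - p) e) * (vT Minus k p * vT Plus k (m - p + int e))"
    have "sumbl ?g"
      by (rule sumbl_mult_left, rule sumbl_mult_left)
         (use sumbl_vT[of Plus k] in \<open>simp only: sumbl_shift(3)[of "\<lambda>p. vT Plus k (p + int e)" m] sumbl_shift(1)\<close>)
    then have "lsum ?g * y = y * lsum ?g"
      by (rule commute_lsum) (simp only: mult.assoc[of "cs _"] t cs_left_commute[of y])
    then show "xp 1 e * lsum ?g * y = y * (xp 1 e * lsum ?g)"
      by (simp only: mult.assoc xp_left_commute[of y])
  qed
  show ?thesis
    by (intro cc) (rule cc[symmetric], rule U[symmetric])
qed

theorem Kp_commute: "Kp i m * Kp j n = Kp j n * Kp i m"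
proof -
  have s: "sumbl (\<lambda>e. xp (gb c m e) e * F (m + int e))" for c F m by (rule sumbl_xp)
  have g: "sh c F m * y = y * sh c F m" if "\<And>m. F m * y = y * F m" for c F m and y :: "'i vend fps"
    unfolding sh_def by (rule commute_lsum[OF s]) (simp only: mult.assoc that xp_left_commute[of y])
  show ?thesis unfolding Kp_def by (intro g) (rule g[symmetric], rule Cc_commute)
qed

end

section \<open>Squared linear factors, and translation of special series\<close>

lemma zwsq_hb:
  fixes F :: "int \<Rightarrow> int \<Rightarrow> 'i::finite vend fps"
  shows "zwsq (hb u) F m n = zw (hb u) (zw (hb (- u)) F) m n"
proof -
  have "hb u * hb (- u) = - (hb u :: 'i vend fps)\<^sup>2" by (simp add: hb_minus power2_eq_square)
  then have "hb u * (hb (- u) * x) = - ((hb u)\<^sup>2 * x)" for x :: "'i vend fps"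
    by (simp add: mult.assoc[symmetric])
  then show ?thesis unfolding zwsq_def zw_def by (simp add: algebra_simps hb_minus)
qed

text \<open>(z - w)^2 cancels in the difference, which leaves a multiple of \<hbar>^2. This makes it
  possible to divide the mixed relation of the currents by \<hbar>^2.\<close>

lemma zwsq_hb_diff:
  fixes F :: "int \<Rightarrow> int \<Rightarrow> 'i::finite vend fps"
  shows "zwsq (hb u) F m n - zwsq (hb v) F m n = hb 1 * (hb 1 * (fps_const (sc (v\<^sup>2 - u\<^sup>2)) * F m n))"
proof -
  have "(hb u)\<^sup>2 * x = hb 1 * (hb 1 * (fps_const (sc (u\<^sup>2)) * x))" for u and x :: "'i vend fps"
  proof -
    have "hb u = hb 1 * (fps_const (sc u) :: 'i vend fps)"
      by (simp add: hb_def fps_const_sc_commute)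
    then have "(hb u)\<^sup>2 * x = hb 1 * ((fps_const (sc u) * hb 1) * (fps_const (sc u) * x))"
      by (simp only: power2_eq_square mult.assoc)
    also have "fps_const (sc u) * hb 1 = hb 1 * (fps_const (sc u) :: 'i vend fps)" by (rule fps_const_sc_commute)
    finally show ?thesis by (simp add: mult.assoc power2_eq_square fps_const_mult[symmetric] del: fps_const_mult)
  qed
  then show ?thesis
    unfolding zwsq_def
    by (simp add: algebra_simps fps_const_sub[symmetric] fps_const_add[symmetric] del: fps_const_sub fps_const_add)
qed

lemma zwsq_add: "zwsq u (\<lambda>m n. F m n + G m n) m n = zwsq u F m n + zwsq u G m n"
  by (simp add: zwsq_def zw_def algebra_simps)

lemma zwsq_uminus: "zwsq u (\<lambda>m n. - F m n) m n = - zwsq u F m n"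
  by (simp add: zwsq_def zw_def algebra_simps)

lemma zwsq_hb_mult: "zwsq (hb u) (\<lambda>m n. hb c * F m n) m n = hb c * zwsq (hb u) F m n"
  unfolding zwsq_hb zw_hb_mult_left' ..

lemma sh_delta: "sh c (\<lambda>m. 1 when m = 0) l = (1 when l = 0 :: 'i::finite vend fps)"
proof -
  have "sh c (\<lambda>m. (1 when m = 0) :: 'i vend fps) l = xp (gb c l (nat (- l))) (nat (- l)) * (1 when l + int (nat (- l)) = 0)"
    unfolding sh_def by (rule lsum_single[of "nat (- l)"]) (auto simp: when_def)
  also have "\<dots> = (1 when l = 0)"
  proof (cases "l < 0")
    case True
    then have "gb c l (nat (- l)) = 0" unfolding gb_def by (simp add: gbinomial_0_left)
    then show ?thesis using True by simp
  qed (auto simp: when_def)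
  finally show ?thesis .
qed

lemma sh_finite:
  assumes "\<And>m. m \<ge> 0 \<Longrightarrow> F m = 0"
  shows "sh c F n = (\<Sum>m\<in>{n..- 1}. xp (gb c n (nat (m - n))) (nat (m - n)) * F m)"
proof -
  have "sh c F n = (\<Sum>e\<in>(\<lambda>m. nat (m - n)) ` {n..- 1}. xp (gb c n e) e * F (n + int e))"
    unfolding sh_def
  proof (rule lsum_finite)
    fix e assume "e \<notin> (\<lambda>m. nat (m - n)) ` {n..- 1}"
    then have "n + int e \<ge> 0" by (force intro: rev_image_eqI[of "n + int e"])
    then show "xp (gb c n e) e * F (n + int e) = 0" using assms by simp
  qed simp
  also have "\<dots> = (\<Sum>m\<in>{n..- 1}. xp (gb c n (nat (m - n))) (nat (m - n)) * F m)"
    by (subst sum.reindex) (auto simp: inj_on_def)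
  finally show ?thesis .
qed

context vertex
begin

section \<open>The defining relations\<close>

lemma Kp_hpl: "Kp i m = (1 when m = 0) + hb 1 * hpl i m"
  by (simp add: hb_hpl)

lemma kap_hmi: "mu (kap i) m = (1 when m = 0) - hb 1 * hmi i m"
  by (simp add: hb_hmi)

lemma hb2_cancel: "hb 1 * (hb 1 * x) = hb 1 * (hb 1 * y) \<Longrightarrow> x = y"
  by (blast dest: hb_cancel)

lemma commute_hb:
  assumes "P * Q = Q * P" "hb 1 * x = P - (1 when m = (0::int))" "hb 1 * y = Q - (1 when n = (0::int))"
  shows "x * y = y * x"
proof (rule hb2_cancel)
  have e: "hb 1 * (hb 1 * (x * y)) = (hb 1 * x) * (hb 1 * y)" for x y
    by (simp add: mult.assoc hb_left_commute[of x 1 y])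
  show "hb 1 * (hb 1 * (x * y)) = hb 1 * (hb 1 * (y * x))"
    unfolding e assms(2,3) by (cases "m = 0"; cases "n = 0"; simp add: algebra_simps assms(1))
qed

lemma hpl_commute: "hpl i m * hpl j n = hpl j n * hpl i m"
  by (rule commute_hb[OF Kp_commute hb_hpl hb_hpl])

lemma hmi_commute: "hmi i m * hmi j n = hmi j n * hmi i m"
proof -
  have "(- hmi i m) * (- hmi j n) = (- hmi j n) * (- hmi i m)"
    by (rule commute_hb[OF mu_commute[of "kap i" m "kap j" n], where m = m and n = n]) (simp_all add: hb_hmi)
  then show ?thesis by simp
qed

lemma hb_cs: "hb k * x = hb 1 * (cs k * x)"
proof -
  have "hb k = hb 1 * cs k" using fps_const_sc_commute[of k fps_X] by (simp add: hb_def)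
  then show ?thesis by (simp only: mult.assoc)
qed

text \<open>When 1 + \<hbar> h^+ and 1 - \<hbar> h^- are multiplied out in \<open>Kp_kap\<close>,
  the part \<open>A\<close> of degree at most 1 in the currents is the same in both orders. By
  \<open>zwsq_hb_diff\<close> its contribution is a multiple of \<hbar>^2, which is
  cancelled.\<close>

lemma hpl_hmi:
  assumes d_def: "d = of_int (a i j) / 2"
  shows "zwsq (hb (d + 1 / 2)) (\<lambda>m n. hmi j n * hpl i m) m n - zwsq (hb (d - 1 / 2)) (\<lambda>m n. hpl i m * hmi j n) m n
    = - cs (2 * d) * ((1 when m = 0) * (1 when n = 0) + hb 1 * ((1 when n = 0) * hpl i m) - hb 1 * ((1 when m = 0) * hmi j n))"
proof (rule hb2_cancel)
  define A where "A = (\<lambda>m n. (1 when m = (0::int)) * (1 when n = (0::int)) + hb 1 * ((1 when n = 0) * hpl i m) - hb 1 * ((1 when m = 0) * hmi j n))"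
  have 1: "(\<lambda>m n. mu (kap j) n * Kp i m) = (\<lambda>m n. A m n + - (hb 1 * (hb 1 * (hmi j n * hpl i m))))"
    unfolding A_def Kp_hpl kap_hmi
    by (intro ext) (simp add: when_def algebra_simps hb_left_commute[of "hmi j n" 1 for n])
  have 2: "(\<lambda>m n. Kp i m * mu (kap j) n) = (\<lambda>m n. A m n + - (hb 1 * (hb 1 * (hpl i m * hmi j n))))"
    unfolding A_def Kp_hpl kap_hmi
    by (intro ext) (simp add: when_def algebra_simps hb_left_commute[of "hpl i m" 1 for m])
  \<comment> \<open>Origin of the coefficient -2 d_ij c in the relation, with c acting as 1.\<close>
  have sq: "(d - 1 / 2)\<^sup>2 - (d + 1 / 2)\<^sup>2 = - (2 * d)" by (simp add: power2_eq_square algebra_simps)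
  have "zwsq (hb (d - 1 / 2)) (\<lambda>m n. Kp i m * mu (kap j) n) m n = zwsq (hb (d + 1 / 2)) (\<lambda>m n. mu (kap j) n * Kp i m) m n"
    unfolding zwsq_hb by (rule Kp_kap[OF d_def])
  then have "hb 1 * (hb 1 * zwsq (hb (d + 1 / 2)) (\<lambda>m n. hmi j n * hpl i m) m n)
      - hb 1 * (hb 1 * zwsq (hb (d - 1 / 2)) (\<lambda>m n. hpl i m * hmi j n) m n)
      = zwsq (hb (d + 1 / 2)) A m n - zwsq (hb (d - 1 / 2)) A m n"
    unfolding 1 2 zwsq_add zwsq_uminus zwsq_hb_mult by (simp add: algebra_simps)
  then show "hb 1 * (hb 1 * (zwsq (hb (d + 1 / 2)) (\<lambda>m n. hmi j n * hpl i m) m n - zwsq (hb (d - 1 / 2)) (\<lambda>m n. hpl i m * hmi j n) m n))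
     = hb 1 * (hb 1 * (- cs (2 * d) * ((1 when m = 0) * (1 when n = 0) + hb 1 * ((1 when n = 0) * hpl i m) - hb 1 * ((1 when m = 0) * hmi j n))))"
    unfolding zwsq_hb_diff sq A_def by (simp add: right_diff_distrib sc_hom(5) del: sc_hom(4))
qed

lemma zw_hb_diff:
  fixes F :: "int \<Rightarrow> int \<Rightarrow> 'i vend fps"
  shows "zw (hb u) F m n - zw (hb v) F m n = hb 1 * (cs (u - v) * F m n)"
proof -
  have "hb (u - v) = (hb u - hb v :: 'i vend fps)" using hb_add[of u "- v", where ?'a = 'i] by (simp add: hb_minus)
  then show ?thesis unfolding hb_cs[symmetric] zw_def by (simp only: left_diff_distrib) simp
qed

lemma hpl_Xf:
  assumes d_def: "d = of_int (a i j) / 2"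
  shows "zw (hb (- pm s * (d - 1 / 2))) (\<lambda>m n. hpl i m * Xf s j n) m n - zw (hb (pm s * (d + 1 / 2))) (\<lambda>m n. Xf s j n * hpl i m) m n
    = cs (pm s * (2 * d)) * ((1 when m = 0) * Xf s j n)"
proof (rule hb_cancel)
  let ?X = "Xf s j" and ?P = "\<lambda>m n. (1 when m = (0::int)) * Xf s j n"
  have 1: "(\<lambda>m n. Kp i m * ?X n) = (\<lambda>m n. ?P m n + hb 1 * (hpl i m * ?X n))"
    unfolding Kp_hpl by (simp add: algebra_simps)
  have 2: "(\<lambda>m n. ?X n * Kp i m) = (\<lambda>m n. ?P m n + hb 1 * (?X n * hpl i m))"
    unfolding Kp_hpl by (intro ext) (simp add: when_def algebra_simps hb_left_commute[of "?X n" 1 for n])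
  have e: "pm s * (d + 1 / 2) - - pm s * (d - 1 / 2) = pm s * (2 * d)" by (simp add: algebra_simps)
  have "hb 1 * zw (hb (- pm s * (d - 1 / 2))) (\<lambda>m n. hpl i m * ?X n) m n - hb 1 * zw (hb (pm s * (d + 1 / 2))) (\<lambda>m n. ?X n * hpl i m) m n
      = zw (hb (pm s * (d + 1 / 2))) ?P m n - zw (hb (- pm s * (d - 1 / 2))) ?P m n"
    using Kp_Xf[of s i j m n] unfolding d_def[symmetric] 1 2 zw_add zw_hb_mult_left by (simp add: algebra_simps)
  then show "hb 1 * (zw (hb (- pm s * (d - 1 / 2))) (\<lambda>m n. hpl i m * ?X n) m n - zw (hb (pm s * (d + 1 / 2))) (\<lambda>m n. ?X n * hpl i m) m n)
      = hb 1 * (cs (pm s * (2 * d)) * ?P m n)"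
    unfolding right_diff_distrib[of "hb 1"] zw_hb_diff e .
qed

lemma hmi_Xf:
  assumes d_def: "d = of_int (a i j) / 2"
  shows "zw (hb (pm s * d)) (\<lambda>m n. Xf s j n * hmi i m) m n - zw (hb (- pm s * d)) (\<lambda>m n. hmi i m * Xf s j n) m n
    = cs (pm s * (2 * d)) * ((1 when m = 0) * Xf s j n)"
proof (rule hb_cancel)
  let ?X = "Xf s j" and ?P = "\<lambda>m n. (1 when m = (0::int)) * Xf s j n"
  have 1: "(\<lambda>m n. ?X n * mu (kap i) m) = (\<lambda>m n. ?P m n - hb 1 * (?X n * hmi i m))"
    unfolding kap_hmi by (intro ext) (simp add: when_def algebra_simps hb_left_commute[of "?X n" 1 for n])
  have 2: "(\<lambda>m n. mu (kap i) m * ?X n) = (\<lambda>m n. ?P m n - hb 1 * (hmi i m * ?X n))"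
    unfolding kap_hmi by (simp add: algebra_simps)
  have e: "pm s * d - - pm s * d = pm s * (2 * d)" by (simp add: algebra_simps)
  have pd: "pm s * of_int (a i j) / 2 = pm s * d" "- pm s * of_int (a i j) / 2 = - pm s * d" by (simp_all add: d_def)
  have "hb 1 * zw (hb (pm s * d)) (\<lambda>m n. ?X n * hmi i m) m n - hb 1 * zw (hb (- pm s * d)) (\<lambda>m n. hmi i m * ?X n) m n
      = zw (hb (pm s * d)) ?P m n - zw (hb (- pm s * d)) ?P m n"
    using kap_Xf[of s i j m n] unfolding pd 1 2 zw_diff zw_hb_mult_left by (simp add: algebra_simps)
  then show "hb 1 * (zw (hb (pm s * d)) (\<lambda>m n. ?X n * hmi i m) m n - zw (hb (- pm s * d)) (\<lambda>m n. hmi i m * ?X n) m n)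
      = hb 1 * (cs (pm s * (2 * d)) * ?P m n)"
    unfolding right_diff_distrib[of "hb 1"] zw_hb_diff e .
qed

text \<open>The coefficients of \<open>h\<^sup>+(w + \<hbar>/2)\<close>.\<close>

definition hsh :: "'i \<Rightarrow> int \<Rightarrow> 'i vend fps" where "hsh i = sh (1 / 2) (hpl i)"

lemma Cc_hsh: "Cc i (l - 2) = (1 when l = 0) + hb 1 * hsh i l"
proof -
  have "Cc i (l - 2) = sh (1 / 2) (\<lambda>m. (1 when m = 0) + hb 1 * hpl i m) l"
    by (simp only: sh_half_Kp[symmetric] Kp_hpl[abs_def])
  then show ?thesis by (simp only: sh_add sh_delta sh_mult_left hsh_def)
qed

lemma hsh_nonneg: "l \<ge> 0 \<Longrightarrow> hsh i l = 0"
  unfolding hsh_def by (simp add: sh_finite[OF hpl_zero])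

text \<open>\<open>Xf_commutator\<close> divided by \<hbar>. Translating back by -\<hbar> turns the
  residue on z = w + \<hbar> into coefficients of \<delta>(w + \<hbar>, z): the leading 1 gives the
  difference quotient of delta functions, the rest the term with h^+(w + \<hbar>/2). The residue on
  z = w gives the term with h^-.\<close>

lemma Xf_Xf_same:
  "commutator (Xf Plus i m) (Xf Minus i n)
    = (xp (of_int (- m - 1) gchoose nat (- m - 1 - n)) (nat (- m - 1 - n) - 1) when n < - m - 1)
      + (\<Sum>q\<in>{n + 1..- m - 1}. xp (of_int (- m - 1) gchoose nat (- m - 1 - q)) (nat (- m - 1 - q)) * hsh i (n - q))
      + hmi i (m + n + 1)"
proof (rule hb_cancel)
  let ?g = "\<lambda>e. of_int (- m - 1) gchoose e :: complex"
  let ?l = "m + n + 1"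
  \<comment> \<open>Upper negation: the coefficients of the translation by -\<hbar> become those of
    (w + \<hbar>)^r with r = -m - 1.\<close>
  have gb: "gb (- 1) m e = ?g e" for e
  proof -
    have "of_int (- m - 1) = - (of_int (m + 1) :: complex)" "of_int (m + 1) + of_nat e - 1 = (of_int (m + int e) :: complex)"
      by simp_all
    then show ?thesis unfolding gb_def by (simp only: gbinomial_minus mult.commute)
  qed
  have C: "Cc i (m + int e + n - 1) = (1 when ?l + int e = 0) + hb 1 * hsh i (?l + int e)" for e
    using Cc_hsh[of i "?l + int e"] by (simp add: algebra_simps)
  have "sh (- 1) (\<lambda>m. Cc i (m + n - 1)) m = lsum (\<lambda>e. xp (?g e) e * (1 when ?l + int e = 0) + xp (?g e) e * (hb 1 * hsh i (?l + int e)))"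
    unfolding sh_def gb C distrib_left ..
  also have "\<dots> = lsum (\<lambda>e. xp (?g e) e * (1 when ?l + int e = 0)) + lsum (\<lambda>e. xp (?g e) e * (hb 1 * hsh i (?l + int e)))"
    by (intro lsum_add sumbl_xp)
  also have "lsum (\<lambda>e. xp (?g e) e * (1 when ?l + int e = 0) :: 'i vend fps) = xp (?g (nat (- ?l))) (nat (- ?l)) * (1 when ?l + int (nat (- ?l)) = 0)"
    by (rule lsum_single) (auto simp: when_def)
  \<comment> \<open>One factor \<hbar> is split off for the cancellation. The term of
    \<open>?l = 0\<close> belongs to the unshifted delta function and cancels against the leading 1
    of \<open>kap\<close>.\<close>
  also have "\<dots> = (1 when ?l = 0) + hb 1 * (xp (?g (nat (- ?l))) (nat (- ?l) - 1) when n < - m - 1)"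
  proof (cases "?l < 0")
    case True
    then obtain k where k: "nat (- ?l) = Suc k" by (metis nat_eq_iff2 not0_implies_Suc neg_0_less_iff_less less_irrefl zero_less_nat_eq nat_0_iff)
    have e: "xp (?g (Suc k)) (Suc k) = hb 1 * (xp (?g (Suc k)) k :: 'i vend fps)"
      unfolding xp_def hb_1 power_Suc mult.assoc[symmetric] fps_const_sc_commute[of _ fps_X] ..
    have z: "?l + int (Suc k) = 0" using k True by linarith
    show ?thesis unfolding k z e using True by simp
  qed (auto simp: when_def)
  also have "lsum (\<lambda>e. xp (?g e) e * (hb 1 * hsh i (?l + int e)))
      = (\<Sum>e\<in>(\<lambda>q. nat (- m - 1 - q)) ` {n + 1..- m - 1}. xp (?g e) e * (hb 1 * hsh i (?l + int e)))"
  proof (rule lsum_finite)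
    fix e assume e: "e \<notin> (\<lambda>q. nat (- m - 1 - q)) ` {n + 1..- m - 1}"
    have "?l + int e \<ge> 0"
    proof (rule ccontr)
      assume "\<not> ?l + int e \<ge> 0"
      then have "- m - 1 - int e \<in> {n + 1..- m - 1}" "e = nat (- m - 1 - (- m - 1 - int e))" by auto
      with e show False by blast
    qed
    then show "xp (?g e) e * (hb 1 * hsh i (?l + int e)) = 0" by (simp add: hsh_nonneg)
  qed simp
  also have "\<dots> = (\<Sum>q\<in>{n + 1..- m - 1}. hb 1 * (xp (?g (nat (- m - 1 - q))) (nat (- m - 1 - q)) * hsh i (n - q)))"
    by (subst sum.reindex) (auto simp: inj_on_def algebra_simps xp_left_commute[of "hb 1"] intro!: sum.cong)
  finally have S: "sh (- 1) (\<lambda>m. Cc i (m + n - 1)) m = (1 when ?l = 0)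
      + hb 1 * (xp (?g (nat (- ?l))) (nat (- ?l) - 1) when n < - m - 1)
      + (\<Sum>q\<in>{n + 1..- m - 1}. hb 1 * (xp (?g (nat (- m - 1 - q))) (nat (- m - 1 - q)) * hsh i (n - q)))" .
  have l: "- ?l = - m - 1 - n" by simp
  show "hb 1 * commutator (Xf Plus i m) (Xf Minus i n) = hb 1 * ((xp (?g (nat (- m - 1 - n))) (nat (- m - 1 - n) - 1) when n < - m - 1)
      + (\<Sum>q\<in>{n + 1..- m - 1}. xp (?g (nat (- m - 1 - q))) (nat (- m - 1 - q)) * hsh i (n - q))
      + hmi i ?l)"
    unfolding Xf_commutator S kap_hmi l by (simp add: distrib_left sum_distrib_left)
qed

end

section \<open>Evaluation of the free algebra\<close>

type_synonym 'i gring = "int \<times> 'i lattice \<Rightarrow>\<^sub>0 'i vend fps"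

lemma poly_mapping_sum_singles: "f = (\<Sum>k\<in>Poly_Mapping.keys f. Poly_Mapping.single k (Poly_Mapping.lookup f k))"
proof (rule poly_mapping_eqI)
  fix k
  have "Poly_Mapping.lookup (\<Sum>k\<in>Poly_Mapping.keys f. Poly_Mapping.single k (Poly_Mapping.lookup f k)) k
      = (\<Sum>l\<in>Poly_Mapping.keys f. if l = k then Poly_Mapping.lookup f k else 0)"
    by (simp add: lookup_sum lookup_single when_def cong: sum.cong)
  then show "Poly_Mapping.lookup f k = Poly_Mapping.lookup (\<Sum>k\<in>Poly_Mapping.keys f. Poly_Mapping.single k (Poly_Mapping.lookup f k)) k"
    by (simp add: sum.delta in_keys_iff)
qed

text \<open>Additive extension from the basis elements. Weights of monomials, forgetting of degrees,
  evaluation of words and the action on components all have this form, so their additivity is proved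
  once.\<close>

definition extend_sum :: "('k \<Rightarrow> 'b::zero \<Rightarrow> 'c::comm_monoid_add) \<Rightarrow> ('k \<Rightarrow>\<^sub>0 'b) \<Rightarrow> 'c" where
  "extend_sum F x = (\<Sum>k\<in>Poly_Mapping.keys x. F k (Poly_Mapping.lookup x k))"

lemma extend_sum_superset:
  assumes "\<And>k. F k 0 = 0" "finite A" "Poly_Mapping.keys x \<subseteq> A"
  shows "extend_sum F x = (\<Sum>k\<in>A. F k (Poly_Mapping.lookup x k))"
  unfolding extend_sum_def by (rule sum.mono_neutral_left) (use assms in \<open>auto simp: in_keys_iff\<close>)

lemma extend_sum_single: "(\<And>k. F k 0 = 0) \<Longrightarrow> extend_sum F (Poly_Mapping.single k b) = F k b"
  by (subst extend_sum_superset[of F "{k}"]) (auto split: if_splits)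

lemma extend_sum_add:
  assumes "\<And>k. F k 0 = 0" "\<And>k b c. F k (b + c) = F k b + F k c"
  shows "extend_sum F (x + y) = extend_sum F x + extend_sum F y"
proof -
  let ?A = "Poly_Mapping.keys x \<union> Poly_Mapping.keys y"
  have "extend_sum F z = (\<Sum>k\<in>?A. F k (Poly_Mapping.lookup z k))" if "z = x \<or> z = y \<or> z = x + y" for z
    by (rule extend_sum_superset) (use that assms in \<open>auto simp: Poly_Mapping.keys_add[THEN subsetD] dest!: Poly_Mapping.keys_add[THEN subsetD]\<close>)
  then show ?thesis by (simp add: lookup_add assms sum.distrib)
qed

lemma extend_sum_mult:
  fixes F :: "'k::monoid_add \<Rightarrow> 'b::ring_1 \<Rightarrow> 'c::ring_1"
  assumes F: "\<And>k. F k 0 = 0" "\<And>k b c. F k (b + c) = F k b + F k c"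
    and m: "\<And>k l b c. F (k + l) (b * c) = F k b * F l c"
  shows "extend_sum F (x * y) = extend_sum F x * extend_sum F y"
proof (induction x rule: poly_mapping_single_induct)
  case (3 k b)
  show ?case
    by (induction y rule: poly_mapping_single_induct)
       (simp_all add: extend_sum_add[of F, OF F] extend_sum_single[of F, OF F(1)] distrib_left mult_single m extend_sum_def[of F 0])
qed (simp_all add: extend_sum_add[of F, OF F] distrib_right extend_sum_def[of F 0])

definition aug :: "'i::finite gring \<Rightarrow> 'i vend fps" where "aug = extend_sum (\<lambda>_ x. x)"

lemma aug_hom [simp]: "aug (x + y) = aug x + aug y" "aug (x * y) = aug x * aug y" "aug (Poly_Mapping.single k b) = b"
  unfolding aug_def by (simp_all add: extend_sum_add extend_sum_mult extend_sum_single)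

lemma central_single:
  fixes y :: "'i::finite gring"
  assumes "\<And>z. b * z = z * b"
  shows "Poly_Mapping.single k b * y = y * Poly_Mapping.single k b"
  by (induction y rule: poly_mapping_single_induct) (simp_all add: distrib_left distrib_right mult_single assms add.commute)

definition kR :: "complex \<Rightarrow> 'i::finite gring" where "kR c = Poly_Mapping.single 0 (fps_const (sc c))"
definition hR :: "'i::finite gring" where "hR = Poly_Mapping.single (1, 0) fps_X"

lemma kR_hom: "kR 0 = 0" "kR 1 = 1" "kR (c + d) = kR c + kR d" "kR (c * d) = kR c * kR d"
  unfolding kR_def
  by (simp_all add: single_add[symmetric] mult_single fps_const_add[symmetric] fps_const_mult[symmetric] del: fps_const_add fps_const_mult)

lemma kR_central: "kR c * y = y * kR c"
  unfolding kR_def by (rule central_single) (rule fps_const_sc_commute)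

lemma hR_central: "hR * y = y * hR"
  unfolding hR_def by (rule central_single) (rule fps_mult_fps_X_commute)

definition embR :: "complex poly \<Rightarrow> 'i::finite gring" where
  "embR p = fold_coeffs (\<lambda>c r. kR c + hR * r) p 0"

lemma embR_0 [simp]: "embR 0 = 0"
  by (simp add: embR_def)

lemma embR_pCons: "embR (pCons c p) = kR c + hR * embR p"
  by (cases "c = 0 \<and> p = 0") (auto simp: embR_def kR_hom fold_coeffs_pCons_eq)

lemma embR_add: "embR (p + q) = embR p + embR q"
  by (induction p q rule: poly_induct2) (simp_all add: embR_pCons kR_hom algebra_simps)

lemma embR_smult: "embR (Polynomial.smult c p) = kR c * embR p"
proof (induction p)
  case (pCons b p)
  have "hR * (kR c * embR p) = kR c * (hR * embR p :: 'a gring)"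
    unfolding mult.assoc[symmetric] hR_central[of "kR c"] ..
  with pCons show ?case by (simp add: embR_pCons kR_hom distrib_left)
qed simp

lemma embR_mult: "embR (p * q) = embR p * embR q"
  by (induction p) (simp_all add: embR_pCons embR_add embR_smult kR_hom distrib_right mult.assoc)

lemma embR_central: "embR p * y = y * embR p"
proof (induction p)
  case (pCons c p)
  have "hR * embR p * y = y * (hR * embR p)"
    unfolding mult.assoc pCons(2) unfolding mult.assoc[symmetric] hR_central[of y] ..
  then show ?case by (simp add: embR_pCons distrib_left distrib_right kR_central[of c y])
qed simp

context vertex
begin

fun gval :: "'i dy_gen \<Rightarrow> 'i vend fps" where
  "gval GenC = 1"
| "gval (GenX s i r) = Xf s i (- r - 1)"
| "gval (GenH i r) = (if r \<ge> 0 then hpl i (- r - 1) else hmi i (- r - 1))"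

fun gdeg :: "'i dy_gen \<Rightarrow> int \<times> 'i lattice" where
  "gdeg GenC = 0"
| "gdeg (GenX s i r) = (r, sroot s i)"
| "gdeg (GenH i r) = (r, 0)"

fun wR :: "'i dy_gen word \<Rightarrow> 'i gring" where
  "wR (Word gs) = prod_list (map (\<lambda>g. Poly_Mapping.single (gdeg g) (gval g)) gs)"

lemma wR_add: "wR (u + v) = wR u * wR v"
  by (cases u; cases v) simp

definition psi :: "'i dy_free \<Rightarrow> 'i gring" where
  "psi = extend_sum (\<lambda>w p. embR p * wR w)"

lemma psi_add: "psi (x + y) = psi x + psi y"
  unfolding psi_def by (rule extend_sum_add) (simp_all add: embR_add distrib_right)

lemma psi_mult: "psi (x * y) = psi x * psi y"
  unfolding psi_def
proof (rule extend_sum_mult)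
  fix u v :: "'i dy_gen word" and p q :: "complex poly"
  show "embR (p * q) * wR (u + v) = embR p * wR u * (embR q * wR v)"
    unfolding embR_mult wR_add mult.assoc
    by (simp only: mult.assoc[symmetric] embR_central[of q "wR u"])
qed (simp_all add: embR_add distrib_right)

lemma psi_single: "psi (Poly_Mapping.single w p) = embR p * wR w"
  unfolding psi_def by (rule extend_sum_single) simp

lemma psi_gen: "psi (gen g) = Poly_Mapping.single (gdeg g) (gval g)"
  by (simp add: gen_def psi_single one_pCons embR_pCons kR_hom)

lemma psi_scal: "psi (scal p) = embR p"
  by (simp add: scal_def psi_single zero_word_def)

lemma psi_one: "psi 1 = 1"
proof -
  have "psi (scal 1) = 1" by (simp add: psi_scal one_pCons embR_pCons kR_hom)
  then show ?thesis by (simp add: scal_def)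
qed

definition phi :: "'i dy_free \<Rightarrow> 'i vend fps" where "phi x = aug (psi x)"

lemma phi_hom [simp]: "phi (x + y) = phi x + phi y" "phi (x * y) = phi x * phi y" "phi 1 = 1"
proof -
  have "aug 1 = (1 :: 'i vend fps)" using aug_hom(3)[of 0 1] by simp
  then show "phi 1 = 1" by (simp add: phi_def psi_one)
qed (simp_all add: phi_def psi_add psi_mult)

lemma phi_zero [simp]: "phi 0 = 0"
  using phi_hom(1)[of 0 0] by simp

lemma phi_uminus [simp]: "phi (- x) = - phi x"
  using phi_hom(1)[of x "- x"] by (simp add: eq_neg_iff_add_eq_0 add.commute)

lemma phi_diff [simp]: "phi (x - y) = phi x - phi y"
  using phi_hom(1)[of x "- y"] by simp

lemma phi_numeral [simp]: "phi 2 = 2"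
  by (simp flip: one_add_one)

lemma phi_pm [simp]: "phi (pm s) = pm s"
  by (cases s) simp_all

lemma phi_when [simp]: "phi (x when P) = (phi x when P)"
  by (simp add: when_def)

lemma phi_power [simp]: "phi (x ^ n) = phi x ^ n"
  by (induction n) simp_all

lemma phi_sum: "phi (sum f A) = (\<Sum>x\<in>A. phi (f x))"
  by (induction A rule: infinite_finite_induct) simp_all

lemma phi_Sum_any: "finite A \<Longrightarrow> {x. f x \<noteq> 0} \<subseteq> A \<Longrightarrow> phi (Sum_any f) = (\<Sum>x\<in>A. phi (f x))"
  by (simp add: Sum_any.expand_superset phi_sum)

lemma phi_gen [simp]: "phi (gen g) = gval g"
  by (simp add: phi_def psi_gen)

lemma aug_kR [simp]: "aug (kR c) = cs c" and aug_hR [simp]: "aug hR = hb 1"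
  by (simp_all add: kR_def hR_def hb_1)

lemma aug_0 [simp]: "aug 0 = 0"
  by (simp add: aug_def extend_sum_def)

lemma phi_const [simp]: "phi (scal [:c:]) = cs c"
  by (simp add: phi_def psi_scal embR_pCons)

lemma phi_hbar [simp]: "phi hbar = hb 1"
  by (simp add: phi_def psi_scal embR_pCons kR_hom)

lemma phi_commutator [simp]: "phi (commutator x y) = commutator (phi x) (phi y)"
  by (simp add: commutator_def)

lemma phi_zw [simp]: "phi (zw u F m n) = zw (phi u) (\<lambda>m n. phi (F m n)) m n"
  by (simp add: zw_def)

lemma phi_zwsq [simp]: "phi (zwsq u F m n) = zwsq (phi u) (\<lambda>m n. phi (F m n)) m n"
  by (simp add: zwsq_def zw_def)

lemma phi_x [simp]: "phi (ser_x s i m) = Xf s i m"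
  by (simp add: ser_x_def)

lemma phi_h [simp]: "phi (ser_h Plus i m) = hpl i m" "phi (ser_h Minus i m) = hmi i m"
  by (auto simp: ser_h_def Let_def when_def hpl_zero hmi_zero)

lemma phi_dd [simp]: "phi (dd a i j) = cs (of_int (a i j) / 2)"
  unfolding dd_def by (rule phi_const)

lemma phi_hbar_const: "phi (hbar * dd a i j) = hb (of_int (a i j) / 2)"
  unfolding phi_hom phi_hbar phi_dd using hb_cs[of "of_int (a i j) / 2" 1] by simp

lemma phi_pm_hbar: "phi (pm s * (hbar * dd a i j)) = hb (pm s * (of_int (a i j) / 2))"
  "phi (- pm s * (hbar * dd a i j)) = hb (- pm s * (of_int (a i j) / 2))"
  by (simp_all only: mult_minus_left phi_uminus phi_hom(2)[of "pm s"] phi_pm phi_hbar_const hb_pm hb_minus)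

lemma phi_cij: "phi (cij a s i j) = hb (of_int (a i j) / 2 + pm s * (1 / 2))"
proof -
  have "cs (1 / 2) * hb 1 = (hb (1 / 2) :: 'i vend fps)"
    by (simp add: hb_def)
  then show ?thesis
    unfolding cij_def phi_hom(1) phi_hbar_const phi_hom(2)[of "pm s"] by (simp add: hb_add hb_pm[of s "1 / 2", simplified])
qed

lemma phi_pm_cij: "phi (pm s * cij a t i j) = hb (pm s * (of_int (a i j) / 2 + pm t * (1 / 2)))"
  "phi (- pm s * cij a t i j) = hb (- pm s * (of_int (a i j) / 2 + pm t * (1 / 2)))"
  by (simp_all only: mult_minus_left phi_uminus phi_hom(2) phi_pm phi_cij hb_pm hb_minus)

lemma phi_rel_hh: "phi (rel_hh s i j m n) = 0"
  by (cases s) (simp_all add: rel_hh_def commutator_def hpl_commute[of i m j n] hmi_commute[of i m j n])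

lemma phi_rel_hh_mixed: "phi (rel_hh_mixed a i j m n) = 0"
proof -
  let ?d = "of_int (a i j) / 2 :: complex"
  have d2: "cs (2 * ?d) = (2 * cs ?d :: 'i vend fps)" by (simp only: sc_hom(4) sc_numeral fps_const_mult[symmetric] fps_numeral_fps_const)
  have c: "cij a Plus i j = cij a Plus i j" ..
  have "zwsq (hb (?d + 1 / 2)) (\<lambda>m n. hmi j n * hpl i m) m n - zwsq (hb (?d - 1 / 2)) (\<lambda>m n. hpl i m * hmi j n) m n
    = - (2 * cs ?d) * ((1 when m = 0) * (1 when n = 0) + hb 1 * ((1 when n = 0) * hpl i m) - hb 1 * ((1 when m = 0) * hmi j n))"
    using hpl_hmi[OF refl, of i j m n] unfolding d2 .
  also have "\<dots> = (- 2 * cs ?d when m = 0 \<and> n = 0) + 2 * (hb 1 * cs ?d) * ((hmi j n when m = 0) - (hpl i m when n = 0))"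
    by (simp add: when_def algebra_simps hb_commute)
  finally show ?thesis
    unfolding rel_hh_mixed_def by (simp add: phi_cij mult.assoc)
qed

lemma cs_pm_double: "cs (pm s * (2 * d)) * x = pm s * (2 * cs d * x)"
proof -
  have "cs (2 * d) = 2 * cs d" unfolding mult_2 sc_hom(3) fps_const_add[symmetric] ..
  moreover have "cs (- (2 * d)) = - cs (2 * d)" by simp
  ultimately show ?thesis by (cases s) (simp_all only: pm_simps mult_1_left mult_minus_left)
qed

lemma phi_rel_hx_plus: "phi (rel_hx_plus a s i j m n) = 0"
proof -
  let ?d = "of_int (a i j) / 2 :: complex"
  have "zw (hb (- pm s * (?d + pm Minus * (1 / 2)))) (\<lambda>m n. hpl i m * Xf s j n) m n - zw (hb (pm s * (?d + pm Plus * (1 / 2)))) (\<lambda>m n. Xf s j n * hpl i m) m n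
      = cs (pm s * (2 * ?d)) * ((1 when m = 0) * Xf s j n)"
    using hpl_Xf[OF refl, of s i j m n] by simp
  also have "\<dots> = (pm s * (2 * cs ?d * Xf s j n) when m = 0)"
    unfolding cs_pm_double by (simp add: when_def)
  finally show ?thesis
    unfolding rel_hx_plus_def phi_diff phi_zw phi_pm_cij by (simp add: mult.assoc)
qed

lemma phi_rel_hx_minus: "phi (rel_hx_minus a s i j m n) = 0"
proof -
  let ?d = "of_int (a i j) / 2 :: complex"
  have "zw (hb (pm s * ?d)) (\<lambda>m n. Xf s j n * hmi i m) m n - zw (hb (- pm s * ?d)) (\<lambda>m n. hmi i m * Xf s j n) m n
      = cs (pm s * (2 * ?d)) * ((1 when m = 0) * Xf s j n)"
    using hmi_Xf[OF refl, of s i j m n] by simp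
  also have "\<dots> = (pm s * (2 * cs ?d * Xf s j n) when m = 0)"
    unfolding cs_pm_double by (simp add: when_def)
  finally show ?thesis
    unfolding rel_hx_minus_def phi_diff phi_zw phi_pm_hbar by (simp add: mult.assoc)
qed

lemma phi_rel_xx: "phi (rel_xx a s i j m n) = 0"
  unfolding rel_xx_def phi_diff phi_zw phi_pm_hbar using Xf_Xf[of s i j m n] by simp

lemma phi_rel_serre: "i \<noteq> j \<Longrightarrow> phi (rel_serre a s i j e n) = 0"
proof -
  assume ij: "i \<noteq> j"
  then consider "a i j = 0" | "a i j = - 1" using a_cases[of i j] by auto
  then show ?thesis
  proof cases
    case 1
    have "{\<sigma>. \<sigma> permutes {1::nat..nat (1 - a i j)}} = {id}" using 1 by auto
    then show ?thesis unfolding rel_serre_def Let_def using 1 Serre_commute[OF ij 1] by (simp add: phi_sum)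
  next
    case 2
    have s: "{1::nat..nat (1 - a i j)} = {1, 2}" using 2 by auto
    have P: "{\<sigma>. \<sigma> permutes {1::nat, 2}} = {id, Transposition.transpose 1 2}" by (auto simp: permutes_doubleton_iff)
    have ne: "id \<noteq> Transposition.transpose (1::nat) 2" by (metis id_apply one_eq_numeral_iff semiring_norm(85) transpose_apply_first)
    have l: "[1..<Suc (nat (1 - a i j))] = [1, 2]" using 2 by (simp add: upt_rec numeral_2_eq_2)
    show ?thesis
      unfolding rel_serre_def Let_def s P l using ne Serre_adjacent[OF 2] by (simp add: transpose_def)
  qed
qed

lemma phi_shifted_pow: "phi (shifted_pow u r n) = (cs (of_int r gchoose nat (r - n)) * phi u ^ nat (r - n) when n \<le> r)"
  unfolding shifted_pow_def by simp

lemma cs_hb_power: "cs k * hb c ^ e = (xp (k * c ^ e) e :: 'i vend fps)"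
proof -
  have "hb c ^ e = (cs (c ^ e) * fps_X ^ e :: 'i vend fps)"
  proof (induction e)
    case (Suc e)
    have "hb c ^ Suc e = cs c * ((fps_X * cs (c ^ e)) * fps_X ^ e :: 'i vend fps)"
      unfolding power_Suc Suc by (simp add: hb_def mult.assoc)
    also have "fps_X * cs (c ^ e) = (cs (c ^ e) * fps_X :: 'i vend fps)" by (rule fps_const_sc_commute[symmetric])
    finally show ?case by (simp add: mult.assoc fps_const_mult[symmetric] del: fps_const_mult)
  qed simp
  then show ?thesis by (simp add: xp_def mult.assoc[symmetric])
qed

lemma phi_ser_h_shifted: "phi (ser_h_shifted (scal [:1 / 2:] * hbar * cc) i n) = hsh i n"
proof -
  let ?u = "scal [:1 / 2:] * hbar * cc :: 'i dy_free"
  have u: "phi ?u = hb (1 / 2)" by (simp add: hb_def)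
  have t: "phi (ser_h Plus i m * shifted_pow ?u m n) = xp (gb (1 / 2) n (nat (m - n))) (nat (m - n)) * hpl i m" if "n \<le> m" for m
  proof -
    have "n + int (nat (m - n)) = m" using that by simp
    then have "phi (shifted_pow ?u m n) = xp (gb (1 / 2) n (nat (m - n))) (nat (m - n))"
      unfolding phi_shifted_pow u cs_hb_power gb_def using that by simp
    then show ?thesis by (simp only: phi_hom phi_h xp_commute)
  qed
  have "phi (ser_h_shifted ?u i n) = (\<Sum>m\<in>{n..- 1}. phi (ser_h Plus i m * shifted_pow ?u m n))"
    unfolding ser_h_shifted_def
    by (rule phi_Sum_any) (auto simp: ser_h_def shifted_pow_def when_def Let_def)
  also have "\<dots> = (\<Sum>m\<in>{n..- 1}. xp (gb (1 / 2) n (nat (m - n))) (nat (m - n)) * hpl i m)"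
    by (rule sum.cong) (use t in auto)
  finally show ?thesis using sh_finite[of "hpl i" "1 / 2" n, OF hpl_zero] by (simp only: hsh_def)
qed

lemma ser_h_shifted_nonneg: "n \<ge> 0 \<Longrightarrow> ser_h_shifted u i n = 0"
proof -
  assume "n \<ge> 0"
  then have "ser_h Plus i m * shifted_pow u m n = 0" for m
    by (auto simp: ser_h_def shifted_pow_def when_def Let_def)
  then show ?thesis by (simp add: ser_h_shifted_def)
qed

lemma phi_rel_xx_mixed: "phi (rel_xx_mixed i j m n) = 0"
proof (cases "i = j")
  case False
  then show ?thesis by (simp add: rel_xx_mixed_def commutator_def Xf_Xf_mixed[OF False])
next
  case True
  have 1: "phi (ser_delta_quot m n) = (xp (of_int (- m - 1) gchoose nat (- m - 1 - n)) (nat (- m - 1 - n) - 1) when n < - m - 1)"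
    unfolding ser_delta_quot_def Let_def using cs_hb_power[of _ 1] by simp
  have 2: "phi (Sum_any (\<lambda>q. ser_delta (hbar * cc) m q * ser_h_shifted (scal [:1 / 2:] * hbar * cc) i (n - q)))
      = (\<Sum>q\<in>{n + 1..- m - 1}. xp (of_int (- m - 1) gchoose nat (- m - 1 - q)) (nat (- m - 1 - q)) * hsh i (n - q))"
  proof -
    have "phi (Sum_any (\<lambda>q. ser_delta (hbar * cc) m q * ser_h_shifted (scal [:1 / 2:] * hbar * cc) i (n - q)))
        = (\<Sum>q\<in>{n + 1..- m - 1}. phi (ser_delta (hbar * cc) m q * ser_h_shifted (scal [:1 / 2:] * hbar * cc) i (n - q)))"
    proof (rule phi_Sum_any)
      \<comment> \<open>h^+ has no nonnegative powers of w, and the expansion of the delta function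
        none above -m - 1; this bounds q on both sides.\<close>
      show "{q. ser_delta (hbar * cc) m q * ser_h_shifted (scal [:1 / 2:] * hbar * cc) i (n - q) \<noteq> 0} \<subseteq> {n + 1..- m - 1}"
      proof
        fix q assume q: "q \<in> {q. ser_delta (hbar * cc) m q * ser_h_shifted (scal [:1 / 2:] * hbar * cc) i (n - q) \<noteq> (0 :: 'i dy_free)}"
        then have "\<not> n - q \<ge> 0" "q \<le> - m - 1"
          using ser_h_shifted_nonneg[of "n - q" "scal [:1 / 2:] * hbar * cc" i] by (auto simp: ser_delta_def shifted_pow_def when_def split: if_splits)
        then show "q \<in> {n + 1..- m - 1}" by simp
      qed
    qed simp
    also have "\<dots> = (\<Sum>q\<in>{n + 1..- m - 1}. xp (of_int (- m - 1) gchoose nat (- m - 1 - q)) (nat (- m - 1 - q)) * hsh i (n - q))"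
      by (rule sum.cong) (use cs_hb_power[of _ 1] in \<open>auto simp: phi_ser_h_shifted ser_delta_def phi_shifted_pow simp del: phi_hom(2) simp: phi_hom(2)[of "ser_delta _ _ _"] phi_hom(2)[of "shifted_pow _ _ _"] phi_hom(2)[of hbar]\<close>)
    finally show ?thesis .
  qed
  have 3: "phi (Sum_any (\<lambda>p. ser_delta 0 p n * ser_h Minus i (m - p))) = hmi i (m + n + 1)"
  proof -
    have "phi (Sum_any (\<lambda>p. ser_delta 0 p n * ser_h Minus i (m - p))) = (\<Sum>p\<in>{- n - 1}. phi (ser_delta 0 p n * ser_h Minus i (m - p)))"
    proof (rule phi_Sum_any)
      show "{p. ser_delta 0 p n * ser_h Minus i (m - p) \<noteq> 0} \<subseteq> {- n - 1}"
      proof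
        fix p assume "p \<in> {p. ser_delta 0 p n * ser_h Minus i (m - p) \<noteq> 0}"
        then have "shifted_pow 0 (- p - 1) n \<noteq> (0 :: 'i dy_free)" by (auto simp: ser_delta_def)
        then show "p \<in> {- n - 1}" by (auto simp: shifted_pow_def when_def power_0_left split: if_splits)
      qed
    qed simp
    also have "\<dots> = hmi i (m + n + 1)"
      by (simp add: ser_delta_def phi_shifted_pow algebra_simps)
    finally show ?thesis .
  qed
  show ?thesis
    using Xf_Xf_same[of i m n] unfolding rel_xx_mixed_def phi_diff phi_commutator phi_x phi_when phi_hom(1) 1 2 3 unfolding True[symmetric] by simp
qed

theorem phi_relators: "x \<in> dy_relators a \<Longrightarrow> phi x = 0"
  unfolding dy_relators_def
  by (auto simp: phi_rel_hh phi_rel_hh_mixed phi_rel_hx_plus phi_rel_hx_minus phi_rel_xx phi_rel_xx_mixed phi_rel_serre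
      commutator_def)

end

section \<open>Degrees\<close>

lemma Vdeg_iff: "v \<in> Vdeg a n \<beta> \<longleftrightarrow>
    (\<forall>\<gamma> \<mu>. Poly_Mapping.lookup (Poly_Mapping.lookup v \<gamma>) \<mu> \<noteq> 0 \<longrightarrow> \<gamma> = \<beta> \<and> - mon_weight \<mu> - half_norm a \<beta> = n)"
proof
  assume v: "v \<in> Vdeg a n \<beta>"
  show "\<forall>\<gamma> \<mu>. Poly_Mapping.lookup (Poly_Mapping.lookup v \<gamma>) \<mu> \<noteq> 0 \<longrightarrow> \<gamma> = \<beta> \<and> - mon_weight \<mu> - half_norm a \<beta> = n"
  proof (intro allI impI)
    fix \<gamma> \<mu> assume l: "Poly_Mapping.lookup (Poly_Mapping.lookup v \<gamma>) \<mu> \<noteq> 0"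
    then have "\<gamma> \<in> Poly_Mapping.keys v" by (auto simp: in_keys_iff)
    then have "\<gamma> = \<beta>" using v by (auto simp: Vdeg_def)
    then show "\<gamma> = \<beta> \<and> - mon_weight \<mu> - half_norm a \<beta> = n" using v l by (auto simp: Vdeg_def in_keys_iff)
  qed
next
  assume R: "\<forall>\<gamma> \<mu>. Poly_Mapping.lookup (Poly_Mapping.lookup v \<gamma>) \<mu> \<noteq> 0 \<longrightarrow> \<gamma> = \<beta> \<and> - mon_weight \<mu> - half_norm a \<beta> = n"
  have "Poly_Mapping.keys v \<subseteq> {\<beta>}"
  proof
    fix \<gamma> assume "\<gamma> \<in> Poly_Mapping.keys v"
    then have "Poly_Mapping.lookup v \<gamma> \<noteq> 0" by (simp add: in_keys_iff)
    then obtain \<mu> where "Poly_Mapping.lookup (Poly_Mapping.lookup v \<gamma>) \<mu> \<noteq> 0"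
      using poly_mapping_eqI[of "Poly_Mapping.lookup v \<gamma>" 0] by auto
    with R show "\<gamma> \<in> {\<beta>}" by blast
  qed
  moreover have "- mon_weight \<mu> - half_norm a \<beta> = n" if "\<mu> \<in> Poly_Mapping.keys (Poly_Mapping.lookup v \<beta>)" for \<mu>
    using R that unfolding in_keys_iff by blast
  ultimately show "v \<in> Vdeg a n \<beta>" unfolding Vdeg_def by blast
qed

lemma VdegI: "(\<And>\<gamma> \<mu>. Poly_Mapping.lookup (Poly_Mapping.lookup v \<gamma>) \<mu> \<noteq> 0 \<Longrightarrow>
    \<gamma> = \<beta> \<and> - mon_weight \<mu> - half_norm a \<beta> = n) \<Longrightarrow> v \<in> Vdeg a n \<beta>"
  unfolding Vdeg_iff by blast

lemma VdegD: "v \<in> Vdeg a n \<beta> \<Longrightarrow> Poly_Mapping.lookup (Poly_Mapping.lookup v \<gamma>) \<mu> \<noteq> 0 \<Longrightarrow>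
    \<gamma> = \<beta> \<and> - mon_weight \<mu> - half_norm a \<beta> = n"
  unfolding Vdeg_iff by blast

lemma Vdeg_zero [simp]: "0 \<in> Vdeg a n \<beta>"
  by (simp add: Vdeg_iff)

lemma Vdeg_add: "u \<in> Vdeg a n \<beta> \<Longrightarrow> v \<in> Vdeg a n \<beta> \<Longrightarrow> u + v \<in> Vdeg a n \<beta>"
  unfolding Vdeg_iff lookup_add by (metis add.right_neutral)

lemma cf_lookup: "Poly_Mapping.lookup (cf c * f) \<mu> = c * Poly_Mapping.lookup f \<mu>"
proof (induction f rule: poly_mapping_single_induct)
  case (3 k b)
  then show ?case by (simp add: cf_def mult_single lookup_single when_def)
qed (simp_all add: lookup_add algebra_simps)

lemma Vdeg_vscale: "v \<in> Vdeg a n \<beta> \<Longrightarrow> vscale c v \<in> Vdeg a n \<beta>"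
  by (rule VdegI, rule VdegD) (auto simp: cf_lookup)

lemma Vdeg_uminus: "v \<in> Vdeg a n \<beta> \<Longrightarrow> - v \<in> Vdeg a n \<beta>"
  by (rule VdegI, rule VdegD) auto

lemma Vdeg_sum: "(\<And>x. x \<in> A \<Longrightarrow> f x \<in> Vdeg a n \<beta>) \<Longrightarrow> sum f A \<in> Vdeg a n \<beta>"
  by (induction A rule: infinite_finite_induct) (auto intro: Vdeg_add)

abbreviation vdeg :: "('i::finite \<Rightarrow> 'i \<Rightarrow> int) \<Rightarrow> int \<Rightarrow> 'i lattice \<Rightarrow> 'i vend \<Rightarrow> bool" where
  "vdeg a m \<gamma> f \<equiv> has_degree a m \<gamma> (ap f)"

lemma vdegI: "(\<And>n \<beta> v. v \<in> Vdeg a n \<beta> \<Longrightarrow> ap f v \<in> Vdeg a (n + m) (\<beta> + \<gamma>)) \<Longrightarrow> vdeg a m \<gamma> f"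
  by (auto simp: has_degree_def)

lemma vdegD: "vdeg a m \<gamma> f \<Longrightarrow> v \<in> Vdeg a n \<beta> \<Longrightarrow> ap f v \<in> Vdeg a (n + m) (\<beta> + \<gamma>)"
  by (auto simp: has_degree_def)

lemma vdeg_zero [simp]: "vdeg a m \<gamma> 0"
  by (rule vdegI) simp

lemma vdeg_add: "vdeg a m \<gamma> f \<Longrightarrow> vdeg a m \<gamma> g \<Longrightarrow> vdeg a m \<gamma> (f + g)"
  by (rule vdegI) (auto intro: Vdeg_add vdegD)

lemma vdeg_uminus: "vdeg a m \<gamma> f \<Longrightarrow> vdeg a m \<gamma> (- f)"
  by (rule vdegI) (auto intro: Vdeg_uminus vdegD)

lemma vdeg_sum: "(\<And>x. x \<in> A \<Longrightarrow> vdeg a m \<gamma> (f x)) \<Longrightarrow> vdeg a m \<gamma> (sum f A)"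
  by (induction A rule: infinite_finite_induct) (auto intro: vdeg_add)

lemma vdeg_mult: "vdeg a m \<gamma> f \<Longrightarrow> vdeg a m' \<gamma>' g \<Longrightarrow> vdeg a (m + m') (\<gamma> + \<gamma>') (f * g)"
proof (rule vdegI)
  fix n \<beta> v assume f: "vdeg a m \<gamma> f" and g: "vdeg a m' \<gamma>' g" and v: "v \<in> Vdeg a n \<beta>"
  show "ap (f * g) v \<in> Vdeg a (n + (m + m')) (\<beta> + (\<gamma> + \<gamma>'))"
    using vdegD[OF f vdegD[OF g v]] by (simp add: algebra_simps)
qed

lemma vdeg_sc: "vdeg a 0 0 (sc c)"
  by (rule vdegI) (auto intro: Vdeg_vscale)

lemma vdeg_sc_mult: "vdeg a m \<gamma> f \<Longrightarrow> vdeg a m \<gamma> (sc c * f)"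
  using vdeg_mult[OF vdeg_sc] by force

section \<open>Weights of polynomials and homogeneity of the operators\<close>

lemma mon_weight_extend: "mon_weight \<mu> = extend_sum (\<lambda>x c. int (snd x + 1) * int c) \<mu>"
  unfolding mon_weight_def extend_sum_def by (simp add: case_prod_beta)

lemma mon_weight_add: "mon_weight (\<mu> + \<nu>) = mon_weight \<mu> + mon_weight \<nu>"
  unfolding mon_weight_extend by (rule extend_sum_add) (simp_all add: algebra_simps)

lemma mon_weight_single: "mon_weight (Poly_Mapping.single x c) = int (snd x + 1) * int c"
  unfolding mon_weight_extend by (rule extend_sum_single) simp

lemma mon_weight_zero [simp]: "mon_weight 0 = 0"
  by (simp add: mon_weight_def)

definition fw :: "int \<Rightarrow> 'i fock \<Rightarrow> bool" where
  "fw w g \<longleftrightarrow> (\<forall>\<mu>. Poly_Mapping.lookup g \<mu> \<noteq> 0 \<longrightarrow> mon_weight \<mu> = w)"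

lemma fw_zero [simp]: "fw w 0" by (simp add: fw_def)

lemma fw_add: "fw w f \<Longrightarrow> fw w g \<Longrightarrow> fw w (f + g)"
  unfolding fw_def lookup_add by (metis add.right_neutral)

lemma fw_sum: "(\<And>x. x \<in> A \<Longrightarrow> fw w (f x)) \<Longrightarrow> fw w (sum f A)"
  by (induction A rule: infinite_finite_induct) (auto intro: fw_add)

lemma fw_mult: "fw w f \<Longrightarrow> fw w' g \<Longrightarrow> fw (w + w') (f * g)"
proof (unfold fw_def, intro allI impI)
  fix \<mu> assume f: "\<forall>\<mu>. Poly_Mapping.lookup f \<mu> \<noteq> 0 \<longrightarrow> mon_weight \<mu> = w"
    and g: "\<forall>\<mu>. Poly_Mapping.lookup g \<mu> \<noteq> 0 \<longrightarrow> mon_weight \<mu> = w'" and "Poly_Mapping.lookup (f * g) \<mu> \<noteq> 0"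
  then have "\<mu> \<in> Poly_Mapping.keys (f * g)" by (simp add: in_keys_iff)
  then obtain x y where "\<mu> = x + y" "x \<in> Poly_Mapping.keys f" "y \<in> Poly_Mapping.keys g"
    using keys_mult[of f g] by blast
  then show "mon_weight \<mu> = w + w'" using f g by (simp add: in_keys_iff mon_weight_add)
qed

lemma fw_cf: "fw 0 (cf c)"
  by (simp add: fw_def cf_def lookup_single when_def)

lemma fw_cf_mult: "fw w f \<Longrightarrow> fw w (cf c * f)"
  using fw_mult[OF fw_cf] by force

lemma fw_var: "r > 0 \<Longrightarrow> fw (int r) (fock_var i r)"
  by (auto simp: fw_def fock_var_def lookup_single when_def mon_weight_single)

lemma fw_gco: "fw (int n) (gco s j n)"
proof (induction n rule: less_induct)
  case (less n)
  show ?case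
  proof (cases n)
    case 0 then show ?thesis using fw_cf[of 1] by simp
  next
    case (Suc m)
    have "fw (int (Suc m)) (fock_var j (Suc m - k) * gco s j k)" if "k \<le> m" for k
      using fw_mult[OF fw_var[of "Suc m - k" j] less[of k]] that Suc by (simp add: of_nat_diff)
    then show ?thesis unfolding Suc gco.simps(2) by (intro fw_cf_mult fw_sum) auto
  qed
qed

text \<open>Homogeneity when z and \<hbar> have degree 1 and H_{j,-r} has weight r. The series A is
  homogeneous because the powers (z + c\<hbar>)^r are; this is the source of the degree k - a in the
  theorem.\<close>

definition Shom :: "'i fock fps fps \<Rightarrow> bool" where
  "Shom x \<longleftrightarrow> (\<forall>m d. fw (int (m + d)) (fps_nth (fps_nth x m) d))"

lemma Shom_Ec: "Shom (Ec c (gh s j))"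
  unfolding Shom_def Ec_nth gh_nth by (intro allI fw_cf_mult fw_gco)

lemma Shom_mult: "Shom x \<Longrightarrow> Shom y \<Longrightarrow> Shom (x * y)"
proof (unfold Shom_def fps2_mult_nth, intro allI fw_sum)
  fix m d k e :: nat
  assume x: "\<forall>m d. fw (int (m + d)) (fps_nth (fps_nth x m) d)" and y: "\<forall>m d. fw (int (m + d)) (fps_nth (fps_nth y m) d)"
    and "k \<in> {..m}" "e \<in> {..d}"
  then have e: "int (k + e) + int (m - k + (d - e)) = int (m + d)" by auto
  show "fw (int (m + d)) (fps_nth (fps_nth x k) e * fps_nth (fps_nth y (m - k)) (d - e))"
    using fw_mult[OF x[rule_format, of k e] y[rule_format, of "m - k" "d - e"]] unfolding e .
qed

lemma Shom_one: "Shom 1"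
  using fw_cf[of 1] by (simp add: Shom_def)

lemma Shom_prod: "(\<And>j. j \<in> J \<Longrightarrow> Shom (f j)) \<Longrightarrow> Shom (\<Prod>j\<in>J. f j)"
  by (induction J rule: infinite_finite_induct) (simp_all add: Shom_mult Shom_one)

lemma Shom_vA: "Shom (vA a s i)"
  unfolding vA_def by (intro Shom_mult Shom_Ec Shom_prod)

lemma vdeg_mo: "fw w g \<Longrightarrow> vdeg a (- w) 0 (mo g)"
proof (rule vdegI)
  fix n \<beta> v assume g: "fw w g" and v: "v \<in> Vdeg a n \<beta>"
  have l: "fw (- n - half_norm a \<beta>) (Poly_Mapping.lookup v \<beta>)" 
    unfolding fw_def
  proof (intro allI impI)
    fix \<mu> assume "Poly_Mapping.lookup (Poly_Mapping.lookup v \<beta>) \<mu> \<noteq> 0"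
    from VdegD[OF v this] show "mon_weight \<mu> = - n - half_norm a \<beta>" by linarith
  qed
  have z: "\<gamma> \<noteq> \<beta> \<Longrightarrow> Poly_Mapping.lookup v \<gamma> = 0" for \<gamma>
    using VdegD[OF v] poly_mapping_eqI[of "Poly_Mapping.lookup v \<gamma>" 0] by (metis lookup_zero)
  have K: "Poly_Mapping.lookup (g * Poly_Mapping.lookup v \<gamma>) \<mu> \<noteq> 0 \<Longrightarrow> \<gamma> = \<beta> \<and> - mon_weight \<mu> - half_norm a \<beta> = n + - w" for \<gamma> \<mu>
  proof (cases "\<gamma> = \<beta>")
    assume n: "Poly_Mapping.lookup (g * Poly_Mapping.lookup v \<gamma>) \<mu> \<noteq> 0"
    case True
    with n fw_mult[OF g l] have "mon_weight \<mu> = w + (- n - half_norm a \<beta>)" unfolding fw_def by blast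
    then show ?thesis using True by linarith
  qed (use z[of \<gamma>] in simp)
  show "ap (mo g) v \<in> Vdeg a (n + - w) (\<beta> + 0)"
    unfolding add_0_right by (rule VdegI) (unfold lookup_mo, rule K)
qed

lemma vdeg_hann: "r > 0 \<Longrightarrow> vdeg a (int r) 0 (hann i r)"
proof (rule vdegI)
  fix n \<beta> v assume r: "r > 0" and v: "v \<in> Vdeg a n \<beta>"
  have K: "\<gamma> = \<beta> \<and> - mon_weight \<mu> - half_norm a \<beta> = n + int r"
    if "Poly_Mapping.lookup (of_nat r * fock_deriv i r (Poly_Mapping.lookup v \<gamma>)) \<mu> \<noteq> 0" for \<gamma> \<mu>
  proof -
    have "Poly_Mapping.lookup (Poly_Mapping.lookup v \<gamma>) (\<mu> + Poly_Mapping.single (i, r - 1) 1) \<noteq> 0"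
      using that unfolding cf_of_nat[symmetric] cf_lookup lookup_fock_deriv by auto
    from VdegD[OF v this] have "\<gamma> = \<beta> \<and> - mon_weight (\<mu> + Poly_Mapping.single (i, r - 1) 1) - half_norm a \<beta> = n" .
    then show ?thesis using r unfolding mon_weight_add mon_weight_single by (simp add: of_nat_diff)
  qed
  show "ap (hann i r) v \<in> Vdeg a (n + int r) (\<beta> + 0)"
    unfolding add_0_right ap_hann by (rule VdegI) (unfold lookup_Hann, rule K)
qed

lemma vdeg_bser: "vdeg a (int r) 0 (fps_nth (bser s i) r)"
proof (cases "r = 0")
  case False
  then have "fps_nth (bser s i) r = sc (- pm s / of_nat r) * hann i r" by (simp add: bser_def)
  then show ?thesis using False by (simp only: vdeg_sc_mult vdeg_hann)
qed simp

lemma vdeg_bser_power: "vdeg a (int k) 0 (fps_nth (bser s i ^ n) k)"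
proof (induction n arbitrary: k)
  case 0
  then show ?case by (auto simp: has_degree_def)
next
  case (Suc n)
  have "vdeg a (int k) 0 (fps_nth (bser s i) j * fps_nth (bser s i ^ n) (k - j))" if "j \<le> k" for j
    using vdeg_mult[OF vdeg_bser[of a j s i] Suc[of "k - j"]] that by (simp add: of_nat_diff)
  then show ?case unfolding power_Suc fps_mult_nth by (intro vdeg_sum) simp
qed

lemma vdeg_ibexp: "vdeg a k 0 (ibexp s i k)"
proof -
  have "vdeg a (int n) 0 (bexp s i n)" for n
    unfolding bexp_def by (intro vdeg_sum vdeg_sc_mult vdeg_bser_power)
  from this[of "nat k"] show ?thesis by (cases "k \<ge> 0") (simp_all add: ibexp_def)
qed

text \<open>The coefficient of \<hbar>^b has its degree lowered by b, so K is the degree of the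
  whole operator if multiplication by \<hbar> is counted as (1, 0). With this convention degrees add
  under products.\<close>

definition homog :: "('i::finite \<Rightarrow> 'i \<Rightarrow> int) \<Rightarrow> int \<times> 'i lattice \<Rightarrow> 'i vend fps \<Rightarrow> bool" where
  "homog a K x \<longleftrightarrow> (\<forall>b. vdeg a (fst K - int b) (snd K) (fps_nth x b))"

lemma homog_zero [simp]: "homog a K 0"
  by (simp add: homog_def)

lemma homog_add: "homog a K x \<Longrightarrow> homog a K y \<Longrightarrow> homog a K (x + y)"
  by (simp add: homog_def vdeg_add)

lemma homog_uminus: "homog a K x \<Longrightarrow> homog a K (- x)"
  by (simp add: homog_def vdeg_uminus)

lemma homog_mult: "homog a K x \<Longrightarrow> homog a L y \<Longrightarrow> homog a (K + L) (x * y)"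
proof (unfold homog_def fps_mult_nth, intro allI vdeg_sum)
  fix b i :: nat assume x: "\<forall>b. vdeg a (fst K - int b) (snd K) (fps_nth x b)" and y: "\<forall>b. vdeg a (fst L - int b) (snd L) (fps_nth y b)"
    and "i \<in> {0..b}"
  then have e: "fst K - int i + (fst L - int (b - i)) = fst (K + L) - int b" "snd K + snd L = snd (K + L)" by auto
  show "vdeg a (fst (K + L) - int b) (snd (K + L)) (fps_nth x i * fps_nth y (b - i))"
    using vdeg_mult[OF x[rule_format, of i] y[rule_format, of "b - i"]] unfolding e .
qed

lemma homog_lsum:
  assumes "sumbl F" "\<And>p. homog a K (F p)"
  shows "homog a K (lsum F)"
  unfolding homog_def
proof (intro allI vdegI)
  fix b n \<beta> v assume v: "v \<in> Vdeg a n \<beta>"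
  have "app (F p) b v \<in> Vdeg a (n + (fst K - int b)) (\<beta> + snd K)" for p
    using assms(2)[of p] v unfolding homog_def app_def by (blast intro: vdegD)
  then have "app (lsum F) b v \<in> Vdeg a (n + (fst K - int b)) (\<beta> + snd K)"
    unfolding app_lsum[OF assms(1)] Sum_any.expand_set by (intro Vdeg_sum)
  then show "ap (fps_nth (lsum F) b) v \<in> Vdeg a (n + (fst K - int b)) (\<beta> + snd K)" by (simp add: app_def)
qed

lemma homog_const: "vdeg a k \<gamma> f \<Longrightarrow> homog a (k, \<gamma>) (fps_const f)"
  by (simp add: homog_def)

lemma homog_cs: "homog a 0 (fps_const (sc c))"
  using vdeg_sc[of a c] by (simp add: homog_def)

lemma homog_one: "homog a 0 1"
  using homog_cs[of a 1] by simp

lemma homog_X: "homog a (1, 0) fps_X"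
  using vdeg_sc[of a 1] by (simp add: homog_def)

lemma homog_X_power: "homog a (int n, 0) (fps_X ^ n)"
proof (induction n)
  case 0 then show ?case using homog_one[of a] by (simp add: zero_prod_def)
next
  case (Suc n)
  then show ?case using homog_mult[OF homog_X, of a "(int n, 0)"] by (simp add: add.commute)
qed

lemma homog_xp: "homog a (int e, 0) (xp k e)"
  unfolding xp_def using homog_mult[OF homog_cs[of a k] homog_X_power[of a e]] by simp

lemma homog_mu: "Shom x \<Longrightarrow> homog a (- m, 0) (mu x m)"
proof -
  assume x: "Shom x"
  have "vdeg a (- m - int b) 0 (mo (fps_nth (fps_nth x (nat m)) b))" if "m \<ge> 0" for b
    using vdeg_mo[OF x[unfolded Shom_def, rule_format, of "nat m" b], of a] that by (simp add: algebra_simps)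
  then show ?thesis by (simp add: homog_def mu_def)
qed

lemma homog_sh:
  assumes "\<And>m. homog a (- m - D, \<gamma>) (F m)"
  shows "homog a (- m - D, \<gamma>) (sh c F m)"
  unfolding sh_def
proof (rule homog_lsum[OF sumbl_xp])
  fix e
  show "homog a (- m - D, \<gamma>) (xp (gb c m e) e * F (m + int e))"
    using homog_mult[OF homog_xp assms[of "m + int e"], of e "gb c m e"] by simp
qed

lemma homog_fps_shift: "homog a (k, \<gamma>) x \<Longrightarrow> homog a (k - 1, \<gamma>) (fps_shift 1 x)"
  unfolding homog_def
proof
  fix b assume "\<forall>b. vdeg a (fst (k, \<gamma>) - int b) (snd (k, \<gamma>)) (fps_nth x b)"
  from this[rule_format, of "b + 1"] show "vdeg a (fst (k - 1, \<gamma>) - int b) (snd (k - 1, \<gamma>)) (fps_nth (fps_shift 1 x) b)"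
    by (simp add: algebra_simps)
qed

definition gr_homog :: "('i::finite \<Rightarrow> 'i \<Rightarrow> int) \<Rightarrow> 'i gring \<Rightarrow> bool" where
  "gr_homog a g \<longleftrightarrow> (\<forall>K. homog a K (Poly_Mapping.lookup g K))"

lemma gr_homog_add: "gr_homog a g \<Longrightarrow> gr_homog a h \<Longrightarrow> gr_homog a (g + h)"
  by (simp add: gr_homog_def lookup_add homog_add)

lemma gr_homog_zero [simp]: "gr_homog a 0"
  by (simp add: gr_homog_def)

lemma gr_homog_sum: "(\<And>x. x \<in> A \<Longrightarrow> gr_homog a (f x)) \<Longrightarrow> gr_homog a (sum f A)"
  by (induction A rule: infinite_finite_induct) (auto intro: gr_homog_add)

lemma gr_homog_single: "homog a K x \<Longrightarrow> gr_homog a (Poly_Mapping.single K x)"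
  unfolding gr_homog_def lookup_single when_def by (auto simp del: split_paired_All)

lemma gr_homog_mult:
  assumes "gr_homog a g" "gr_homog a h" shows "gr_homog a (g * h)"
proof -
  let ?s = "\<lambda>g K. Poly_Mapping.single K (Poly_Mapping.lookup g K)"
  have "gr_homog a ((\<Sum>K\<in>Poly_Mapping.keys g. ?s g K) * (\<Sum>L\<in>Poly_Mapping.keys h. ?s h L))"
    unfolding sum_product mult_single
    by (intro gr_homog_sum gr_homog_single homog_mult) (use assms in \<open>auto simp: gr_homog_def\<close>)
  then show ?thesis by (simp only: poly_mapping_sum_singles[symmetric])
qed

text \<open>Components of different degrees move a homogeneous vector into different components of the space, so
  they cannot cancel each other.\<close>

lemma gr_homog_aug_zero:
  assumes g: "gr_homog a g" and z: "aug g = 0"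
  shows "g = 0"
proof (rule poly_mapping_eqI)
  fix K
  have coord: "Poly_Mapping.lookup (Poly_Mapping.lookup (app (Poly_Mapping.lookup g K) d (Poly_Mapping.single \<beta> (Poly_Mapping.single \<mu> c))) \<gamma>) \<nu> = 0"
    for d \<beta> \<mu> c \<gamma> \<nu>
  proof (rule ccontr)
    let ?v = "Poly_Mapping.single \<beta> (Poly_Mapping.single \<mu> c)"
    let ?l = "\<lambda>v. Poly_Mapping.lookup (Poly_Mapping.lookup v \<gamma>) \<nu>"
    let ?n = "- mon_weight \<mu> - half_norm a \<beta>"
    assume K: "?l (app (Poly_Mapping.lookup g K) d ?v) \<noteq> 0"
    have v: "?v \<in> Vdeg a ?n \<beta>" by (rule VdegI) (auto simp: lookup_single when_def split: if_splits)
    \<comment> \<open>The input monomial, the output monomial and the order in \<hbar> together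
      determine the degree L.\<close>
    have D: "\<gamma> = \<beta> + snd L \<and> - mon_weight \<nu> - half_norm a (\<beta> + snd L) = ?n + (fst L - int d)"
      if "?l (app (Poly_Mapping.lookup g L) d ?v) \<noteq> 0" for L
      using VdegD[OF vdegD[OF g[unfolded gr_homog_def homog_def, rule_format, of L d] v] that[unfolded app_def]] by simp
    have "L = K" if "?l (app (Poly_Mapping.lookup g L) d ?v) \<noteq> 0" for L
      using D[OF that] D[OF K] by (auto simp: prod_eq_iff)
    then have 1: "(\<Sum>L\<in>Poly_Mapping.keys g. ?l (app (Poly_Mapping.lookup g L) d ?v)) = (\<Sum>L\<in>{K}. ?l (app (Poly_Mapping.lookup g L) d ?v))"
      by (intro sum.mono_neutral_cong) (auto simp: in_keys_iff)
    have "?l (app (aug g) d ?v) = 0" using z by simp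
    then have "(\<Sum>L\<in>Poly_Mapping.keys g. ?l (app (Poly_Mapping.lookup g L) d ?v)) = 0"
      by (simp add: aug_def extend_sum_def app_sum lookup_sum)
    with 1 K show False by simp
  qed
  have "app (Poly_Mapping.lookup g K) d v = 0" for d v
  proof (induction v rule: poly_mapping_single_induct)
    case (3 \<beta> f)
    show ?case
    proof (induction f rule: poly_mapping_single_induct)
      case (3 \<mu> c)
      show ?case by (intro poly_mapping_eqI) (simp add: coord)
    qed (simp_all add: single_add)
  qed simp_all
  then show "Poly_Mapping.lookup g K = Poly_Mapping.lookup 0 K" by (intro app_eqI) simp
qed

context vertex
begin

lemma Shom_kap: "Shom (kap i)"
  unfolding kap_def by (intro Shom_mult Shom_vA)

text \<open>On the \<beta> that survive the pairing with the root is m, and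
  \<open>half_norm_add_sroot\<close> gives the change of degree.\<close>

lemma vdeg_zmode: "vdeg a (- m - 1) (sroot s i) (zmode s i m)"
proof (rule vdegI)
  fix n \<beta> v assume v: "v \<in> Vdeg a n \<beta>"
  have K: "\<gamma> = \<beta> + sroot s i \<and> - mon_weight \<mu> - half_norm a (\<beta> + sroot s i) = n + (- m - 1)"
    if "Poly_Mapping.lookup (Poly_Mapping.lookup (ap (zmode s i m) v) \<gamma>) \<mu> \<noteq> 0" for \<gamma> \<mu>
  proof -
    have f: "form a (sroot s i) (\<gamma> - sroot s i) = m" "Poly_Mapping.lookup (Poly_Mapping.lookup v (\<gamma> - sroot s i)) \<mu> \<noteq> 0"
      using that by (auto simp: lookup_zmode cf_lookup when_def split: if_splits)
    from VdegD[OF v f(2)] have b: "\<gamma> - sroot s i = \<beta>" "- mon_weight \<mu> - half_norm a \<beta> = n" by auto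
    then have "form a (sroot s i) \<beta> = m" using f(1) by simp
    moreover have "\<gamma> = \<beta> + sroot s i" using b(1) by (simp add: algebra_simps)
    ultimately show ?thesis using b(2) half_norm_add_sroot[of s i \<beta>] by (simp add: add.commute[of \<beta>])
  qed
  show "ap (zmode s i m) v \<in> Vdeg a (n + (- m - 1)) (\<beta> + sroot s i)"
    by (rule VdegI) (rule K)
qed

lemma pm_vdeg: "vdeg a m \<gamma> f \<Longrightarrow> vdeg a m \<gamma> (pm s * f)"
  by (cases s) (simp_all add: vdeg_uminus)

lemma homog_vT: "homog a (- m - 1, sroot s i) (vT s i m)"
  unfolding vT_def
proof (rule homog_lsum)
  show "sumbl (\<lambda>k. fps_const (pm s * (ibexp s i k * zmode s i (m + k))))" using sumbl_vT_terms[where l = 0 and j = i and t = s] by simp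
  fix k
  show "homog a (- m - 1, sroot s i) (fps_const (pm s * (ibexp s i k * zmode s i (m + k))))"
  proof (intro homog_const pm_vdeg)
    have e: "k + (- (m + k) - 1) = - m - 1" "0 + sroot s i = sroot s i" by simp_all
    show "vdeg a (- m - 1) (sroot s i) (ibexp s i k * zmode s i (m + k))"
      using vdeg_mult[OF vdeg_ibexp[of a k s i] vdeg_zmode[of "m + k" s i]] unfolding e .
  qed
qed

lemma homog_Xf: "homog a (- m - 1, sroot s i) (Xf s i m)"
  unfolding Xf_def
proof (rule homog_lsum[OF sumbl_al_vT(1)])
  fix p
  show "homog a (- m - 1, sroot s i) (al s i (m - p) * vT s i p)"
    using homog_mult[OF homog_mu[OF Shom_vA[of a s i], of a "m - p"] homog_vT[of p s i]] by simp
qed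

lemma homog_Cc: "homog a (- m - 2, 0) (Cc i m)"
  unfolding Cc_def
proof (rule homog_lsum[OF sumbl_Cc_terms])
  fix p
  have T: "homog a (- q - 1, sroot Plus i) (sh 1 (vT Plus i) q)" for q
    by (rule homog_sh) (rule homog_vT)
  have "sroot Minus i + sroot Plus i = 0" by (simp add: sroot_Minus)
  then show "homog a (- m - 2, 0) (vT Minus i p * sh 1 (vT Plus i) (m - p))"
    using homog_mult[OF homog_vT[of p Minus i] T[of "m - p"]] by (simp add: algebra_simps)
qed

lemma homog_hpl: "homog a (- m - 1, 0) (hpl i m)"
proof -
  have "homog a (- m - 0, 0) (Kp i m)"
    unfolding Kp_def by (rule homog_sh) (use homog_Cc[of "m - 2" i for m] in \<open>simp add: algebra_simps\<close>)
  then show ?thesis unfolding hpl_def by (intro homog_fps_shift) simp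
qed

lemma homog_hmi: "homog a (- m - 1, 0) (hmi i m)"
  unfolding hmi_def by (intro homog_uminus homog_fps_shift homog_mu Shom_kap)

lemma homog_gval: "homog a (gdeg g) (gval g)"
proof (cases g)
  case (GenX s i r) then show ?thesis using homog_Xf[of "- r - 1" s i] by simp
next
  case (GenH i r) then show ?thesis using homog_hpl[of "- r - 1" i] homog_hmi[of "- r - 1" i] by simp
qed (simp add: homog_one)

lemma gr_homog_psi: "gr_homog a (psi x)"
proof -
  have k: "gr_homog a (kR c)" for c unfolding kR_def by (rule gr_homog_single) (rule homog_cs)
  have h: "gr_homog a hR" unfolding hR_def by (rule gr_homog_single) (rule homog_X)
  have e: "gr_homog a (embR p)" for p
    by (induction p) (simp_all add: embR_pCons gr_homog_add gr_homog_mult k h)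
  have w: "gr_homog a (wR (Word gs))" for gs
  proof (induction gs)
    case Nil then show ?case using k[of 1] by (simp add: kR_hom)
  qed (simp add: gr_homog_mult gr_homog_single homog_gval)
  have "gr_homog a (wR u)" for u by (cases u) (simp only: w)
  then show ?thesis unfolding psi_def extend_sum_def by (intro gr_homog_sum gr_homog_mult e)
qed

theorem psi_relators: "x \<in> dy_relators a \<Longrightarrow> psi x = 0"
  using gr_homog_aug_zero[OF gr_homog_psi] phi_relators unfolding phi_def by blast

end

section \<open>The vertex operators as locally finite sums\<close>

definition act :: "'i::finite vend fps \<Rightarrow> 'i vspace fps \<Rightarrow> 'i vspace fps" where
  "act x v = Abs_fps (\<lambda>n. \<Sum>b\<le>n. app x b (fps_nth v (n - b)))"

lemma act_nth: "fps_nth (act x v) n = (\<Sum>b\<le>n. app x b (fps_nth v (n - b)))"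
  by (simp add: act_def)

lemma act_mult: "act (x * y) v = act x (act y v)"
proof (rule fps_ext)
  fix n
  have "fps_nth (act x (act y v)) n = (\<Sum>e\<le>n. \<Sum>c\<le>n - e. app x e (app y c (fps_nth v (n - e - c))))"
    by (simp add: act_nth app_sum_right)
  also have "\<dots> = (\<Sum>b\<le>n. \<Sum>e\<le>b. app x e (app y (b - e) (fps_nth v (n - e - (b - e)))))"
    by (rule triangle_sum)
  also have "\<dots> = fps_nth (act (x * y) v) n"
    by (auto simp: act_nth app_mult intro!: sum.cong)
  finally show "fps_nth (act (x * y) v) n = fps_nth (act x (act y v)) n" ..
qed

lemma act_zero [simp]: "act 0 v = 0"
  by (rule fps_ext) (simp add: act_nth)

lemma act_one [simp]: "act 1 v = v"
proof (rule fps_ext)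
  fix n
  have "app 1 b (fps_nth v (n - b)) = (if b = 0 then fps_nth v n else 0)" for b by (simp add: app_def)
  then show "fps_nth (act 1 v) n = fps_nth v n" by (simp add: act_nth)
qed

lemma act_lsum:
  assumes "sumbl F" shows "fps_Sum (\<lambda>p. act (F p) v) = act (lsum F) v"
  by (rule fps_ext)
     (simp add: fps_Sum_def act_nth Sum_any_sum sumblD[OF assms] app_lsum[OF assms])

lemma act_const: "act (fps_const f) v = ext_h (ap f) v"
proof (rule fps_ext)
  fix n
  have "app (fps_const f) b (fps_nth v (n - b)) = (if b = 0 then ap f (fps_nth v n) else 0)" for b by (simp add: app_def)
  then show "fps_nth (act (fps_const f) v) n = fps_nth (ext_h (ap f) v) n" by (simp add: act_nth ext_h_def)
qed

lemma vscale_act: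
  fixes x :: "'i::finite vend fps"
  shows "ext_h (vscale c) (act x v) = act (fps_const (sc c) * x) v"
proof -
  have "(vscale c :: 'i vspace \<Rightarrow> _) = ap (sc c)" by (rule ext) simp
  then show ?thesis by (simp add: act_mult act_const)
qed

lemma hact_monom: "hact (Polynomial.monom 1 b) (ext_h T v) = Abs_fps (\<lambda>n. if b \<le> n then T (fps_nth v (n - b)) else 0)"
proof (rule fps_ext)
  fix n
  have "vscale (if b = c then 1 else 0) (T (fps_nth v (n - c))) = (if c = b then T (fps_nth v (n - b)) else 0)" for c
    by simp
  then show "fps_nth (hact (Polynomial.monom 1 b) (ext_h T v)) n = fps_nth (Abs_fps (\<lambda>n. if b \<le> n then T (fps_nth v (n - b)) else 0)) n"
    by (simp add: hact_def ext_h_def coeff_monom)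
qed

lemma act_expand: "act x v = fps_Sum (\<lambda>b. hact (Polynomial.monom 1 b) (ext_h (ap (fps_nth x b)) v))"
proof (rule fps_ext)
  fix n
  have "Sum_any (\<lambda>b. if b \<le> n then ap (fps_nth x b) (fps_nth v (n - b)) else 0)
      = (\<Sum>b\<le>n. if b \<le> n then ap (fps_nth x b) (fps_nth v (n - b)) else 0)"
    by (rule Sum_any.expand_superset) (auto split: if_splits)
  then show "fps_nth (act x v) n = fps_nth (fps_Sum (\<lambda>b. hact (Polynomial.monom 1 b) (ext_h (ap (fps_nth x b)) v))) n"
    by (simp add: fps_Sum_def hact_monom act_nth app_def)
qed

text \<open>The bridge between series of arbitrary functions on V[[\<hbar>]], in which the vertex
  operators are defined, and the series of operators in which the computations are made.\<close>

definition reps :: "'i::finite opser \<Rightarrow> (int \<Rightarrow> 'i vend fps) \<Rightarrow> bool" where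
  "reps S F \<longleftrightarrow> (\<forall>m v. S m v = act (F m) v)"

lemma reps_mult: "reps S F \<Longrightarrow> reps T G \<Longrightarrow> (\<And>m. sumbl (\<lambda>p. F p * G (m - p))) \<Longrightarrow>
    reps (op_mult S T) (\<lambda>m. lsum (\<lambda>p. F p * G (m - p)))"
  by (simp add: reps_def op_mult_def act_mult[symmetric] act_lsum)

lemma reps_one: "reps op_one (\<lambda>m. 1 when m = 0)"
  by (auto simp: reps_def op_one_def when_def)

text \<open>The powers are supplied as \<open>P\<close>, so that closed forms such as the
  coefficients of x^n can replace iterated convolutions.\<close>

lemma reps_exp:
  assumes S: "reps S (P 1)" and P0: "P 0 = (\<lambda>m. 1 when m = 0)"
    and P: "\<And>n m. sumbl (\<lambda>p. P 1 p * P n (m - p))" "\<And>n m. P (Suc n) m = lsum (\<lambda>p. P 1 p * P n (m - p))"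
    and E: "\<And>m. sumbl (\<lambda>n. fps_const (sc (1 / fact n)) * P n m)"
  shows "reps (op_exp S) (\<lambda>m. lsum (\<lambda>n. fps_const (sc (1 / fact n)) * P n m))"
proof -
  have R: "reps ((op_mult S ^^ n) op_one) (P n)" for n
  proof (induction n)
    case 0 then show ?case using reps_one by (simp add: P0)
  next
    case (Suc n)
    have "P (Suc n) = (\<lambda>m. lsum (\<lambda>p. P 1 p * P n (m - p)))" by (rule ext) (rule P(2))
    then show ?case using reps_mult[OF S Suc P(1)] by simp
  qed
  show ?thesis
    unfolding reps_def op_exp_def
  proof (intro allI)
    fix m v
    have "((op_mult S ^^ n) op_one) m v = act (P n m) v" for n using R by (simp add: reps_def)
    then show "fps_Sum (\<lambda>n. ext_h (vscale (1 / fact n)) (((op_mult S ^^ n) op_one) m v)) = act (lsum (\<lambda>n. fps_const (sc (1 / fact n)) * P n m)) v"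
      by (simp add: vscale_act act_lsum[OF E])
  qed
qed

section \<open>The exponentials A and B in the definition of the vertex operators\<close>

lemma zvar_power_coeff:
  "Polynomial.coeff (Polynomial.coeff ((zvar + [:[:0, c:]:]) ^ r) m) d = (of_nat (r choose d) * c ^ d when r = m + d)"
proof -
  have Z: "zvar ^ k = Polynomial.monom 1 k" for k
    by (simp add: monom_altdef)
  have H: "[:[:0, c:]:] ^ l = [:Polynomial.monom (c ^ l) l:]" for l
  proof -
    have "[:[:0, c:]:] ^ l = [:[:0, c:] ^ l:]" by (induction l) simp_all
    moreover have "[:0, c:] = Polynomial.smult c [:0, 1:]" by simp
    ultimately show ?thesis by (simp only: smult_power monom_altdef)
  qed
  have t: "of_nat (r choose k) * zvar ^ k * [:[:0, c:]:] ^ (r - k) = Polynomial.monom (Polynomial.monom (of_nat (r choose k) * c ^ (r - k)) (r - k)) k" for k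
    unfolding Z H
    by (rule poly_eqI, rule poly_eqI) (auto simp: of_nat_poly mult.commute[of _ "[:_:]"] coeff_monom)
  have "Polynomial.coeff (Polynomial.coeff ((zvar + [:[:0, c:]:]) ^ r) m) d
      = (\<Sum>k\<le>r. if k = m then (if r - m = d then of_nat (r choose m) * c ^ (r - m) else 0) else 0)"
    unfolding binomial_ring t coeff_sum by (rule sum.cong) (auto simp: coeff_monom)
  also have "\<dots> = (of_nat (r choose d) * c ^ d when r = m + d)"
    using binomial_symmetric[of d "m + d"] by (auto simp: when_def)
  finally show ?thesis .
qed

lemma zvar_power_coeff':
  "Polynomial.coeff (Polynomial.coeff ([:[:0, c:], 1:] ^ r) m) d = (of_nat (r choose d) * c ^ d when r = m + d)" for c :: complex
  using zvar_power_coeff[of c r m d] by simp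

lemma hact_add: "hact (p + q) v = hact p v + hact q v"
  by (rule fps_ext) (simp add: hact_def vs.scale_left_distrib sum.distrib)

context vertex
begin

definition Atm :: "complex \<Rightarrow> 'i \<Rightarrow> int \<Rightarrow> 'i vspace fps \<Rightarrow> nat \<Rightarrow> 'i vspace fps" where
  "Atm c j m v r = (ext_h (vscale (1 / of_nat r)) (ext_h (Hcre j r) (op_zpoly ((zvar + [:[:0, c:]:]) ^ r) m v)) when r > 0)"

lemma Hcre_ap: "Hcre j r = ap (hcre j r)"
  by (rule ap_hcre[symmetric])

text \<open>For a fixed exponent M of z the r-th term contributes only at the order r - M of
  \<hbar>, so the sum over r is a sum over orders of \<hbar>.\<close>

lemma Atm_nth: "fps_nth (Atm c j (int M) v r) n
    = (if r \<ge> M \<and> r \<le> M + n then app (mu (Ec c (eta j)) (int M)) (r - M) (fps_nth v (n - (r - M))) else 0)"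
proof -
  let ?t = "\<lambda>b. app (mu (Ec c (eta j)) (int M)) b (fps_nth v (n - b))"
  show ?thesis
  proof (cases "r > 0 \<and> r \<ge> M")
    case True
    have e: "r = M + b \<longleftrightarrow> b = r - M" for b using True by auto
    have "fps_nth (Atm c j (int M) v r) n
        = vscale (1 / of_nat r) (ap (hcre j r) (\<Sum>b\<le>n. vscale (of_nat (r choose b) * c ^ b when r = M + b) (fps_nth v (n - b))))"
      using True by (simp add: Atm_def ext_h_def op_zpoly_def hact_def zvar_power_coeff' Hcre_ap)
    also have "(\<Sum>b\<le>n. vscale (of_nat (r choose b) * c ^ b when r = M + b) (fps_nth v (n - b)))
        = (\<Sum>b\<le>n. if b = r - M then vscale (of_nat (r choose b) * c ^ b) (fps_nth v (n - b)) else 0)"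
      unfolding e by (rule sum.cong) (auto simp: when_def)
    also have "vscale (1 / of_nat r) (ap (hcre j r) \<dots>) = (if r \<ge> M \<and> r \<le> M + n then ?t (r - M) else 0)"
    proof (cases "r \<le> M + n")
      case le: True
      have "?t (r - M) = ap (sc (of_nat (r choose (r - M)) * c ^ (r - M)) * (sc (1 / of_nat r) * hcre j r)) (fps_nth v (n - (r - M)))"
      proof -
        have r: "M + (r - M) = r" "r \<noteq> 0" using True by auto
        show ?thesis
          unfolding app_def mu_nth Ec_nth eta_def hcre_def fps_nth_Abs_fps r(1) by (simp only: r(2) if_False mo_hom(4) mo_cf)
      qed
      then show ?thesis using True le by (simp add: vs.scale_scale mult.commute ap_of_nat le_diff_conv add.commute)
    qed (use True in simp)
    finally show ?thesis .
  next
    case False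
    show ?thesis
    proof (cases "r = 0")
      case True
      then show ?thesis by (cases "M = 0") (simp_all add: Atm_def app_def mu_nth[of _ 0, simplified] Ec_nth eta_def)
    next
      case r: False
      then have "r < M" using False by simp
      then have "hact (Polynomial.coeff ((zvar + [:[:0, c:]:]) ^ r) M) v = 0"
        by (intro fps_ext) (simp add: hact_def zvar_power_coeff')
      then show ?thesis using r \<open>r < M\<close> by (simp add: Atm_def ext_h_def op_zpoly_def Hcre_ap)
    qed
  qed
qed

lemma Atm_finite: "finite {r. fps_nth (Atm c j (int M) v r) n \<noteq> 0}"
  by (rule finite_subset[of _ "{..M + n}"]) (auto simp: Atm_nth split: if_splits)

lemma Atm_Sum: "Sum_any (\<lambda>r. fps_nth (Atm c j (int M) v r) n) = fps_nth (act (mu (Ec c (eta j)) (int M)) v) n"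
proof -
  let ?t = "\<lambda>b. app (mu (Ec c (eta j)) (int M)) b (fps_nth v (n - b))"
  have "Sum_any (\<lambda>r. fps_nth (Atm c j (int M) v r) n) = (\<Sum>r\<in>{M..M + n}. if r \<ge> M \<and> r \<le> M + n then ?t (r - M) else 0)"
    unfolding Atm_nth by (rule Sum_any.expand_superset) (auto split: if_splits)
  also have "\<dots> = (\<Sum>b\<le>n. ?t b)"
    by (rule sum.reindex_bij_witness[of _ "\<lambda>b. b + M" "\<lambda>r. r - M"]) auto
  finally show ?thesis by (simp add: act_nth)
qed

lemma mu_sum: "mu (sum f A) m = (\<Sum>x\<in>A. mu (f x) m)"
  by (induction A rule: infinite_finite_induct) (simp_all add: mu_add)

lemma act_lin: "fps_nth (act (x + y) v) n = fps_nth (act x v) n + fps_nth (act y v) n"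
  "fps_nth (act (x - y) v) n = fps_nth (act x v) n - fps_nth (act y v) n"
  "fps_nth (act (- x) v) n = - fps_nth (act x v) n"
  by (simp_all add: act_nth sum.distrib sum_subtractf sum_negf)

lemma act_sum: "fps_nth (act (sum f A) v) n = (\<Sum>x\<in>A. fps_nth (act (f x) v) n)"
  by (induction A rule: infinite_finite_induct) (simp_all add: act_lin)

lemma reps_A: "reps (A_exponent a s i) (mu (vAexp a s i))"
  unfolding reps_def
proof (intro allI)
  fix m v
  show "A_exponent a s i m v = act (mu (vAexp a s i) m) v"
  proof (cases "m < 0")
    case True
    have z: "ext_h (Hcre j r) 0 = 0" for j :: 'i and r
      by (rule fps_ext) (simp add: ext_h_def Hcre_ap)
    have ez: "ext_h (vscale c) 0 = 0" for c :: complex by (rule fps_ext) (simp add: ext_h_def)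
    have f: "fps_Sum (\<lambda>r :: nat. 0) = (0 :: 'i vspace fps)" by (rule fps_ext) (simp add: fps_Sum_def)
    have t: "op_zpoly P m v = 0" for P using True by (simp add: op_zpoly_def)
    show ?thesis using True by (simp add: A_exponent_def t z ez f)
  next
    case False
    then obtain M where m: "m = int M" by (metis nonneg_int_cases not_less)
    have p: "zvar - pm s * hvar = zvar + [:[:0, - pm s:]:]" "zvar - pm s * [:[:1 / 2:]:] * hvar = zvar + [:[:0, - pm s / 2:]:]"
      "zvar ^ r = (zvar + [:[:0, 0:]:]) ^ r" for r
      by (cases s; simp)+
    have 1: "fps_nth (ext_h (vscale (1 / of_nat r)) (ext_h (Hcre i r) (op_zpoly (zvar ^ r + (zvar - pm s * hvar) ^ r) m v)) when r > 0) n
        = fps_nth (Atm 0 i m v r) n + fps_nth (Atm (- pm s) i m v r) n" for r n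
      unfolding p(1) p(3) Atm_def using False
      by (simp add: when_def op_zpoly_def hact_add ext_h_def Hcre_ap vs.scale_right_distrib)
    have 2: "fps_nth (\<Sum>j\<in>nbrs a i. ext_h (vscale (1 / of_nat r)) (ext_h (Hcre j r) (op_zpoly ((zvar - pm s * [:[:1 / 2:]:] * hvar) ^ r) m v)) when r > 0) n
        = (\<Sum>j\<in>nbrs a i. fps_nth (Atm (- pm s / 2) j m v r) n)" for r n
      unfolding p(2) Atm_def by (simp add: when_def fps_sum_nth)
    have "fps_nth (A_exponent a s i m v) n = vscale (pm s)
      (fps_nth (act (mu (Ec 0 (eta i)) m) v) n + fps_nth (act (mu (Ec (- pm s) (eta i)) m) v) n
        - (\<Sum>j\<in>nbrs a i. fps_nth (act (mu (Ec (- pm s / 2) (eta j)) m) v) n))" for n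
      unfolding A_exponent_def ext_h_def[of "vscale (pm s)"] fps_nth_Abs_fps fps_sub_nth fps_Sum_def 1 2
      unfolding m
      by (simp add: Sum_any.distrib Sum_any_sum Atm_finite Atm_Sum)
    moreover have "mu (vAexp a s i) m = pm s * (mu (Ec 0 (eta i)) m + mu (Ec (- pm s) (eta i)) m - (\<Sum>j\<in>nbrs a i. mu (Ec (- pm s / 2) (eta j)) m))"
      unfolding vAexp_def by (cases s) (simp_all add: mu_add mu_diff mu_minus mu_sum)
    ultimately show ?thesis
      by (intro fps_ext) (cases s; simp add: act_lin act_sum)
  qed
qed

lemma sumbl_mu_mu: "sumbl (\<lambda>p. mu x p * mu y (m - p))"
proof (rule sumbl_finite, rule finite_subset[of _ "{0..m}"])
  show "{p. mu x p * mu y (m - p) \<noteq> 0} \<subseteq> {0..m}"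
  proof
    fix p assume "p \<in> {p. mu x p * mu y (m - p) \<noteq> 0}"
    then have "\<not> p < 0" "\<not> m - p < 0" by auto
    then show "p \<in> {0..m}" by simp
  qed
qed simp

lemma mu_mult_conv: "mu (x * y) m = lsum (\<lambda>p. mu x p * mu y (m - p))"
  using lsum_shift(3)[OF sumbl_mu_mu[of x y m], of m] mu_mult_lsum[of x y m] by simp

lemma reps_exp_A: "reps (op_exp (A_exponent a s i)) (al s i)"
proof -
  let ?x = "vAexp a s i"
  have z: "app (cs c * mu (?x ^ n) m) d v = 0" if "nat m + d < n" for n d m v c
    using that by (simp add: app_cs app_def mu_def fps2_power_zero[OF vAexp_0])
  have z': "app (cs c * mu (?x ^ n) m) d v \<noteq> 0 \<Longrightarrow> n \<le> nat m + d" for n d m v c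
    by (rule leI, rule notI) (use z[of m d n c v] in blast)
  have S: "sumbl (\<lambda>n. cs (1 / fact n) * mu (?x ^ n) m)" for m
    unfolding sumbl_def
  proof (intro allI)
    fix d v
    show "finite {n. app (cs (1 / fact n) * mu (?x ^ n) m) d v \<noteq> 0}"
      by (rule finite_subset[of _ "{..nat m + d}"]) (auto dest: z')
  qed
  have L: "lsum (\<lambda>n. cs (1 / fact n) * mu (?x ^ n) m) = al s i m" for m
  proof (rule app_eqI)
    fix d v
    have "app (lsum (\<lambda>n. cs (1 / fact n) * mu (?x ^ n) m)) d v = (\<Sum>n\<le>nat m + d. app (cs (1 / fact n) * mu (?x ^ n) m) d v)"
      by (rule app_lsum_superset[OF S]) (simp, rule z, simp)
    also have "\<dots> = app (mu (eS ?x) m) d v"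
      by (auto simp: mu_def app_def eS_def mo_sum ap_sum_left mo_cf mult.assoc)
    finally show "app (lsum (\<lambda>n. cs (1 / fact n) * mu (?x ^ n) m)) d v = app (al s i m) d v" by (simp add: vA_eq_exp)
  qed
  have "reps (op_exp (A_exponent a s i)) (\<lambda>m. lsum (\<lambda>n. cs (1 / fact n) * mu (?x ^ n) m))"
  proof (rule reps_exp[where P = "\<lambda>n. mu (?x ^ n)"])
    show "mu (?x ^ 0) = (\<lambda>m. 1 when m = 0)" by (rule ext) (simp add: mu_one)
    show "mu (?x ^ Suc n) m = lsum (\<lambda>p. mu (?x ^ 1) p * mu (?x ^ n) (m - p))" for n m
      by (simp add: mu_mult_conv)
  qed (simp_all add: reps_A sumbl_mu_mu S)
  then show ?thesis by (simp add: L)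
qed

lemma reps_B: "reps (B_exponent s i) (\<lambda>m. fps_const (if m \<le> 0 then fps_nth (bser s i) (nat (- m)) else 0))"
  unfolding reps_def
proof (intro allI fps_ext)
  fix m v n
  let ?f = "\<lambda>r. vscale (1 / of_nat r) (Hann i r (fps_nth v n))"
  have "fps_nth (B_exponent s i m v) n = vscale (- pm s) (Sum_any (\<lambda>r. ?f r when r > 0 \<and> m = - int r))"
    by (simp add: B_exponent_def ext_h_def fps_Sum_def when_def if_distrib[of "\<lambda>f. fps_nth f n"] cong: if_cong)
  also have "(\<lambda>r. ?f r when r > 0 \<and> m = - int r) = (\<lambda>r. (?f r when m < 0) when r = nat (- m))"
    by (rule ext) (auto simp: when_def)
  also have "Sum_any \<dots> = (?f (nat (- m)) when m < 0)" by simp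
  finally show "fps_nth (B_exponent s i m v) n = fps_nth (act (fps_const (if m \<le> 0 then fps_nth (bser s i) (nat (- m)) else 0)) v) n"
    by (auto simp: act_const ext_h_def bser_def ap_hann when_def)
qed

lemma reps_exp_B:
  fixes i :: 'i
  shows "reps (op_exp (B_exponent s i)) (\<lambda>m. fps_const (ibexp s i (- m)))"
proof -
  let ?P = "\<lambda>n m. fps_const (if m \<le> 0 then fps_nth (bser s i ^ n) (nat (- m)) else 0)"
  have z: "cs (1 / fact n) * ?P n m = 0" if "nat (- m) < n" for n m
    using that by (simp add: fps_power_nth_zero)
  have z': "cs (1 / fact n) * ?P n m \<noteq> 0 \<Longrightarrow> n \<le> nat (- m)" for n m
    by (rule leI, rule notI) (use z[of m n] in blast)
  have S: "sumbl (\<lambda>n. cs (1 / fact n) * ?P n m)" for m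
  proof (rule sumbl_finite, rule finite_subset[of _ "{..nat (- m)}"])
    show "{n. cs (1 / fact n) * ?P n m \<noteq> 0} \<subseteq> {..nat (- m)}" using z'[of _ m] by blast
  qed simp
  have L: "lsum (\<lambda>n. cs (1 / fact n) * ?P n m) = fps_const (ibexp s i (- m))" for m
  proof -
    have "lsum (\<lambda>n. cs (1 / fact n) * ?P n m) = (\<Sum>n\<le>nat (- m). cs (1 / fact n) * ?P n m)"
      by (rule lsum_finite) (simp, rule z, simp)
    also have "\<dots> = fps_const (ibexp s i (- m))"
      by (auto simp: ibexp_def bexp_def intro!: fps_ext simp: fps_sum_nth)
    finally show ?thesis .
  qed
  have conv: "sumbl (\<lambda>p. ?P 1 p * ?P n (m - p)) \<and> ?P (Suc n) m = lsum (\<lambda>p. ?P 1 p * ?P n (m - p))" for n m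
  proof
    have z: "?P 1 p * ?P n (m - p) = 0" if "p \<notin> {m..0}" for p using that by auto
    show "sumbl (\<lambda>p. ?P 1 p * ?P n (m - p))"
      by (rule sumbl_finite, rule finite_subset[of _ "{m..0}"]) (use z in auto)
    have "lsum (\<lambda>p. ?P 1 p * ?P n (m - p)) = (\<Sum>p\<in>{m..0}. ?P 1 p * ?P n (m - p))"
      by (rule lsum_finite) (use z in auto)
    also have "\<dots> = ?P (Suc n) m"
    proof (cases "m \<le> 0")
      case True
      have "(\<Sum>p\<in>{m..0}. ?P 1 p * ?P n (m - p)) = (\<Sum>k\<in>{0..nat (- m)}. fps_const (fps_nth (bser s i) k * fps_nth (bser s i ^ n) (nat (- m) - k)))"
        by (rule sum.reindex_bij_witness[of _ "\<lambda>k. - int k" "\<lambda>p. nat (- p)"]) (use True in \<open>auto simp: nat_diff_distrib[symmetric] le_nat_iff algebra_simps\<close>)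
      then show ?thesis using True by (simp add: fps_mult_nth) (intro fps_ext, simp add: fps_sum_nth)
    qed simp
    finally show "?P (Suc n) m = lsum (\<lambda>p. ?P 1 p * ?P n (m - p))" ..
  qed
  have "reps (op_exp (B_exponent s i)) (\<lambda>m. lsum (\<lambda>n. cs (1 / fact n) * ?P n m))"
  proof (rule reps_exp[where P = ?P])
    show "reps (B_exponent s i) (?P 1)" unfolding power_one_right by (rule reps_B)
    show "?P 0 = (\<lambda>m. 1 when m = 0)" by (rule ext) (auto simp: when_def)
  qed (use conv S in blast)+
  then show ?thesis by (simp only: L)
qed

definition latv :: "sign \<Rightarrow> 'i \<Rightarrow> 'i vend" where "latv s i = Abs_vend (lat_exp \<epsilon> (sroot s i))"

definition zpv :: "sign \<Rightarrow> 'i \<Rightarrow> int \<Rightarrow> 'i vend" where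
  "zpv s i m = Abs_vend (\<lambda>v. Sum_any (\<lambda>\<beta>. (Poly_Mapping.single \<beta> (Poly_Mapping.lookup v \<beta>) when form a (sroot s i) \<beta> = m)))"

lemma ap_latv: "ap (latv s i) = lat_exp \<epsilon> (sroot s i)"
  unfolding latv_def
  by (rule Abs_vend_inverse) (auto intro!: poly_mapping_eqI simp: vlinear_iff lookup_lat_exp lookup_add algebra_simps)

lemma ap_zpv: "ap (zpv s i m) = (\<lambda>v. Sum_any (\<lambda>\<beta>. (Poly_Mapping.single \<beta> (Poly_Mapping.lookup v \<beta>) when form a (sroot s i) \<beta> = m)))"
  unfolding zpv_def
proof (rule Abs_vend_inverse, unfold mem_Collect_eq, rule vlinearI; rule poly_mapping_eqI)
  let ?Z = "\<lambda>v. Sum_any (\<lambda>\<beta>. (Poly_Mapping.single \<beta> (Poly_Mapping.lookup v \<beta>) when form a (sroot s i) \<beta> = m)) :: 'i vspace"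
  show "Poly_Mapping.lookup (?Z (u + v)) k = Poly_Mapping.lookup (?Z u + ?Z v) k" for u v k
    unfolding lookup_zpart[where v = "u + v"] lookup_add[of "?Z u"] lookup_zpart[where v = u] lookup_zpart[where v = v]
    by (simp add: when_def lookup_add)
  show "Poly_Mapping.lookup (?Z (vscale c v)) k = Poly_Mapping.lookup (vscale c (?Z v)) k" for c v k
    unfolding lookup_zpart[where v = "vscale c v"] lookup_vscale[of c "?Z v"] lookup_zpart[where v = v]
    by (simp add: when_def)
qed

lemma zmode_latv: "zmode s i m = latv s i * zpv s i m"
  by (rule vend_eqI) (simp add: ap_zmode ap_latv ap_zpv)

lemma sumbl_zpv: "sumbl (\<lambda>m. fps_const (zpv s i m))"
  unfolding sumbl_def
proof (intro allI)
  fix d v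
  have "{m. app (fps_const (zpv s i m)) d v \<noteq> 0} \<subseteq> form a (sroot s i) ` Poly_Mapping.keys v"
  proof
    fix m assume "m \<in> {m. app (fps_const (zpv s i m)) d v \<noteq> 0}"
    then have "ap (zpv s i m) v \<noteq> 0" by (cases d) (auto simp: app_def)
    then obtain \<beta> where "Poly_Mapping.lookup (ap (zpv s i m) v) \<beta> \<noteq> 0" using poly_mapping_eqI[of "ap (zpv s i m) v" 0] by auto
    then have "(Poly_Mapping.lookup v \<beta> when form a (sroot s i) \<beta> = m) \<noteq> 0" unfolding ap_zpv lookup_zpart .
    then show "m \<in> form a (sroot s i) ` Poly_Mapping.keys v"
      by (auto simp: when_def in_keys_iff split: if_splits)
  qed
  then show "finite {m. app (fps_const (zpv s i m)) d v \<noteq> 0}" by (rule finite_subset) simp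
qed

lemma sumbl_ibexp: "sumbl (\<lambda>k. fps_const (ibexp s i k))"
proof -
  have "finite {k. ap (ibexp s i k) v \<noteq> 0}" for v
  proof (induction v rule: vspace_induct)
    case (1 u v)
    show ?case by (rule finite_subset[of _ "{k. ap (ibexp s i k) u \<noteq> 0} \<union> {k. ap (ibexp s i k) v \<noteq> 0}"]) (use 1 in auto)
  next
    case (2 c v)
    show ?case by (rule finite_subset[OF _ 2]) auto
  next
    case (3 b)
    show ?case by (rule finite_subset[of _ "{0}"]) (auto simp: ibexp_ebas)
  next
    case (4 j r v)
    have e: "ap (ibexp s i k) (ap (hcre j r) v) = ap (hcre j r) (ap (ibexp s i k) v) - ap (pm s * ibexp s i (k - int r) when i = j) v" for k
      using arg_cong[OF ibexp_hcre[OF 4(1), of s i k j], of "\<lambda>f. ap f v"] by simp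
    have "{k. ap (ibexp s i k) (ap (hcre j r) v) \<noteq> 0} \<subseteq> {k. ap (ibexp s i k) v \<noteq> 0} \<union> (\<lambda>k. k + int r) ` {k. ap (ibexp s i k) v \<noteq> 0}"
    proof
      fix k assume k: "k \<in> {k. ap (ibexp s i k) (ap (hcre j r) v) \<noteq> 0}"
      show "k \<in> {k. ap (ibexp s i k) v \<noteq> 0} \<union> (\<lambda>k. k + int r) ` {k. ap (ibexp s i k) v \<noteq> 0}"
      proof (rule ccontr)
        assume n: "\<not> ?thesis"
        then have "ap (ibexp s i k) v = 0" "ap (ibexp s i (k - int r)) v = 0"
          by (auto simp: image_iff)
        then have "ap (ibexp s i k) (ap (hcre j r) v) = 0" unfolding e by (cases s; auto simp: when_def)
        then show False using k by simp
      qed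
    qed
    then show ?case by (rule finite_subset) (use 4 in auto)
  qed
  then have "finite {k. app (fps_const (ibexp s i k)) d v \<noteq> 0}" for d v
    by (cases d) (simp_all add: app_def)
  then show ?thesis by (simp add: sumbl_def)
qed

text \<open>The definition multiplies from left to right, whereas \<open>Xf\<close> groups B,
  e^\<alpha> and z^\<partial> into T. The regrouping is an exchange of sums, justified by the local
  finiteness of the zero modes.\<close>

theorem vertex_op_Xf: "vertex_op a \<epsilon> s i m v = act (Xf s i m) v"
proof -
  let ?E = "\<lambda>k. fps_const (ibexp s i k)" and ?L = "fps_const (latv s i)" and ?Z = "\<lambda>m. fps_const (zpv s i m)"
  define G where "G p = lsum (\<lambda>q. al s i q * ?E (- (p - q)))" for p
  have SE: "sumbl (\<lambda>q. al s i q * ?E (- (p - q)))" for p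
  proof -
    have "sumbl (\<lambda>q. ?E (q - p))" using sumbl_ibexp[of s i] by (simp only: sumbl_shift(2)[of ?E p])
    then show ?thesis using sumbl_mult_left[of "\<lambda>q. ?E (q - p)" "al s i"] by simp
  qed
  have 1: "reps (op_mult (op_exp (A_exponent a s i)) (op_exp (B_exponent s i))) G"
    unfolding G_def[abs_def] by (rule reps_mult[OF reps_exp_A reps_exp_B SE])
  have RL: "reps (op_lat_exp \<epsilon> (sroot s i)) (\<lambda>m. ?L when m = 0)"
    by (auto simp: reps_def op_lat_exp_def when_def act_const ap_latv)
  have RZ: "reps (op_zpartial a (sroot s i)) ?Z"
    by (simp add: reps_def op_zpartial_def act_const ap_zpv)
  have "reps (op_mult (op_mult (op_exp (A_exponent a s i)) (op_exp (B_exponent s i))) (op_lat_exp \<epsilon> (sroot s i)))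
      (\<lambda>m. lsum (\<lambda>p. G p * (?L when m - p = 0)))"
  proof (rule reps_mult[OF 1 RL])
    show "sumbl (\<lambda>p. G p * (?L when m - p = 0))" for m by (rule sumbl_single[of m]) (simp add: when_def)
  qed
  moreover have "lsum (\<lambda>p. G p * (?L when m - p = 0)) = G m * ?L" for m
    by (subst lsum_single[of m]) (auto simp: when_def)
  ultimately have R2: "reps (op_mult (op_mult (op_exp (A_exponent a s i)) (op_exp (B_exponent s i))) (op_lat_exp \<epsilon> (sroot s i))) (\<lambda>m. G m * ?L)"
    by simp
  have SZ: "sumbl (\<lambda>p. G p * ?L * ?Z (m - p))" for m
    by (rule sumbl_mult_left) (use sumbl_zpv[of s i] in \<open>simp only: sumbl_shift(3)[of ?Z m]\<close>)
  from reps_mult[OF R2 RZ SZ]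
  have 2: "reps (op_mult (op_mult (op_mult (op_exp (A_exponent a s i)) (op_exp (B_exponent s i))) (op_lat_exp \<epsilon> (sroot s i))) (op_zpartial a (sroot s i)))
      (\<lambda>m. lsum (\<lambda>p. G p * ?L * ?Z (m - p)))"
    .
  let ?T = "\<lambda>p. fps_const (pm s * zmode s i (m - p))"
  have ST: "sumbl ?T"
  proof -
    have "sumbl (\<lambda>p. fps_const (zmode s i (m - p)))"
      using sumbl_zmode[of s i] by (simp only: sumbl_shift(3)[of "\<lambda>m. fps_const (zmode s i m)" m])
    then show ?thesis
      using sumbl_mult_left[of "\<lambda>p. fps_const (zmode s i (m - p))" "\<lambda>_. fps_const (pm s)"] by simp
  qed
  have v: "vT s i (m - q) = lsum (\<lambda>p. ?E (q - p) * ?T p)" for q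
  proof -
    have "vT s i (m - q) = lsum (\<lambda>p. fps_const (pm s * (ibexp s i (q - p) * zmode s i (m - q + (q - p)))))"
      unfolding vT_def
      using lsum_shift(3)[of "\<lambda>k. fps_const (pm s * (ibexp s i k * zmode s i (m - q + k)))" q]
        sumbl_vT_terms[where l = 0 and s = s and i = i and t = s and j = i and m = "m - q"] by simp
    then show ?thesis by (simp add: pm_left_commute)
  qed
  have Sv: "sumbl (\<lambda>p. ?E (q - p) * ?T p)" for q by (rule sumbl_mult_left[OF ST])
  have "Xf s i m = lsum (\<lambda>q. lsum (\<lambda>p. al s i q * ?E (q - p) * ?T p))"
    unfolding Xf_alt v lsum_mult_left[OF Sv] mult.assoc ..
  also have "\<dots> = lsum (\<lambda>p. lsum (\<lambda>q. al s i q * ?E (q - p)) * ?T p)"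
    by (rule lsum_conv_swap[OF ST]) (use SE in simp)
  also have "\<dots> = lsum (\<lambda>p. fps_const (sc (pm s)) * (G p * ?L * ?Z (m - p)))"
  proof -
    have "lsum (\<lambda>q. al s i q * ?E (q - p)) * ?T p = fps_const (sc (pm s)) * (G p * ?L * ?Z (m - p))" for p
    proof -
      have g: "lsum (\<lambda>q. al s i q * ?E (q - p)) = G p" by (simp add: G_def)
      have t: "?T p = cs (pm s) * (?L * ?Z (m - p))" by (simp add: zmode_latv sc_pm)
      show ?thesis unfolding g t cs_left_commute[of "G p"] mult.assoc ..
    qed
    then show ?thesis by (simp only:)
  qed
  also have "\<dots> = fps_const (sc (pm s)) * lsum (\<lambda>p. G p * ?L * ?Z (m - p))"
    by (rule lsum_mult_left[OF SZ, symmetric])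
  finally have X: "Xf s i m = fps_const (sc (pm s)) * lsum (\<lambda>p. G p * ?L * ?Z (m - p))" .
  show ?thesis
    unfolding vertex_op_def X vscale_act[symmetric] using 2 by (simp add: reps_def)
qed

end

section \<open>Operators on the completed space\<close>

text \<open>Components indexed by \<beta>, n and the order in \<hbar>, without finiteness
  conditions. On this larger space homogeneous operators act and compose by finite sums alone;
  \<open>Cv\<close> singles out the completed space inside it.\<close>

type_synonym 'i comps = "'i lattice \<Rightarrow> int \<Rightarrow> nat \<Rightarrow> 'i vspace"

definition rop :: "int \<times> 'i lattice \<Rightarrow> 'i::finite vend fps \<Rightarrow> 'i comps \<Rightarrow> 'i comps" where
  "rop K x U \<beta> n d = (\<Sum>b\<le>d. app x b (U (\<beta> - snd K) (n - fst K + int b) (d - b)))"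

lemma rop_zero [simp]: "rop K 0 U \<beta> n d = 0"
  by (simp add: rop_def)

lemma rop_add: "rop K (x + y) U \<beta> n d = rop K x U \<beta> n d + rop K y U \<beta> n d"
  by (simp add: rop_def sum.distrib)

lemma rop_add_right: "rop K x (\<lambda>\<beta> n d. U \<beta> n d + V \<beta> n d) \<beta> n d = rop K x U \<beta> n d + rop K x V \<beta> n d"
  by (simp add: rop_def sum.distrib)

lemma rop_zero_right [simp]: "rop K x (\<lambda>\<beta> n d. 0) \<beta> n d = 0"
  by (simp add: rop_def)

lemma rop_mult: "rop (K + L) (x * y) U \<beta> n d = rop K x (rop L y U) \<beta> n d"
proof -
  have "rop K x (rop L y U) \<beta> n d = (\<Sum>e\<le>d. \<Sum>c\<le>d - e. app x e (app y c
      (U (\<beta> - snd K - snd L) (n - fst K + int e - fst L + int c) (d - e - c))))"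
    by (simp add: rop_def app_sum_right)
  also have "\<dots> = (\<Sum>b\<le>d. \<Sum>e\<le>b. app x e (app y (b - e)
      (U (\<beta> - snd K - snd L) (n - fst K + int e - fst L + int (b - e)) (d - e - (b - e)))))"
    by (rule triangle_sum)
  also have "\<dots> = (\<Sum>b\<le>d. \<Sum>e\<le>b. app x e (app y (b - e) (U (\<beta> - snd (K + L)) (n - fst (K + L) + int b) (d - b))))"
    by (intro sum.cong refl) (auto simp: of_nat_diff diff_diff_eq algebra_simps intro!: arg_cong[of _ _ "app _ _"])
  also have "\<dots> = rop (K + L) (x * y) U \<beta> n d"
    unfolding rop_def app_mult ..
  finally show ?thesis ..
qed

definition Rop :: "'i gring \<Rightarrow> 'i::finite comps \<Rightarrow> 'i comps" where
  "Rop g U \<beta> n d = extend_sum (\<lambda>K x. rop K x U \<beta> n d) g"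

lemma Rop_add: "Rop (g + h) U \<beta> n d = Rop g U \<beta> n d + Rop h U \<beta> n d"
  unfolding Rop_def by (rule extend_sum_add) (simp_all add: rop_add)

lemma Rop_single: "Rop (Poly_Mapping.single K x) U = rop K x U"
  unfolding Rop_def[abs_def] by (intro ext) (simp add: extend_sum_single)

lemma Rop_zero: "Rop 0 U \<beta> n d = 0"
  by (simp add: Rop_def extend_sum_def)

lemma Rop_add_right: "Rop g (\<lambda>\<beta> n d. U \<beta> n d + V \<beta> n d) \<beta> n d = Rop g U \<beta> n d + Rop g V \<beta> n d"
  by (simp add: Rop_def extend_sum_def rop_add_right sum.distrib)

lemma Rop_mult: "Rop (g * h) U \<beta> n d = Rop g (Rop h U) \<beta> n d"
proof (induction g arbitrary: \<beta> n d rule: poly_mapping_single_induct)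
  case (3 K x)
  show ?case
  proof (induction h arbitrary: \<beta> n d rule: poly_mapping_single_induct)
    case 1
    have "Rop 0 U = (\<lambda>\<beta> n d. 0)" by (intro ext) (rule Rop_zero)
    then show ?case by (simp add: Rop_single Rop_zero)
  next
    case (2 f g)
    have "Rop (f + g) U = (\<lambda>\<beta> n d. Rop f U \<beta> n d + Rop g U \<beta> n d)" by (intro ext) (rule Rop_add)
    then show ?case by (simp add: distrib_left Rop_add 2 Rop_add_right)
  next
    case (3 L y)
    show ?case by (simp add: mult_single Rop_single rop_mult)
  qed
qed (simp_all add: Rop_zero distrib_right Rop_add)

definition sR :: "complex poly \<Rightarrow> 'i::finite comps \<Rightarrow> 'i comps" where
  "sR p U \<beta> n d = (\<Sum>b\<le>d. vscale (Polynomial.coeff p b) (U \<beta> n (d - b)))"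

lemma Rop_embR: "Rop (embR p) U \<beta> n d = sR p U \<beta> n d"
proof (induction p arbitrary: d n \<beta>)
  case 0
  then show ?case by (simp add: Rop_zero sR_def)
next
  case (pCons c p)
  have "app (fps_const (sc c)) b v = (if b = 0 then vscale c v else 0)" for b and v :: "'a vspace" by (simp add: app_def)
  then have k: "Rop (kR c) U \<beta> n d = vscale c (U \<beta> n d)" by (simp add: kR_def Rop_single rop_def)
  have "app fps_X b v = (if b = 1 then v else 0)" for b and v :: "'a vspace" by (simp add: app_def)
  then have h: "Rop hR V \<beta> n d = (if d = 0 then 0 else V \<beta> n (d - 1))" for V :: "'a comps"
    by (auto simp: hR_def Rop_single rop_def)
  have "sR (pCons c p) U \<beta> n d = vscale c (U \<beta> n d) + (if d = 0 then 0 else sR p U \<beta> n (d - 1))"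
    by (cases d) (simp_all add: sR_def sum.atMost_Suc_shift del: sum.atMost_Suc)
  then show ?case by (simp add: embR_pCons Rop_add Rop_mult k h pCons)
qed

definition crep :: "('i::finite lattice \<Rightarrow> int \<Rightarrow> 'i vspace poly) \<Rightarrow> 'i comps" where
  "crep u \<beta> n d = Polynomial.coeff (u \<beta> n) d"

lemma crep_inject: "crep u = crep v \<Longrightarrow> u = v"
  by (intro ext poly_eqI) (metis crep_def)

lemma hact_poly_coeff: "Polynomial.coeff (hact_poly p u) n = (\<Sum>b\<le>n. vscale (Polynomial.coeff p b) (Polynomial.coeff u (n - b)))"
proof -
  let ?f = "\<lambda>b c. vscale (Polynomial.coeff p b) (Polynomial.coeff u c)"
  have inner: "(\<Sum>c\<le>Polynomial.degree u. if b + c = n then ?f b c else 0) = (if b \<le> n then ?f b (n - b) else 0)" for b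
  proof (cases "b \<le> n")
    case True
    have "(\<Sum>c\<le>Polynomial.degree u. if b + c = n then ?f b c else 0) = (\<Sum>c\<le>Polynomial.degree u. if c = n - b then ?f b c else 0)"
      by (rule sum.cong) (use True in auto)
    then show ?thesis using True coeff_eq_0[of u "n - b"] by auto
  qed auto
  have "Polynomial.coeff (hact_poly p u) n = (\<Sum>b\<le>Polynomial.degree p. if b \<le> n then ?f b (n - b) else 0)"
    unfolding hact_poly_def coeff_sum coeff_monom inner ..
  also have "\<dots> = (\<Sum>b\<in>{..Polynomial.degree p} \<inter> {..n}. ?f b (n - b))"
    unfolding sum.inter_restrict[OF finite_atMost] by simp
  also have "\<dots> = (\<Sum>b\<le>n. ?f b (n - b))"
    by (rule sum.mono_neutral_left) (auto simp: coeff_eq_0)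
  finally show ?thesis .
qed

lemma crep_smult: "crep (\<lambda>\<beta> n. hact_poly p (u \<beta> n)) = sR p (crep u)"
  by (intro ext) (simp add: crep_def sR_def hact_poly_coeff)

text \<open>The bound n \<le> n(\<beta>) is contained in membership in \<open>Vdeg\<close>
  (\<open>Vdeg_trivial\<close>), and the last condition says that the components are polynomials in
  \<hbar>.\<close>

definition Cv :: "('i::finite \<Rightarrow> 'i \<Rightarrow> int) \<Rightarrow> 'i comps \<Rightarrow> bool" where
  "Cv a U \<longleftrightarrow> finite {\<beta>. \<exists>n d. U \<beta> n d \<noteq> 0} \<and> (\<forall>\<beta> n d. U \<beta> n d \<in> Vdeg a n \<beta>) \<and> (\<forall>\<beta> n. finite {d. U \<beta> n d \<noteq> 0})"

lemma mon_weight_nonneg: "mon_weight \<mu> \<ge> 0"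
  unfolding mon_weight_def by (intro sum_nonneg) auto

lemma Vdeg_trivial: "n > - half_norm a \<beta> \<Longrightarrow> v \<in> Vdeg a n \<beta> \<Longrightarrow> v = 0"
proof (rule poly_mapping_eqI, rule poly_mapping_eqI)
  fix \<gamma> \<mu> assume n: "n > - half_norm a \<beta>" and v: "v \<in> Vdeg a n \<beta>"
  show "Poly_Mapping.lookup (Poly_Mapping.lookup v \<gamma>) \<mu> = Poly_Mapping.lookup (Poly_Mapping.lookup 0 \<gamma>) \<mu>"
    using VdegD[OF v, of \<gamma> \<mu>] n mon_weight_nonneg[of \<mu>] by fastforce
qed

lemma Vtilde_carrier: "u \<in> carrier (Vtilde a) \<longleftrightarrow> Cv a (crep u)"
proof
  have e: "u \<beta> n \<noteq> 0 \<longleftrightarrow> (\<exists>d. crep u \<beta> n d \<noteq> 0)" for \<beta> n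
    by (simp add: crep_def poly_eq_iff)
  {
    assume "u \<in> carrier (Vtilde a)"
    then show "Cv a (crep u)"
      unfolding Vtilde_def Cv_def using MOST_coeff_eq_0[of "u \<beta> n" for \<beta> n]
      by (auto simp: crep_def e[unfolded crep_def] MOST_iff_cofinite)
  next
    assume C: "Cv a (crep u)"
    then have "u \<beta> n = 0" if "n > - half_norm a \<beta>" for \<beta> n
      using that Vdeg_trivial[of a \<beta> n] by (intro poly_eqI) (auto simp: Cv_def crep_def)
    with C show "u \<in> carrier (Vtilde a)"
      unfolding Vtilde_def Cv_def by (auto simp: e crep_def)
  }
qed

lemma Cv_realize:
  assumes "Cv a U"
  shows "crep (\<lambda>\<beta> n. Abs_poly (U \<beta> n)) = U" "(\<lambda>\<beta> n. Abs_poly (U \<beta> n)) \<in> carrier (Vtilde a)"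
proof -
  show c: "crep (\<lambda>\<beta> n. Abs_poly (U \<beta> n)) = U"
    using assms by (intro ext) (simp add: crep_def Cv_def Abs_poly_inverse MOST_iff_cofinite)
  show "(\<lambda>\<beta> n. Abs_poly (U \<beta> n)) \<in> carrier (Vtilde a)"
    unfolding Vtilde_carrier c by (rule assms)
qed

lemma Cv_zero: "Cv a (\<lambda>\<beta> n d. 0)"
  by (simp add: Cv_def)

lemma Cv_add:
  assumes "Cv a U" "Cv a V" shows "Cv a (\<lambda>\<beta> n d. U \<beta> n d + V \<beta> n d)"
proof -
  have "finite {\<beta>. \<exists>n d. U \<beta> n d + V \<beta> n d \<noteq> 0}"
  proof (rule finite_subset)
    show "{\<beta>. \<exists>n d. U \<beta> n d + V \<beta> n d \<noteq> 0} \<subseteq> {\<beta>. \<exists>n d. U \<beta> n d \<noteq> 0} \<union> {\<beta>. \<exists>n d. V \<beta> n d \<noteq> 0}"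
    proof
      fix \<beta> assume "\<beta> \<in> {\<beta>. \<exists>n d. U \<beta> n d + V \<beta> n d \<noteq> 0}"
      then obtain n d where "U \<beta> n d + V \<beta> n d \<noteq> 0" by blast
      then have "U \<beta> n d \<noteq> 0 \<or> V \<beta> n d \<noteq> 0" by auto
      then show "\<beta> \<in> {\<beta>. \<exists>n d. U \<beta> n d \<noteq> 0} \<union> {\<beta>. \<exists>n d. V \<beta> n d \<noteq> 0}" by blast
    qed
  qed (use assms in \<open>simp add: Cv_def\<close>)
  moreover have "finite {d. U \<beta> n d + V \<beta> n d \<noteq> 0}" for \<beta> n
    by (rule finite_subset[of _ "{d. U \<beta> n d \<noteq> 0} \<union> {d. V \<beta> n d \<noteq> 0}"]) (use assms in \<open>auto simp: Cv_def\<close>)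
  ultimately show ?thesis using assms by (simp add: Cv_def Vdeg_add)
qed

lemma Cv_vanish: "Cv a U \<Longrightarrow> n > - half_norm a \<beta> \<Longrightarrow> U \<beta> n d = 0"
  using Vdeg_trivial[of a \<beta> n "U \<beta> n d"] by (simp add: Cv_def)

text \<open>The coefficient of \<hbar>^b acts on the component of degree n - k + b, which is 0 once
  it exceeds the top degree over the source lattice point. So only finitely many b contribute, and
  the result is again polynomial in \<hbar>.\<close>

lemma Cv_rop_finite:
  assumes "Cv a U" shows "finite {d. rop K x U \<beta> n d \<noteq> 0}"
proof -
  let ?m = "\<lambda>b. n - fst K + int b" and ?B = "nat (- half_norm a (\<beta> - snd K) - n + fst K)"
  have "{d. rop K x U \<beta> n d \<noteq> 0} \<subseteq> (\<Union>b\<le>?B. (\<lambda>e. e + b) ` {e. U (\<beta> - snd K) (?m b) e \<noteq> 0})"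
  proof
    fix d assume "d \<in> {d. rop K x U \<beta> n d \<noteq> 0}"
    then have "rop K x U \<beta> n d \<noteq> 0" by blast
    then obtain b where b: "b \<le> d" "app x b (U (\<beta> - snd K) (?m b) (d - b)) \<noteq> 0"
      unfolding rop_def by (meson atMost_iff sum.not_neutral_contains_not_neutral)
    then have u: "U (\<beta> - snd K) (?m b) (d - b) \<noteq> 0" by auto
    then have "\<not> ?m b > - half_norm a (\<beta> - snd K)" using Cv_vanish[OF assms] by blast
    then have "b \<le> ?B" by linarith
    moreover have "d = (d - b) + b" using b by simp
    ultimately show "d \<in> (\<Union>b\<le>?B. (\<lambda>e. e + b) ` {e. U (\<beta> - snd K) (?m b) e \<noteq> 0})" using u by blast
  qed
  moreover have "finite (\<Union>b\<le>?B. (\<lambda>e. e + b) ` {e. U (\<beta> - snd K) (?m b) e \<noteq> 0})"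
    using assms by (auto simp: Cv_def)
  ultimately show ?thesis by (rule finite_subset)
qed

lemma Cv_rop:
  assumes U: "Cv a U" and x: "homog a K x"
  shows "Cv a (rop K x U)"
  unfolding Cv_def
proof (intro conjI allI Cv_rop_finite[OF U])
  have "{\<beta>. \<exists>n d. rop K x U \<beta> n d \<noteq> 0} \<subseteq> (\<lambda>\<beta>. \<beta> + snd K) ` {\<beta>. \<exists>n d. U \<beta> n d \<noteq> 0}"
  proof
    fix \<beta> assume "\<beta> \<in> {\<beta>. \<exists>n d. rop K x U \<beta> n d \<noteq> 0}"
    then obtain n d where "rop K x U \<beta> n d \<noteq> 0" by blast
    then obtain b where "app x b (U (\<beta> - snd K) (n - fst K + int b) (d - b)) \<noteq> 0"
      unfolding rop_def by (meson sum.not_neutral_contains_not_neutral)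
    then have "U (\<beta> - snd K) (n - fst K + int b) (d - b) \<noteq> 0" by auto
    moreover have "\<beta> = (\<beta> - snd K) + snd K" by simp
    ultimately show "\<beta> \<in> (\<lambda>\<beta>. \<beta> + snd K) ` {\<beta>. \<exists>n d. U \<beta> n d \<noteq> 0}" by blast
  qed
  then show "finite {\<beta>. \<exists>n d. rop K x U \<beta> n d \<noteq> 0}" by (rule finite_subset) (use U in \<open>simp add: Cv_def\<close>)
  fix \<beta> n d
  have "app x b (U (\<beta> - snd K) (n - fst K + int b) (d - b)) \<in> Vdeg a n \<beta>" for b
  proof -
    have "U (\<beta> - snd K) (n - fst K + int b) (d - b) \<in> Vdeg a (n - fst K + int b) (\<beta> - snd K)" using U by (simp add: Cv_def)
    from vdegD[OF x[unfolded homog_def, rule_format, of b] this] show ?thesis by (simp add: app_def)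
  qed
  then show "rop K x U \<beta> n d \<in> Vdeg a n \<beta>" unfolding rop_def by (intro Vdeg_sum)
qed

lemma Cv_Rop:
  assumes U: "Cv a U" and g: "gr_homog a g"
  shows "Cv a (Rop g U)"
proof -
  have "Cv a (\<lambda>\<beta> n d. \<Sum>K\<in>A. rop K (Poly_Mapping.lookup g K) U \<beta> n d)" for A
  proof (induction A rule: infinite_finite_induct)
    case (insert K A)
    then show ?case using Cv_add[OF Cv_rop[OF U, of K "Poly_Mapping.lookup g K"]] g by (simp add: gr_homog_def del: split_paired_All)
  qed (simp_all add: Cv_zero)
  then show ?thesis unfolding Rop_def[abs_def] extend_sum_def .
qed

definition Cop :: "('i::finite \<Rightarrow> 'i \<Rightarrow> int) \<Rightarrow> 'i gring \<Rightarrow>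
    ('i lattice \<Rightarrow> int \<Rightarrow> 'i vspace poly) \<Rightarrow> 'i lattice \<Rightarrow> int \<Rightarrow> 'i vspace poly" where
  "Cop a g = (\<lambda>u\<in>carrier (Vtilde a). \<lambda>\<beta> n. Abs_poly (Rop g (crep u) \<beta> n))"

lemma Cop_crep:
  assumes "gr_homog a g" "u \<in> carrier (Vtilde a)"
  shows "crep (Cop a g u) = Rop g (crep u)" "Cop a g u \<in> carrier (Vtilde a)"
proof -
  have "Cv a (Rop g (crep u))" using assms by (simp add: Cv_Rop Vtilde_carrier)
  from Cv_realize[OF this] show "crep (Cop a g u) = Rop g (crep u)" "Cop a g u \<in> carrier (Vtilde a)"
    using assms by (simp_all add: Cop_def)
qed

lemma Cop_eqI:
  assumes "u \<in> carrier (Vtilde a)" "gr_homog a g" "\<And>\<beta> n d. crep w \<beta> n d = Rop g (crep u) \<beta> n d"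
  shows "Cop a g u = w"
  by (rule crep_inject) (use assms Cop_crep in \<open>simp add: fun_eq_iff\<close>)

lemma Vtilde_add: "u \<in> carrier (Vtilde a) \<Longrightarrow> v \<in> carrier (Vtilde a) \<Longrightarrow> (\<lambda>\<beta> n. u \<beta> n + v \<beta> n) \<in> carrier (Vtilde a)"
proof -
  assume "u \<in> carrier (Vtilde a)" "v \<in> carrier (Vtilde a)"
  moreover have "crep (\<lambda>\<beta> n. u \<beta> n + v \<beta> n) = (\<lambda>\<beta> n d. crep u \<beta> n d + crep v \<beta> n d)" by (intro ext) (simp add: crep_def)
  ultimately show ?thesis unfolding Vtilde_carrier by (simp add: Cv_add)
qed

lemma gr_homog_embR: "gr_homog a (embR p)"
proof (induction p)
  case (pCons c p)
  have "gr_homog a (kR c)" unfolding kR_def by (rule gr_homog_single) (rule homog_cs)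
  moreover have "gr_homog a hR" unfolding hR_def by (rule gr_homog_single) (rule homog_X)
  ultimately show ?case using pCons by (simp add: embR_pCons gr_homog_add gr_homog_mult)
qed simp

lemma Vtilde_simps: "x \<oplus>\<^bsub>Vtilde a\<^esub> y = (\<lambda>\<beta> n. x \<beta> n + y \<beta> n)" "p \<odot>\<^bsub>Vtilde a\<^esub> x = (\<lambda>\<beta> n. hact_poly p (x \<beta> n))"
  by (simp_all add: Vtilde_def)

lemma crep_add: "crep (\<lambda>\<beta> n. u \<beta> n + v \<beta> n) \<beta> n d = crep u \<beta> n d + crep v \<beta> n d"
  by (simp add: crep_def)

lemma Cop_add: "gr_homog a g \<Longrightarrow> gr_homog a h \<Longrightarrow> u \<in> carrier (Vtilde a) \<Longrightarrow>
    Cop a (g + h) u = (\<lambda>\<beta> n. Cop a g u \<beta> n + Cop a h u \<beta> n)"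
  by (rule Cop_eqI) (simp_all add: gr_homog_add Rop_add crep_add Cop_crep(1))

lemma Cop_mult: "gr_homog a g \<Longrightarrow> gr_homog a h \<Longrightarrow> u \<in> carrier (Vtilde a) \<Longrightarrow> Cop a (g * h) u = Cop a g (Cop a h u)"
  by (rule Cop_eqI) (simp_all add: gr_homog_mult Rop_mult Cop_crep)

lemma Cop_embR: "u \<in> carrier (Vtilde a) \<Longrightarrow> Cop a (embR p) u = (\<lambda>\<beta> n. hact_poly p (u \<beta> n))"
  by (rule Cop_eqI) (simp_all add: gr_homog_embR Rop_embR crep_smult)

text \<open>Linearity over \<complex>[\<hbar>] comes from the centrality of \<open>embR p\<close> in
  the group ring.\<close>

lemma Cop_endo:
  assumes g: "gr_homog a g"
  shows "Cop a g \<in> carrier (endo_alg Ch (Vtilde a))"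
proof -
  have s: "Cop a g (\<lambda>\<beta> n. hact_poly p (u \<beta> n)) = (\<lambda>\<beta> n. hact_poly p (Cop a g u \<beta> n))" if u: "u \<in> carrier (Vtilde a)" for p u
  proof -
    have "Cop a g (Cop a (embR p) u) = Cop a (embR p) (Cop a g u)"
      using Cop_mult[OF g gr_homog_embR u, of p] Cop_mult[OF gr_homog_embR g u, of p] by (simp only: embR_central)
    then show ?thesis using Cop_crep(2)[OF g u] by (simp add: Cop_embR u)
  qed
  have t: "Cop a g (\<lambda>\<beta> n. u \<beta> n + v \<beta> n) = (\<lambda>\<beta> n. Cop a g u \<beta> n + Cop a g v \<beta> n)"
    if u: "u \<in> carrier (Vtilde a)" and v: "v \<in> carrier (Vtilde a)" for u v
  proof (rule Cop_eqI[OF Vtilde_add[OF u v] g])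
    fix \<beta> n d
    have "crep (\<lambda>\<beta> n. u \<beta> n + v \<beta> n) = (\<lambda>\<beta> n d. crep u \<beta> n d + crep v \<beta> n d)" by (intro ext) (simp add: crep_def)
    moreover have "crep (\<lambda>\<beta> n. Cop a g u \<beta> n + Cop a g v \<beta> n) \<beta> n d = crep (Cop a g u) \<beta> n d + crep (Cop a g v) \<beta> n d"
      by (simp add: crep_def)
    ultimately show "crep (\<lambda>\<beta> n. Cop a g u \<beta> n + Cop a g v \<beta> n) \<beta> n d = Rop g (crep (\<lambda>\<beta> n. u \<beta> n + v \<beta> n)) \<beta> n d"
      by (simp add: Rop_add_right Cop_crep g u v)
  qed
  have "Cop a g \<in> extensional (carrier (Vtilde a))" by (simp add: Cop_def)
  then show ?thesis
    unfolding endo_alg_def using s t Cop_crep(2)[OF g] by (simp add: Vtilde_simps)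
qed

lemma complete_op_Cop:
  assumes x: "homog a (k, \<gamma>) x"
  shows "complete_op a k \<gamma> (\<lambda>b. ap (fps_nth x b)) = Cop a (Poly_Mapping.single (k, \<gamma>) x)"
proof
  fix u
  show "complete_op a k \<gamma> (\<lambda>b. ap (fps_nth x b)) u = Cop a (Poly_Mapping.single (k, \<gamma>) x) u"
  proof (cases "u \<in> carrier (Vtilde a)")
    case False
    then show ?thesis by (simp add: complete_op_def Cop_def)
  next
    case True
    then have C: "Cv a (crep u)" by (simp add: Vtilde_carrier)
    show ?thesis
    proof (rule Cop_eqI[OF True gr_homog_single[OF x], symmetric])
      fix \<beta> n d
      let ?t = "\<lambda>b. hact_poly (Polynomial.monom 1 b) (map_poly (ap (fps_nth x b)) (u (\<beta> - \<gamma>) (n - k + int b)))"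
      \<comment> \<open>Large enough for the orders b \<le> d of the coefficient at hand and for all
        b that meet a nonzero component.\<close>
      let ?B = "max d (nat (- half_norm a (\<beta> - \<gamma>) - n + k))"
      have c: "Polynomial.coeff (?t b) d = (if b \<le> d then app x b (crep u (\<beta> - \<gamma>) (n - k + int b) (d - b)) else 0)" for b
      proof -
        have "Polynomial.coeff (?t b) d = (\<Sum>e\<le>d. if e = b then app x b (crep u (\<beta> - \<gamma>) (n - k + int b) (d - e)) else 0)"
          unfolding hact_poly_coeff by (rule sum.cong) (auto simp: coeff_monom coeff_map_poly app_def crep_def)
        then show ?thesis by simp
      qed
      have z: "?t b = 0" if "b > nat (- half_norm a (\<beta> - \<gamma>) - n + k)" for b
      proof -
        have "n - k + int b > - half_norm a (\<beta> - \<gamma>)" using that by linarith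
        then have "u (\<beta> - \<gamma>) (n - k + int b) = 0" using Cv_vanish[OF C] by (intro poly_eqI) (simp add: crep_def)
        then show ?thesis by (intro poly_eqI) (simp add: hact_poly_coeff)
      qed
      have "Sum_any ?t = (\<Sum>b\<le>?B. ?t b)"
      proof (rule Sum_any.expand_superset)
        show "{b. ?t b \<noteq> 0} \<subseteq> {..?B}"
        proof
          fix b assume "b \<in> {b. ?t b \<noteq> 0}"
          then have "\<not> b > nat (- half_norm a (\<beta> - \<gamma>) - n + k)" using z[of b] by blast
          then show "b \<in> {..?B}" by simp
        qed
      qed simp
      then have "Polynomial.coeff (complete_op a k \<gamma> (\<lambda>b. ap (fps_nth x b)) u \<beta> n) d
          = (\<Sum>b\<le>?B. if b \<le> d then app x b (crep u (\<beta> - \<gamma>) (n - k + int b) (d - b)) else 0)"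
        using True by (simp add: complete_op_def coeff_sum c)
      also have "\<dots> = rop (k, \<gamma>) x (crep u) \<beta> n d"
        unfolding rop_def by (simp add: sum.inter_restrict[symmetric] Int_absorb1 lessThan_def atMost_def[symmetric])
           (rule sum.mono_neutral_cong_right, auto)
      finally show "crep (complete_op a k \<gamma> (\<lambda>b. ap (fps_nth x b)) u) \<beta> n d = Rop (Poly_Mapping.single (k, \<gamma>) x) (crep u) \<beta> n d"
        by (simp add: crep_def Rop_single)
    qed
  qed
qed

section \<open>The quotient algebra\<close>

lemma ring_of_type_algebra_ring: "ring (ring_of_type_algebra :: 'r::ring_1 ring)"
proof -
  have "\<exists>y. x + y = 0" for x :: 'r using add.right_inverse by blast
  then show ?thesis
    unfolding ring_of_type_algebra_def using add.right_inverse
    by unfold_locales (auto simp: algebra_simps Units_def)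
qed

lemma type_algebra_simps [simp]:
  "carrier (ring_of_type_algebra :: 'r::ring_1 ring) = UNIV"
  "x \<otimes>\<^bsub>ring_of_type_algebra\<^esub> y = x * (y :: 'r)" "x \<oplus>\<^bsub>ring_of_type_algebra\<^esub> y = x + y"
  "\<one>\<^bsub>ring_of_type_algebra\<^esub> = (1 :: 'r)" "\<zero>\<^bsub>ring_of_type_algebra\<^esub> = (0 :: 'r)"
  by (simp_all add: ring_of_type_algebra_def)

lemma type_algebra_idealI:
  fixes J :: "'r::ring_1 set"
  assumes "0 \<in> J" "\<And>x y. x \<in> J \<Longrightarrow> y \<in> J \<Longrightarrow> x + y \<in> J" "\<And>x. x \<in> J \<Longrightarrow> - x \<in> J"
    "\<And>x y. x \<in> J \<Longrightarrow> y * x \<in> J" "\<And>x y. x \<in> J \<Longrightarrow> x * y \<in> J"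
  shows "ideal J ring_of_type_algebra"
proof (rule idealI[OF ring_of_type_algebra_ring])
  interpret R: ring "ring_of_type_algebra :: 'r ring" by (rule ring_of_type_algebra_ring)
  have inv: "\<ominus>\<^bsub>ring_of_type_algebra\<^esub> x = - x" for x :: 'r
    by (rule R.minus_equality) simp_all
  show "subgroup J (add_monoid (ring_of_type_algebra :: 'r ring))"
    by (rule R.add.subgroupI) (use assms inv in \<open>auto simp: a_inv_def\<close>)
qed (use assms in simp_all)

definition dq :: "('i \<Rightarrow> 'i \<Rightarrow> int) \<Rightarrow> 'i dy_free \<Rightarrow> 'i dy_free set" where
  "dq a x = dy_ideal a +>\<^bsub>dy_free_ring\<^esub> x"

lemma dy_ideal_ideal: "ideal (dy_ideal a) dy_free_ring"
  unfolding dy_ideal_def by (rule ring.genideal_ideal[OF ring_of_type_algebra_ring]) simp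

lemma dy_relators_ideal: "x \<in> dy_relators a \<Longrightarrow> x \<in> dy_ideal a"
  unfolding dy_ideal_def using ring.genideal_self[OF ring_of_type_algebra_ring, of "dy_relators a"] by auto

lemma dy_ideal_mult: "x \<in> dy_ideal a \<Longrightarrow> y * x \<in> dy_ideal a"
  using ideal.I_l_closed[OF dy_ideal_ideal, of x a y] by simp

lemma dq_iff: "y \<in> dq a x \<longleftrightarrow> y - x \<in> dy_ideal a"
  unfolding dq_def a_r_coset_def' by (auto intro: bexI[of _ "y - x"])

lemma dq_self: "x \<in> dq a x"
  using additive_subgroup.zero_closed[OF ideal.axioms(1)[OF dy_ideal_ideal]] by (simp add: dq_iff)

lemma dq_eqI: "y - x \<in> dy_ideal a \<Longrightarrow> dq a x = dq a y"
  unfolding dq_iff[symmetric] unfolding dq_def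
  by (rule abelian_subgroup.a_repr_independence'[OF abelian_subgroupI3[OF ideal.axioms(1)[OF dy_ideal_ideal] ring.is_abelian_group[OF ring_of_type_algebra_ring]]]) simp_all

lemma DY_simps:
  "carrier (DY a) = a_rcosets\<^bsub>dy_free_ring\<^esub> (dy_ideal a)" "C \<otimes>\<^bsub>DY a\<^esub> D = rcoset_mult dy_free_ring (dy_ideal a) C D"
  "C \<oplus>\<^bsub>DY a\<^esub> D = set_add dy_free_ring C D" "\<one>\<^bsub>DY a\<^esub> = dy_ideal a +>\<^bsub>dy_free_ring\<^esub> 1"
  "p \<odot>\<^bsub>DY a\<^esub> C = (\<Union>x\<in>C. dy_ideal a +>\<^bsub>dy_free_ring\<^esub> (scal p * x))"
  unfolding DY_def FactRing_def ring.defs module.defs by simp_all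

lemma DY_carrier: "carrier (DY a) = range (dq a)"
  unfolding DY_simps(1) A_RCOSETS_def' by (auto simp: dq_def)

lemma DY_mult: "dq a x \<otimes>\<^bsub>DY a\<^esub> dq a y = dq a (x * y)"
  using ideal.rcoset_mult_add[OF dy_ideal_ideal, of x y a] unfolding DY_simps dq_def by simp

lemma DY_add: "dq a x \<oplus>\<^bsub>DY a\<^esub> dq a y = dq a (x + y)"
  using ideal.a_rcos_sum[OF dy_ideal_ideal, of x y a] unfolding DY_simps dq_def by simp

lemma DY_one: "\<one>\<^bsub>DY a\<^esub> = dq a 1"
  unfolding DY_simps dq_def ..

lemma DY_smult: "p \<odot>\<^bsub>DY a\<^esub> dq a x = dq a (scal p * x)"
proof -
  have "p \<odot>\<^bsub>DY a\<^esub> dq a x = (\<Union>y\<in>dq a x. dq a (scal p * y))"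
    unfolding DY_simps(5) dq_def ..
  also have "\<dots> = (\<Union>y\<in>dq a x. dq a (scal p * x))"
  proof (rule SUP_cong[OF refl])
    fix y assume that: "y \<in> dq a x"
    show "dq a (scal p * y) = dq a (scal p * x)"
    by (rule dq_eqI[symmetric], unfold right_diff_distrib[symmetric]) (rule dy_ideal_mult, use that in \<open>simp only: dq_iff\<close>)
  qed
  also have "\<dots> = dq a (scal p * x)" using dq_self[of x a] by blast
  finally show ?thesis .
qed

section \<open>Generation of the Yangian double by the elements x\<close>

lemma ser_h_shifted_sum: "ser_h_shifted u i n = (\<Sum>m\<in>{n..- 1}. ser_h Plus i m * shifted_pow u m n)"
  unfolding ser_h_shifted_def
  by (rule Sum_any.expand_superset) (auto simp: ser_h_def shifted_pow_def when_def Let_def)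

lemma scal_simps:
  fixes x :: "'i dy_free"
  shows "scal 0 = (0 :: 'i dy_free)" "scal 1 = (1 :: 'i dy_free)" "scal (- 1) * x = - x"
proof -
  show 1: "scal 1 = (1 :: 'i dy_free)" by (simp add: scal_def)
  have "scal (- 1) = - (scal 1 :: 'i dy_free)" by (simp add: scal_def single_uminus)
  then show "scal (- 1) * x = - x" by (simp add: 1)
qed (simp add: scal_def)

lemma const_poly_0_1: "[:0:] = (0 :: complex poly)" "[:1:] = (1 :: complex poly)"
  by (simp_all add: one_pCons)

lemma shifted_pow_self: "shifted_pow u r r = 1"
  by (simp add: shifted_pow_def const_poly_0_1 scal_simps)

lemma shifted_pow_zero: "shifted_pow 0 r n = (1 when n = r)"
  by (auto simp: shifted_pow_def const_poly_0_1 scal_simps power_0_left when_def)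

lemma shifted_pow_exp_zero: "shifted_pow u 0 n = (1 when n = 0)"
  by (auto simp: shifted_pow_def const_poly_0_1 scal_simps when_def gbinomial_0_left)

text \<open>Formulated for a subset of the free algebra that is stable under the ideal, so that it
  applies directly to the set on which two morphisms agree.\<close>

lemma dy_generated:
  fixes S :: "'i dy_free set"
  assumes one: "1 \<in> S" and sm: "\<And>p x. x \<in> S \<Longrightarrow> scal p * x \<in> S" and add: "\<And>x y. x \<in> S \<Longrightarrow> y \<in> S \<Longrightarrow> x + y \<in> S"
    and mul: "\<And>x y. x \<in> S \<Longrightarrow> y \<in> S \<Longrightarrow> x * y \<in> S" and gx: "\<And>s i r. gen (GenX s i r) \<in> S"
    and I: "\<And>x y. x - y \<in> dy_ideal a \<Longrightarrow> y \<in> S \<Longrightarrow> x \<in> S"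
  shows "x \<in> S"
proof -
  have sc: "scal p \<in> S" for p using sm[OF one, of p] by simp
  have neg: "- x \<in> S" if "x \<in> S" for x using sm[OF that, of "- 1"] by (simp add: scal_simps)
  have dif: "x - y \<in> S" if "x \<in> S" "y \<in> S" for x y using add[OF that(1) neg[OF that(2)]] by simp
  have sum: "sum f A \<in> S" if "\<And>x. x \<in> A \<Longrightarrow> f x \<in> S" for f :: "int \<Rightarrow> 'i dy_free" and A
    using that by (induction A rule: infinite_finite_induct) (use sc[of 0] add in \<open>auto simp: scal_simps\<close>)
  have pow: "x ^ n \<in> S" if "x \<in> S" for x n by (induction n) (use that one mul in auto)
  let ?u = "scal [:1 / 2:] * hbar * cc :: 'i dy_free"
  \<comment> \<open>The commutator of the x generators lies in S, hence so does the right side of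
    the mixed relation, by stability under the ideal.\<close>
  have R: "ser_delta_quot m n + Sum_any (\<lambda>q. ser_delta (hbar * cc) m q * ser_h_shifted ?u i (n - q))
      + ser_h Minus i (m + n + 1) \<in> S" for i m n
  proof -
    have "Sum_any (\<lambda>p. ser_delta 0 p n * ser_h Minus i (m - p)) = Sum_any (\<lambda>p. ser_h Minus i (m + n + 1) when p = - n - 1)"
      by (rule arg_cong[of _ _ Sum_any], rule ext) (auto simp: ser_delta_def shifted_pow_zero when_def intro!: arg_cong[of _ _ "ser_h Minus i"])
    then have C: "Sum_any (\<lambda>p. ser_delta 0 p n * ser_h Minus i (m - p)) = ser_h Minus i (m + n + 1)" by simp
    let ?x = "ser_delta_quot m n + Sum_any (\<lambda>q. ser_delta (hbar * cc) m q * ser_h_shifted ?u i (n - q)) + ser_h Minus i (m + n + 1)"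
    have "rel_xx_mixed i i m n \<in> dy_ideal a"
      by (rule dy_relators_ideal) (auto simp: dy_relators_def)
    then have "commutator (ser_x Plus i m) (ser_x Minus i n) - ?x \<in> dy_ideal a"
      unfolding rel_xx_mixed_def C by simp
    from dy_ideal_mult[OF this, of "- 1"] have "?x - commutator (ser_x Plus i m) (ser_x Minus i n) \<in> dy_ideal a" by simp
    moreover have "commutator (ser_x Plus i m) (ser_x Minus i n) \<in> S"
      unfolding commutator_def ser_x_def by (intro dif mul gx)
    ultimately show ?thesis by (rule I)
  qed
  \<comment> \<open>m = -1 selects the power (w + \<hbar>c)^0 = 1: the difference quotient vanishes,
    and h^+ occurs without a convolution.\<close>
  have R1: "ser_h_shifted ?u i n + ser_h Minus i n \<in> S" for i n
  proof -
    have "Sum_any (\<lambda>q. ser_delta (hbar * cc) (- 1) q * ser_h_shifted ?u i (n - q)) = Sum_any (\<lambda>q :: int. ser_h_shifted ?u i n when q = 0)"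
      by (rule arg_cong[of _ _ Sum_any], rule ext) (auto simp: ser_delta_def shifted_pow_exp_zero when_def)
    moreover have "ser_delta_quot (- 1) n = (0 :: 'i dy_free)"
      by (auto simp: ser_delta_quot_def Let_def when_def gbinomial_0_left const_poly_0_1 scal_simps)
    ultimately show ?thesis using R[of "- 1" n i] by simp
  qed
  \<comment> \<open>For n = -t - 1 \<ge> 0 the translated h^+ has no coefficient, and only h_t
    remains.\<close>
  have hneg: "gen (GenH i t) \<in> S" if "t < 0" for i t
    using R1[of i "- t - 1"] that by (simp add: ser_h_shifted_sum ser_h_def)
  have h0: "gen (GenH i 0) \<in> S" for i
    using R1[of i "- 1"] by (simp add: ser_h_shifted_sum ser_h_def shifted_pow_self)
  \<comment> \<open>m = -2, n = 0 selects the power r = 1, where the difference quotient is exactly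
    c; the rest of the coefficient is h_0.\<close>
  have cS: "cc \<in> S"
  proof -
    fix i :: 'i
    have "Sum_any (\<lambda>q. ser_delta (hbar * cc) (- 2) q * ser_h_shifted ?u i (0 - q)) = (\<Sum>q\<in>{1}. ser_delta (hbar * cc) (- 2) q * ser_h_shifted ?u i (0 - q))"
    proof (rule Sum_any.expand_superset)
      show "{q. ser_delta (hbar * cc) (- 2) q * ser_h_shifted ?u i (0 - q) \<noteq> 0} \<subseteq> {1}"
      proof
        fix q assume q: "q \<in> {q. ser_delta (hbar * cc) (- 2) q * ser_h_shifted ?u i (0 - q) \<noteq> (0 :: 'i dy_free)}"
        then have "\<not> 0 - q \<ge> 0" by (auto simp: ser_h_shifted_sum)
        moreover have "q \<le> 1" using q by (auto simp: ser_delta_def shifted_pow_def when_def split: if_splits)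
        ultimately show "q \<in> {1}" by simp
      qed
    qed simp
    moreover have "ser_delta_quot (- 2) 0 = (cc :: 'i dy_free)"
      by (simp add: ser_delta_quot_def Let_def const_poly_0_1 scal_simps)
    ultimately have "cc + gen (GenH i 0) \<in> S"
      using R[of "- 2" 0 i] by (simp add: ser_delta_def shifted_pow_self ser_h_shifted_sum ser_h_def)
    from dif[OF this h0[of i]] show ?thesis by simp
  qed
  have sp: "shifted_pow ?u r n \<in> S" for r n
    unfolding shifted_pow_def when_def using mul[OF sc pow[OF mul[OF mul[OF sc sc] cS]]] sc[of 0] by (simp add: scal_simps)
  \<comment> \<open>The coefficient of w^(-N - 1) in h^+(w + \<hbar>c/2) is h_N plus a combination
    of h_r with r < N, whose coefficients involve c and are already in S.\<close>
  have hnat: "gen (GenH i (int N)) \<in> S" for i N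
  proof (induction N rule: less_induct)
    case (less N)
    have n: "{- int N - 1..- 1} = insert (- int N - 1) {- int N..- 1}" by auto
    have e: "ser_h_shifted ?u i (- int N - 1) = gen (GenH i (int N)) + (\<Sum>m\<in>{- int N..- 1}. ser_h Plus i m * shifted_pow ?u m (- int N - 1))"
      unfolding ser_h_shifted_sum n by (simp add: shifted_pow_self ser_h_def)
    have s: "(\<Sum>m\<in>{- int N..- 1}. ser_h Plus i m * shifted_pow ?u m (- int N - 1)) \<in> S"
    proof (rule sum, rule mul[OF _ sp])
      fix m assume m: "m \<in> {- int N..- 1}"
      then have "ser_h Plus i m = gen (GenH i (int (nat (- m - 1))))" by (simp add: ser_h_def)
      moreover have "nat (- m - 1) < N" using m by (auto simp: nat_less_iff)
      ultimately show "ser_h Plus i m \<in> S" using less[of "nat (- m - 1)"] by simp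
    qed
    have "ser_h_shifted ?u i (- int N - 1) \<in> S" using R1[of i "- int N - 1"] by (simp add: ser_h_def)
    from dif[OF this s] show ?case unfolding e by simp
  qed
  have g: "gen y \<in> S" for y
  proof (cases y)
    case (GenH i t) then show ?thesis using hneg[of t i] hnat[of i "nat t"] by (cases "t < 0") simp_all
  qed (simp_all add: cS gx)
  have w: "Poly_Mapping.single (Word gs) p \<in> S" for gs p
  proof (induction gs)
    case Nil
    then show ?case using sc[of p] by (simp add: scal_def zero_word_def)
  next
    case (Cons y gs)
    have "Poly_Mapping.single (Word (y # gs)) p = gen y * Poly_Mapping.single (Word gs) p"
      by (simp add: gen_def mult_single)
    then show ?case using mul[OF g Cons] by simp
  qed
  show "x \<in> S"
  proof (induction x rule: poly_mapping_single_induct)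
    case 1 then show ?case using sc[of 0] by (simp add: scal_simps)
  next
    case (3 k c) then show ?case by (cases k) (simp add: w)
  qed (rule add)
qed

section \<open>The representation and its uniqueness\<close>

context vertex
begin

lemma psi_ideal: "x \<in> dy_ideal a \<Longrightarrow> psi x = 0"
proof -
  have neg: "psi (- x) = 0" if "psi x = 0" for x
    using psi_add[of x "- x"] that psi_add[of 0 0] by simp
  have "ideal {x. psi x = 0} dy_free_ring"
    by (rule type_algebra_idealI) (use psi_add[of 0 0] neg in \<open>auto simp: psi_add psi_mult\<close>)
  then have "dy_ideal a \<subseteq> {x. psi x = 0}"
    unfolding dy_ideal_def by (rule ring.genideal_minimal[OF ring_of_type_algebra_ring]) (use psi_relators in auto)
  then show "x \<in> dy_ideal a \<Longrightarrow> psi x = 0" by auto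
qed

definition rho :: "'i dy_free set \<Rightarrow> ('i lattice \<Rightarrow> int \<Rightarrow> 'i vspace poly) \<Rightarrow> 'i lattice \<Rightarrow> int \<Rightarrow> 'i vspace poly" where
  "rho = (\<lambda>C\<in>carrier (DY a). Cop a (psi (SOME x. x \<in> C)))"

text \<open>Independence of the chosen representative follows from the vanishing of
  \<open>psi\<close> on the ideal.\<close>

lemma rho_dq: "rho (dq a x) = Cop a (psi x)"
proof -
  let ?z = "SOME z. z \<in> dq a x"
  have "?z \<in> dq a x" using dq_self by (rule someI)
  then have "psi (?z - x) = 0" by (intro psi_ideal) (simp add: dq_iff)
  then have "psi ?z = psi x" using psi_add[of "?z - x" x] by simp
  then show ?thesis by (simp add: rho_def DY_carrier)
qed

lemma Cop_one: "u \<in> carrier (Vtilde a) \<Longrightarrow> Cop a 1 u = u"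
proof -
  assume u: "u \<in> carrier (Vtilde a)"
  have "embR 1 = (1 :: 'i gring)" using psi_scal[of 1] psi_one by (simp add: scal_simps)
  moreover have "hact_poly 1 q = q" for q :: "'i vspace poly"
  proof (rule poly_eqI)
    fix n
    have "vscale (Polynomial.coeff 1 b) (Polynomial.coeff q (n - b)) = (if b = 0 then Polynomial.coeff q n else 0)" for b
      by simp
    then show "Polynomial.coeff (hact_poly 1 q) n = Polynomial.coeff q n" by (simp add: hact_poly_coeff)
  qed
  ultimately show ?thesis using Cop_embR[OF u, of 1] by simp
qed

lemma rho_alg_hom: "rho \<in> alg_hom Ch (DY a) (endo_alg Ch (Vtilde a))"
proof -
  have "rho \<in> ring_hom (DY a) (endo_alg Ch (Vtilde a))"
  proof (rule ring_hom_memI)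
    fix C D assume "C \<in> carrier (DY a)" "D \<in> carrier (DY a)"
    then obtain x y where C: "C = dq a x" and D: "D = dq a y" by (auto simp: DY_carrier)
    show "rho C \<in> carrier (endo_alg Ch (Vtilde a))" unfolding C rho_dq by (rule Cop_endo[OF gr_homog_psi])
    show "rho (C \<otimes>\<^bsub>DY a\<^esub> D) = rho C \<otimes>\<^bsub>endo_alg Ch (Vtilde a)\<^esub> rho D"
      unfolding C D DY_mult rho_dq psi_mult
    proof (rule extensionalityI[of _ "carrier (Vtilde a)"])
      show "Cop a (psi x * psi y) \<in> extensional (carrier (Vtilde a))" by (simp add: Cop_def)
      show "Cop a (psi x) \<otimes>\<^bsub>endo_alg Ch (Vtilde a)\<^esub> Cop a (psi y) \<in> extensional (carrier (Vtilde a))" by (simp add: endo_alg_def)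
      show "Cop a (psi x * psi y) u = (Cop a (psi x) \<otimes>\<^bsub>endo_alg Ch (Vtilde a)\<^esub> Cop a (psi y)) u"
        if "u \<in> carrier (Vtilde a)" for u
        using that by (simp add: endo_alg_def compose_eq Cop_mult gr_homog_psi)
    qed
    show "rho (C \<oplus>\<^bsub>DY a\<^esub> D) = rho C \<oplus>\<^bsub>endo_alg Ch (Vtilde a)\<^esub> rho D"
      unfolding C D DY_add rho_dq psi_add
    proof (rule extensionalityI[of _ "carrier (Vtilde a)"])
      show "Cop a (psi x + psi y) \<in> extensional (carrier (Vtilde a))" by (simp add: Cop_def)
      show "Cop a (psi x) \<oplus>\<^bsub>endo_alg Ch (Vtilde a)\<^esub> Cop a (psi y) \<in> extensional (carrier (Vtilde a))" by (simp add: endo_alg_def)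
      show "Cop a (psi x + psi y) u = (Cop a (psi x) \<oplus>\<^bsub>endo_alg Ch (Vtilde a)\<^esub> Cop a (psi y)) u"
        if "u \<in> carrier (Vtilde a)" for u
        using that by (simp add: endo_alg_def Vtilde_simps Cop_add gr_homog_psi)
    qed
  next
    show "rho \<one>\<^bsub>DY a\<^esub> = \<one>\<^bsub>endo_alg Ch (Vtilde a)\<^esub>"
      unfolding DY_one rho_dq psi_one
      by (rule extensionalityI[of _ "carrier (Vtilde a)"])
         (simp_all add: endo_alg_def Cop_one, simp add: Cop_def)
  qed
  moreover have "rho (p \<odot>\<^bsub>DY a\<^esub> C) = p \<odot>\<^bsub>endo_alg Ch (Vtilde a)\<^esub> rho C" if "C \<in> carrier (DY a)" for p C
  proof -
    obtain x where C: "C = dq a x" using \<open>C \<in> carrier (DY a)\<close> by (auto simp: DY_carrier)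
    show ?thesis
    proof (rule extensionalityI[of _ "carrier (Vtilde a)"])
      show "rho (p \<odot>\<^bsub>DY a\<^esub> C) \<in> extensional (carrier (Vtilde a))" unfolding C DY_smult rho_dq by (simp add: Cop_def)
      show "p \<odot>\<^bsub>endo_alg Ch (Vtilde a)\<^esub> rho C \<in> extensional (carrier (Vtilde a))" by (simp add: endo_alg_def)
      fix u assume u: "u \<in> carrier (Vtilde a)"
      show "rho (p \<odot>\<^bsub>DY a\<^esub> C) u = (p \<odot>\<^bsub>endo_alg Ch (Vtilde a)\<^esub> rho C) u"
        unfolding C DY_smult rho_dq psi_mult psi_scal Cop_mult[OF gr_homog_embR gr_homog_psi u] Cop_embR[OF Cop_crep(2)[OF gr_homog_psi u]]
        using u by (simp add: endo_alg_def Vtilde_simps)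
    qed
  qed
  ultimately show ?thesis by (simp add: alg_hom_def rho_def)
qed

text \<open>The elements whose classes have equal images under f and g form a set as in
  \<open>dy_generated\<close>. The argument is purely equational and works for any target E.\<close>

lemma rho_unique:
  assumes f: "f \<in> alg_hom Ch (DY a) E" and g: "g \<in> alg_hom Ch (DY a) E"
    and eq: "\<And>s i k. f (dy_x a s i k) = g (dy_x a s i k)"
  shows "f = g"
proof (rule extensionalityI[of _ "carrier (DY a)"])
  show "f \<in> extensional (carrier (DY a))" "g \<in> extensional (carrier (DY a))" using f g by (auto simp: alg_hom_def)
  fix C assume "C \<in> carrier (DY a)"
  then obtain x where C: "C = dq a x" by (auto simp: DY_carrier)
  have q: "dq a y \<in> carrier (DY a)" for y by (simp add: DY_carrier)
  have hom: "h (dq a (y * z)) = h (dq a y) \<otimes>\<^bsub>E\<^esub> h (dq a z)" "h (dq a (y + z)) = h (dq a y) \<oplus>\<^bsub>E\<^esub> h (dq a z)"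
    "h (dq a 1) = \<one>\<^bsub>E\<^esub>" if "h \<in> alg_hom Ch (DY a) E" for h y z
    using that q[of y] q[of z] unfolding alg_hom_def ring_hom_def
    by (auto simp: DY_mult[symmetric] DY_add[symmetric] DY_one[symmetric])
  have smul: "h (dq a (scal p * y)) = p \<odot>\<^bsub>E\<^esub> h (dq a y)" if "h \<in> alg_hom Ch (DY a) E" for h y p
  proof -
    have "h (p \<odot>\<^bsub>DY a\<^esub> dq a y) = p \<odot>\<^bsub>E\<^esub> h (dq a y)" using that q[of y] unfolding alg_hom_def by auto
    then show ?thesis by (simp only: DY_smult)
  qed
  have "x \<in> {y. f (dq a y) = g (dq a y)}"
  proof (rule dy_generated[where a = a])
    fix y z assume "y - z \<in> dy_ideal a" "z \<in> {y. f (dq a y) = g (dq a y)}"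
    then show "y \<in> {y. f (dq a y) = g (dq a y)}" using dq_eqI[of y z a] by simp
  next
    fix p y assume "y \<in> {y. f (dq a y) = g (dq a y)}"
    then show "scal p * y \<in> {y. f (dq a y) = g (dq a y)}" by (simp only: mem_Collect_eq smul[OF f] smul[OF g])
  qed (use hom[OF f] hom[OF g] eq in \<open>simp_all add: dy_x_def dq_def\<close>)
  then show "f C = g C" by (simp add: C)
qed

end

theorem proposition5p9:
  fixes a :: "'i :: finite \<Rightarrow> 'i \<Rightarrow> int"
    and \<epsilon> :: "'i lattice \<Rightarrow> 'i lattice \<Rightarrow> complex"
  assumes "simply_laced_cartan a"
    and "sign_function a \<epsilon>"
  shows "\<exists>XX :: sign \<Rightarrow> 'i \<Rightarrow> int \<Rightarrow> nat \<Rightarrow> 'i vspace \<Rightarrow> 'i vspace.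
    (\<forall>s i k b. Vector_Spaces.linear vscale vscale (XX s i k b)
               \<and> has_degree a (k - int b) (sroot s i) (XX s i k b)) \<and>
    (\<forall>s i k v. vertex_mode a \<epsilon> s i k v
               = fps_Sum (\<lambda>b. hact (Polynomial.monom 1 b) (ext_h (XX s i k b) v))) \<and>
    (\<forall>s i k. complete_op a k (sroot s i) (XX s i k) \<in> carrier (endo_alg Ch (Vtilde a))) \<and>
    (\<exists>!\<rho>. \<rho> \<in> alg_hom Ch (DY a) (endo_alg Ch (Vtilde a)) \<and>
          (\<forall>s i k. \<rho> (dy_x a s i k) = complete_op a k (sroot s i) (XX s i k)))"
proof -
  interpret vertex a \<epsilon> using assms by unfold_locales
  let ?XX = "\<lambda>s i k b. ap (fps_nth (Xf s i (- k - 1)) b)"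
  have H: "homog a (k, sroot s i) (Xf s i (- k - 1))" for s i k using homog_Xf[of "- k - 1" s i] by simp
  have C: "complete_op a k (sroot s i) (?XX s i k) = rho (dq a (gen (GenX s i k)))" for s i k
    using complete_op_Cop[OF H[of k s i]] by (simp add: rho_dq psi_gen)
  have x: "dq a (gen (GenX s i k)) = dy_x a s i k" for s i k by (simp add: dq_def dy_x_def)
  show ?thesis
  proof (intro exI[of _ ?XX] conjI allI)
    fix s i k
    show "complete_op a k (sroot s i) (?XX s i k) \<in> carrier (endo_alg Ch (Vtilde a))"
      unfolding C rho_dq by (rule Cop_endo[OF gr_homog_psi])
    show "Vector_Spaces.linear vscale vscale (?XX s i k b)" for b by (rule ap_linear)
    show "has_degree a (k - int b) (sroot s i) (?XX s i k b)" for b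
      using H[of k s i] by (simp add: homog_def)
    show "vertex_mode a \<epsilon> s i k v = fps_Sum (\<lambda>b. hact (Polynomial.monom 1 b) (ext_h (?XX s i k b) v))" for v
      unfolding vertex_mode_def vertex_op_Xf by (rule act_expand)
  next
    show "\<exists>!\<rho>. \<rho> \<in> alg_hom Ch (DY a) (endo_alg Ch (Vtilde a)) \<and>
          (\<forall>s i k. \<rho> (dy_x a s i k) = complete_op a k (sroot s i) (?XX s i k))"
    proof (rule ex1I[of _ rho])
      show "rho \<in> alg_hom Ch (DY a) (endo_alg Ch (Vtilde a)) \<and>
          (\<forall>s i k. rho (dy_x a s i k) = complete_op a k (sroot s i) (?XX s i k))"
        using rho_alg_hom by (simp only: C x) simp
    next
      fix f assume f: "f \<in> alg_hom Ch (DY a) (endo_alg Ch (Vtilde a)) \<and>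
          (\<forall>s i k. f (dy_x a s i k) = complete_op a k (sroot s i) (?XX s i k))"
      then show "f = rho" by (intro rho_unique[OF _ rho_alg_hom]) (auto simp: C x)
    qed
  qed
qed

end
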